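(* Let $(k_n)_n$ and $(l_n)_n$ be two sequences of natural numbers with $\lim_n k_n=\lim_n l_n=\infty$. Let $\varphi:\mathrm{U}^{\mathrm{HS}}[(k_n)_n]\to \mathrm{U}^{\mathrm{HS}}[(l_n)_n]$ be a group isomorphism of product form. Then $\lim_n \frac{k_n}{l_n}=1$ and there exists a sequence $(\alpha_n)_n$ with $\alpha_n\in\mathrm{Aut}(\mathrm{U}(l_n))$ such that $\varphi$ maps every $[u_n]_n\in \mathrm{U}^{\mathrm{HS}}[(k_n)_n]$ to $[\alpha_n(v_n)]_n\in \mathrm{U}^{\mathrm{HS}}[(l_n)_n]$, where $[v_n]_n=[u_n]_n\updownarrow \mathrm{U}^{\mathrm{HS}}[(l_n)_n]$.
   Context: For $k\ge 1$, $\mathrm{U}(k)$ is the group of unitary complex $k\times k$ matrices, $\|x\|_{2,k}=(\frac1k\mathrm{tr}(x^*x))^{1/2}$ for $x\in \mathrm{M}_k(\mathbb C)$, and $d^{\mathrm{HS}}_k(x,y)=\|x-y\|_{2,k}$. For a sequence $(k_n)_n$ of positive integers, $\mathrm{U}^{\mathrm{HS}}[(k_n)_n]$ is the quotient of the group $\prod_n\mathrm{U}(k_n)$ by the normal subgroup of sequences $(u_n)_n$ with $d^{\mathrm{HS}}_{k_n}(u_n,1)\to0$; $[u_n]_n$ denotes the class of $(u_n)_n$. A map $\varphi:\mathrm{U}^{\mathrm{HS}}[(k_n)_n]\to\mathrm{U}^{\mathrm{HS}}[(l_n)_n]$ is of product form if there are maps (of sets) $h_n:\mathrm{U}(k_n)\to\mathrm{U}(l_n)$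 such that $\varphi([u_n]_n)=[h_n(u_n)]_n$ for every sequence $(u_n)_n\in\prod_n \mathrm{U}(k_n)$. $\mathrm{Aut}(\mathrm{U}(l))$ is the group of (continuous) automorphisms of the compact group $\mathrm{U}(l)$; all of these are isometric for $d^{\mathrm{HS}}_l$. If $k_n/l_n\to1$ and $[u_n]_n\in\mathrm{U}^{\mathrm{HS}}[(k_n)_n]$, then $[u_n]_n\updownarrow\mathrm{U}^{\mathrm{HS}}[(l_n)_n]$ denotes the unique element $[v_n]_n\in \mathrm{U}^{\mathrm{HS}}[(l_n)_n]$ such that $\lim_n d^{\mathrm{HS}}_{k_n\vee l_n}(u_n\oplus I_{k_n\vee l_n-k_n},\,v_n\oplus I_{k_n\vee l_n-l_n})=0$, where $k\vee l=\max(k,l)$. This defines an isometric group isomorphism $\mathrm{U}^{\mathrm{HS}}[(k_n)_n]\to\mathrm{U}^{\mathrm{HS}}[(l_n)_n]$. *)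

theory Defs
  imports
    "HOL-Analysis.Analysis"
    "HOL-Algebra.Bij"
    "HOL-Algebra.Product_Groups"
    "Jordan_Normal_Form.Schur_Decomposition"
begin

definition mat_trace :: "'a::comm_monoid_add mat \<Rightarrow> 'a" where
  "mat_trace x = (\<Sum>i<dim_row x. x $$ (i, i))"

definition hs_norm :: "nat \<Rightarrow> complex mat \<Rightarrow> real" where
  "hs_norm k x = sqrt (Re (mat_trace (mat_adjoint x * x)) / real k)"

definition hs_dist :: "nat \<Rightarrow> complex mat \<Rightarrow> complex mat \<Rightarrow> real" where
  "hs_dist k x y = hs_norm k (x - y)"

definition unitary_group :: "nat \<Rightarrow> complex mat monoid" where
  "unitary_group k =
     \<lparr>carrier = {u \<in> carrier_mat k k. mat_adjoint u * u = 1\<^sub>m k \<and> u * mat_adjoint u = 1\<^sub>m k},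
      monoid.mult = (*), one = 1\<^sub>m k\<rparr>"

text \<open>Topological group automorphisms: the compact group topology is the one induced by
  \<^term>\<open>hs_dist k\<close>. By compactness, the inverse of a continuous automorphism is
  continuous. The locale \<^locale>\<open>Metric_space\<close> wants symmetry also off the carrier, where
  subtraction of matrices of different dimensions is not symmetric; hence the conditional.
  Elements of \<^term>\<open>auto G\<close> are extensional functions on \<^term>\<open>carrier G\<close>.\<close>

definition unitary_topology :: "nat \<Rightarrow> complex mat topology" where
  "unitary_topology k = Metric_space.mtopology (carrier (unitary_group k))
     (\<lambda>x y. if x \<in> carrier (unitary_group k) \<and> y \<in> carrier (unitary_group k) then hs_dist k x y else 0)"

definition unitary_aut :: "nat \<Rightarrow> (complex mat \<Rightarrow> complex mat) set" where
  "unitary_aut k =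
     {\<alpha> \<in> auto (unitary_group k). continuous_map (unitary_topology k) (unitary_topology k) \<alpha>}"

definition unitary_prod :: "(nat \<Rightarrow> nat) \<Rightarrow> (nat \<Rightarrow> complex mat) monoid" where
  "unitary_prod k = product_group UNIV (\<lambda>n. unitary_group (k n))"

definition hs_null :: "(nat \<Rightarrow> nat) \<Rightarrow> (nat \<Rightarrow> complex mat) set" where
  "hs_null k = {u \<in> carrier (unitary_prod k). (\<lambda>n. hs_dist (k n) (u n) (1\<^sub>m (k n))) \<longlonglongrightarrow> 0}"

definition UHS :: "(nat \<Rightarrow> nat) \<Rightarrow> (nat \<Rightarrow> complex mat) set monoid" where
  "UHS k = unitary_prod k Mod hs_null k"

definition hs_class :: "(nat \<Rightarrow> nat) \<Rightarrow> (nat \<Rightarrow> complex mat) \<Rightarrow> (nat \<Rightarrow> complex mat) set" where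
  "hs_class k u = hs_null k #>\<^bsub>unitary_prod k\<^esub> u"

definition product_form ::
  "(nat \<Rightarrow> nat) \<Rightarrow> (nat \<Rightarrow> nat) \<Rightarrow> ((nat \<Rightarrow> complex mat) set \<Rightarrow> (nat \<Rightarrow> complex mat) set) \<Rightarrow> bool" where
  "product_form k l \<phi> \<longleftrightarrow>
     (\<exists>h. (\<forall>n. h n \<in> carrier (unitary_group (k n)) \<rightarrow> carrier (unitary_group (l n))) \<and>
          (\<forall>u\<in>carrier (unitary_prod k). \<phi> (hs_class k u) = hs_class l (\<lambda>n. h n (u n))))"

text \<open>The element \<open>[u\<^sub>n]\<^sub>n \<updownarrow> UHS l\<close>, as an operation on
  classes; \<open>diag_block_mat [x, 1\<^sub>m r]\<close> is \<open>x \<oplus> I\<^sub>r\<close>. Only meaningful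
  when \<open>k n / l n\<close> tends to 1.\<close>

definition updown ::
  "(nat \<Rightarrow> nat) \<Rightarrow> (nat \<Rightarrow> nat) \<Rightarrow> (nat \<Rightarrow> complex mat) set \<Rightarrow> (nat \<Rightarrow> complex mat) set" where
  "updown k l X = (THE Y. \<exists>u\<in>carrier (unitary_prod k). \<exists>v\<in>carrier (unitary_prod l).
     X = hs_class k u \<and> Y = hs_class l v \<and>
     (\<lambda>n. hs_dist (max (k n) (l n))
            (diag_block_mat [u n, 1\<^sub>m (max (k n) (l n) - k n)])
            (diag_block_mat [v n, 1\<^sub>m (max (k n) (l n) - l n)])) \<longlonglongrightarrow> 0)"

end

theory Submission
 imports Defs "Jordan_Normal_Form.Spectral_Radius"
begin

text \<open>The maps \<open>h n\<close> of a product form isomorphism are asymptotically uniformly multiplicative,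
 uniformly continuous and uniformly injective. Scalars correspond to scalars, and on them the
 \<open>h n\<close> are close to \<open>z \<mapsto> z\<close> or to \<open>z \<mapsto> cnj z\<close>; after a complex conjugation assume the former.
 An irreducible nice error basis (shifts and clock matrices) is then mapped close to a conjugate
 of copies of itself, which compares the dimensions (so that \<open>k n / l n\<close> tends to 1, using also the inverse)
 and, after conjugation, reduces the study of \<open>h n\<close> to the commutant of a large basis,
 a copy of \<open>U(m)\<close>. A map which is uniformly within a small constant of the identity is within o(1) of it
 (\<open>self_correct\<close>), so errors do not accumulate: starting from \<open>U(2)\<close>, one passes from \<open>U(m)\<close> to
 \<open>U(2m)\<close> by normalisers of the basis (controlled-not, swap, Hadamard) and the cosine-sine decomposition,
 and from \<open>U(m)\<close> to \<open>U(m+1)\<close> because block sums of many copies are close. Passing from large \<open>m\<close>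
 to \<open>k n\<close> by finitely many doublings shows that \<open>h n\<close> is close to a conjugation on the whole group.\<close>

text \<open>The obstacle is that the number of steps from \<open>m\<close> to \<open>m + 1\<close>
  grows with \<open>n\<close>, so no statement about one sequence of sizes covers the whole climb;
  and steps by 1 are unavoidable, because only a bounded number of doublings is controlled by
  limits. \<open>close_step\<close> therefore keeps a fixed threshold: closeness 1/4 for
  \<open>m\<close> gives closeness 1/4 for \<open>m + 1\<close>, for all large \<open>n\<close> and
  all \<open>m\<close> that are large but small compared with \<open>k n\<close>; otherwise the
  counterexamples would form one sequence to which the asymptotic theory applies. In one round the
  increment costs 1/24, the resulting 7/24 becomes 5/16 on changing the size,
  \<open>re_anchor\<close> triples this to a number just below 1, and \<open>self_correct\<close>
  brings it down to o(1), hence back under 1/4. The bound 1 in \<open>self_correct\<close> keeps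
  traces of averaged matrices away from 0. Averages over finite error bases and a minimal norm
  argument take the place of Haar integration.\<close>

section \<open>Finitely supported matrices with the Frobenius inner product\<close>

text \<open>A single type contains the matrices of all sizes: \<open>k \<times> k\<close> matrices are those supported
 in the upper left corner \<open>MM k\<close>, with unit \<open>fid k\<close>.\<close>

typedef fmat = "{f :: nat => nat => complex. \<exists>N. \<forall>i j. f i j \<noteq> 0 \<longrightarrow> i < N \<and> j < N}"
 morphisms ent Abs_fmat
 by (rule exI[of _ "\<lambda>_ _. 0"]) auto

definition MM :: "nat => fmat set" where
 "MM n = {x. \<forall>i j. ent x i j \<noteq> 0 \<longrightarrow> i < n \<and> j < n}"

definition mk :: "nat => (nat => nat => complex) => fmat" where
 "mk n f = Abs_fmat (\<lambda>i j. if i < n \<and> j < n then f i j else 0)"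

text \<open>Some admissible size, not necessarily the least; \<open>ent_mult\<close>,
  \<open>inner_fmat_eq\<close> and \<open>ftr_eq\<close> make every formula independent of this
  choice.\<close>

definition bnd :: "fmat => nat" where "bnd x = (SOME n. x \<in> MM n)"

lemma fmat_eqI: "(\<And>i j. ent x i j = ent y i j) ==> x = y"
 by (metis ext ent_inject)

lemma ent_mk: "ent (mk n f) i j = (if i < n \<and> j < n then f i j else 0)"
 unfolding mk_def by (subst Abs_fmat_inverse) auto

lemma mk_MM [simp]: "mk n f \<in> MM n"
 unfolding MM_def by (auto simp: ent_mk split: if_splits)

lemma MM_bnd: "x \<in> MM (bnd x)"
 unfolding bnd_def by (rule someI_ex) (use ent[of x] in \<open>auto simp: MM_def\<close>)

lemma MM_zero: "x \<in> MM n ==> \<not> (i < n \<and> j < n) ==> ent x i j = 0"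
 unfolding MM_def by auto

lemma MM_zero':
 "x \<in> MM n ==> n \<le> i ==> ent x i j = 0" "x \<in> MM n ==> n \<le> j ==> ent x i j = 0"
 by (auto intro: MM_zero)

lemma MM_mono: "x \<in> MM n ==> n \<le> m ==> x \<in> MM m"
 unfolding MM_def by force

lemma MM_eqI: "x \<in> MM n ==> y \<in> MM n ==> (\<And>i j. i < n ==> j < n ==> ent x i j = ent y i j) ==> x = y"
 by (rule fmat_eqI) (metis MM_zero)

lemma MM_common: "\<exists>n. x \<in> MM n \<and> y \<in> MM n \<and> z \<in> MM n"
proof -
 let ?n = "max (bnd x) (max (bnd y) (bnd z))"
 have "x \<in> MM ?n" "y \<in> MM ?n" "z \<in> MM ?n"
  using MM_bnd MM_mono by (metis max.cobounded1 max.cobounded2 order_trans)+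
 then show ?thesis by blast
qed

instantiation fmat :: "{zero, plus, minus, uminus, times, scaleR}"
begin
definition "0 = mk 0 (\<lambda>_ _. 0)"
definition "x + y = mk (max (bnd x) (bnd y)) (\<lambda>i j. ent x i j + ent y i j)"
definition "x - y = mk (max (bnd x) (bnd y)) (\<lambda>i j. ent x i j - ent y i j)"
definition "- x = mk (bnd x) (\<lambda>i j. - ent x i j)"
definition "x * y = mk (max (bnd x) (bnd y)) (\<lambda>i j. \<Sum>k<bnd x. ent x i k * ent y k j)"
definition "r *\<^sub>R x = mk (bnd x) (\<lambda>i j. r *\<^sub>R ent x i j)"
instance ..
end

lemma ent_zero [simp]: "ent 0 i j = 0"
 by (simp add: zero_fmat_def ent_mk)

lemma ent_outside: "\<not> (i < bnd x \<and> j < bnd x) ==> ent x i j = 0"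
 using MM_zero MM_bnd by blast

lemma ent_outside' [simp]:
 "bnd x \<le> i ==> ent x i j = 0" "bnd x \<le> j ==> ent x i j = 0"
 by (auto intro: ent_outside)

lemma ent_add [simp]: "ent (x + y) i j = ent x i j + ent y i j"
 by (auto simp: plus_fmat_def ent_mk not_less)

lemma ent_diff [simp]: "ent (x - y) i j = ent x i j - ent y i j"
 by (auto simp: minus_fmat_def ent_mk not_less)

lemma ent_uminus [simp]: "ent (- x) i j = - ent x i j"
 by (auto simp: uminus_fmat_def ent_mk ent_outside)

lemma ent_scaleR [simp]: "ent (r *\<^sub>R x) i j = r *\<^sub>R ent x i j"
 by (auto simp: scaleR_fmat_def ent_mk ent_outside)

lemma sum_lessThan_extend:
 fixes f :: "nat => 'a::comm_monoid_add"
 assumes "\<And>k. f k \<noteq> 0 ==> k < m" "\<And>k. f k \<noteq> 0 ==> k < n"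
 shows "(\<Sum>k<m. f k) = (\<Sum>k<n. f k)"
proof (rule sum.mono_neutral_cong)
 show "f k = 0" if "k \<in> {..<n} - {..<m}" for k using assms(1)[of k] that by auto
 show "f k = 0" if "k \<in> {..<m} - {..<n}" for k using assms(2)[of k] that by auto
qed auto

lemma ent_mult_bnd: "ent (x * y) i j = (\<Sum>k<bnd x. ent x i k * ent y k j)"
proof (cases "i < max (bnd x) (bnd y) \<and> j < max (bnd x) (bnd y)")
 case False
 then have "ent x i k * ent y k j = 0" for k
  by (cases "k < bnd x"; cases "k < bnd y"; use False in auto)
 with False show ?thesis by (auto simp: times_fmat_def ent_mk)
qed (simp add: times_fmat_def ent_mk)

lemma ent_mult: "x \<in> MM n \<or> y \<in> MM n ==> ent (x * y) i j = (\<Sum>k<n. ent x i k * ent y k j)"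
 unfolding ent_mult_bnd
 by (rule sum_lessThan_extend; rule ccontr) (auto simp: not_less MM_zero')

text \<open>A unit would have infinite support, so the type is a ring without 1, and the local units
  \<open>fid n\<close> take its place.\<close>

instance fmat :: ring
proof
 fix a b c :: fmat
 obtain n where n: "a \<in> MM n" "b \<in> MM n" "c \<in> MM n" using MM_common by blast
 show "a * b * c = a * (b * c)"
  by (rule fmat_eqI)
   (simp add: ent_mult[of _ n] n sum_distrib_left sum_distrib_right mult.assoc,
    rule sum.swap)
 show "a + b + c = a + (b + c)" by (rule fmat_eqI) simp
 show "a + b = b + a" by (rule fmat_eqI) simp
 show "0 + a = a" by (rule fmat_eqI) simp
 show "- a + a = 0" by (rule fmat_eqI) simp
 show "a - b = a + - b" by (rule fmat_eqI) simp
 show "(a + b) * c = a * c + b * c"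
  by (rule fmat_eqI) (simp add: ent_mult[of _ n] n sum.distrib algebra_simps)
 show "a * (b + c) = a * b + a * c"
  by (rule fmat_eqI) (simp add: ent_mult[of _ n] n sum.distrib algebra_simps)
qed

lemma ent_sum: "ent (\<Sum>a\<in>A. f a) i j = (\<Sum>a\<in>A. ent (f a) i j)"
 by (induction A rule: infinite_finite_induct) auto

instantiation fmat :: real_inner
begin
definition inner_fmat :: "fmat => fmat => real" where
 "inner_fmat x y = (\<Sum>i<bnd x. \<Sum>j<bnd x. Re (cnj (ent x i j) * ent y i j))"
definition norm_fmat :: "fmat => real" where "norm_fmat x = sqrt (inner x x)"
definition sgn_fmat :: "fmat => fmat" where "sgn_fmat x = x /\<^sub>R norm x"
definition dist_fmat :: "fmat => fmat => real" where "dist_fmat x y = norm (x - y)"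
definition uniformity_fmat :: "(fmat \<times> fmat) filter" where
 "uniformity_fmat = (INF e\<in>{0<..}. principal {(x, y). dist x y < e})"
definition open_fmat :: "fmat set => bool" where
 "open_fmat S = (\<forall>x\<in>S. \<forall>\<^sub>F (x', y) in uniformity. x' = x \<longrightarrow> y \<in> S)"

lemma inner_fmat_eq:
 assumes "x \<in> MM n \<or> y \<in> MM n"
 shows "inner x y = (\<Sum>i<n. \<Sum>j<n. Re (cnj (ent x i j) * ent y i j))"
proof -
 have *: "(\<Sum>j<bnd x. Re (cnj (ent x i j) * ent y i j)) = (\<Sum>j<n. Re (cnj (ent x i j) * ent y i j))" for i
  by (rule sum_lessThan_extend; rule ccontr) (use assms in \<open>auto simp: not_less MM_zero'\<close>)
 show ?thesis unfolding inner_fmat_def *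
 proof (rule sum_lessThan_extend)
  fix i assume "(\<Sum>j<n. Re (cnj (ent x i j) * ent y i j)) \<noteq> 0"
  then obtain j where j: "ent x i j \<noteq> 0" "ent y i j \<noteq> 0"
   by (metis (no_types, lifting) complex_cnj_zero mult_eq_0_iff sum.not_neutral_contains_not_neutral zero_complex.simps(1))
  show "i < bnd x" using j ent_outside'(1)[of x i j] by (meson not_le)
  show "i < n" using j assms MM_zero'(1)[of _ n i j] by (meson not_le)
 qed
qed

instance
proof
 fix x y z :: fmat and r :: real
 obtain n where n: "x \<in> MM n" "y \<in> MM n" "z \<in> MM n" using MM_common by blast
 show "r *\<^sub>R (x + y) = r *\<^sub>R x + r *\<^sub>R y" by (rule fmat_eqI) (simp add: algebra_simps)
 show "1 *\<^sub>R x = x" by (rule fmat_eqI) simp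
 show "dist x y = norm (x - y)" by (simp add: dist_fmat_def)
 show "sgn x = x /\<^sub>R norm x" by (simp add: sgn_fmat_def)
 show "uniformity = (INF e\<in>{0<..}. principal {(x::fmat, y). dist x y < e})"
  by (rule uniformity_fmat_def)
 show "inner x y = inner y x"
  by (simp add: inner_fmat_eq[of _ n] n algebra_simps)
 show "inner (x + y) z = inner x z + inner y z"
  by (simp add: inner_fmat_eq[of _ n] n algebra_simps sum.distrib)
 show "inner (r *\<^sub>R x) y = r * inner x y"
  by (simp add: inner_fmat_eq[of _ n] n algebra_simps sum_distrib_left)
 have nn: "0 \<le> Re (cnj (ent x i j) * ent x i j)" for i j
  by (simp add: flip: power2_eq_square)
 show "0 \<le> inner x x"
  by (simp add: inner_fmat_eq[of _ n] n sum_nonneg)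
 show "(inner x x = 0) = (x = 0)"
 proof
  assume *: "inner x x = 0"
  have "(\<Sum>i<n. \<Sum>j<n. Re (cnj (ent x i j) * ent x i j)) = 0"
   using * by (simp only: inner_fmat_eq[of _ n] n disj_absorb)
  then have "\<forall>i\<in>{..<n}. (\<Sum>j<n. Re (cnj (ent x i j) * ent x i j)) = 0"
   by (subst (asm) sum_nonneg_eq_0_iff) (auto intro!: sum_nonneg nn simp del: times_complex.simps)
  then have "\<forall>i\<in>{..<n}. \<forall>j\<in>{..<n}. Re (cnj (ent x i j) * ent x i j) = 0"
   by (subst (asm) sum_nonneg_eq_0_iff) (auto intro!: nn simp del: times_complex.simps)
  then have "ent x i j = 0" if "i < n" "j < n" for i j
   using that by (simp add: complex_eq_iff)
  then show "x = 0" by (intro fmat_eqI) (metis MM_zero n(1) ent_zero)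
 qed (simp add: inner_fmat_def)
 show "norm x = sqrt (inner x x)" by (rule norm_fmat_def)
 show "open U = (\<forall>x\<in>U. \<forall>\<^sub>F (x', y) in uniformity. x' = x \<longrightarrow> y \<in> U)" for U :: "fmat set"
  by (rule open_fmat_def)
 show "(a + b) *\<^sub>R x = a *\<^sub>R x + b *\<^sub>R x" "a *\<^sub>R b *\<^sub>R x = (a * b) *\<^sub>R x"
 for a b
  by (auto intro!: fmat_eqI simp: algebra_simps)
qed

end

section \<open>Adjoint, complex scalars, trace, unitaries and contractions\<close>

definition adj :: "fmat => fmat" where "adj x = mk (bnd x) (\<lambda>i j. cnj (ent x j i))"
text \<open>The class \<open>real_inner\<close> provides real scalars only, so multiplication by
  complex numbers is a separate operation.\<close>

definition csc :: "complex => fmat => fmat" where "csc c x = mk (bnd x) (\<lambda>i j. c * ent x i j)"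
definition fid :: "nat => fmat" where "fid n = mk n (\<lambda>i j. if i = j then 1 else 0)"
definition eu :: "nat => nat => fmat" where
 "eu p q = mk (Suc (max p q)) (\<lambda>i j. if i = p \<and> j = q then 1 else 0)"
definition ftr :: "fmat => complex" where "ftr x = (\<Sum>i<bnd x. ent x i i)"

lemma ent_adj [simp]: "ent (adj x) i j = cnj (ent x j i)"
 by (auto simp: adj_def ent_mk)

lemma ent_csc [simp]: "ent (csc c x) i j = c * ent x i j"
 by (auto simp: csc_def ent_mk)

lemma ent_fid [simp]: "ent (fid n) i j = (if i = j \<and> i < n then 1 else 0)"
 by (auto simp: fid_def ent_mk)

lemma ent_eu [simp]: "ent (eu p q) i j = (if i = p \<and> j = q then 1 else 0)"
 by (auto simp: eu_def ent_mk)

lemma MM_I: "(\<And>i j. n \<le> i \<or> n \<le> j ==> ent x i j = 0) ==> x \<in> MM n"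
 unfolding MM_def by (auto simp: not_less[symmetric])

lemma MM_add [intro]: "x \<in> MM n ==> y \<in> MM n ==> x + y \<in> MM n"
 by (rule MM_I) (auto simp: MM_zero')
lemma MM_diff [intro]: "x \<in> MM n ==> y \<in> MM n ==> x - y \<in> MM n"
 by (rule MM_I) (auto simp: MM_zero')
lemma MM_uminus [intro]: "x \<in> MM n ==> - x \<in> MM n"
 by (rule MM_I) (auto simp: MM_zero')
lemma MM_scaleR [intro]: "x \<in> MM n ==> r *\<^sub>R x \<in> MM n"
 by (rule MM_I) (auto simp: MM_zero')
lemma MM_csc [intro]: "x \<in> MM n ==> csc c x \<in> MM n"
 by (rule MM_I) (auto simp: MM_zero')
lemma MM_adj [intro]: "x \<in> MM n ==> adj x \<in> MM n"
 by (rule MM_I) (auto simp: MM_zero')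
lemma MM_0 [simp]: "0 \<in> MM n"
 by (rule MM_I) auto
lemma MM_fid [intro]: "n \<le> m ==> fid n \<in> MM m"
 by (rule MM_I) auto
lemma MM_eu [intro]: "p < n ==> q < n ==> eu p q \<in> MM n"
 by (rule MM_I) auto
lemma MM_mult [intro]: "x \<in> MM n ==> y \<in> MM n ==> x * y \<in> MM n"
 by (rule MM_I) (auto simp: MM_zero' ent_mult[of _ n])
lemma MM_sum [intro]: "(\<And>a. a \<in> A ==> f a \<in> MM n) ==> sum f A \<in> MM n"
 by (induction A rule: infinite_finite_induct) auto

lemma fid_mult [simp]: assumes "x \<in> MM n" shows "fid n * x = x" "x * fid n = x"
proof -
 have "(\<Sum>k<n. ent (fid n) i k * ent x k j) = (\<Sum>k<n. if k = i then ent x i j else 0)"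
  "(\<Sum>k<n. ent x i k * ent (fid n) k j) = (\<Sum>k<n. if k = j then ent x i j else 0)" for i j
  by (rule sum.cong; simp)+
 then show "fid n * x = x" "x * fid n = x"
  using assms by (auto intro!: fmat_eqI simp: ent_mult[of _ n] MM_zero')
qed

lemma fid_mult_le: "x \<in> MM n ==> n \<le> m ==> fid m * x = x" "x \<in> MM n ==> n \<le> m ==> x * fid m = x"
 using MM_mono fid_mult by blast+

lemma fid_0 [simp]: "fid 0 = 0" by (rule fmat_eqI) auto

lemma adj_adj [simp]: "adj (adj x) = x" by (rule fmat_eqI) simp
lemma adj_add [simp]: "adj (x + y) = adj x + adj y" by (rule fmat_eqI) simp
lemma adj_diff [simp]: "adj (x - y) = adj x - adj y" by (rule fmat_eqI) simp
lemma adj_uminus [simp]: "adj (- x) = - adj x" by (rule fmat_eqI) simp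
lemma adj_0 [simp]: "adj 0 = 0" by (rule fmat_eqI) simp
lemma adj_scaleR [simp]: "adj (r *\<^sub>R x) = r *\<^sub>R adj x" by (rule fmat_eqI) simp
lemma adj_csc [simp]: "adj (csc c x) = csc (cnj c) (adj x)" by (rule fmat_eqI) simp
lemma adj_fid [simp]: "adj (fid n) = fid n" by (rule fmat_eqI) auto
lemma adj_eu [simp]: "adj (eu i j) = eu j i" by (rule fmat_eqI) auto
lemma adj_mult [simp]: "adj (x * y) = adj y * adj x"
proof -
 obtain n where n: "x \<in> MM n" "y \<in> MM n" using MM_common by blast
 show ?thesis by (rule fmat_eqI) (simp add: ent_mult[of _ n] n MM_adj mult.commute)
qed
lemma adj_sum: "adj (sum f A) = (\<Sum>a\<in>A. adj (f a))"
 by (induction A rule: infinite_finite_induct) auto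
lemma csc_1 [simp]: "csc 1 x = x" by (rule fmat_eqI) simp
lemma csc_0 [simp]: "csc 0 x = 0" "csc c 0 = 0" by (rule fmat_eqI; simp)+
lemma csc_csc [simp]: "csc c (csc d x) = csc (c * d) x" by (rule fmat_eqI) simp
lemma csc_add_right: "csc c (x + y) = csc c x + csc c y" by (rule fmat_eqI) (simp add: algebra_simps)
lemma csc_diff_right: "csc c (x - y) = csc c x - csc c y" by (rule fmat_eqI) (simp add: algebra_simps)
lemma csc_add_left: "csc (c + d) x = csc c x + csc d x" by (rule fmat_eqI) (simp add: algebra_simps)
lemma csc_diff_left: "csc (c - d) x = csc c x - csc d x" by (rule fmat_eqI) (simp add: algebra_simps)
lemma csc_uminus: "csc (- c) x = - csc c x" "csc c (- x) = - csc c x" by (rule fmat_eqI; simp)+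
lemma csc_mult_left [simp]: "csc c x * y = csc c (x * y)"
proof -
 obtain n where n: "x \<in> MM n" "y \<in> MM n" using MM_common by blast
 show ?thesis by (rule fmat_eqI) (simp add: ent_mult[of _ n] n MM_csc sum_distrib_left mult.assoc)
qed
lemma csc_mult_right [simp]: "x * csc c y = csc c (x * y)"
proof -
 obtain n where n: "x \<in> MM n" "y \<in> MM n" using MM_common by blast
 show ?thesis by (rule fmat_eqI) (simp add: ent_mult[of _ n] n MM_csc sum_distrib_left algebra_simps)
qed
lemma scaleR_csc: "r *\<^sub>R x = csc (of_real r) x" by (rule fmat_eqI) (simp add: scaleR_conv_of_real)
lemma scaleR_mult [simp]: "(r *\<^sub>R x) * y = r *\<^sub>R (x * y)" "x * (r *\<^sub>R y) = r *\<^sub>R (x * y)" for x y :: fmat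
 by (simp_all add: scaleR_csc)

lemma eu_mult: "eu i j * eu k l = (if j = k then eu i l else 0)"
proof (rule fmat_eqI)
 fix a b
 define n where "n = Suc (max (max i j) (max k l))"
 have n: "eu i j \<in> MM n" "j < n" by (auto simp: n_def)
 have "ent (eu i j * eu k l) a b = (\<Sum>m<n. if m = j then (if a = i \<and> j = k \<and> b = l then 1 else 0) else 0)"
  unfolding ent_mult[OF disjI1[OF n(1)]] by (rule sum.cong) auto
 also have "\<dots> = (if a = i \<and> j = k \<and> b = l then 1 else 0)" using n by simp
 finally show "ent (eu i j * eu k l) a b = ent (if j = k then eu i l else 0) a b" by simp
qed

lemma ftr_eq: "x \<in> MM n ==> ftr x = (\<Sum>i<n. ent x i i)"
 unfolding ftr_def by (rule sum_lessThan_extend; rule ccontr) (auto simp: MM_zero')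

lemma ftr_add [simp]: "ftr (x + y) = ftr x + ftr y"
proof -
 obtain n where n: "x \<in> MM n" "y \<in> MM n" using MM_common by blast
 show ?thesis using n by (simp add: ftr_eq[of _ n] MM_add sum.distrib)
qed
lemma ftr_csc [simp]: "ftr (csc c x) = c * ftr x"
 using ftr_eq[OF MM_csc[OF MM_bnd]] by (simp add: ftr_def sum_distrib_left)
lemma ftr_0 [simp]: "ftr 0 = 0" by (simp add: ftr_def)
lemma ftr_uminus [simp]: "ftr (- x) = - ftr x"
 using ftr_csc[of "-1" x] by (simp add: csc_uminus)
lemma ftr_diff [simp]: "ftr (x - y) = ftr x - ftr y"
 using ftr_add[of x "- y"] by simp
lemma ftr_scaleR [simp]: "ftr (r *\<^sub>R x) = of_real r * ftr x" by (simp add: scaleR_csc)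
lemma ftr_sum: "ftr (sum f A) = (\<Sum>a\<in>A. ftr (f a))"
 by (induction A rule: infinite_finite_induct) auto
lemma ftr_adj [simp]: "ftr (adj x) = cnj (ftr x)"
 using ftr_eq[OF MM_adj[OF MM_bnd]] by (simp add: ftr_def)
lemma ftr_fid [simp]: "ftr (fid n) = of_nat n"
 by (simp add: ftr_eq[of _ n] MM_fid)
lemma ftr_mult: "x \<in> MM n ==> y \<in> MM n ==> ftr (x * y) = (\<Sum>i<n. \<Sum>j<n. ent x i j * ent y j i)"
 by (simp add: ftr_eq[of _ n] MM_mult ent_mult[of _ n])
lemma ftr_comm: "ftr (x * y) = ftr (y * x)"
proof -
 obtain n where n: "x \<in> MM n" "y \<in> MM n" using MM_common by blast
 show ?thesis unfolding ftr_mult[OF n] ftr_mult[OF n(2,1)] by (subst sum.swap) (simp add: mult.commute)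
qed

lemma inner_ftr: "inner x y = Re (ftr (adj x * y))"
proof -
 obtain n where n: "x \<in> MM n" "y \<in> MM n" using MM_common by blast
 show ?thesis unfolding ftr_mult[OF MM_adj[OF n(1)] n(2)] inner_fmat_eq[OF disjI1, OF n(1)]
  by (subst sum.swap) simp
qed

lemma norm_sq: "(norm x)\<^sup>2 = Re (ftr (adj x * x))" for x :: fmat
 by (simp add: power2_norm_eq_inner inner_ftr)

lemma norm_sq_sum: "x \<in> MM n ==> (norm x)\<^sup>2 = (\<Sum>i<n. \<Sum>j<n. (cmod (ent x i j))\<^sup>2)" for x :: fmat
 unfolding power2_norm_eq_inner[of x] inner_fmat_eq[OF disjI1, of x n]
 by (simp add: cmod_power2) (simp add: power2_eq_square)

lemma ftr_adj_self: "ftr (adj x * x) = of_real ((norm x)\<^sup>2)"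
proof -
 have "ftr (adj x * x) = cnj (ftr (adj x * x))" by (metis adj_adj adj_mult ftr_adj)
 then have "Im (ftr (adj x * x)) = 0" by (metis complex_cnj_cancel_iff Reals_cnj_iff complex_is_Real_iff)
 then show ?thesis by (simp add: complex_eq_iff norm_sq)
qed

lemma norm_csc [simp]: "norm (csc c x) = cmod c * norm x"
proof -
 have "(norm (csc c x))\<^sup>2 = (\<Sum>i<bnd x. \<Sum>j<bnd x. (cmod c)\<^sup>2 * (cmod (ent x i j))\<^sup>2)"
  by (subst norm_sq_sum[OF MM_csc[OF MM_bnd]]) (simp add: norm_mult power_mult_distrib)
 also have "\<dots> = (cmod c * norm x)\<^sup>2"
  by (simp add: power_mult_distrib norm_sq_sum[OF MM_bnd] sum_distrib_left)
 finally show ?thesis by (simp add: power2_eq_iff_nonneg)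
qed

lemma norm_adj [simp]: "norm (adj x) = norm x"
 by (metis adj_adj ftr_comm norm_eq_sqrt_inner inner_ftr)

text \<open>\<open>inner\<close> sees only the real part of the trace; multiplying \<open>x\<close>
  by the phase of the trace turns the whole modulus into a real inner product.\<close>

lemma ftr_CS: "cmod (ftr (adj x * y)) \<le> norm x * norm y"
proof (cases "ftr (adj x * y) = 0")
 case False
 define t where "t = ftr (adj x * y)"
 define c where "c = t / of_real (cmod t)"
 have c: "cmod c = 1" using False by (simp add: c_def t_def norm_divide)
 have "cnj c * t = of_real (cmod t)"
  using False unfolding c_def
  by (simp add: t_def[symmetric] mult.commute[of "cnj t"] complex_norm_square[symmetric] power2_eq_square)
 then have "cmod t = inner (csc c x) y" by (simp add: inner_ftr t_def)
 also have "\<dots> \<le> norm x * norm y" using norm_cauchy_schwarz[of "csc c x" y] c by simp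
 finally show ?thesis by (simp add: t_def)
qed simp

definition UU :: "nat => fmat set" where
 "UU n = {u \<in> MM n. adj u * u = fid n \<and> u * adj u = fid n}"

lemma UU_I: "u \<in> MM n ==> adj u * u = fid n ==> u * adj u = fid n ==> u \<in> UU n"
 by (simp add: UU_def)

lemma UU_D: "u \<in> UU n ==> u \<in> MM n" "u \<in> UU n ==> adj u * u = fid n" "u \<in> UU n ==> u * adj u = fid n"
 by (auto simp: UU_def)

lemma UU_MM: "u \<in> UU n ==> u \<in> MM n" by (rule UU_D)

lemma UU_fid: "fid n \<in> UU n" by (simp add: UU_def MM_fid)

lemma UU_adj [intro]: "u \<in> UU n ==> adj u \<in> UU n" by (simp add: UU_def MM_adj)

lemma UU_canc: "u \<in> UU n ==> x \<in> MM n ==> adj u * (u * x) = x"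
 "u \<in> UU n ==> x \<in> MM n ==> u * (adj u * x) = x"
 "u \<in> UU n ==> x \<in> MM n ==> x * u * adj u = x"
 "u \<in> UU n ==> x \<in> MM n ==> x * adj u * u = x"
 using fid_mult UU_D mult.assoc by metis+

lemma UU_mult [intro]: "u \<in> UU n ==> v \<in> UU n ==> u * v \<in> UU n"
proof -
 assume u: "u \<in> UU n" and v: "v \<in> UU n"
 have "adj (u * v) * (u * v) = adj v * (adj u * (u * v))" by (simp add: mult.assoc)
 moreover have "u * v * adj (u * v) = u * (v * adj v) * adj u" by (simp add: mult.assoc)
 ultimately show ?thesis using u v UU_canc(1)[OF u] UU_D[OF u] UU_D[OF v]
  by (simp add: UU_def MM_mult)
qed

lemma UU_csc [intro]: "u \<in> UU n ==> cmod c = 1 ==> csc c u \<in> UU n"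
proof -
 assume u: "u \<in> UU n" and "cmod c = 1"
 then have "c * cnj c = 1" "cnj c * c = 1" by (simp_all add: complex_norm_square[symmetric] mult.commute)
 with u show ?thesis by (auto simp: UU_def MM_csc)
qed

lemma norm_UU: "u \<in> UU n ==> norm u = sqrt n"
 by (simp add: norm_eq_sqrt_inner inner_ftr UU_D)

lemma norm_UU_left: "u \<in> UU n ==> x \<in> MM n ==> norm (u * x) = norm x"
 by (simp add: norm_eq_sqrt_inner inner_ftr mult.assoc UU_canc(1))

lemma norm_UU_right: "u \<in> UU n ==> x \<in> MM n ==> norm (x * u) = norm x"
 using norm_UU_left[of "adj u" n "adj x"] by (metis MM_adj UU_adj adj_mult norm_adj)

definition KK :: "nat => fmat set" where
 "KK n = {x \<in> MM n. \<forall>y. norm (x * y) \<le> norm y \<and> norm (y * x) \<le> norm y}"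

lemma norm_fid_mult: "norm (fid n * y) \<le> norm y"
proof -
 obtain m where m: "y \<in> MM m" "n \<le> m"
  by (metis MM_bnd MM_mono max.cobounded1 max.cobounded2)
 have "fid n \<in> MM m" using m by auto
 then have e: "ent (fid n * y) i j = (if i < n then ent y i j else 0)" for i j
  using m by (auto simp: ent_mult[of _ m] if_distrib if_distribR MM_zero' cong: if_cong)
 have "(norm (fid n * y))\<^sup>2 \<le> (norm y)\<^sup>2"
  using m by (subst (1 2) norm_sq_sum[of _ m]) (auto simp: e MM_mult MM_fid intro!: sum_mono)
 then show ?thesis by (simp add: power2_le_iff_abs_le)
qed

lemma UU_KK: assumes u: "u \<in> UU n" shows "u \<in> KK n"
proof -
 have *: "norm (v * y) \<le> norm y" if "v \<in> UU n" for v y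
 proof -
  have "v * y = v * (fid n * y)" using that by (metis UU_MM fid_mult(2) mult.assoc)
  then have "norm (v * y) = norm (v * (fid n * y))" by simp
  also have "adj v * (v * (fid n * y)) = fid n * y"
   using that by (simp add: UU_D MM_fid flip: mult.assoc)
  then have "adj (v * (fid n * y)) * (v * (fid n * y)) = adj (fid n * y) * (fid n * y)"
   by (simp add: mult.assoc)
  then have "norm (v * (fid n * y)) = norm (fid n * y)" by (simp only: norm_eq_sqrt_inner inner_ftr)
  finally show ?thesis using norm_fid_mult by simp
 qed
 have "norm (y * u) \<le> norm y" for y
  using *[of "adj u" "adj y"] u by (metis UU_adj adj_mult norm_adj)
 with * u show ?thesis by (auto simp: KK_def UU_MM)
qed

lemma KK_MM: "x \<in> KK n ==> x \<in> MM n" by (auto simp: KK_def)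
lemma KK_left: "x \<in> KK n ==> norm (x * y) \<le> norm y" by (auto simp: KK_def)
lemma KK_right: "x \<in> KK n ==> norm (y * x) \<le> norm y" by (auto simp: KK_def)
lemma KK_mult [intro]: "x \<in> KK n ==> y \<in> KK n ==> x * y \<in> KK n"
 unfolding KK_def by (simp add: MM_mult) (metis mult.assoc order_trans)
lemma KK_adj [intro]: "x \<in> KK n ==> adj x \<in> KK n"
 unfolding KK_def by (simp add: MM_adj) (metis adj_adj adj_mult norm_adj)
lemma KK_convex:
 assumes "finite A" "\<And>a. a \<in> A ==> f a \<in> KK n" "\<And>a. a \<in> A ==> 0 \<le> w a" "sum w A \<le> 1"
 shows "(\<Sum>a\<in>A. w a *\<^sub>R f a) \<in> KK n"
proof -
 have "norm ((\<Sum>a\<in>A. w a *\<^sub>R f a) * y) \<le> norm y \<and> norm (y * (\<Sum>a\<in>A. w a *\<^sub>R f a)) \<le> norm y" for y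
 proof -
  have "norm (\<Sum>a\<in>A. w a *\<^sub>R (f a * y)) \<le> (\<Sum>a\<in>A. w a * norm y)"
     "norm (\<Sum>a\<in>A. w a *\<^sub>R (y * f a)) \<le> (\<Sum>a\<in>A. w a * norm y)"
   using assms KK_left[OF assms(2)] KK_right[OF assms(2)]
   by (auto intro!: sum_norm_le mult_left_mono)
  moreover have "(\<Sum>a\<in>A. w a * norm y) \<le> norm y"
   using assms(4) by (simp add: mult_left_le_one_le sum_nonneg assms flip: sum_distrib_right)
  ultimately show ?thesis by (simp add: sum_distrib_left sum_distrib_right)
 qed
 then show ?thesis using assms by (auto simp: KK_def)
qed

lemma KK_fid: "n \<le> m ==> fid n \<in> KK m"
 using UU_KK[OF UU_fid[of n]] by (auto simp: KK_def MM_fid)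

lemmas UU_intros [simp, intro] = UU_MM UU_KK KK_MM UU_fid MM_fid[OF order_refl]
lemmas closure_simps [simp] = MM_add MM_diff MM_mult MM_adj MM_csc MM_scaleR MM_uminus
 UU_mult UU_adj KK_mult KK_adj

section \<open>Kronecker products\<close>

text \<open>The Kronecker product of \<open>x\<close> with \<open>y\<close> read as an
  \<open>m\<close> by \<open>m\<close> matrix: \<open>i div m\<close> is the block and
  \<open>i mod m\<close> the place inside it. Padding by zeros makes the result the same for every
  size in which \<open>x\<close> is read.\<close>

definition kr :: "nat => fmat => fmat => fmat" where
 "kr m x y = mk (bnd x * m) (\<lambda>i j. ent x (i div m) (j div m) * ent y (i mod m) (j mod m))"

lemma ent_kr: "m > 0 ==> ent (kr m x y) i j = ent x (i div m) (j div m) * ent y (i mod m) (j mod m)"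
proof -
 assume m: "m > 0"
 have *: "bnd x \<le> k div m" if "\<not> k < bnd x * m" for k
  using that m by (simp add: less_eq_div_iff_mult_less_eq)
 have "ent x (i div m) (j div m) = 0" if "\<not> (i < bnd x * m \<and> j < bnd x * m)"
  using that *[of i] *[of j] by (auto simp: ent_outside')
 then show ?thesis unfolding kr_def ent_mk by (simp split: if_splits)
qed

lemma kr_MM [intro]: "x \<in> MM q ==> m > 0 ==> kr m x y \<in> MM (q * m)"
proof (rule MM_I)
 fix i j assume x: "x \<in> MM q" and m: "m > 0" and "q * m \<le> i \<or> q * m \<le> j"
 then have "q \<le> i div m \<or> q \<le> j div m" by (simp add: less_eq_div_iff_mult_less_eq)
 then show "ent (kr m x y) i j = 0" using x m by (auto simp: ent_kr MM_zero')
qed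

context
 fixes m :: nat assumes m: "m > 0"
begin

lemma kr_add_left: "kr m (x + x') y = kr m x y + kr m x' y"
 by (rule fmat_eqI) (simp add: ent_kr m algebra_simps)
lemma kr_add_right: "kr m x (y + y') = kr m x y + kr m x y'"
 by (rule fmat_eqI) (simp add: ent_kr m algebra_simps)
lemma kr_diff_left: "kr m (x - x') y = kr m x y - kr m x' y"
 by (rule fmat_eqI) (simp add: ent_kr m algebra_simps)
lemma kr_diff_right: "kr m x (y - y') = kr m x y - kr m x y'"
 by (rule fmat_eqI) (simp add: ent_kr m algebra_simps)
lemma kr_csc_left: "kr m (csc c x) y = csc c (kr m x y)"
 by (rule fmat_eqI) (simp add: ent_kr m)
lemma kr_csc_right: "kr m x (csc c y) = csc c (kr m x y)"
 by (rule fmat_eqI) (simp add: ent_kr m)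
lemma kr_uminus: "kr m (- x) y = - kr m x y" "kr m x (- y) = - kr m x y"
 by (rule fmat_eqI; simp add: ent_kr m)+
lemma kr_0: "kr m 0 y = 0" "kr m x 0 = 0"
 by (rule fmat_eqI; simp add: ent_kr m)+
lemma adj_kr: "adj (kr m x y) = kr m (adj x) (adj y)"
 by (rule fmat_eqI) (simp add: ent_kr m)
lemma kr_fid: "kr m (fid q) (fid m) = fid (q * m)"
proof (rule fmat_eqI)
 fix i j
 have "i = j" if "i div m = j div m" "i mod m = j mod m" using that by (metis div_mult_mod_eq)
 moreover have "(i div m < q) = (i < q * m)" using m by (simp add: div_less_iff_less_mult)
 ultimately show "ent (kr m (fid q) (fid m)) i j = ent (fid (q * m)) i j" using m by (auto simp: ent_kr)
qed

lemma sum_div_mod: "(\<Sum>k<q*m. F (k div m) (k mod m)) = (\<Sum>a<q. \<Sum>b<m. F a b)"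
 for F :: "nat => nat => 'a::comm_monoid_add"
proof (induction q)
 case (Suc q)
 have "(\<Sum>k<Suc q*m. F (k div m) (k mod m)) = (\<Sum>k<q*m. F (k div m) (k mod m)) + (\<Sum>k\<in>{q*m..<q*m+m}. F (k div m) (k mod m))"
  by (simp add: lessThan_atLeast0 sum.atLeastLessThan_concat add.commute)
 also have "(\<Sum>k\<in>{q*m..<q*m+m}. F (k div m) (k mod m)) = (\<Sum>b\<in>{0..<m}. F ((b + q * m) div m) ((b + q * m) mod m))"
  using sum.shift_bounds_nat_ivl[of "\<lambda>k. F (k div m) (k mod m)" 0 "q * m" m] by (simp add: add.commute)
 also have "\<dots> = (\<Sum>b<m. F q b)" using m by (auto simp: lessThan_atLeast0 intro!: sum.cong)
 finally show ?case using Suc by simp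
qed simp

lemma kr_mult: assumes "y \<in> MM m"
 shows "kr m x y * kr m x' y' = kr m (x * x') (y * y')"
proof (rule fmat_eqI)
 fix i j
 have "ent (kr m x y * kr m x' y') i j = (\<Sum>k<bnd x*m. ent x (i div m) (k div m) * ent y (i mod m) (k mod m)
   * (ent x' (k div m) (j div m) * ent y' (k mod m) (j mod m)))"
  by (subst ent_mult[OF disjI1[OF kr_MM[OF MM_bnd m]]]) (simp add: ent_kr m)
 also have "\<dots> = (\<Sum>a<bnd x. \<Sum>b<m. ent x (i div m) a * ent y (i mod m) b
   * (ent x' a (j div m) * ent y' b (j mod m)))"
  by (rule sum_div_mod[of "\<lambda>a b. ent x (i div m) a * ent y (i mod m) b * (ent x' a (j div m) * ent y' b (j mod m))"])
 also have "\<dots> = ent (kr m (x * x') (y * y')) i j"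
  using assms by (subst sum.swap) (simp add: ent_kr m ent_mult[of _ m] ent_mult_bnd[of x] sum_product algebra_simps)
 finally show "ent (kr m x y * kr m x' y') i j = ent (kr m (x * x') (y * y')) i j" .
qed

lemma ftr_kr: "y \<in> MM m ==> ftr (kr m x y) = ftr x * ftr y"
 using sum_div_mod[of "\<lambda>a b. ent x a a * ent y b b" "bnd x"]
 by (simp add: ftr_eq[OF kr_MM[OF MM_bnd m]] ftr_eq[of y m] ent_kr m ftr_def[of x] sum_product)

lemma norm_kr: "y \<in> MM m ==> norm (kr m x y) = norm x * norm y"
proof -
 assume y: "y \<in> MM m"
 have "(norm (kr m x y))\<^sup>2 = (norm x * norm y)\<^sup>2"
  using y by (simp add: norm_sq[of "kr m x y"] adj_kr kr_mult MM_adj ftr_kr MM_mult ftr_adj_self power_mult_distrib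
    flip: of_real_mult)
 then show ?thesis by (simp add: power2_eq_iff_nonneg)
qed

lemma UU_kr [intro]: "x \<in> UU q ==> y \<in> UU m ==> kr m x y \<in> UU (q * m)"
 by (rule UU_I) (simp_all add: adj_kr kr_mult MM_adj kr_fid kr_MM m UU_D)

lemma kr_sum_left: "kr m (sum f A) y = (\<Sum>a\<in>A. kr m (f a) y)"
 by (induction A rule: infinite_finite_induct) (auto simp: kr_add_left kr_0)
lemma kr_sum_right: "kr m x (sum f A) = (\<Sum>a\<in>A. kr m x (f a))"
 by (induction A rule: infinite_finite_induct) (auto simp: kr_add_right kr_0)

end

lemma kr_assoc: assumes "m > 0" "n > 0"
 shows "kr n (kr m x y) z = kr (m * n) x (kr n y z)"
proof (rule fmat_eqI)
 fix i j
 have 1: "k div n div m = k div (m * n)" for k by (metis div_mult2_eq mult.commute)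
 have 2: "(k div n) mod m = k mod (m * n) div n" for k
 proof -
  have "k mod (m * n) = n * (k div n mod m) + k mod n"
   using mod_mult2_eq[of k n m] by (simp only: mult.commute[of m n])
  then show ?thesis using assms by simp
 qed
 have 3: "k mod n = k mod (m * n) mod n" for k by (simp add: mod_mult_self2 mod_mod_cancel)
 show "ent (kr n (kr m x y) z) i j = ent (kr (m * n) x (kr n y z)) i j"
  using assms 3 by (simp add: ent_kr 1 2)
qed

lemma kr_1 [simp]: assumes "x \<in> MM m" "m > 0" shows "kr m (fid 1) x = x"
proof (rule fmat_eqI)
 fix i j
 show "ent (kr m (fid 1) x) i j = ent x i j"
  using assms MM_zero'[OF assms(1), of i j] MM_zero'[OF assms(1), of j i]
  by (cases "i < m"; cases "j < m") (auto simp: ent_kr MM_zero' div_eq_0_iff not_less)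
qed

section \<open>Spectral theorem and singular values\<close>

definition dg :: "nat => (nat => complex) => fmat" where
 "dg n d = mk n (\<lambda>i j. if i = j then d i else 0)"

lemma ent_dg [simp]: "ent (dg n d) i j = (if i = j \<and> i < n then d i else 0)"
 by (auto simp: dg_def ent_mk)

lemma dg_MM [simp]: "dg n d \<in> MM n" by (simp add: dg_def)

lemma dg_mult: "dg n d * dg n e = dg n (\<lambda>i. d i * e i)"
proof (rule fmat_eqI)
 fix i j
 have "ent (dg n d * dg n e) i j = (\<Sum>k<n. if k = i then (if i = j then d i * e i else 0) else 0)"
  unfolding ent_mult[OF disjI1[OF dg_MM]] by (rule sum.cong) auto
 then show "ent (dg n d * dg n e) i j = ent (dg n (\<lambda>i. d i * e i)) i j" by simp
qed

lemma adj_dg: "adj (dg n d) = dg n (\<lambda>i. cnj (d i))" by (rule fmat_eqI) auto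
lemma dg_cong: "(\<And>i. i < n ==> d i = e i) ==> dg n d = dg n e" by (rule fmat_eqI) auto
lemma dg_1: "dg n (\<lambda>i. 1) = fid n" by (rule fmat_eqI) auto
lemma dg_add: "dg n d + dg n e = dg n (\<lambda>i. d i + e i)" by (rule fmat_eqI) auto
lemma dg_diff: "dg n d - dg n e = dg n (\<lambda>i. d i - e i)" by (rule fmat_eqI) auto
lemma dg_csc: "csc c (dg n d) = dg n (\<lambda>i. c * d i)" by (rule fmat_eqI) auto
lemma ftr_dg: "ftr (dg n d) = (\<Sum>i<n. d i)" by (simp add: ftr_eq[OF dg_MM])
lemma UU_dg: assumes "\<And>i. i < n ==> cmod (d i) = 1" shows "dg n d \<in> UU n"
proof (rule UU_I)
 have "cnj (d i) * d i = 1" if "i < n" for i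
  using assms[OF that] by (simp add: mult.commute complex_norm_square[symmetric])
 then show "adj (dg n d) * dg n d = fid n" "dg n d * adj (dg n d) = fid n"
  by (auto simp: adj_dg dg_mult dg_1[symmetric] mult.commute intro!: dg_cong)
qed simp
lemma norm_dg: "(norm (dg n d))\<^sup>2 = (\<Sum>i<n. (cmod (d i))\<^sup>2)"
proof -
 have "(\<Sum>j<n. (cmod (ent (dg n d) i j))\<^sup>2) = (\<Sum>j<n. if j = i then (cmod (d i))\<^sup>2 else 0)" if "i < n" for i
  using that by (intro sum.cong) auto
 then show ?thesis by (simp add: norm_sq_sum[OF dg_MM])
qed

text \<open>Vectors are encoded as matrices supported in column 0, which is what
  \<open>v * eu 0 0 = v\<close> says; the eigenvector comes from the nonempty spectrum of the
  corresponding \<open>complex mat\<close>.\<close>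

lemma eigenvector_exists:
 assumes x: "x \<in> MM n" and n: "n > 0"
 obtains v lam where "v \<in> MM n" "v * eu 0 0 = v" "norm v = 1" "x * v = csc lam v"
proof -
 define A where "A = mat n n (\<lambda>(i, j). ent x i j)"
 have A: "A \<in> carrier_mat n n" by (simp add: A_def)
 from spectrum_non_empty[OF A] n obtain k where "eigenvalue A k" by (auto simp: spectrum_def)
 then obtain w where w: "w \<in> carrier_vec n" "w \<noteq> 0\<^sub>v n" "A *\<^sub>v w = k \<cdot>\<^sub>v w"
  using A by (auto simp: eigenvalue_def eigenvector_def)
 define v where "v = mk n (\<lambda>i j. if j = 0 then w $ i else 0)"
 have v: "v \<in> MM n" by (simp add: v_def)
 have ev: "ent v i j = (if i < n \<and> j = 0 then w $ i else 0)" for i j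
  using n by (auto simp: v_def ent_mk)
 have "v \<noteq> 0"
 proof
  assume "v = 0"
  then have "w $ i = 0" if "i < n" for i using ev[of i 0] that by simp
  then show False using w(1,2) by (auto intro!: eq_vecI)
 qed
 have 1: "v * eu 0 0 = v"
 proof (rule fmat_eqI)
  fix i j
  have "ent (v * eu 0 0) i j = (\<Sum>k<n. if k = 0 then (if j = 0 then ent v i 0 else 0) else 0)"
   unfolding ent_mult[OF disjI1[OF v]] by (rule sum.cong) auto
  then show "ent (v * eu 0 0) i j = ent v i j" using n by (simp add: ev)
 qed
 have 2: "x * v = csc k v"
 proof (rule MM_eqI[of _ n])
  fix i j assume ij: "i < n" "j < n"
  have "(A *\<^sub>v w) $ i = (\<Sum>l<n. ent x i l * w $ l)"
   using ij A w(1) by (simp add: A_def scalar_prod_def lessThan_atLeast0)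
  then have "(\<Sum>l<n. ent x i l * w $ l) = k * w $ i" using w ij by simp
  then show "ent (x * v) i j = ent (csc k v) i j"
   using ij by (simp add: ent_mult[of _ n] x ev)
 qed (use x v in auto)
 have "v /\<^sub>R norm v \<in> MM n" "v /\<^sub>R norm v * eu 0 0 = v /\<^sub>R norm v" "norm (v /\<^sub>R norm v) = 1"
  "x * (v /\<^sub>R norm v) = csc k (v /\<^sub>R norm v)"
  using 1 2 v \<open>v \<noteq> 0\<close> by (auto simp: scaleR_csc mult.commute norm_inverse)
 then show ?thesis using that by blast
qed

lemma vec_norm: "v * eu 0 0 = v ==> adj v * v = csc (of_real ((norm v)\<^sup>2)) (eu 0 0)"
proof -
 assume v: "v * eu 0 0 = v"
 then have "adj v * v = eu 0 0 * (adj v * v) * eu 0 0"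
  by (metis adj_eu adj_mult mult.assoc)
 moreover have "eu 0 0 * x * eu 0 0 = csc (ent x 0 0) (eu 0 0)" for x
 proof (rule fmat_eqI)
  fix i j
  have e: "eu 0 0 \<in> MM 1" by auto
  show "ent (eu 0 0 * x * eu 0 0) i j = ent (csc (ent x 0 0) (eu 0 0)) i j"
   by (simp add: ent_mult[OF disjI2[OF e]] ent_mult[OF disjI1[OF e]])
 qed
 ultimately have *: "adj v * v = csc (ent (adj v * v) 0 0) (eu 0 0)" by metis
 have "ftr (eu 0 0) = 1" using ftr_eq[of "eu 0 0" 1] by auto
 then have "ftr (adj v * v) = ent (adj v * v) 0 0" using * by (metis ftr_csc mult.right_neutral)
 then show ?thesis using * by (simp add: ftr_adj_self)
qed

text \<open>A reflection exchanges two unit vectors when their inner product is real. The phase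
  \<open>c\<close> makes the inner product of \<open>csc c v\<close> with the last basis vector
  real.\<close>

lemma householder:
 assumes v: "v \<in> MM (Suc n)" "v * eu 0 0 = v" "norm v = 1"
 obtains u c where "u \<in> UU (Suc n)" "cmod c = 1" "u * eu n 0 = csc c v"
proof -
 let ?e = "eu n 0"
 define s where "s = ent v n 0"
 define c where "c = (if s = 0 then 1 else cnj s / of_real (cmod s))"
 have c: "cmod c = 1" by (simp add: c_def norm_divide)
 have cs: "cnj (c * s) = c * s"
  by (auto simp: c_def mult.commute complex_norm_square[symmetric] simp flip: of_real_mult)
 define w where "w = csc c v - ?e"
 have e: "?e \<in> MM (Suc n)" by auto
 have w: "w \<in> MM (Suc n)" "w * eu 0 0 = w" using v e by (auto simp: w_def algebra_simps eu_mult)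
 have e0: "adj ?e * v = csc s (eu 0 0)"
 proof (rule fmat_eqI)
  fix i j
  have "ent (adj ?e * v) i j = (\<Sum>k<Suc n. if k = n then (if i = 0 then ent v n j else 0) else 0)"
   unfolding ent_mult[OF disjI2[OF v(1)]] by (rule sum.cong) auto
  also have "\<dots> = (if i = 0 then ent v n j else 0)" by simp
  moreover have "ent v n j = (if j = 0 then s else 0)"
  proof -
   have "ent v n j = ent (v * eu 0 0) n j" using v by simp
   also have "\<dots> = (\<Sum>k<Suc n. if k = 0 then (if j = 0 then ent v n 0 else 0) else 0)"
    unfolding ent_mult[OF disjI1[OF v(1)]] by (rule sum.cong) auto
   finally show ?thesis by (simp add: s_def)
  qed
  ultimately show "ent (adj ?e * v) i j = ent (csc s (eu 0 0)) i j" by simp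
 qed
 have ve: "adj v * ?e = csc (cnj s) (eu 0 0)"
  using arg_cong[OF e0, of adj] by simp
 have vv: "adj v * v = eu 0 0" using vec_norm[OF v(2)] v(3) by simp
 have ee: "adj ?e * ?e = eu 0 0" by (simp add: eu_mult)
 define r where "r = c * s"
 have cc: "cnj c * c = 1" using c by (simp add: mult.commute complex_norm_square[symmetric])
 have e0': "eu 0 n * v = csc s (eu 0 0)" and ee': "eu 0 n * eu n 0 = eu 0 0"
  using e0 ee by simp_all
 have cs': "cnj c * cnj s = r" using cs by (simp add: r_def)
 have "adj w * w = csc (cnj c * c) (adj v * v) - csc (cnj c) (adj v * ?e) - csc c (eu 0 n * v) + eu 0 n * ?e"
  by (simp add: w_def algebra_simps csc_diff_right)
 also have "\<dots> = eu 0 0 - csc r (eu 0 0) - csc r (eu 0 0) + eu 0 0"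
  by (simp add: cc vv ve e0' ee' cs' r_def[symmetric])
 also have "\<dots> = csc (2 - 2 * r) (eu 0 0)" by (rule fmat_eqI) simp
 finally have ww: "adj w * w = csc (2 - 2 * r) (eu 0 0)" .
 have "adj w * ?e = csc (cnj c) (adj v * ?e) - eu 0 n * ?e" by (simp add: w_def algebra_simps)
 also have "\<dots> = csc r (eu 0 0) - eu 0 0" by (simp add: ve ee' cs')
 also have "\<dots> = csc (r - 1) (eu 0 0)" by (rule fmat_eqI) simp
 finally have we: "adj w * ?e = csc (r - 1) (eu 0 0)" .
 show ?thesis
 proof (cases "w = 0")
  case True
  then have "fid (Suc n) * ?e = csc c v" using e by (simp add: w_def)
  then show ?thesis using that[OF UU_fid c] by blast
 next
  case False
  have wn: "of_real ((norm w)\<^sup>2) = 2 - 2 * r"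
  proof -
   have "csc (of_real ((norm w)\<^sup>2)) (eu 0 0) = csc (2 - 2 * r) (eu 0 0)" using vec_norm[OF w(2)] ww by simp
   from arg_cong[OF this, of "\<lambda>x. ent x 0 0"] show ?thesis by simp
  qed
  define t where "t = 2 - 2 * r"
  have t: "t \<noteq> 0" "cnj t = t" using False wn unfolding t_def by (auto simp flip: wn)
  define P where "P = w * adj w"
  have P: "P \<in> MM (Suc n)" "adj P = P" "P * P = csc t P"
  proof -
   have "P * P = w * (adj w * w) * adj w" by (simp add: P_def mult.assoc)
   then show "P * P = csc t P" using w(2) by (simp add: ww t_def P_def)
  qed (use w in \<open>auto simp: P_def\<close>)
  \<comment> \<open>\<open>t\<close> is the squared norm of \<open>w\<close>, so \<open>u\<close> is
    the reflection 1 - 2 w w* / |w|^2 in the hyperplane orthogonal to \<open>w\<close>.\<close>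
  define u where "u = fid (Suc n) - csc (2 / t) P"
  have ua: "adj u = u" by (simp add: u_def P t)
  have "u * u = fid (Suc n)"
  proof -
   have "2 / t * (2 / t) * t = 2 / t + 2 / t" using t by (simp add: field_simps)
   moreover have "u * u = fid (Suc n) - csc (2 / t) P - csc (2 / t) P + csc (2 / t * (2 / t)) (P * P)"
    using P(1) by (simp add: u_def algebra_simps csc_diff_right)
   ultimately show ?thesis by (simp only: P(3) csc_csc csc_add_left) simp
  qed
  then have U: "u \<in> UU (Suc n)" using P ua by (intro UU_I) (auto simp: u_def)
  have "u * ?e = ?e - csc (2 / t) (w * (adj w * ?e))"
   using e by (simp add: u_def algebra_simps P_def mult.assoc)
  also have "\<dots> = ?e - csc (2 / t * (r - 1)) w" by (simp add: we w(2))
  also have "2 / t * (r - 1) = -1" using t by (simp add: t_def field_simps)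
  finally have "u * ?e = csc c v" by (simp add: csc_uminus w_def)
  then show ?thesis using that[OF U c] by blast
 qed
qed

lemma fid_Suc: "fid (Suc n) = fid n + eu n n" by (rule fmat_eqI) auto

lemma MM_eu_0: "x \<in> MM n ==> n \<le> j ==> x * eu j k = 0" "x \<in> MM n ==> n \<le> j ==> eu k j * x = 0"
proof -
 assume x: "x \<in> MM n" and j: "n \<le> j"
 show "x * eu j k = 0" "eu k j * x = 0"
  using j by (auto intro!: fmat_eqI sum.neutral simp: ent_mult[OF disjI1[OF x]] ent_mult[OF disjI2[OF x]])
qed

lemma UU_extend: "u \<in> UU n ==> n \<le> m ==> u + (fid m - fid n) \<in> UU m"
proof (rule UU_I)
 assume u: "u \<in> UU n" and nm: "n \<le> m"
 have f: "fid n * fid m = fid n" "fid m * fid n = fid n" using nm by (auto intro: fid_mult_le)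
 have g: "u * fid m = u" "fid m * u = u" "adj u * fid m = adj u" "fid m * adj u = adj u"
  using u nm by (simp_all add: fid_mult_le[of _ n] UU_adj)
 have "adj u \<in> MM n" using u by auto
 then show "adj (u + (fid m - fid n)) * (u + (fid m - fid n)) = fid m"
  "(u + (fid m - fid n)) * adj (u + (fid m - fid n)) = fid m"
  using f g u by (simp_all add: algebra_simps UU_D)
 show "u + (fid m - fid n) \<in> MM m" using MM_mono[OF UU_MM[OF u] nm] nm by (auto intro!: MM_add MM_diff)
qed

text \<open>The last column of \<open>A\<close> is read off from \<open>A * eu n 0\<close> and the
  last row from the adjoint, so both carry only the corner entry.\<close>

lemma split_last:
 assumes A: "A \<in> MM (Suc n)" and 1: "A * eu n 0 = csc \<mu> (eu n 0)" and 2: "adj A * eu n 0 = csc (cnj \<mu>) (eu n 0)"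
 shows "A - csc \<mu> (eu n n) \<in> MM n"
proof (rule MM_I)
 have col: "ent (B * eu n 0) i 0 = ent B i n" if "B \<in> MM (Suc n)" for B i
 proof -
  have "ent (B * eu n 0) i 0 = (\<Sum>k<Suc n. if k = n then ent B i n else 0)"
   unfolding ent_mult[OF disjI1[OF that]] by (rule sum.cong) auto
  then show ?thesis by simp
 qed
 have c1: "ent A i n = (if i = n then \<mu> else 0)" for i using col[OF A, of i] 1 by auto
 have c2: "ent A n i = (if i = n then \<mu> else 0)" for i
  using col[OF MM_adj[OF A], of i] 2 by (auto split: if_splits simp: complex_cnj_cancel_iff)
 fix i j assume "n \<le> i \<or> n \<le> j"
 then show "ent (A - csc \<mu> (eu n n)) i j = 0"
  using c1[of i] c2[of j] MM_zero'[OF A, of i j] MM_zero'[OF A, of j i]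
  by (cases "i = n"; cases "j = n") auto
qed

lemma dg_extend: "dg n d + csc c (eu n n) = dg (Suc n) (d(n := c))"
 by (rule fmat_eqI) auto

lemma UU_extend_Suc: "u \<in> UU n ==> u + eu n n \<in> UU (Suc n)"
 using UU_extend[of u n "Suc n"] by (simp add: fid_Suc)

text \<open>Induction on the size: a Householder unitary turns an eigenvector into the last basis
  vector, normality makes that vector an eigenvector of the adjoint too, and the corner splits
  off.\<close>

theorem spectral_normal:
 assumes "N \<in> MM n" "adj N * N = N * adj N"
 obtains u d where "u \<in> UU n" "N = u * dg n d * adj u"
proof -
 have "\<exists>u d. u \<in> UU n \<and> N = u * dg n d * adj u" using assms
 proof (induction n arbitrary: N)
  case 0
  then have "N = 0" by (intro fmat_eqI) (simp add: MM_zero')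
  then have "N = fid 0 * dg 0 (\<lambda>_. 0) * adj (fid 0)" by simp
  then show ?case using UU_fid by blast
 next
  case (Suc n)
  let ?e = "eu n 0"
  have e: "?e \<in> MM (Suc n)" by auto
  obtain v lam where v: "v \<in> MM (Suc n)" "v * eu 0 0 = v" "norm v = 1" "N * v = csc lam v"
   using eigenvector_exists[OF Suc.prems(1)] by blast
  obtain u c where u: "u \<in> UU (Suc n)" "cmod c = 1" "u * ?e = csc c v"
   using householder[OF v(1-3)] by blast
  define A where "A = adj u * N * u"
  have A: "A \<in> MM (Suc n)" using u Suc.prems by (auto simp: A_def)
  have An: "adj A * A = A * adj A"
  proof -
   have "adj A * A = adj u * (adj N * (u * adj u) * N) * u" by (simp add: A_def mult.assoc)
   also have "\<dots> = adj u * (N * (u * adj u) * adj N) * u"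
    using u(1) Suc.prems by (simp add: UU_D MM_adj)
   also have "\<dots> = A * adj A" by (simp add: A_def mult.assoc)
   finally show ?thesis .
  qed
  have Ae: "A * ?e = csc lam ?e"
  proof -
   have "A * ?e = adj u * (N * (u * ?e))" by (simp add: A_def mult.assoc)
   also have "\<dots> = csc lam (adj u * (u * ?e))" by (simp add: u(3) v(4) mult.commute)
   finally show ?thesis using UU_canc(1)[OF u(1) e] by simp
  qed
  \<comment> \<open>A normal matrix and its adjoint have the same norm on every vector, so
    \<open>B\<close> killing the last basis vector forces \<open>adj B\<close> to kill it.\<close>
  define B where "B = A - csc lam (fid (Suc n))"
  have "adj B * B = B * adj B" using An A by (simp add: B_def algebra_simps csc_diff_right)
  moreover have "adj (B * ?e) * (B * ?e) = adj ?e * (adj B * B) * ?e"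
   "adj (adj B * ?e) * (adj B * ?e) = adj ?e * (B * adj B) * ?e" by (simp_all add: mult.assoc)
  ultimately have "norm (adj B * ?e) = norm (B * ?e)" by (simp only: norm_eq_sqrt_inner inner_ftr)
  then have "adj B * ?e = 0" using Ae e by (simp add: B_def algebra_simps)
  then have Ae': "adj A * ?e = csc (cnj lam) ?e" using e by (simp add: B_def algebra_simps)
  define C where "C = A - csc lam (eu n n)"
  have C: "C \<in> MM n" unfolding C_def by (rule split_last[OF A Ae Ae'])
  have AC: "A = C + csc lam (eu n n)" by (simp add: C_def)
  have "adj C * C = C * adj C"
   using An C MM_adj[OF C] by (simp add: AC algebra_simps MM_eu_0[of _ n, OF _ order_refl] eu_mult)
  then obtain w d where w: "w \<in> UU n" "C = w * dg n d * adj w" using Suc.IH[OF C] by blast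
  define W where "W = w + eu n n"
  have W: "W \<in> UU (Suc n)" unfolding W_def by (rule UU_extend_Suc[OF w(1)])
  have "W * dg (Suc n) (d(n := lam)) * adj W = A"
   unfolding AC dg_extend[symmetric] W_def w(2) using w(1) UU_adj[OF w(1)]
   by (simp add: algebra_simps MM_eu_0[of _ n, OF _ order_refl] eu_mult csc_add_right)
  then have "u * W * dg (Suc n) (d(n := lam)) * adj (u * W) = u * A * adj u"
   by (metis adj_mult mult.assoc)
  also have "\<dots> = u * adj u * N * (u * adj u)" by (simp add: A_def mult.assoc)
  also have "\<dots> = N" using u(1) Suc.prems by (simp add: UU_D)
  finally show ?case using UU_mult[OF u(1) W] by metis
 qed
 then show ?thesis using that by blast
qed

text \<open>An eigenvector \<open>v\<close> of A*A with nonzero eigenvalue and its normalised image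
  \<open>w\<close> are moved to the last basis vector by separate unitaries \<open>V\<close> and
  \<open>U\<close>. The phases of the two reflections survive, so the diagonal is complex at this
  stage; \<open>svd\<close> moves the phases into \<open>u\<close>.\<close>

lemma svd_complex:
 "A \<in> MM n ==> \<exists>u\<in>UU n. \<exists>v\<in>UU n. \<exists>s. A = u * dg n s * adj v"
proof (induction n arbitrary: A)
 case 0
 then have "A = 0" by (intro fmat_eqI) (simp add: MM_zero')
 then have "A = fid 0 * dg 0 (\<lambda>_. 0) * adj (fid 0)" by simp
 then show ?case using UU_fid by blast
next
 case (Suc n)
 show ?case
 proof (cases "A = 0")
  case True
  have "dg (Suc n) (\<lambda>_. 0) = 0" by (rule fmat_eqI) simp
  then have "A = fid (Suc n) * dg (Suc n) (\<lambda>_. 0) * adj (fid (Suc n))" using True by simp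
  then show ?thesis using UU_fid by blast
 next
  case False
  let ?e = "eu n 0"
  have e: "?e \<in> MM (Suc n)" by auto
  have H: "adj A * A \<in> MM (Suc n)" using Suc.prems by auto
  obtain p d where p: "p \<in> UU (Suc n)" "adj A * A = p * dg (Suc n) d * adj p"
  proof (rule spectral_normal[OF H])
   show "adj (adj A * A) * (adj A * A) = adj A * A * adj (adj A * A)" by simp
  qed blast
  have "\<exists>i<Suc n. d i \<noteq> 0"
  proof (rule ccontr)
   assume "\<not> ?thesis"
   then have "dg (Suc n) d = 0" by (intro fmat_eqI) auto
   then have "adj A * A = 0" by (simp add: p(2))
   then have "norm A = 0" using norm_sq[of A] by simp
   then show False using False by simp
  qed
  then obtain i where i: "i < Suc n" "d i \<noteq> 0" by blast
  define v where "v = p * eu i 0"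
  have ei: "eu i 0 \<in> MM (Suc n)" using i by auto
  have v: "v \<in> MM (Suc n)" "v * eu 0 0 = v" using p ei by (auto simp: v_def mult.assoc eu_mult)
  have nei: "norm (eu i 0) = 1"
  proof -
   have "ftr (eu 0 0) = 1" using ftr_eq[of "eu 0 0" 1] by auto
   then show ?thesis by (simp add: norm_eq_sqrt_inner inner_ftr eu_mult)
  qed
  have vn: "norm v = 1" using norm_UU_left[OF p(1) ei] nei by (simp add: v_def)
  have dgi: "dg (Suc n) d * eu i 0 = csc (d i) (eu i 0)"
  proof (rule fmat_eqI)
   fix a b
   have "ent (dg (Suc n) d * eu i 0) a b = (\<Sum>k<Suc n. if k = i then (if a = i \<and> b = 0 then d i else 0) else 0)"
    unfolding ent_mult[OF disjI1[OF dg_MM]] using i by (intro sum.cong) auto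
   then show "ent (dg (Suc n) d * eu i 0) a b = ent (csc (d i) (eu i 0)) a b" using i by simp
  qed
  have Av: "adj A * (A * v) = csc (d i) v"
  proof -
   have "adj A * (A * v) = p * (dg (Suc n) d * (adj p * (p * eu i 0)))"
    by (simp add: v_def p(2) mult.assoc flip: mult.assoc[of "adj A"])
   then show ?thesis using UU_canc(1)[OF p(1) ei] by (simp add: dgi v_def)
  qed
  have "adj (A * v) * (A * v) = csc (d i) (adj v * v)" by (simp add: mult.assoc Av)
  then have "of_real ((norm (A * v))\<^sup>2) = d i"
   using vn ftr_adj_self[of "A * v"] ftr_adj_self[of v] by simp
  define \<sigma> where "\<sigma> = norm (A * v)"
  have di: "d i = of_real (\<sigma>\<^sup>2)" and \<sigma>: "\<sigma> > 0"
   using \<open>of_real ((norm (A * v))\<^sup>2) = d i\<close> i(2) by (auto simp: \<sigma>_def)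
  define w where "w = csc (1 / of_real \<sigma>) (A * v)"
  have w: "w \<in> MM (Suc n)" "w * eu 0 0 = w" "norm w = 1" "A * v = csc \<sigma> w"
   using v Suc.prems \<sigma> by (auto simp: w_def mult.assoc norm_divide \<sigma>_def)
  have Aw: "adj A * w = csc \<sigma> v" using \<sigma> by (simp add: w_def Av di power2_eq_square)
  obtain U c where U: "U \<in> UU (Suc n)" "cmod c = 1" "U * ?e = csc c w"
   using householder[OF w(1-3)] by blast
  obtain V c' where V: "V \<in> UU (Suc n)" "cmod c' = 1" "V * ?e = csc c' v"
   using householder[OF v vn] by blast
  have cc: "cnj c * c = 1" "cnj c' * c' = 1" "c \<noteq> 0" "c' \<noteq> 0"
   using U(2) V(2) by (auto simp: mult.commute complex_norm_square[symmetric])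
  have Uw: "adj U * w = csc (1 / c) ?e"
   using arg_cong[OF U(3), of "\<lambda>x. csc (1/c) (adj U * x)"] UU_canc(1)[OF U(1) e] cc by simp
  have Vv: "adj V * v = csc (1 / c') ?e"
   using arg_cong[OF V(3), of "\<lambda>x. csc (1/c') (adj V * x)"] UU_canc(1)[OF V(1) e] cc by simp
  define B where "B = adj U * A * V"
  define \<mu> where "\<mu> = c' * \<sigma> / c"
  have B: "B \<in> MM (Suc n)" using U(1) V(1) Suc.prems by (auto simp: B_def)
  have Be: "B * ?e = csc \<mu> ?e" by (simp add: B_def mult.assoc V(3) w(4) Uw \<mu>_def)
  have "c * \<sigma> * cnj c = (cnj c * c) * \<sigma>" "cnj c' * \<sigma> * c' = (cnj c' * c') * \<sigma>" by (simp_all add: ac_simps)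
  then have "c * \<sigma> / c' = cnj \<mu>" using cc by (simp add: \<mu>_def frac_eq_eq)
  then have Be': "adj B * ?e = csc (cnj \<mu>) ?e"
   by (simp add: B_def mult.assoc U(3) Aw Vv)
  define C where "C = B - csc \<mu> (eu n n)"
  have C: "C \<in> MM n" unfolding C_def by (rule split_last[OF B Be Be'])
  obtain x y s where xy: "x \<in> UU n" "y \<in> UU n" "C = x * dg n s * adj y" using Suc.IH[OF C] by blast
  have X: "x + eu n n \<in> UU (Suc n)" "y + eu n n \<in> UU (Suc n)" using xy UU_extend_Suc by auto
  have "(x + eu n n) * dg (Suc n) (s(n := \<mu>)) * adj (y + eu n n) = C + csc \<mu> (eu n n)"
   unfolding dg_extend[symmetric] xy(3) using xy(1) UU_adj[OF xy(2)]
   by (simp add: algebra_simps MM_eu_0[of _ n, OF _ order_refl] eu_mult csc_add_right)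
  then have "(x + eu n n) * dg (Suc n) (s(n := \<mu>)) * adj (y + eu n n) = B" by (simp add: C_def)
  then have "U * (x + eu n n) * dg (Suc n) (s(n := \<mu>)) * adj (V * (y + eu n n)) = U * B * adj V"
   by (metis adj_mult mult.assoc)
  also have "\<dots> = U * adj U * A * (V * adj V)" by (simp add: B_def mult.assoc)
  also have "\<dots> = A" using U(1) V(1) Suc.prems by (simp add: UU_D)
  finally show ?thesis using UU_mult[OF U(1) X(1)] UU_mult[OF V(1) X(2)] by metis
 qed
qed

theorem svd:
 assumes "A \<in> MM n"
 obtains u v s where "u \<in> UU n" "v \<in> UU n" "\<And>i. 0 \<le> s i" "A = u * dg n (\<lambda>i. of_real (s i)) * adj v"
proof -
 obtain u v s where uv: "u \<in> UU n" "v \<in> UU n" "A = u * dg n s * adj v" using svd_complex[OF assms] by blast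
 define p where "p i = (if s i = 0 then 1 else s i / of_real (cmod (s i)))" for i
 have p: "dg n p \<in> UU n" by (rule UU_dg) (auto simp: p_def norm_divide)
 have "p i * of_real (cmod (s i)) = s i" for i by (simp add: p_def)
 then have "dg n s = dg n p * dg n (\<lambda>i. of_real (cmod (s i)))" by (simp add: dg_mult)
 then have "A = (u * dg n p) * dg n (\<lambda>i. of_real (cmod (s i))) * adj v" using uv by (simp add: mult.assoc)
 then show ?thesis using that[of "u * dg n p" v "\<lambda>i. cmod (s i)"] uv p by auto
qed

section \<open>Nice error bases\<close>

text \<open>The basis is a group up to phases and orthogonal for the trace. The last clause is
  completeness in coordinates; summed against a matrix it becomes the twirl identity
  \<open>neb_twirl\<close>.\<close>

definition neb :: "nat => fmat set => bool" where
 "neb n B \<longleftrightarrow> n > 0 \<and> finite B \<and> B \<subseteq> UU n \<and>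
   (\<forall>a\<in>B. \<forall>b\<in>B. \<exists>c. \<exists>d\<in>B. cmod c = 1 \<and> a * b = csc c d) \<and>
   (\<forall>a\<in>B. \<forall>b\<in>B. ftr (adj a * b) = (if a = b then of_nat n else 0)) \<and>
   (\<forall>i<n. \<forall>p<n. \<forall>j<n. \<forall>q<n.
    (\<Sum>b\<in>B. ent b i p * cnj (ent b j q)) = (if i = j \<and> p = q then of_nat n else 0))"

lemma nebD:
 assumes "neb n B"
 shows "n > 0" "finite B" "b \<in> B ==> b \<in> UU n"
  "a \<in> B ==> b \<in> B ==> \<exists>c. \<exists>d\<in>B. cmod c = 1 \<and> a * b = csc c d"
  "a \<in> B ==> b \<in> B ==> ftr (adj a * b) = (if a = b then of_nat n else 0)"
  "i < n ==> p < n ==> j < n ==> q < n ==>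
    (\<Sum>b\<in>B. ent b i p * cnj (ent b j q)) = (if i = j \<and> p = q then of_nat n else 0)"
 using assms unfolding neb_def by blast+

lemma ent_mult3:
 assumes "x \<in> MM n" "y \<in> MM n"
 shows "ent (x * y * z) i j = (\<Sum>p<n. \<Sum>q<n. ent x i p * ent y p q * ent z q j)"
 using assms by (simp add: ent_mult[of _ n] sum_distrib_right) (rule sum.swap)

text \<open>Averaging conjugates over the basis projects onto the scalars. Whatever almost commutes
  with the basis is therefore almost scalar.\<close>

lemma neb_twirl:
 assumes B: "neb n B" and x: "x \<in> MM n"
 shows "(\<Sum>b\<in>B. b * x * adj b) = csc (of_nat n * ftr x) (fid n)"
proof (rule MM_eqI[of _ n])
 fix i j assume ij: "i < n" "j < n"
 have "ent (\<Sum>b\<in>B. b * x * adj b) i j = (\<Sum>b\<in>B. \<Sum>p<n. \<Sum>q<n. ent x p q * (ent b i p * cnj (ent b j q)))"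
  unfolding ent_sum
 proof (intro sum.cong refl)
  fix b assume "b \<in> B"
  then have "b \<in> MM n" using nebD(3)[OF B] by auto
  from ent_mult3[OF this x] show "ent (b * x * adj b) i j = (\<Sum>p<n. \<Sum>q<n. ent x p q * (ent b i p * cnj (ent b j q)))"
   by (simp add: ac_simps)
 qed
 also have "\<dots> = (\<Sum>p<n. \<Sum>q<n. ent x p q * (\<Sum>b\<in>B. ent b i p * cnj (ent b j q)))"
  by (simp add: sum_distrib_left sum.swap[of _ B])
 also have "\<dots> = (\<Sum>p<n. \<Sum>q<n. if q = p then ent x p p * (if i = j then of_nat n else 0) else 0)"
  by (intro sum.cong refl) (use nebD(6)[OF B ij(1) _ ij(2)] in auto)
 also have "\<dots> = ent (csc (of_nat n * ftr x) (fid n)) i j"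
  using ij x by (simp add: ftr_eq[of _ n] sum_distrib_left mult.commute)
 finally show "ent (\<Sum>b\<in>B. b * x * adj b) i j = ent (csc (of_nat n * ftr x) (fid n)) i j" .
qed (use nebD(3)[OF B] x in \<open>auto intro!: MM_sum\<close>)

lemma neb_card: assumes B: "neb n B" shows "card B = n\<^sup>2"
proof -
 have "(\<Sum>b\<in>B. b * fid n * adj b) = (\<Sum>b\<in>B. fid n)"
  using nebD(3)[OF B] by (intro sum.cong) (auto simp: UU_D)
 then have "ftr (\<Sum>b\<in>B. fid n) = ftr (csc (of_nat n * ftr (fid n)) (fid n))"
  using neb_twirl[OF B, of "fid n"] by simp
 then have "of_nat (card B * n) = (of_nat (n * n * n) :: complex)" by (simp add: ftr_sum)
 then have "card B * n = n * n * n" by (simp only: of_nat_eq_iff)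
 then show ?thesis using nebD(1)[OF B] by (simp add: power2_eq_square)
qed

lemma neb_ne: "neb n B ==> B \<noteq> {}" using neb_card nebD(1) by fastforce

text \<open>Left multiplication by a basis element permutes the basis up to phases; \<open>d\<close>
  is injective because distinct elements are trace-orthogonal. Sums over the basis can thus be
  reindexed.\<close>

lemma neb_left:
 assumes B: "neb n B" and a: "a \<in> B"
 obtains z d where "bij_betw d B B" "\<And>b. b \<in> B ==> cmod (z b) = 1" "\<And>b. b \<in> B ==> a * b = csc (z b) (d b)"
proof -
 have "\<forall>b\<in>B. \<exists>p. cmod (fst p) = 1 \<and> snd p \<in> B \<and> a * b = csc (fst p) (snd p)"
  using nebD(4)[OF B a] by fastforce
 then obtain p where p: "\<And>b. b \<in> B ==> cmod (fst (p b)) = 1 \<and> snd (p b) \<in> B \<and> a * b = csc (fst (p b)) (snd (p b))"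
  using bchoice[of B "\<lambda>b p. cmod (fst p) = 1 \<and> snd p \<in> B \<and> a * b = csc (fst p) (snd p)"] by blast
 define z where "z b = fst (p b)" for b
 define d where "d b = snd (p b)" for b
 have zd: "cmod (z b) = 1" "d b \<in> B" "a * b = csc (z b) (d b)" if "b \<in> B" for b
  using p[OF that] by (auto simp: z_def d_def)
 have "inj_on d B"
 proof (rule inj_onI)
  fix b b' assume b: "b \<in> B" "b' \<in> B" "d b = d b'"
  have "ftr (adj (a * b) * (a * b')) = cnj (z b) * z b' * ftr (adj (d b) * d b')"
   using b zd by (simp add: mult.assoc)
  also have "ftr (adj (d b) * d b') = of_nat n" using nebD(5)[OF B zd(2) zd(2), OF b(1,2)] b by simp
  also have "adj (a * b) * (a * b') = adj b * (adj a * (a * b'))" by (simp add: mult.assoc)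
  also have "\<dots> = adj b * b'" using nebD(3)[OF B] a b by (simp add: UU_canc(1)[of a n])
  finally have "ftr (adj b * b') \<noteq> 0" using zd(1)[OF b(1)] zd(1)[OF b(2)] nebD(1)[OF B] by auto
  then show "b = b'" using nebD(5)[OF B b(1,2)] by (auto split: if_splits)
 qed
 moreover have "d ` B \<subseteq> B" using zd by auto
 ultimately have "bij_betw d B B" using nebD(2)[OF B] by (simp add: bij_betw_def endo_inj_surj)
 then show ?thesis using that[of d z] zd by blast
qed

text \<open>The Weyl matrix X^a Z^c: the clock matrix to the power \<open>c\<close>, followed by the
  cyclic shift by \<open>a\<close>.\<close>

definition hb :: "nat => nat => nat => fmat" where
 "hb n a c = mk n (\<lambda>i p. if i = (p + a) mod n then cis (2 * pi * real (c * p) / real n) else 0)"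
definition heis :: "nat => fmat set" where
 "heis n = (\<lambda>(a, c). hb n a c) ` ({..<n} \<times> {..<n})"

lemma ent_hb: "ent (hb n a c) i p = (if i < n \<and> p < n \<and> i = (p + a) mod n then cis (2 * pi * real (c * p) / real n) else 0)"
 by (auto simp: hb_def ent_mk)

lemma hb_MM [simp]: "hb n a c \<in> MM n" by (simp add: hb_def)

lemma cis_mod: assumes "n > 0" shows "cis (2 * pi * real (k mod n) / real n) = cis (2 * pi * real k / real n)"
proof -
 have "real k = real (k mod n) + real n * real (k div n)"
  by (metis mod_mult_div_eq of_nat_add of_nat_mult)
 then have "2 * pi * real k / real n = 2 * pi * real (k mod n) / real n + 2 * pi * real (k div n)"
  using assms by (simp add: field_simps)
 then have "cis (2 * pi * real k / real n) = cis (2 * pi * real (k mod n) / real n) * cis (2 * pi * real (k div n))"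
  by (simp only: cis_mult)
 also have "cis (2 * pi * real (k div n)) = 1"
  by (rule cis_multiple_2pi) auto
 finally show ?thesis by simp
qed

lemma cis_mod_eqI: assumes "n > 0" "k mod n = l mod n"
 shows "cis (2 * pi * real k / real n) = cis (2 * pi * real l / real n)"
 using cis_mod[OF assms(1), of k] cis_mod[OF assms(1), of l] assms(2) by simp

lemma roots_sum:
 assumes n: "n > 0" and "p < n" "q < n"
 shows "(\<Sum>c<n. cis (2 * pi * real (c * p) / real n) * cnj (cis (2 * pi * real (c * q) / real n))) = (if p = q then of_nat n else 0)"
proof -
 define z where "z = cis (2 * pi * real p / real n) * cnj (cis (2 * pi * real q / real n))"
 have pw: "cis (2 * pi * real p / real n) ^ c = cis (2 * pi * real (c * p) / real n)" for p c
  by (simp add: Complex.DeMoivre ac_simps)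
 have zc: "cis (2 * pi * real (c * p) / real n) * cnj (cis (2 * pi * real (c * q) / real n)) = z ^ c" for c
  by (simp only: z_def power_mult_distrib complex_cnj_power[symmetric] pw)
 have one: "cis (2 * pi * real p / real n) ^ n = 1" for p
 proof -
  have *: "2 * pi * real (n * p) / real n = 2 * pi * real p" using n by simp
  show ?thesis unfolding pw * by (rule cis_multiple_2pi) simp
 qed
 have zn: "z ^ n = 1" by (simp only: z_def power_mult_distrib one flip: complex_cnj_power) simp
 have "z = 1 \<longleftrightarrow> p = q"
 proof
  assume "z = 1"
  then have "cis (2 * pi * real p / real n) = cis (2 * pi * real q / real n)"
   by (metis cis_cnj cis_neq_zero cis_mult add.commute add.right_inverse cis_zero mult_right_cancel z_def)
  then show "p = q"
   using Complex.bij_betw_roots_unity[OF n] assms unfolding bij_betw_def inj_on_def by blast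
 qed (simp add: z_def cis_cnj cis_mult)
 then show ?thesis
 proof (cases "p = q")
  case False
  then have "z \<noteq> 1" using \<open>z = 1 \<longleftrightarrow> p = q\<close> by simp
  then have "(\<Sum>c<n. z ^ c) = 0" using zn by (simp add: geometric_sum)
  then show ?thesis using False zc by simp
 qed (use \<open>z = 1 \<longleftrightarrow> p = q\<close> zc in simp)
qed

lemma mod_add_eq_iff:
 fixes p q a n :: nat
 assumes "p < n" "q < n" shows "(p + a) mod n = (q + a) mod n \<longleftrightarrow> p = q"
proof
 assume *: "(p + a) mod n = (q + a) mod n"
 have "p = q" if "p \<le> q" "(p + a) mod n = (q + a) mod n" "q < n" for p q
 proof -
  have "n dvd (q + a) - (p + a)" using mod_eq_dvd_iff_nat[of "p + a" "q + a" n] that by simp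
  then have "n dvd q - p" by simp
  then show ?thesis using that by (metis diff_less_mono2 dvd_imp_le le_antisym less_imp_diff_less not_le diff_is_0_eq zero_less_diff)
 qed
 from this[of p q] this[of q p] show "p = q" using * assms by linarith
qed simp

lemma mod_sum_delta:
 fixes f :: "nat => 'a::comm_monoid_add"
 assumes n: "n > 0" and i: "i < n" and p: "p < n"
 shows "(\<Sum>a<n. if i = (p + a) mod n then f a else 0) = f ((i + (n - p)) mod n)"
proof -
 have "(i = (p + a) mod n) = (a = (i + (n - p)) mod n)" if "a < n" for a
 proof
  assume "i = (p + a) mod n"
  then have "(i + (n - p)) mod n = (p + a + (n - p)) mod n" by (simp add: mod_add_left_eq)
  also have "p + a + (n - p) = a + n" using p by simp
  finally show "a = (i + (n - p)) mod n" using that by simp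
 next
  assume "a = (i + (n - p)) mod n"
  then have "(p + a) mod n = (p + (i + (n - p))) mod n" by (simp add: mod_add_right_eq)
  also have "p + (i + (n - p)) = i + n" using p by simp
  finally show "i = (p + a) mod n" using i by simp
 qed
 then have "(\<Sum>a<n. if i = (p + a) mod n then f a else 0) = (\<Sum>a<n. if a = (i + (n - p)) mod n then f a else 0)"
  by (intro sum.cong) auto
 then show ?thesis using n by simp
qed

lemma hb_mult:
 assumes n: "n > 0"
 shows "hb n a c * hb n a' c' = csc (cis (2 * pi * real (c * a') / real n)) (hb n ((a + a') mod n) ((c + c') mod n))"
proof (rule MM_eqI[of _ n])
 fix i p assume ip: "i < n" "p < n"
 let ?w = "\<lambda>k. cis (2 * pi * real k / real n)"
 have "ent (hb n a c * hb n a' c') i p = (\<Sum>k<n. if k = (p + a') mod n then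
   (if i = (k + a) mod n then ?w (c * k) * ?w (c' * p) else 0) else 0)"
  unfolding ent_mult[OF disjI1[OF hb_MM]] using ip by (intro sum.cong refl) (auto simp: ent_hb)
 also have "\<dots> = (if i = (p + a' + a) mod n then ?w (c * ((p + a') mod n)) * ?w (c' * p) else 0)"
  using n by (simp add: mod_add_left_eq)
 also have "?w (c * ((p + a') mod n)) = ?w (c * (p + a'))"
  by (rule cis_mod_eqI[OF n]) (simp add: mod_mult_right_eq)
 also have "?w (c * (p + a')) * ?w (c' * p) = ?w (c * a') * ?w ((c + c') * p)"
  by (simp add: cis_mult algebra_simps add_divide_distrib)
 also have "?w ((c + c') * p) = ?w ((c + c') mod n * p)"
  by (rule cis_mod_eqI[OF n]) (simp add: mod_mult_left_eq)
 also have "(if i = (p + a' + a) mod n then ?w (c * a') * ?w ((c + c') mod n * p) else 0) =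
   ent (csc (?w (c * a')) (hb n ((a + a') mod n) ((c + c') mod n))) i p"
  using ip by (simp add: ent_hb mod_add_right_eq ac_simps)
 finally show "ent (hb n a c * hb n a' c') i p = ent (csc (?w (c * a')) (hb n ((a + a') mod n) ((c + c') mod n))) i p" .
qed auto

lemma hb_orth:
 assumes n: "n > 0" and "a < n" "a' < n" "c < n" "c' < n"
 shows "ftr (adj (hb n a c) * hb n a' c') = (if a = a' \<and> c = c' then of_nat n else 0)"
proof -
 let ?w = "\<lambda>k. cis (2 * pi * real k / real n)"
 have "ftr (adj (hb n a c) * hb n a' c') = (\<Sum>p<n. \<Sum>i<n. cnj (ent (hb n a c) i p) * ent (hb n a' c') i p)"
  by (subst ftr_mult[of _ n]) auto
 also have "\<dots> = (\<Sum>p<n. \<Sum>i<n. if i = (p + a) mod n then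
   (if a = a' then ?w (p * c') * cnj (?w (p * c)) else 0) else 0)"
 proof (intro sum.cong refl)
  fix p i assume "p \<in> {..<n}" "i \<in> {..<n}"
  then show "cnj (ent (hb n a c) i p) * ent (hb n a' c') i p = (if i = (p + a) mod n then
   (if a = a' then ?w (p * c') * cnj (?w (p * c)) else 0) else 0)"
   using mod_add_eq_iff[OF assms(2,3), of p] by (auto simp: ent_hb add.commute mult.commute)
 qed
 also have "\<dots> = (if a = a' then \<Sum>p<n. ?w (p * c') * cnj (?w (p * c)) else 0)" using n by simp
 finally show ?thesis using roots_sum[OF n assms(5,4)] by auto
qed

lemma adj_hb_mult: assumes n: "n > 0" shows "adj (hb n a c) * hb n a c = fid n"
proof (rule MM_eqI[of _ n])
 fix p q assume pq: "p < n" "q < n"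
 let ?w = "\<lambda>k. cis (2 * pi * real k / real n)"
 have "ent (adj (hb n a c) * hb n a c) p q = (\<Sum>i<n. if i = (p + a) mod n then
   (if p = q then cnj (?w (c * p)) * ?w (c * p) else 0) else 0)"
  unfolding ent_mult[OF disjI2[OF hb_MM]]
 proof (intro sum.cong refl)
  fix i assume "i \<in> {..<n}"
  then show "ent (adj (hb n a c)) p i * ent (hb n a c) i q = (if i = (p + a) mod n then
   (if p = q then cnj (?w (c * p)) * ?w (c * p) else 0) else 0)"
   using mod_add_eq_iff[OF pq, of a] pq by (auto simp: ent_hb)
 qed
 also have "\<dots> = ent (fid n) p q" using n pq by (simp add: cis_cnj cis_mult)
 finally show "ent (adj (hb n a c) * hb n a c) p q = ent (fid n) p q" .
qed auto

text \<open>The singular values of \<open>x\<close> are forced to be 1, so \<open>x\<close> is a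
  product of two unitaries.\<close>

lemma left_inv_right_inv:
 assumes x: "x \<in> MM n" and "adj x * x = fid n" shows "x \<in> UU n"
proof -
 obtain u v s where uv: "u \<in> UU n" "v \<in> UU n" "\<And>i. 0 \<le> s i" "x = u * dg n (\<lambda>i. of_real (s i)) * adj v"
  using svd[OF x] by metis
 let ?D = "dg n (\<lambda>i. of_real (s i)) :: fmat"
 have "adj x * x = v * (?D * (adj u * (u * ?D))) * adj v" by (simp add: uv(4) adj_dg mult.assoc)
 then have "v * (?D * ?D) * adj v = fid n" using assms(2) UU_canc(1)[OF uv(1) dg_MM] by simp
 then have "adj v * (v * (?D * ?D) * adj v) * v = adj v * fid n * v" by simp
 then have "?D * ?D = fid n"
  using uv(2) by (simp add: mult.assoc UU_D UU_canc(1)[OF uv(2)])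
 then have e: "ent (dg n (\<lambda>i. of_real (s i * s i))) i i = ent (fid n) i i" for i by (simp add: dg_mult)
 have "s i = 1" if "i < n" for i
 proof -
  have "s i * s i = 1" using e[of i] that by (simp flip: of_real_mult)
  then have "(s i)\<^sup>2 = 1" by (simp add: power2_eq_square)
  then show ?thesis using uv(3)[of i] by (simp add: power2_eq_1_iff)
 qed
 then have "?D = fid n" by (subst dg_1[symmetric]) (auto intro: dg_cong)
 then show ?thesis using uv by simp
qed

lemma hb_UU: "n > 0 ==> hb n a c \<in> UU n"
 by (rule left_inv_right_inv[OF hb_MM adj_hb_mult])

lemma neb_heis: assumes n: "n > 0" shows "neb n (heis n)"
proof -
 have inj: "inj_on (\<lambda>(a, c). hb n a c) ({..<n} \<times> {..<n})"
 proof (rule inj_onI, clarsimp)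
  fix a c a' c' assume *: "a < n" "c < n" "a' < n" "c' < n" "hb n a c = hb n a' c'"
  then show "a = a' \<and> c = c'"
   using hb_orth[OF n *(1,3,2,4)] hb_orth[OF n *(1,1,2,2)] n by (auto split: if_splits)
 qed
 show ?thesis unfolding neb_def
 proof (intro conjI allI impI ballI)
  show "heis n \<subseteq> UU n" "finite (heis n)" by (auto simp: heis_def hb_UU n)
  fix x y assume "x \<in> heis n" "y \<in> heis n"
  then obtain a c a' c' where *: "a < n" "c < n" "a' < n" "c' < n" "x = hb n a c" "y = hb n a' c'"
   by (auto simp: heis_def)
  have "hb n ((a + a') mod n) ((c + c') mod n) \<in> heis n" using n by (auto simp: heis_def)
  then show "\<exists>c. \<exists>d\<in>heis n. cmod c = 1 \<and> x * y = csc c d"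
   unfolding *(5,6) hb_mult[OF n] by (intro exI bexI[rotated] conjI) auto
  have "x = y \<longleftrightarrow> a = a' \<and> c = c'" using inj_on_eq_iff[OF inj, of "(a, c)" "(a', c')"] * by simp
  then show "ftr (adj x * y) = (if x = y then of_nat n else 0)"
   using hb_orth[OF n *(1,3,2,4)] * by auto
 next
  fix i p j q assume a: "i < n" "p < n" "j < n" "q < n"
  let ?w = "\<lambda>k. cis (2 * pi * real k / real n)"
  have "(\<Sum>b\<in>heis n. ent b i p * cnj (ent b j q)) = (\<Sum>x\<in>{..<n} \<times> {..<n}. ent (hb n (fst x) (snd x)) i p * cnj (ent (hb n (fst x) (snd x)) j q))"
   unfolding heis_def by (subst sum.reindex[OF inj]) (simp add: case_prod_unfold)
  also have "\<dots> = (\<Sum>a<n. \<Sum>c<n. ent (hb n a c) i p * cnj (ent (hb n a c) j q))"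
   by (simp add: sum.cartesian_product case_prod_unfold)
  also have "\<dots> = (\<Sum>a<n. if i = (p + a) mod n then (if j = (q + a) mod n then \<Sum>c<n. ?w (c * p) * cnj (?w (c * q)) else 0) else 0)"
   using a by (intro sum.cong refl) (auto simp: ent_hb)
  also have "\<dots> = (\<Sum>a<n. if i = (p + a) mod n then (if i = j \<and> p = q then of_nat n else 0) else 0)"
   unfolding roots_sum[OF n a(2,4)] using mod_add_eq_iff[OF a(2,4)] by (intro sum.cong refl) auto
  also have "\<dots> = (if i = j \<and> p = q then of_nat n else 0)" by (rule mod_sum_delta[OF n a(1,2)])
  finally show "(\<Sum>b\<in>heis n. ent b i p * cnj (ent b j q)) = (if i = j \<and> p = q then of_nat n else 0)" .
 qed (use n in auto)
qed

lemma eu_sandwich: "eu q p * Z * eu p' q' = csc (ent Z p p') (eu q q')"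
proof (rule fmat_eqI)
 fix i j
 obtain n where n: "eu q p \<in> MM n" "Z \<in> MM n" "eu p' q' \<in> MM n" using MM_common by blast
 then have pn: "p < n" "p' < n" unfolding MM_def by (auto split: if_splits)
 have "ent (eu q p * Z * eu p' q') i j = (\<Sum>a<n. \<Sum>b<n. ent (eu q p) i a * ent Z a b * ent (eu p' q') b j)"
  by (rule ent_mult3) (use n in auto)
 also have "\<dots> = (\<Sum>a<n. \<Sum>b<n. if b = p' then (if a = p then (if i = q \<and> j = q' then ent Z p p' else 0) else 0) else 0)"
  by (intro sum.cong refl) auto
 also have "\<dots> = ent (csc (ent Z p p') (eu q q')) i j" using pn by simp
 finally show "ent (eu q p * Z * eu p' q') i j = ent (csc (ent Z p p') (eu q q')) i j" .
qed

lemma fid_eu: "(\<Sum>q<n. eu q q) = fid n"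
 by (rule fmat_eqI) (auto simp: ent_sum)

lemma sum_swap3: "(\<Sum>p\<in>P. \<Sum>q\<in>Q. \<Sum>b\<in>B. f p q b) = (\<Sum>b\<in>B. \<Sum>p\<in>P. \<Sum>q\<in>Q. f p q b)"
proof -
 have "(\<Sum>q\<in>Q. \<Sum>b\<in>B. f p q b) = (\<Sum>b\<in>B. \<Sum>q\<in>Q. f p q b)" for p by (rule sum.swap)
 then show ?thesis by (simp only: sum.swap[of _ B P])
qed

text \<open>Summing over all matrix units makes only the diagonal terms of the double sum over the basis survive.\<close>

lemma neb_sum_units:
 assumes B: "neb n B" and y: "\<And>b. b \<in> B ==> y b \<in> MM n"
 shows "(\<Sum>p<n. \<Sum>q<n. (norm (\<Sum>b\<in>B. y b * eu p q * adj b))\<^sup>2) = n * (\<Sum>b\<in>B. (norm (y b))\<^sup>2)"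
proof -
 have "of_real ((norm (\<Sum>b\<in>B. y b * eu p q * adj b))\<^sup>2) =
   (\<Sum>b\<in>B. \<Sum>c\<in>B. ent (adj (y b) * y c) p p * ftr (b * eu q q * adj c))" for p q
 proof -
  have "adj (y b * eu p q * adj b) * (y c * eu p q * adj c) = csc (ent (adj (y b) * y c) p p) (b * eu q q * adj c)" for b c
  proof -
   have "adj (y b * eu p q * adj b) * (y c * eu p q * adj c) = b * (eu q p * (adj (y b) * y c) * eu p q) * adj c"
    by (simp add: mult.assoc)
   then show ?thesis by (simp add: eu_sandwich)
  qed
  then show ?thesis
   unfolding ftr_adj_self[symmetric] adj_sum sum_product ftr_sum by (simp only: ftr_csc)
 qed
 then have "of_real (\<Sum>p<n. \<Sum>q<n. (norm (\<Sum>b\<in>B. y b * eu p q * adj b))\<^sup>2) =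
   (\<Sum>p<n. \<Sum>q<n. \<Sum>b\<in>B. \<Sum>c\<in>B. ent (adj (y b) * y c) p p * ftr (b * eu q q * adj c))"
  by simp
 also have "\<dots> = (\<Sum>b\<in>B. \<Sum>c\<in>B. \<Sum>p<n. \<Sum>q<n. ent (adj (y b) * y c) p p * ftr (b * eu q q * adj c))"
  by (simp only: sum_swap3[of _ B "{..<n}" "{..<n}"])
 also have "\<dots> = (\<Sum>b\<in>B. \<Sum>c\<in>B. if c = b then of_nat n * of_real ((norm (y b))\<^sup>2) else 0)"
 proof (intro sum.cong refl)
  fix b c assume bc: "b \<in> B" "c \<in> B"
  have "(\<Sum>q<n. ftr (b * eu q q * adj c)) = ftr (b * (\<Sum>q<n. eu q q) * adj c)"
   by (simp add: ftr_sum sum_distrib_left sum_distrib_right)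
  also have "\<dots> = ftr (adj c * b)" using nebD(3)[OF B bc(1)] by (simp add: fid_eu ftr_comm[of b])
  finally have "(\<Sum>p<n. \<Sum>q<n. ent (adj (y b) * y c) p p * ftr (b * eu q q * adj c)) = ftr (adj (y b) * y c) * ftr (adj c * b)"
   using y[OF bc(1)] y[OF bc(2)] by (simp add: ftr_eq[of _ n] flip: sum_distrib_left sum_distrib_right)
  then show "(\<Sum>p<n. \<Sum>q<n. ent (adj (y b) * y c) p p * ftr (b * eu q q * adj c)) =
    (if c = b then of_nat n * of_real ((norm (y b))\<^sup>2) else 0)"
   using nebD(5)[OF B bc(2,1)] by (simp add: ftr_adj_self)
 qed
 also have "\<dots> = of_real (n * (\<Sum>b\<in>B. (norm (y b))\<^sup>2))"
  using nebD(2)[OF B] by (simp add: sum_distrib_left)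
 finally show ?thesis by (simp only: of_real_eq_iff)
qed

section \<open>Almost representations of an error basis\<close>

text \<open>\<open>S p q\<close> almost intertwines the map \<open>a\<close> with the basis itself,
  because left multiplication permutes the basis. A single \<open>S p q\<close> could be tiny, but
  squared norms and squared defects are controlled after summation over all matrix units, so some
  \<open>S p q\<close> has a defect that is small relative to its norm; it is rescaled to squared
  norm \<open>n\<close>.\<close>

lemma anchor_vector:
 assumes B: "neb n B" and l: "0 < l" "l \<le> n" and a: "\<And>b. b \<in> B ==> a b \<in> UU l" and e: "0 \<le> \<epsilon>"
  and def: "\<And>b c z d. b \<in> B ==> c \<in> B ==> d \<in> B ==> cmod z = 1 ==> b * c = csc z d ==>
   norm (a b * a c - csc z (a d)) \<le> \<epsilon> * sqrt l"
 obtains T where "T \<in> MM n" "fid l * T = T" "(norm T)\<^sup>2 = n"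
  "(\<Sum>c\<in>B. (norm (a c * T * adj c - T))\<^sup>2) \<le> \<epsilon>\<^sup>2 * real n ^ 3"
proof -
 have n: "n > 0" using nebD(1)[OF B] .
 have aM: "a b \<in> MM n" if "b \<in> B" for b using a[OF that] l MM_mono by blast
 define S where "S p q = (\<Sum>b\<in>B. a b * eu p q * adj b)" for p q
 have SM: "S p q \<in> MM n" if "p < n" "q < n" for p q
  unfolding S_def using that aM nebD(3)[OF B] by (intro MM_sum MM_mult MM_adj MM_eu) auto
 have N: "(\<Sum>p<n. \<Sum>q<n. (norm (S p q))\<^sup>2) = real n ^ 3 * l"
 proof -
  have "(\<Sum>p<n. \<Sum>q<n. (norm (S p q))\<^sup>2) = n * (\<Sum>b\<in>B. (norm (a b))\<^sup>2)"
   unfolding S_def by (rule neb_sum_units[OF B aM])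
  also have "(\<Sum>b\<in>B. (norm (a b))\<^sup>2) = (\<Sum>b\<in>B. real l)"
   by (intro sum.cong refl) (simp only: norm_UU[OF a], simp)
  finally show ?thesis by (simp add: neb_card[OF B] power2_eq_square power3_eq_cube)
 qed
 have D: "(\<Sum>p<n. \<Sum>q<n. (norm (a c * S p q * adj c - S p q))\<^sup>2) \<le> \<epsilon>\<^sup>2 * (real n ^ 3 * l)" if c: "c \<in> B" for c
 proof -
  obtain z d where zd: "bij_betw d B B" "\<And>b. b \<in> B ==> cmod (z b) = 1" "\<And>b. b \<in> B ==> c * b = csc (z b) (d b)"
   by (rule neb_left[OF B c], rule that)
  have dB: "d b \<in> B" if "b \<in> B" for b using zd(1) that by (auto simp: bij_betw_def)
  \<comment> \<open>\<open>y e\<close> is the multiplicative defect attached to the basis element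
    \<open>e = d b\<close>; reindexing along \<open>d\<close> turns
    \<open>a c * S p q * adj c - S p q\<close> into the sum \<open>S p q\<close> with
    \<open>y\<close> in place of \<open>a\<close>.\<close>
  define y where "y e = (let b = inv_into B d e in csc (cnj (z b)) (a c * a b) - a e)" for e
  have yd: "y (d b) = csc (cnj (z b)) (a c * a b) - a (d b)" if "b \<in> B" for b
   using zd(1) that by (simp add: y_def bij_betw_inv_into_left)
  have yb: "y e \<in> MM n \<and> norm (y e) \<le> \<epsilon> * sqrt l" if "e \<in> B" for e
  proof -
   obtain b where b: "b \<in> B" "e = d b" using zd(1) \<open>e \<in> B\<close> by (auto simp: bij_betw_def)
   have "norm (y e) = norm (csc (z b) (y e))" using zd(2)[OF b(1)] by simp
   also have "csc (z b) (y e) = a c * a b - csc (z b) (a (d b))"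
   proof -
    have "z b * cnj (z b) = 1" using zd(2)[OF b(1)] by (simp add: complex_norm_square[symmetric])
    then show ?thesis using b by (simp add: yd csc_diff_right)
   qed
   also have "norm \<dots> \<le> \<epsilon> * sqrt l" using def[OF c b(1) dB zd(2,3)] b by blast
   finally show ?thesis using b yd aM c dB by auto
  qed
  have "a c * S p q * adj c - S p q = (\<Sum>e\<in>B. y e * eu p q * adj e)" for p q
  proof -
   have "a c * S p q * adj c = (\<Sum>b\<in>B. a c * a b * eu p q * adj (c * b))"
    by (simp add: S_def sum_distrib_left sum_distrib_right mult.assoc)
   also have "\<dots> = (\<Sum>b\<in>B. csc (cnj (z b)) (a c * a b) * eu p q * adj (d b))"
    by (intro sum.cong refl) (simp add: zd(3))
   finally have 1: "a c * S p q * adj c = (\<Sum>b\<in>B. csc (cnj (z b)) (a c * a b) * eu p q * adj (d b))" .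
   have 2: "S p q = (\<Sum>b\<in>B. a (d b) * eu p q * adj (d b))"
    unfolding S_def using sum.reindex_bij_betw[OF zd(1), of "\<lambda>b. a b * eu p q * adj b"] by simp
   have "a c * S p q * adj c - S p q = (\<Sum>b\<in>B. y (d b) * eu p q * adj (d b))"
    by (subst 1, subst 2) (simp add: yd left_diff_distrib flip: sum_subtractf)
   then show ?thesis using sum.reindex_bij_betw[OF zd(1), of "\<lambda>e. y e * eu p q * adj e"] by simp
  qed
  then have "(\<Sum>p<n. \<Sum>q<n. (norm (a c * S p q * adj c - S p q))\<^sup>2) = n * (\<Sum>e\<in>B. (norm (y e))\<^sup>2)"
   using neb_sum_units[OF B, of y] yb by simp
  also have "(\<Sum>e\<in>B. (norm (y e))\<^sup>2) \<le> (\<Sum>e\<in>B. \<epsilon>\<^sup>2 * l)"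
  proof (rule sum_mono)
   fix b assume "b \<in> B"
   then have "(norm (y b))\<^sup>2 \<le> (\<epsilon> * sqrt l)\<^sup>2" using yb by (intro power_mono) auto
   then show "(norm (y b))\<^sup>2 \<le> \<epsilon>\<^sup>2 * l" by (simp add: power_mult_distrib)
  qed
  finally show ?thesis using n by (simp add: neb_card[OF B] power2_eq_square power3_eq_cube ac_simps)
 qed
 \<comment> \<open>Otherwise the reverse inequalities, summed over all \<open>p\<close> and
   \<open>q\<close> and strict at one place, would contradict the sum of \<open>D\<close> over the
   basis.\<close>
 have "\<exists>p<n. \<exists>q<n. S p q \<noteq> 0 \<and> (\<Sum>c\<in>B. (norm (a c * S p q * adj c - S p q))\<^sup>2) \<le> \<epsilon>\<^sup>2 * (real n)\<^sup>2 * (norm (S p q))\<^sup>2"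
 proof (rule ccontr)
  assume C: "\<not> ?thesis"
  let ?F = "\<lambda>p q. \<Sum>c\<in>B. (norm (a c * S p q * adj c - S p q))\<^sup>2"
  let ?G = "\<lambda>p q. \<epsilon>\<^sup>2 * (real n)\<^sup>2 * (norm (S p q))\<^sup>2"
  have le: "?G p q \<le> ?F p q" if "p < n" "q < n" for p q
   using C that by (cases "S p q = 0") (force simp: sum_nonneg)+
  have "\<exists>p<n. \<exists>q<n. S p q \<noteq> 0"
  proof (rule ccontr)
   assume "\<not> ?thesis"
   then have "(\<Sum>p<n. \<Sum>q<n. (norm (S p q))\<^sup>2) = 0" by simp
   then show False using N n l by simp
  qed
  then obtain p q where pq: "p < n" "q < n" "S p q \<noteq> 0" by blast
  then have lt: "?G p q < ?F p q" using C by force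
  have "(\<Sum>p<n. \<Sum>q<n. ?G p q) < (\<Sum>p<n. \<Sum>q<n. ?F p q)"
  proof (rule sum_strict_mono_ex1)
   show "\<forall>p\<in>{..<n}. (\<Sum>q<n. ?G p q) \<le> (\<Sum>q<n. ?F p q)" using le by (auto intro: sum_mono)
   show "\<exists>p\<in>{..<n}. (\<Sum>q<n. ?G p q) < (\<Sum>q<n. ?F p q)"
   proof (rule bexI[of _ p])
    show "(\<Sum>q<n. ?G p q) < (\<Sum>q<n. ?F p q)"
    proof (rule sum_strict_mono_ex1)
     show "\<forall>q\<in>{..<n}. ?G p q \<le> ?F p q" using le pq(1) by blast
     show "\<exists>q\<in>{..<n}. ?G p q < ?F p q" using lt pq(2) by (intro bexI[of _ q]) auto
    qed simp
   qed (use pq in auto)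
  qed simp
  also have "(\<Sum>p<n. \<Sum>q<n. ?F p q) = (\<Sum>c\<in>B. \<Sum>p<n. \<Sum>q<n. (norm (a c * S p q * adj c - S p q))\<^sup>2)"
   by (rule sum_swap3)
  also have "\<dots> \<le> (\<Sum>c\<in>B. \<epsilon>\<^sup>2 * (real n ^ 3 * l))" using D by (rule sum_mono)
  also have "\<dots> = \<epsilon>\<^sup>2 * (real n)\<^sup>2 * (real n ^ 3 * l)" by (simp add: neb_card[OF B])
  also have "\<dots> = (\<Sum>p<n. \<Sum>q<n. ?G p q)" by (simp only: N[symmetric] sum_distrib_left)
  finally show False by simp
 qed
 then obtain p q where pq: "p < n" "q < n" "S p q \<noteq> 0"
  "(\<Sum>c\<in>B. (norm (a c * S p q * adj c - S p q))\<^sup>2) \<le> \<epsilon>\<^sup>2 * (real n)\<^sup>2 * (norm (S p q))\<^sup>2" by blast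
 define r where "r = sqrt n / norm (S p q)"
 define T where "T = r *\<^sub>R S p q"
 have r: "r\<^sup>2 * (norm (S p q))\<^sup>2 = n" using pq by (simp add: r_def power_divide)
 show ?thesis
 proof (rule that)
  show "T \<in> MM n" using SM pq by (auto simp: T_def)
  have "fid l * S p q = S p q"
   unfolding S_def using a by (simp add: sum_distrib_left flip: mult.assoc)
  then show "fid l * T = T" by (simp add: T_def)
  show "(norm T)\<^sup>2 = n" using r by (simp add: T_def power_mult_distrib)
  have "norm (a c * T * adj c - T) = norm (r *\<^sub>R (a c * S p q * adj c - S p q))" for c
   by (simp add: T_def scaleR_diff_right)
  then have "(norm (a c * T * adj c - T))\<^sup>2 = r\<^sup>2 * (norm (a c * S p q * adj c - S p q))\<^sup>2" for c
   by (simp add: power_mult_distrib)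
  then have "(\<Sum>c\<in>B. (norm (a c * T * adj c - T))\<^sup>2) = r\<^sup>2 * (\<Sum>c\<in>B. (norm (a c * S p q * adj c - S p q))\<^sup>2)"
   by (simp add: sum_distrib_left)
  also have "\<dots> \<le> r\<^sup>2 * (\<epsilon>\<^sup>2 * (real n)\<^sup>2 * (norm (S p q))\<^sup>2)" using pq(4) by (intro mult_left_mono) auto
  also have "\<dots> = \<epsilon>\<^sup>2 * (real n)\<^sup>2 * (r\<^sup>2 * (norm (S p q))\<^sup>2)" by simp
  also have "\<dots> = \<epsilon>\<^sup>2 * real n ^ 3" unfolding r by (simp add: power2_eq_square power3_eq_cube)
  finally show "(\<Sum>c\<in>B. (norm (a c * T * adj c - T))\<^sup>2) \<le> \<epsilon>\<^sup>2 * real n ^ 3" .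
 qed
qed

text \<open>The hypothesis bounds the trace norm of T*T - 1, since \<open>S\<close> may be the
  matrix of signs of its eigenvalues. The unitary polar factor of \<open>T\<close> is close to
  \<open>T\<close> because (s - 1)^2 \<le> |s^2 - 1| for s \<ge> 0.\<close>

lemma polar_near:
 assumes T: "T \<in> MM n" and S: "\<And>S. S \<in> UU n ==> cmod (ftr (S * (adj T * T - fid n))) \<le> d"
 obtains W where "W \<in> UU n" "(norm (T - W))\<^sup>2 \<le> d"
proof -
 obtain u v s where uv: "u \<in> UU n" "v \<in> UU n" "\<And>i. 0 \<le> s i" "T = u * dg n (\<lambda>i. of_real (s i)) * adj v"
  using svd[OF T] by metis
 let ?D = "dg n (\<lambda>i. of_real (s i)) :: fmat"
 define g where "g i = (if 1 \<le> s i then 1 else -1 :: complex)" for i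
 let ?G = "dg n g"
 have G: "v * ?G * adj v \<in> UU n" using uv(2) by (auto intro!: UU_mult UU_dg simp: g_def)
 have "adj T * T = v * (?D * (adj u * (u * ?D))) * adj v" by (simp add: uv(4) adj_dg mult.assoc)
 then have TT: "adj T * T = v * (?D * ?D) * adj v" using UU_canc(1)[OF uv(1) dg_MM] by simp
 have "adj T * T - fid n = v * (?D * ?D - fid n) * adj v"
  using uv(2) by (simp add: TT algebra_simps UU_D)
 then have "v * ?G * adj v * (adj T * T - fid n) = v * (?G * (adj v * (v * (?D * ?D - fid n)))) * adj v"
  by (simp add: mult.assoc)
 also have "adj v * (v * (?D * ?D - fid n)) = ?D * ?D - fid n" by (rule UU_canc(1)[OF uv(2)]) auto
 also have "?D * ?D - fid n = dg n (\<lambda>i. of_real (s i * s i - 1))" by (simp add: dg_mult dg_1[symmetric] dg_diff)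
 also have "?G * \<dots> = dg n (\<lambda>i. of_real \<bar>s i * s i - 1\<bar>)"
 proof -
  have "(1 \<le> s i) = (0 \<le> s i * s i - 1)" for i
   using uv(3)[of i] by (auto simp: square_diff_one_factored zero_le_mult_iff)
  then show ?thesis by (auto simp: dg_mult g_def intro!: dg_cong)
 qed
 finally have "ftr (v * ?G * adj v * (adj T * T - fid n)) = ftr (v * dg n (\<lambda>i. of_real \<bar>s i * s i - 1\<bar>) * adj v)" by simp
 also have "\<dots> = ftr (adj v * (v * dg n (\<lambda>i. of_real \<bar>s i * s i - 1\<bar>)))" by (rule ftr_comm)
 also have "\<dots> = of_real (\<Sum>i<n. \<bar>s i * s i - 1\<bar>)" using UU_canc(1)[OF uv(2) dg_MM] by (simp add: ftr_dg)
 finally have sum: "(\<Sum>i<n. \<bar>s i * s i - 1\<bar>) \<le> d"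
  using S[OF G] by (simp only: norm_of_real)
 define W where "W = u * adj v"
 have "T - W = u * (?D - fid n) * adj v" using uv by (simp add: W_def algebra_simps)
 then have "norm (T - W) = norm (?D - fid n)"
  using norm_UU_right[OF UU_adj[OF uv(2)], of "u * (?D - fid n)"] norm_UU_left[OF uv(1), of "?D - fid n"] uv by auto
 also have "?D - fid n = dg n (\<lambda>i. of_real (s i - 1))" by (simp add: dg_1[symmetric] dg_diff)
 finally have "(norm (T - W))\<^sup>2 = (\<Sum>i<n. (s i - 1)\<^sup>2)" by (simp add: norm_dg del: of_real_diff)
 also have "\<dots> \<le> (\<Sum>i<n. \<bar>s i * s i - 1\<bar>)"
 proof (rule sum_mono)
  fix i
  have "\<bar>s i * s i - 1\<bar> = \<bar>s i - 1\<bar> * (s i + 1)"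
   using uv(3)[of i] by (simp add: square_diff_one_factored abs_mult)
  moreover have "(s i - 1)\<^sup>2 = \<bar>s i - 1\<bar> * \<bar>s i - 1\<bar>" by (metis power2_abs power2_eq_square)
  moreover have "\<bar>s i - 1\<bar> * \<bar>s i - 1\<bar> \<le> \<bar>s i - 1\<bar> * (s i + 1)"
   using uv(3)[of i] by (intro mult_left_mono) linarith+
  ultimately show "(s i - 1)\<^sup>2 \<le> \<bar>s i * s i - 1\<bar>" by linarith
 qed
 finally show ?thesis using that[of W] uv sum by (auto simp: W_def)
qed

lemma ftr_mult_bound: "S \<in> KK n ==> cmod (ftr (S * (adj X * Y))) \<le> norm X * norm Y"
proof -
 assume S: "S \<in> KK n"
 have "S * (adj X * Y) = adj (X * adj S) * Y" by (simp add: mult.assoc)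
 then have "cmod (ftr (S * (adj X * Y))) \<le> norm (X * adj S) * norm Y" using ftr_CS by metis
 also have "norm (X * adj S) \<le> norm X" using KK_right[OF KK_adj[OF S]] .
 finally show ?thesis by (simp add: mult_right_mono)
qed

lemma proj_norm: assumes "p * p = p" "adj p = p" shows "norm (p * y) \<le> norm y"
proof -
 have "(norm (p * y))\<^sup>2 = Re (ftr (adj y * (p * p) * y))" by (simp add: norm_sq assms(2) mult.assoc)
 also have "\<dots> = inner y (p * y)" by (simp add: assms(1) inner_ftr mult.assoc)
 also have "\<dots> \<le> norm y * norm (p * y)" by (rule norm_cauchy_schwarz)
 finally show ?thesis by (cases "norm (p * y) = 0") (simp_all add: power2_eq_square mult_le_cancel_right)
qed

text \<open>The average of c T*T c* over the basis is exactly 1, since |T|^2 = n. Every term is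
  close to T*T, because a(c) T c* is close to \<open>T\<close> and a(c) is unitary on the first
  \<open>l\<close> coordinates, which contain the range of \<open>T\<close>. Hence T*T is close to 1
  in trace norm and \<open>polar_near\<close> applies.\<close>

lemma anchor_core:
 assumes B: "neb n B" and l: "0 < l" "l \<le> n" and a: "\<And>b. b \<in> B ==> a b \<in> UU l" and e: "0 \<le> r"
  and def: "\<And>b c z d. b \<in> B ==> c \<in> B ==> d \<in> B ==> cmod z = 1 ==> b * c = csc z d ==>
   norm (a b * a c - csc z (a d)) \<le> r * sqrt l"
 obtains T W where "W \<in> UU n" "T \<in> MM n" "fid l * T = T" "(norm (T - W))\<^sup>2 \<le> 2 * r * n"
  "(\<Sum>c\<in>B. (norm (a c * T * adj c - T))\<^sup>2) \<le> r\<^sup>2 * real n ^ 3"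
proof -
 have n: "n > 0" using nebD(1)[OF B] .
 obtain T where T: "T \<in> MM n" "fid l * T = T" "(norm T)\<^sup>2 = n"
  "(\<Sum>c\<in>B. (norm (a c * T * adj c - T))\<^sup>2) \<le> r\<^sup>2 * real n ^ 3"
  by (rule anchor_vector[OF B l, of a r]) (rule a e def that; assumption)+
 have nT: "norm T = sqrt n" using T(3) by (simp add: real_sqrt_unique)
 have aM: "a b \<in> MM n" if "b \<in> B" for b using a[OF that] l MM_mono by blast
 define H where "H = adj T * T"
 have HM: "H \<in> MM n" using T by (simp add: H_def)
 have Hc: "(\<Sum>c\<in>B. c * H * adj c) = csc (of_nat (n * n)) (fid n)"
  using neb_twirl[OF B HM] T(3) by (simp add: H_def ftr_adj_self del: of_real_power)
 have "cmod (ftr (S * (H - fid n))) \<le> 2 * r * n" if S: "S \<in> UU n" for S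
 proof -
  let ?D = "\<lambda>c. norm (a c * T * adj c - T)"
  have tr: "ftr (S * (H - fid n)) * of_nat (n * n) = (\<Sum>c\<in>B. ftr (S * (H - c * H * adj c)))"
  proof -
   have "(\<Sum>c\<in>B. ftr (S * (H - c * H * adj c))) = ftr (S * (\<Sum>c\<in>B. H - c * H * adj c))"
    by (simp add: ftr_sum sum_distrib_left)
   also have "(\<Sum>c\<in>B. H - c * H * adj c) = csc (of_nat (n * n)) (H - fid n)"
    unfolding sum_subtractf Hc csc_diff_right sum_constant_scaleR
    by (simp add: neb_card[OF B] scaleR_csc power2_eq_square)
   finally show ?thesis by simp
  qed
  have bound: "cmod (ftr (S * (H - c * H * adj c))) \<le> 2 * sqrt n * ?D c" if c: "c \<in> B" for c
  proof -
   define Tc where "Tc = a c * T * adj c"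
   have cU: "c \<in> UU n" using nebD(3)[OF B c] .
   have "adj (a c) * (a c * (T * adj c)) = fid l * T * adj c"
    using UU_D(2)[OF a[OF c]] by (simp flip: mult.assoc)
   then have "adj Tc * Tc = c * H * adj c" using T(2) by (simp add: Tc_def H_def mult.assoc)
   then have "S * (H - c * H * adj c) = S * (adj (T - Tc) * T) + S * (adj Tc * (T - Tc))"
    by (simp add: H_def algebra_simps)
   then have "cmod (ftr (S * (H - c * H * adj c))) \<le> cmod (ftr (S * (adj (T - Tc) * T))) + cmod (ftr (S * (adj Tc * (T - Tc))))"
    by (simp add: norm_triangle_ineq)
   also have "\<dots> \<le> norm (T - Tc) * norm T + norm Tc * norm (T - Tc)"
    using ftr_mult_bound[OF UU_KK[OF S]] by (intro add_mono)
   also have "norm Tc \<le> norm T"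
    unfolding Tc_def using KK_right[OF KK_adj[OF UU_KK[OF cU]], of "a c * T"] KK_left[OF UU_KK[OF a[OF c]], of T] by linarith
   finally show ?thesis using norm_minus_commute[of T Tc] by (simp add: nT Tc_def mult_right_mono algebra_simps)
  qed
  have D2: "(\<Sum>c\<in>B. ?D c) \<le> r * n\<^sup>2 * sqrt n * sqrt 1"
  proof -
   have "(\<Sum>c\<in>B. ?D c)\<^sup>2 \<le> (\<Sum>c\<in>B. (?D c)\<^sup>2) * card B"
    by (rule sum_squared_le_sum_of_squares)
   also have "\<dots> \<le> (r\<^sup>2 * real n ^ 3) * card B" using T(4) by (intro mult_right_mono) auto
   also have "\<dots> = (r * n\<^sup>2 * sqrt n)\<^sup>2"
    by (simp add: neb_card[OF B] power_mult_distrib power2_eq_square power3_eq_cube)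
   finally show ?thesis using e by (simp add: power2_le_iff_abs_le)
  qed
  have "cmod (ftr (S * (H - fid n))) * (n * n) = cmod (\<Sum>c\<in>B. ftr (S * (H - c * H * adj c)))"
   unfolding tr[symmetric] by (simp add: norm_mult)
  also have "\<dots> \<le> (\<Sum>c\<in>B. 2 * sqrt n * ?D c)" using bound by (intro sum_norm_le) auto
  also have "\<dots> = 2 * sqrt n * (\<Sum>c\<in>B. ?D c)" by (simp add: sum_distrib_left)
  also have "\<dots> \<le> 2 * sqrt n * (r * n\<^sup>2 * sqrt n)" using D2 by (intro mult_left_mono) auto
  also have "\<dots> = 2 * r * n * (n * n)" by (simp add: power2_eq_square)
  finally show ?thesis using n by simp
 qed
 then obtain W where "W \<in> UU n" "(norm (T - W))\<^sup>2 \<le> 2 * r * n"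
  using polar_near[OF T(1), of "2 * r * n"] unfolding H_def by metis
 then show ?thesis using that T by blast
qed

lemma fid_diff_proj: assumes "k \<le> n"
 shows "(fid n - fid k) * (fid n - fid k) = fid n - fid k" "adj (fid n - fid k) = fid n - fid k"
  "(norm (fid n - fid k))\<^sup>2 = real n - real k"
proof -
 have "fid n * fid k = fid k" "fid k * fid n = fid k" using assms by (auto intro: fid_mult_le)
 then show *: "(fid n - fid k) * (fid n - fid k) = fid n - fid k" "adj (fid n - fid k) = fid n - fid k"
  by (simp_all add: algebra_simps)
 show "(norm (fid n - fid k))\<^sup>2 = real n - real k" unfolding norm_sq *(2) *(1) by simp
qed

text \<open>The projection onto the last \<open>n - l\<close> coordinates kills \<open>T\<close> but
  not the unitary \<open>W\<close>, so its squared norm \<open>n - l\<close> is at most that of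
  \<open>T - W\<close>.\<close>

lemma anchor_dim:
 assumes B: "neb n B" and l: "0 < l" "l \<le> n" and a: "\<And>b. b \<in> B ==> a b \<in> UU l" and e: "0 \<le> r"
  and def: "\<And>b c z d. b \<in> B ==> c \<in> B ==> d \<in> B ==> cmod z = 1 ==> b * c = csc z d ==>
   norm (a b * a c - csc z (a d)) \<le> r * sqrt l"
 shows "real n - real l \<le> 2 * r * n"
proof -
 obtain T W where TW: "W \<in> UU n" "T \<in> MM n" "fid l * T = T" "(norm (T - W))\<^sup>2 \<le> 2 * r * n"
  by (rule anchor_core[OF B l, of a r]) (rule a e def that; assumption)+
 let ?p = "fid n - fid l"
 have "?p * (T - W) = - (?p * W)"
  using TW by (simp add: algebra_simps)
 then have "norm (?p * (T - W)) = norm (?p * W)" by simp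
 also have "\<dots> = norm ?p" using norm_UU_right[OF TW(1), of ?p] l by (auto simp: MM_fid)
 finally have "norm ?p \<le> norm (T - W)" using proj_norm[OF fid_diff_proj(1,2)[OF l(2)], of "T - W"] by simp
 then have "(norm ?p)\<^sup>2 \<le> (norm (T - W))\<^sup>2" by (simp add: power_mono)
 then show ?thesis using TW(4) fid_diff_proj(3)[OF l(2)] by linarith
qed

lemma sum_le_pigeonhole:
 assumes "finite B" "B \<noteq> {}" "(\<Sum>b\<in>B. f b) \<le> K * real (card B)"
 shows "\<exists>b\<in>B. f b \<le> (K::real)"
proof (rule ccontr)
 assume "\<not> ?thesis"
 then have "(\<Sum>b\<in>B. K) < (\<Sum>b\<in>B. f b)" using assms by (intro sum_strict_mono) auto
 then show False using assms by (simp add: mult.commute)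
qed

lemma norm_conj_UU: "u \<in> UU n ==> v \<in> UU n ==> x \<in> MM n ==> norm (u * x * v) = norm x"
 by (simp add: norm_UU_right norm_UU_left)

text \<open>The sum over the basis controls the defect only on average. For a given
  \<open>c\<close>, both \<open>b\<close> and \<open>d b\<close> range over the basis, so some
  \<open>b\<close> has both defects small, and c b = z d(b) carries the estimate over to
  \<open>c\<close>. The 13 is 6 for each of the two defects and 1 for the failure of
  multiplicativity.\<close>

lemma anchor_unitary:
 assumes B: "neb n B" and a: "\<And>b. b \<in> B ==> a b \<in> UU n" and e: "0 \<le> r" "r \<le> 1"
  and def: "\<And>b c z d. b \<in> B ==> c \<in> B ==> d \<in> B ==> cmod z = 1 ==> b * c = csc z d ==>
   norm (a b * a c - csc z (a d)) \<le> r * sqrt n"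
 obtains W where "W \<in> UU n" "\<And>c. c \<in> B ==> norm (a c * W - W * c) \<le> 13 * sqrt r * sqrt n"
proof -
 have n: "n > 0" using nebD(1)[OF B] .
 obtain T W where TW: "W \<in> UU n" "T \<in> MM n" "(norm (T - W))\<^sup>2 \<le> 2 * r * n"
  "(\<Sum>c\<in>B. (norm (a c * T * adj c - T))\<^sup>2) \<le> r\<^sup>2 * real n ^ 3"
  by (rule anchor_core[OF B n order_refl, of a r]) (rule a e def that; assumption)+
 define D where "D c = norm (a c * W * adj c - W)" for c
 have D2: "(D c)\<^sup>2 \<le> 2 * (norm (a c * T * adj c - T))\<^sup>2 + 8 * (norm (T - W))\<^sup>2" if c: "c \<in> B" for c
 proof -
  have cU: "c \<in> UU n" using nebD(3)[OF B c] .
  have "a c * W * adj c - W = (a c * T * adj c - T) - a c * (T - W) * adj c + (T - W)" by (simp add: algebra_simps)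
  then have "D c \<le> norm ((a c * T * adj c - T) - a c * (T - W) * adj c) + norm (T - W)"
   unfolding D_def by (metis norm_triangle_ineq)
  also have "\<dots> \<le> norm (a c * T * adj c - T) + norm (a c * (T - W) * adj c) + norm (T - W)"
   by (intro add_mono norm_triangle_ineq4) simp
  also have "norm (a c * (T - W) * adj c) = norm (T - W)"
   using norm_conj_UU[OF a[OF c] UU_adj[OF cU], of "T - W"] TW by simp
  finally have "D c \<le> norm (a c * T * adj c - T) + 2 * norm (T - W)" by simp
  then have "(D c)\<^sup>2 \<le> (norm (a c * T * adj c - T) + 2 * norm (T - W))\<^sup>2" by (intro power_mono) (auto simp: D_def)
  also have "\<dots> \<le> 2 * (norm (a c * T * adj c - T))\<^sup>2 + 8 * (norm (T - W))\<^sup>2"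
   using sum_squares_bound[of "norm (a c * T * adj c - T)" "2 * norm (T - W)"] by (simp add: power2_sum power_mult_distrib)
  finally show ?thesis .
 qed
 have "(\<Sum>c\<in>B. (D c)\<^sup>2) \<le> (\<Sum>c\<in>B. 2 * (norm (a c * T * adj c - T))\<^sup>2 + 8 * (norm (T - W))\<^sup>2)"
  using D2 by (rule sum_mono)
 also have "\<dots> = 2 * (\<Sum>c\<in>B. (norm (a c * T * adj c - T))\<^sup>2) + real (card B) * (8 * (norm (T - W))\<^sup>2)"
  by (simp add: sum.distrib sum_distrib_left)
 also have "\<dots> \<le> 2 * (r\<^sup>2 * real n ^ 3) + real (card B) * (8 * (2 * r * n))"
  using TW by (intro add_mono mult_left_mono) auto
 also have "\<dots> = (2 * r\<^sup>2 + 16 * r) * n * real (card B)"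
  by (simp add: neb_card[OF B] power2_eq_square power3_eq_cube algebra_simps)
 also have "\<dots> \<le> (18 * r) * n * real (card B)"
  using e by (intro mult_right_mono) (auto simp: power2_eq_square mult_left_le)
 finally have sD: "(\<Sum>c\<in>B. (D c)\<^sup>2) \<le> 18 * r * n * real (card B)" .
 have "norm (a c * W - W * c) \<le> 13 * sqrt r * sqrt n" if c: "c \<in> B" for c
 proof -
  have cU: "c \<in> UU n" using nebD(3)[OF B c] .
  obtain z d where zd: "bij_betw d B B" "\<And>b. b \<in> B ==> cmod (z b) = 1" "\<And>b. b \<in> B ==> c * b = csc (z b) (d b)"
   by (rule neb_left[OF B c], rule that)
  have "(\<Sum>b\<in>B. (D b)\<^sup>2 + (D (d b))\<^sup>2) = (\<Sum>b\<in>B. (D b)\<^sup>2) + (\<Sum>b\<in>B. (D b)\<^sup>2)"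
   using sum.reindex_bij_betw[OF zd(1), of "\<lambda>b. (D b)\<^sup>2"] by (simp add: sum.distrib)
  then have "(\<Sum>b\<in>B. (D b)\<^sup>2 + (D (d b))\<^sup>2) \<le> 36 * r * n * real (card B)" using sD by linarith
  then obtain b where b: "b \<in> B" "(D b)\<^sup>2 + (D (d b))\<^sup>2 \<le> 36 * r * n"
   using sum_le_pigeonhole[OF nebD(2)[OF B] neb_ne[OF B]] by blast
  have "D x \<le> 6 * sqrt r * sqrt n" if "(D x)\<^sup>2 \<le> 36 * r * n" for x
  proof -
   have "(6 * sqrt r * sqrt n)\<^sup>2 = 36 * r * n" using e by (simp add: power_mult_distrib)
   then have "(D x)\<^sup>2 \<le> (6 * sqrt r * sqrt n)\<^sup>2" using that by simp
   then show ?thesis using e by (simp add: power2_le_iff_abs_le)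
  qed
  from this[of b] this[of "d b"] have Db: "D b \<le> 6 * sqrt r * sqrt n" "D (d b) \<le> 6 * sqrt r * sqrt n"
   using b(2) zero_le_power2[of "D b"] zero_le_power2[of "D (d b)"] by linarith+
  have bU: "b \<in> UU n" "d b \<in> B" "d b \<in> UU n" using b zd(1) nebD(3)[OF B] by (auto simp: bij_betw_def)
  have zz: "z b * cnj (z b) = 1" using zd(2)[OF b(1)] by (simp add: complex_norm_square[symmetric])
  let ?a = "a c * (a b * W * adj b) * adj c"
  have 1: "norm (a c * W * adj c - ?a) \<le> D b"
  proof -
   have "a c * W * adj c - ?a = a c * (W - a b * W * adj b) * adj c" by (simp add: algebra_simps)
   then show ?thesis
    using norm_conj_UU[OF a[OF c] UU_adj[OF cU], of "W - a b * W * adj b"] TW a[OF b(1)] bU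
    by (simp add: D_def norm_minus_commute)
  qed
  have 2: "norm (?a - a (d b) * W * adj (d b)) \<le> r * sqrt n"
  proof -
   have "?a = a c * a b * W * adj (c * b)" by (simp add: mult.assoc)
   also have "\<dots> = csc (cnj (z b)) (a c * a b * W * adj (d b))" using zd(3)[OF b(1)] by simp
   finally have "?a - a (d b) * W * adj (d b) = csc (cnj (z b)) (a c * a b - csc (z b) (a (d b))) * (W * adj (d b))"
    using zz by (simp add: algebra_simps csc_diff_right)
   then have "norm (?a - a (d b) * W * adj (d b)) \<le> norm (csc (cnj (z b)) (a c * a b - csc (z b) (a (d b))))"
    using KK_right[of "W * adj (d b)" n] TW(1) bU(3) zd(2)[OF b(1)] by simp
   then show ?thesis using def[OF c b(1) bU(2) zd(2,3)] b zd(2)[OF b(1)] by simp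
  qed
  have "norm (a c * W - W * c) = norm ((a c * W - W * c) * adj c)"
   using norm_UU_right[OF UU_adj[OF cU], of "a c * W - W * c"] TW a[OF c] cU by simp
  also have "(a c * W - W * c) * adj c = a c * W * adj c - W"
   using TW(1) cU by (simp add: left_diff_distrib UU_canc(3))
  also have "norm (a c * W * adj c - W) \<le> norm (a c * W * adj c - ?a) + norm (?a - W)"
   by (metis diff_add_cancel add_diff_eq norm_triangle_ineq)
  also have "norm (?a - W) \<le> norm (?a - a (d b) * W * adj (d b)) + D (d b)"
   unfolding D_def by (metis diff_add_cancel add_diff_eq norm_triangle_ineq)
  finally have "norm (a c * W - W * c) \<le> 12 * sqrt r * sqrt n + r * sqrt n" using 1 2 Db by linarith
  also have "r * sqrt n \<le> sqrt r * sqrt n"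
  proof (rule mult_right_mono)
   have "r = sqrt r * sqrt r" using e by simp
   also have "\<dots> \<le> sqrt r * 1" using e by (intro mult_left_mono) auto
   finally show "r \<le> sqrt r" by simp
  qed simp
  finally show ?thesis by (simp add: algebra_simps)
 qed
 then show ?thesis using that[OF TW(1)] by blast
qed

section \<open>Tensor products of error bases and partial twirls\<close>

definition krset :: "nat => fmat set => fmat set => fmat set" where
 "krset m F G = (\<lambda>(f, g). kr m f g) ` (F \<times> G)"

lemma neb_kr:
 assumes F: "neb q F" and G: "neb m G"
 shows "neb (q * m) (krset m F G)"
proof -
 note q = nebD(1)[OF F] and m = nebD(1)[OF G]
 have MMs: "f \<in> F ==> f \<in> MM q" "g \<in> G ==> g \<in> MM m" for f g using nebD(3)[OF F] nebD(3)[OF G] by auto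
 have orth: "ftr (adj (kr m f g) * kr m f' g') = (if f = f' \<and> g = g' then of_nat (q * m) else 0)"
  if "f \<in> F" "f' \<in> F" "g \<in> G" "g' \<in> G" for f f' g g'
 proof -
  have "adj (kr m f g) * kr m f' g' = kr m (adj f * f') (adj g * g')"
   using that MMs m by (simp add: adj_kr kr_mult)
  then have "ftr (adj (kr m f g) * kr m f' g') = ftr (adj f * f') * ftr (adj g * g')"
   using that MMs m by (simp add: ftr_kr)
  then show ?thesis using nebD(5)[OF F that(1,2)] nebD(5)[OF G that(3,4)] by auto
 qed
 have inj: "inj_on (\<lambda>(f, g). kr m f g) (F \<times> G)"
 proof (rule inj_onI, clarsimp)
  fix f g f' g' assume *: "f \<in> F" "g \<in> G" "f' \<in> F" "g' \<in> G" "kr m f g = kr m f' g'"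
  then show "f = f' \<and> g = g'"
   using orth[of f f' g g'] orth[of f f g g] q m by (auto split: if_splits)
 qed
 show ?thesis unfolding neb_def
 proof (intro conjI allI impI ballI)
  show "0 < q * m" "finite (krset m F G)" "krset m F G \<subseteq> UU (q * m)"
   using q m nebD(2,3)[OF F] nebD(2,3)[OF G] by (auto simp: krset_def UU_kr)
  fix x y assume "x \<in> krset m F G" "y \<in> krset m F G"
  then obtain f g f' g' where *: "f \<in> F" "f' \<in> F" "g \<in> G" "g' \<in> G" "x = kr m f g" "y = kr m f' g'"
   by (auto simp: krset_def)
  obtain c d where cd: "cmod c = 1" "d \<in> F" "f * f' = csc c d" using nebD(4)[OF F *(1,2)] by blast
  obtain c' d' where cd': "cmod c' = 1" "d' \<in> G" "g * g' = csc c' d'" using nebD(4)[OF G *(3,4)] by blast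
  have "x * y = csc (c * c') (kr m d d')"
   using * MMs m by (simp add: kr_mult cd cd' kr_csc_left kr_csc_right mult.commute)
  moreover have "kr m d d' \<in> krset m F G" using cd cd' by (auto simp: krset_def)
  ultimately show "\<exists>c. \<exists>d\<in>krset m F G. cmod c = 1 \<and> x * y = csc c d"
   using cd(1) cd'(1) by (intro exI[of _ "c * c'"] bexI[of _ "kr m d d'"]) (auto simp: norm_mult)
  have "x = y \<longleftrightarrow> f = f' \<and> g = g'" using inj_on_eq_iff[OF inj, of "(f, g)" "(f', g')"] * by simp
  then show "ftr (adj x * y) = (if x = y then of_nat (q * m) else 0)" using orth * by simp
 next
  fix i p j r assume a: "i < q * m" "p < q * m" "j < q * m" "r < q * m"
  have d: "k div m < q" "k mod m < m" if "k < q * m" for k using that m by (simp_all add: div_less_iff_less_mult)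
  have e: "(i = j) = (i div m = j div m \<and> i mod m = j mod m)" for i j by (metis div_mult_mod_eq)
  have "(\<Sum>b\<in>krset m F G. ent b i p * cnj (ent b j r)) =
   (\<Sum>x\<in>F \<times> G. (ent (fst x) (i div m) (p div m) * cnj (ent (fst x) (j div m) (r div m))) *
     (ent (snd x) (i mod m) (p mod m) * cnj (ent (snd x) (j mod m) (r mod m))))"
   unfolding krset_def using m by (subst sum.reindex[OF inj]) (simp add: case_prod_unfold ent_kr ac_simps)
  also have "\<dots> = (\<Sum>f\<in>F. ent f (i div m) (p div m) * cnj (ent f (j div m) (r div m))) *
    (\<Sum>g\<in>G. ent g (i mod m) (p mod m) * cnj (ent g (j mod m) (r mod m)))"
   by (simp add: sum_product sum.cartesian_product case_prod_unfold)
  also have "\<dots> = (if i = j \<and> p = r then of_nat (q * m) else 0)"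
   using nebD(6)[OF F d(1)[OF a(1)] d(1)[OF a(2)] d(1)[OF a(3)] d(1)[OF a(4)]]
    nebD(6)[OF G d(2)[OF a(1)] d(2)[OF a(2)] d(2)[OF a(3)] d(2)[OF a(4)]] e[of i j] e[of p r] by auto
  finally show "(\<Sum>b\<in>krset m F G. ent b i p * cnj (ent b j r)) = (if i = j \<and> p = r then of_nat (q * m) else 0)" .
 qed
qed

lemma decomp_outer:
 assumes Y: "Y \<in> MM (q * m)" and m: "m > 0"
 shows "Y = (\<Sum>a<q. \<Sum>b<q. kr m (eu a b) (mk m (\<lambda>i j. ent Y (a * m + i) (b * m + j))))"
proof (rule fmat_eqI)
 fix r s
 have "ent (\<Sum>a<q. \<Sum>b<q. kr m (eu a b) (mk m (\<lambda>i j. ent Y (a * m + i) (b * m + j)))) r s =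
  (\<Sum>a<q. \<Sum>b<q. if b = s div m then (if a = r div m then ent Y r s else 0) else 0)"
  unfolding ent_sum using m by (intro sum.cong refl) (auto simp: ent_kr ent_mk)
 also have "\<dots> = (if r div m < q \<and> s div m < q then ent Y r s else 0)" by (cases "s div m < q") simp_all
 also have "\<dots> = ent Y r s" using MM_zero[OF Y, of r s] m by (auto simp: div_less_iff_less_mult)
 finally show "ent Y r s = ent (\<Sum>a<q. \<Sum>b<q. kr m (eu a b) (mk m (\<lambda>i j. ent Y (a * m + i) (b * m + j)))) r s" ..
qed

lemma decomp_inner:
 assumes Y: "Y \<in> MM (q * m)" and m: "m > 0"
 shows "Y = (\<Sum>i<m. \<Sum>j<m. kr m (mk q (\<lambda>a b. ent Y (a * m + i) (b * m + j))) (eu i j))"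
proof (rule fmat_eqI)
 fix r s
 have "ent (\<Sum>i<m. \<Sum>j<m. kr m (mk q (\<lambda>a b. ent Y (a * m + i) (b * m + j))) (eu i j)) r s =
  (\<Sum>i<m. \<Sum>j<m. if j = s mod m then (if i = r mod m then (if r div m < q \<and> s div m < q then ent Y r s else 0) else 0) else 0)"
  unfolding ent_sum using m by (intro sum.cong refl) (auto simp: ent_kr ent_mk)
 also have "\<dots> = (if r div m < q \<and> s div m < q then ent Y r s else 0)" using m by simp
 also have "\<dots> = ent Y r s" using MM_zero[OF Y, of r s] m by (auto simp: div_less_iff_less_mult)
 finally show "ent Y r s = ent (\<Sum>i<m. \<Sum>j<m. kr m (mk q (\<lambda>a b. ent Y (a * m + i) (b * m + j))) (eu i j)) r s" ..
qed

text \<open>Decomposing the inner factor into matrix units reduces the average over the outer factor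
  to \<open>neb_twirl\<close>, which leaves only a multiple of the identity there.\<close>

lemma twirl_outer:
 assumes F: "neb q F" and Y: "Y \<in> MM (q * m)" and m: "m > 0"
 obtains y where "y \<in> MM m" "(\<Sum>f\<in>F. kr m f (fid m) * Y * adj (kr m f (fid m))) = kr m (fid q) y"
proof -
 define g where "g i j = mk q (\<lambda>a b. ent Y (a * m + i) (b * m + j))" for i j
 have gM: "g i j \<in> MM q" for i j by (simp add: g_def)
 have FM: "f \<in> F ==> f \<in> MM q" for f using nebD(3)[OF F] by auto
 define y where "y = (\<Sum>i<m. \<Sum>j<m. csc (of_nat q * ftr (g i j)) (eu i j))"
 have "(\<Sum>f\<in>F. kr m f (fid m) * Y * adj (kr m f (fid m))) =
   (\<Sum>f\<in>F. \<Sum>i<m. \<Sum>j<m. kr m (f * g i j * adj f) (eu i j))"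
 proof (rule sum.cong[OF refl])
  fix f assume f: "f \<in> F"
  have "kr m f (fid m) * Y * adj (kr m f (fid m)) =
    (\<Sum>i<m. \<Sum>j<m. kr m f (fid m) * kr m (g i j) (eu i j) * adj (kr m f (fid m)))"
   by (subst decomp_inner[OF Y m]) (simp add: sum_distrib_left sum_distrib_right g_def)
  also have "\<dots> = (\<Sum>i<m. \<Sum>j<m. kr m (f * g i j * adj f) (eu i j))"
   using m by (intro sum.cong refl) (simp add: adj_kr kr_mult MM_eu)
  finally show "kr m f (fid m) * Y * adj (kr m f (fid m)) = (\<Sum>i<m. \<Sum>j<m. kr m (f * g i j * adj f) (eu i j))" .
 qed
 also have "\<dots> = (\<Sum>i<m. \<Sum>j<m. \<Sum>f\<in>F. kr m (f * g i j * adj f) (eu i j))" by (rule sum_swap3[symmetric])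
 also have "\<dots> = (\<Sum>i<m. \<Sum>j<m. kr m (csc (of_nat q * ftr (g i j)) (fid q)) (eu i j))"
  using neb_twirl[OF F gM] m by (simp add: kr_sum_left[symmetric])
 also have "\<dots> = kr m (fid q) y" using m by (simp add: y_def kr_sum_right kr_csc_left kr_csc_right)
 finally show ?thesis using that[of y] by (auto simp: y_def intro!: MM_sum MM_csc MM_eu)
qed

lemma twirl_inner:
 assumes G: "neb m G" and Y: "Y \<in> MM (q * m)"
 obtains z where "z \<in> MM q" "(\<Sum>g\<in>G. kr m (fid q) g * Y * adj (kr m (fid q) g)) = kr m z (fid m)"
proof -
 note m = nebD(1)[OF G]
 define h where "h a b = mk m (\<lambda>i j. ent Y (a * m + i) (b * m + j))" for a b
 have hM: "h i j \<in> MM m" for i j by (simp add: h_def)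
 have GM: "g \<in> G ==> g \<in> MM m" for g using nebD(3)[OF G] by auto
 define z where "z = (\<Sum>i<q. \<Sum>j<q. csc (of_nat m * ftr (h i j)) (eu i j))"
 have "(\<Sum>g\<in>G. kr m (fid q) g * Y * adj (kr m (fid q) g)) =
   (\<Sum>g\<in>G. \<Sum>i<q. \<Sum>j<q. kr m (eu i j) (g * h i j * adj g))"
 proof (rule sum.cong[OF refl])
  fix g assume g: "g \<in> G"
  have "kr m (fid q) g * Y * adj (kr m (fid q) g) =
    (\<Sum>i<q. \<Sum>j<q. kr m (fid q) g * kr m (eu i j) (h i j) * adj (kr m (fid q) g))"
   by (subst decomp_outer[OF Y m]) (simp add: sum_distrib_left sum_distrib_right h_def)
  also have "\<dots> = (\<Sum>i<q. \<Sum>j<q. kr m (eu i j) (g * h i j * adj g))"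
   using m hM GM[OF g] by (intro sum.cong refl) (simp add: adj_kr kr_mult MM_eu)
  finally show "kr m (fid q) g * Y * adj (kr m (fid q) g) = (\<Sum>i<q. \<Sum>j<q. kr m (eu i j) (g * h i j * adj g))" .
 qed
 also have "\<dots> = (\<Sum>i<q. \<Sum>j<q. \<Sum>g\<in>G. kr m (eu i j) (g * h i j * adj g))" by (rule sum_swap3[symmetric])
 also have "\<dots> = (\<Sum>i<q. \<Sum>j<q. kr m (eu i j) (csc (of_nat m * ftr (h i j)) (fid m)))"
  using neb_twirl[OF G hM] m by (simp add: kr_sum_right[symmetric])
 also have "\<dots> = kr m z (fid m)" using m by (simp add: z_def kr_sum_left kr_csc_left kr_csc_right)
 finally show ?thesis using that[of z] by (auto simp: z_def intro!: MM_sum MM_csc MM_eu)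
qed

lemma avg_near:
 fixes Y :: "'a::real_normed_vector"
 assumes B: "finite B" "B \<noteq> {}" and *: "\<And>b. b \<in> B ==> norm (Y - f b) \<le> d"
 shows "norm (Y - (1 / real (card B)) *\<^sub>R (\<Sum>b\<in>B. f b)) \<le> d"
proof -
 have c: "card B > 0" using B by (simp add: card_gt_0_iff)
 have "Y - (1 / real (card B)) *\<^sub>R (\<Sum>b\<in>B. f b) = (1 / real (card B)) *\<^sub>R (\<Sum>b\<in>B. Y - f b)"
  using c by (simp add: sum_subtractf sum_constant_scaleR scaleR_diff_right)
 also have "norm \<dots> = (1 / real (card B)) * norm (\<Sum>b\<in>B. Y - f b)" by simp
 also have "\<dots> \<le> (1 / real (card B)) * (\<Sum>b\<in>B. d)"
  using * by (intro mult_left_mono sum_norm_le) auto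
 also have "\<dots> = d" using c by simp
 finally show ?thesis .
qed

text \<open>When the size decreases, the corner \<open>A\<close> misses being unitary by Y*Y, where
  \<open>Y\<close> has squared norm at most \<open>k - l\<close>; so \<open>polar_near\<close> finds
  a unitary at distance at most the root of \<open>k - l\<close>. Cutting off rows and columns costs
  the same twice, whence the 3.\<close>

lemma resize_exists:
 assumes u: "u \<in> UU k"
 shows "\<exists>v\<in>UU l. norm (u - v) \<le> 3 * sqrt \<bar>real k - real l\<bar>"
proof (cases "k \<le> l")
 case True
 have "norm (u - (u + (fid l - fid k))) = norm (fid l - fid k)" by (simp add: norm_minus_commute)
 also have "\<dots> = sqrt \<bar>real k - real l\<bar>" using fid_diff_proj(3)[OF True] True
  by (simp add: real_sqrt_unique)
 finally have "norm (u - (u + (fid l - fid k))) \<le> 3 * sqrt \<bar>real k - real l\<bar>" by simp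
 then show ?thesis using UU_extend[OF u True] by blast
next
 case False
 then have lk: "l \<le> k" by simp
 define p where "p = fid k - fid l"
 let ?s = "sqrt (real k - real l)"
 have p: "p * p = p" "adj p = p" "fid l + p = fid k" using fid_diff_proj[OF lk] by (simp_all add: p_def)
 have np: "norm p = ?s" unfolding p_def using fid_diff_proj(3)[OF lk] by (simp add: real_sqrt_unique)
 have pM: "p \<in> MM k" using lk by (auto simp: p_def)
 have fl: "fid l * fid k = fid l" "fid k * fid l = fid l" "fid l * p = 0" "p * fid l = 0"
  using lk by (auto intro: fid_mult_le simp: p_def algebra_simps fid_mult_le[of "fid l" l k])
 define A where "A = fid l * u * fid l"
 have A: "A \<in> MM l"
 proof (rule MM_I)
  have fm: "fid l \<in> MM l" by auto
  fix i j assume "l \<le> i \<or> l \<le> j"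
  then show "ent A i j = 0"
   unfolding A_def by (auto simp: ent_mult[OF disjI2[OF fm]] ent_mult[OF disjI1[OF fm], of u] mult.assoc ent_mult[OF disjI1[OF fm], of "u * fid l"])
 qed
 define Y where "Y = p * u * fid l"
 have nY: "norm Y \<le> ?s"
 proof -
  have "norm Y \<le> norm (p * u)" unfolding Y_def using KK_right[OF KK_fid[OF order_refl, of l]] by simp
  also have "\<dots> \<le> norm p" using KK_right[OF UU_KK[OF u]] by simp
  finally show ?thesis by (simp add: np)
 qed
 have AA: "adj A * A - fid l = - (adj Y * Y)"
 proof -
  have "fid l * fid l = fid l" by simp
  then have "adj A * A + adj Y * Y = fid l * (adj u * ((fid l + p) * u)) * fid l"
   unfolding A_def Y_def adj_mult adj_fid p(2)
   by (simp only: mult.assoc[symmetric] distrib_left distrib_right)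
    (simp only: mult.assoc p(1) mult.assoc[of p p, symmetric] mult.assoc[of "fid l" "fid l", symmetric])
  also have "\<dots> = fid l" using u fl by (simp add: p(3) UU_D)
  finally have "adj A * A + adj Y * Y = fid l" .
  then show ?thesis by (simp add: algebra_simps)
 qed
 have "cmod (ftr (S * (adj A * A - fid l))) \<le> real k - real l" if S: "S \<in> UU l" for S
 proof -
  have "cmod (ftr (S * (adj A * A - fid l))) = cmod (ftr (S * (adj Y * Y)))" unfolding AA by simp
  also have "\<dots> \<le> norm Y * norm Y" by (rule ftr_mult_bound[OF UU_KK[OF S]])
  also have "\<dots> \<le> ?s * ?s" using nY lk by (intro mult_mono) auto
  finally show ?thesis using lk by simp
 qed
 then obtain w where w: "w \<in> UU l" "(norm (A - w))\<^sup>2 \<le> real k - real l"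
  using polar_near[OF A, of "real k - real l"] by metis
 have "norm (A - w) \<le> ?s" using w(2) by (simp add: real_le_rsqrt)
 moreover have "norm (u - A) \<le> 2 * ?s"
 proof -
  have "u = (fid l + p) * u" using u by (simp add: p(3))
  also have "\<dots> = fid l * (u * fid k) + p * u" using u by (simp add: distrib_right)
  also have "\<dots> = fid l * u * (fid l + p) + p * u" by (simp add: p(3) mult.assoc)
  finally have "u - A = fid l * u * p + p * u" by (simp add: A_def algebra_simps)
  then have "norm (u - A) \<le> norm (fid l * u * p) + norm (p * u)" by (metis norm_triangle_ineq)
  also have "norm (fid l * u * p) \<le> norm p"
   using KK_left[of "fid l * u" k p] KK_fid[OF lk] u by blast
  also have "norm (p * u) \<le> norm p" using KK_right[OF UU_KK[OF u]] .
  finally show ?thesis by (simp add: np)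
 qed
 ultimately have "norm (u - w) \<le> 3 * ?s" using norm_triangle_ineq[of "u - A" "A - w"] by simp
 then show ?thesis using w(1) lk by auto
qed

text \<open>The trace norm of x*x - 1 is measured on the \<open>q\<close>-fold copy, where the
  distance to the unitary \<open>V\<close> bounds it; the multiplicity \<open>q\<close> then divides
  out. \<open>V\<close> itself may be any unitary, not a copy.\<close>

lemma near_unitary_kr:
 assumes m: "m > 0" and q: "q > 0" and x: "x \<in> MM m" "kr m (fid q) x \<in> KK (q * m)" and V: "V \<in> UU (q * m)"
 obtains y where "y \<in> UU m" "(norm (kr m (fid q) x - kr m (fid q) y))\<^sup>2 \<le> 2 * sqrt (q * m) * norm (kr m (fid q) x - V)"
proof -
 let ?X = "kr m (fid q) x" and ?d = "2 * sqrt (q * m) * norm (kr m (fid q) x - V)"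
 have "cmod (ftr (S * (adj x * x - fid m))) \<le> ?d / q" if S: "S \<in> UU m" for S
 proof -
  have SK: "kr m (fid q) S \<in> KK (q * m)" using UU_kr[OF m UU_fid S] by simp
  have "kr m (fid q) (S * (adj x * x - fid m)) = kr m (fid q) S * (adj ?X * ?X - fid (q * m))"
   using S x m by (simp add: adj_kr kr_mult kr_diff_right kr_fid[symmetric] right_diff_distrib)
  also have "\<dots> = kr m (fid q) S * (adj (?X - V) * ?X) + kr m (fid q) S * (adj V * (?X - V))"
   using UU_D(2)[OF V] by (simp add: algebra_simps)
  finally have "of_nat q * ftr (S * (adj x * x - fid m)) = ftr (kr m (fid q) S * (adj (?X - V) * ?X)) + ftr (kr m (fid q) S * (adj V * (?X - V)))"
   using ftr_kr[OF m, of "S * (adj x * x - fid m)" "fid q"] S x by simp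
  then have "q * cmod (ftr (S * (adj x * x - fid m))) \<le> cmod (ftr (kr m (fid q) S * (adj (?X - V) * ?X))) + cmod (ftr (kr m (fid q) S * (adj V * (?X - V))))"
   by (metis norm_mult norm_of_nat norm_triangle_ineq)
  also have "\<dots> \<le> norm (?X - V) * norm ?X + norm V * norm (?X - V)"
   by (intro add_mono ftr_mult_bound[OF SK])
  also have "\<dots> \<le> norm (?X - V) * sqrt (q * m) + sqrt (q * m) * norm (?X - V)"
   using KK_left[OF x(2), of "fid (q * m)"] norm_UU[OF UU_fid[of "q * m"]] x(2) norm_UU[OF V]
   by (intro add_mono mult_left_mono mult_right_mono) auto
  finally show ?thesis using q by (simp add: pos_le_divide_eq ac_simps)
 qed
 then obtain y where y: "y \<in> UU m" "(norm (x - y))\<^sup>2 \<le> ?d / q" using polar_near[OF x(1), of "?d / q"] by metis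
 have "?X - kr m (fid q) y = kr m (fid q) (x - y)" using m by (simp add: kr_diff_right)
 then have "(norm (?X - kr m (fid q) y))\<^sup>2 = q * (norm (x - y))\<^sup>2"
  using x y m norm_UU[OF UU_fid[of q]] by (simp add: norm_kr power_mult_distrib)
 also have "\<dots> \<le> ?d" using y(2) q by (simp add: field_simps)
 finally show ?thesis using that y by blast
qed

section \<open>Self-correction of maps near the identity\<close>

text \<open>Closure under midpoints is what the parallelogram law uses, and it gives two-term
  inductions in place of general convex combinations.\<close>

inductive_set midhull :: "fmat set => fmat set" for S where
 base: "x \<in> S ==> x \<in> midhull S"
| mid: "x \<in> midhull S ==> y \<in> midhull S ==> (1/2) *\<^sub>R (x + y) \<in> midhull S"

text \<open>Among the midpoint-convex combinations of the matrices \<open>h u * adj u\<close> one of almost minimal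
 norm is almost fixed by the affine action \<open>T \<mapsto> h v * T * adj v\<close> of the whole group; since it
 almost commutes with the irreducible set \<open>B\<close>, it is almost a scalar, and this scalar is not small.\<close>

theorem self_correct:
 assumes B: "neb m B" and h: "\<And>u. u \<in> UU m ==> h u \<in> UU m" and e: "0 < r" "r \<le> 1"
  and mult: "\<And>u v. u \<in> UU m ==> v \<in> UU m ==> norm (h (u * v) - h u * h v) \<le> r * sqrt m"
  and anchor: "\<And>b. b \<in> B ==> norm (h b - b) \<le> r * sqrt m"
  and close: "\<And>u. u \<in> UU m ==> norm (h u - u) \<le> sqrt m"
  and v: "v \<in> UU m"
 shows "norm (h v - v) \<le> 34 * sqrt r * sqrt m"
proof -
 define m' where "m' = sqrt (real m)"
 have mp: "m > 0" "m' > 0" "m' * m' = m" using nebD(1)[OF B] by (auto simp: m'_def)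
 define S where "S = (\<lambda>u. h u * adj u) ` UU m"
 define H where "H = midhull S"
 have HK: "x \<in> KK m" if "x \<in> H" for x
  using that unfolding H_def
 proof induction
  case (base x) then show ?case using h by (auto simp: S_def)
 next
  case (mid x y)
  then show ?case using KK_convex[of "{True, False}" "\<lambda>b. if b then x else y" m "\<lambda>_. 1/2"]
   by (simp add: scaleR_add_right)
 qed
 \<comment> \<open>|h u - u|^2 = 2 m - 2 Re tr(u* h u) is at most \<open>m\<close> by
   \<open>close\<close>; the resulting lower bound for the trace passes to midpoints.\<close>
 have HT: "m / 2 \<le> Re (ftr x)" if "x \<in> H" for x
  using that unfolding H_def
 proof induction
  case (base x)
  then obtain u where u: "u \<in> UU m" "x = h u * adj u" by (auto simp: S_def)
  have "(norm (h u - u))\<^sup>2 \<le> m'\<^sup>2" using close[OF u(1)] by (intro power_mono) (auto simp: m'_def)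
  moreover have "(norm (h u - u))\<^sup>2 = (norm (h u))\<^sup>2 + (norm u)\<^sup>2 - 2 * inner u (h u)"
   by (simp add: power2_norm_eq_inner inner_diff_left inner_diff_right inner_commute)
  moreover have "inner u (h u) = Re (ftr x)" using ftr_comm[of "adj u"] by (simp add: u(2) inner_ftr)
  ultimately show ?case using u(1) h[OF u(1)] by (simp add: norm_UU[of _ m] m'_def)
 next
  case (mid x y) then show ?case by simp
 qed
 \<comment> \<open>The action sends the generator of \<open>u\<close> to that of
   \<open>v * u\<close> up to the multiplicative defect; being affine, it respects midpoints with
   the same error.\<close>
 have Hact: "\<exists>y\<in>H. norm (h v * x * adj v - y) \<le> r * m'" if "x \<in> H" and v: "v \<in> UU m" for x v
  using that(1) unfolding H_def
 proof induction
  case (base x)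
  then obtain u where u: "u \<in> UU m" "x = h u * adj u" by (auto simp: S_def)
  have "h v * x * adj v - h (v * u) * adj (v * u) = (h v * h u - h (v * u)) * adj (v * u)"
   by (simp add: u(2) algebra_simps)
  then have "norm (h v * x * adj v - h (v * u) * adj (v * u)) \<le> norm (h v * h u - h (v * u))"
   using KK_right[of "adj (v * u)" m] u v by (metis UU_KK UU_adj UU_mult)
  then have "norm (h v * x * adj v - h (v * u) * adj (v * u)) \<le> r * m'"
   using mult[OF v u(1)] by (simp add: norm_minus_commute m'_def)
  moreover have "h (v * u) * adj (v * u) \<in> midhull S"
   unfolding S_def using u v by (intro midhull.base image_eqI[of _ _ "v * u"]) auto
  ultimately show ?case by blast
 next
  case (mid x y)
  then obtain x' y' where *: "x' \<in> midhull S" "y' \<in> midhull S" "norm (h v * x * adj v - x') \<le> r * m'" "norm (h v * y * adj v - y') \<le> r * m'"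
   by blast
  have "h v * ((1/2) *\<^sub>R (x + y)) * adj v - (1/2) *\<^sub>R (x' + y') = (1/2) *\<^sub>R ((h v * x * adj v - x') + (h v * y * adj v - y'))"
   by (simp add: algebra_simps)
  then have "norm (h v * ((1/2) *\<^sub>R (x + y)) * adj v - (1/2) *\<^sub>R (x' + y')) \<le> (1/2) * (r * m' + r * m')"
   using norm_triangle_mono[OF *(3,4)] by simp
  then show ?case using midhull.mid[OF *(1,2)] by (intro bexI) (auto simp: mult.commute)
 qed
 define J where "J = (INF x\<in>H. (norm x)\<^sup>2)"
 have bdd: "bdd_below ((\<lambda>x. (norm x)\<^sup>2) ` H)" by (rule bdd_belowI2[of _ 0]) auto
 have "h (fid m) * adj (fid m) \<in> S" unfolding S_def by (rule imageI) simp
 then have Hne: "H \<noteq> {}" unfolding H_def using midhull.base by blast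
 have Jle: "J \<le> (norm x)\<^sup>2" if "x \<in> H" for x unfolding J_def using that bdd by (rule cINF_lower[rotated])
 \<comment> \<open>The infimum may fail to be attained in the hull; a slack of \<open>r * m\<close>
   is of the same order as the other errors.\<close>
 have "J < J + r * m" using e mp by simp
 then obtain T where T: "T \<in> H" "(norm T)\<^sup>2 < J + r * m"
  unfolding J_def using cINF_less_iff[OF Hne bdd] by blast
 have nT: "norm T \<le> m'"
  using KK_left[OF HK[OF T(1)], of "fid m"] norm_UU[OF UU_fid[of m]] HK[OF T(1)] by (simp add: m'_def)
 have se: "r \<le> sqrt r"
 proof -
  have "r = sqrt r * sqrt r" using e by simp
  also have "\<dots> \<le> sqrt r * 1" using e by (intro mult_left_mono) auto
  finally show "r \<le> sqrt r" by simp
 qed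
 have inv: "norm (h v * T * adj v - T) \<le> 5 * sqrt r * m'" if v: "v \<in> UU m" for v
 proof -
  obtain T' where T': "T' \<in> H" "norm (h v * T * adj v - T') \<le> r * m'" using Hact[OF T(1) v] by blast
  have "norm (h v * T * adj v) \<le> norm T"
   using KK_right[OF KK_adj[OF UU_KK[OF v]], of "h v * T"] KK_left[OF UU_KK[OF h[OF v]], of T] by linarith
  then have "norm T' \<le> norm T + r * m'"
   using T'(2) norm_triangle_sub[of T' "h v * T * adj v"] by (simp add: norm_minus_commute)
  then have "(norm T')\<^sup>2 \<le> (norm T + r * m')\<^sup>2" by (intro power_mono) auto
  also have "\<dots> = (norm T)\<^sup>2 + 2 * r * (norm T * m') + r * (r * (m' * m'))" by (simp add: power2_eq_square algebra_simps)
  also have "\<dots> \<le> (norm T)\<^sup>2 + 2 * r * (m' * m') + r * (1 * (m' * m'))"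
   using nT e mp by (intro add_mono mult_left_mono mult_right_mono) auto
  finally have nT': "(norm T')\<^sup>2 \<le> (norm T)\<^sup>2 + 3 * r * m" by (simp add: mp)
  \<comment> \<open>The midpoint of two almost minimal points has squared norm at least
    \<open>J\<close>, so the parallelogram law forces the points together.\<close>
  have "J \<le> (norm ((1/2) *\<^sub>R (T + T')))\<^sup>2" using T(1) T'(1) by (intro Jle) (auto simp: H_def midhull.mid)
  then have "4 * J \<le> (norm (T + T'))\<^sup>2" by (simp add: power_mult_distrib power_divide)
  moreover have "(norm (T - T'))\<^sup>2 + (norm (T + T'))\<^sup>2 = 2 * (norm T)\<^sup>2 + 2 * (norm T')\<^sup>2"
   by (simp add: power2_norm_eq_inner inner_add_left inner_add_right inner_diff_left inner_diff_right)
  ultimately have "(norm (T - T'))\<^sup>2 \<le> 16 * (r * m)" using nT' T(2) Jle[OF T(1)] by linarith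
  also have "\<dots> = (4 * sqrt r * m')\<^sup>2" using e by (simp add: power_mult_distrib m'_def)
  finally have "norm (T - T') \<le> 4 * sqrt r * m'" using e mp by (simp add: power2_le_iff_abs_le)
  then have "norm (h v * T * adj v - T) \<le> r * m' + 4 * sqrt r * m'"
   using T'(2) norm_triangle_ineq[of "h v * T * adj v - T'" "T' - T"] by (simp add: norm_minus_commute)
  moreover have "r * m' \<le> sqrt r * m'" using se mp by (intro mult_right_mono) auto
  ultimately show ?thesis by (simp add: algebra_simps)
 qed
 have comm: "norm (T - b * T * adj b) \<le> 6 * sqrt r * m'" if b: "b \<in> B" for b
 proof -
  have bU: "b \<in> UU m" using nebD(3)[OF B b] .
  have "T - b * T * adj b = (T - h b * T * adj b) + (h b - b) * (T * adj b)" by (simp add: algebra_simps)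
  then have "norm (T - b * T * adj b) \<le> norm (T - h b * T * adj b) + norm ((h b - b) * (T * adj b))"
   by (metis norm_triangle_ineq)
  also have "norm ((h b - b) * (T * adj b)) \<le> norm (h b - b)"
   using KK_right[of "T * adj b" m] HK[OF T(1)] bU by blast
  also have "norm (h b - b) \<le> r * m'" using anchor[OF b] by (simp add: m'_def)
  also have "r * m' \<le> sqrt r * m'" using se mp by (intro mult_right_mono) auto
  finally show ?thesis using inv[OF bU] by (simp add: norm_minus_commute algebra_simps)
 qed
 \<comment> \<open>The average of \<open>b * T * adj b\<close> over the basis is
   \<open>csc t (fid m)\<close>. By \<open>HT\<close> the modulus of \<open>t\<close> is at least
   1/2, so dividing by it at the end only doubles 17 = 5 + 6 + 6 to 34.\<close>
 define t where "t = ftr T / m"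
 have "(1 / real (card B)) *\<^sub>R (\<Sum>b\<in>B. b * T * adj b) = csc t (fid m)"
  using neb_twirl[OF B, of T] HK[OF T(1)] mp by (simp add: neb_card[OF B] scaleR_csc t_def power2_eq_square)
 then have Tt: "norm (T - csc t (fid m)) \<le> 6 * sqrt r * m'"
  using avg_near[OF nebD(2)[OF B] neb_ne[OF B], of T "\<lambda>b. b * T * adj b" "6 * sqrt r * m'"] comm by simp
 have "1/2 \<le> Re t" using HT[OF T(1)] mp by (simp add: t_def field_simps)
 then have ct: "1/2 \<le> cmod t" using complex_Re_le_cmod[of t] by linarith
 have "csc t (h v * adj v - fid m) = (h v * T * adj v - T) - h v * (T - csc t (fid m)) * adj v + (T - csc t (fid m))"
  using h[OF v] v by (simp add: algebra_simps csc_diff_right)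
 then have "norm (csc t (h v * adj v - fid m)) \<le> norm ((h v * T * adj v - T) - h v * (T - csc t (fid m)) * adj v) + norm (T - csc t (fid m))"
  by (metis norm_triangle_ineq)
 also have "\<dots> \<le> norm (h v * T * adj v - T) + norm (h v * (T - csc t (fid m)) * adj v) + norm (T - csc t (fid m))"
  by (intro add_mono norm_triangle_ineq4) simp
 also have "norm (h v * (T - csc t (fid m)) * adj v) = norm (T - csc t (fid m))"
  using HK[OF T(1)] by (intro norm_conj_UU[OF h[OF v] UU_adj[OF v]]) auto
 finally have "cmod t * norm (h v * adj v - fid m) \<le> 17 * sqrt r * m'" using inv[OF v] Tt by simp
 moreover have "1/2 * norm (h v * adj v - fid m) \<le> cmod t * norm (h v * adj v - fid m)"
  using ct by (intro mult_right_mono) auto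
 ultimately have "norm (h v * adj v - fid m) \<le> 34 * sqrt r * m'" by linarith
 moreover have "norm (h v - v) = norm (h v * adj v - fid m)"
  using norm_UU_right[OF UU_adj[OF v], of "h v - v"] v h[OF v] by (simp add: left_diff_distrib UU_D)
 ultimately show ?thesis by (simp add: m'_def)
qed

section \<open>Asymptotic equality along filters and uniform estimates\<close>

definition nn :: "nat => fmat => real" where "nn k x = norm x / sqrt (real k)"

text \<open>The contractions of \<open>KK\<close> without a size, so that asymptotic equalities can
  be multiplied by factors whose size is left implicit.\<close>

definition con :: "fmat => bool" where
 "con x \<longleftrightarrow> (\<forall>y. norm (x * y) \<le> norm y \<and> norm (y * x) \<le> norm y)"

lemma con_KK [intro]: "x \<in> KK n ==> con x" using KK_left KK_right unfolding con_def by blast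
lemma con_UU [intro]: "x \<in> UU n ==> con x" by (blast intro: UU_KK)
lemma con_mult [intro]: "con x ==> con y ==> con (x * y)"
 unfolding con_def by (metis mult.assoc order_trans)
lemma con_adj [intro]: "con x ==> con (adj x)"
 unfolding con_def by (metis adj_adj adj_mult norm_adj)

lemma nn_nonneg [simp]: "0 \<le> nn k x" by (simp add: nn_def)
lemma nn_0 [simp]: "nn k 0 = 0" by (simp add: nn_def)
lemma nn_triangle: "nn k (x + y) \<le> nn k x + nn k y"
 by (simp add: nn_def norm_triangle_ineq divide_right_mono flip: add_divide_distrib)
lemma nn_diff_triangle: "nn k (x - z) \<le> nn k (x - y) + nn k (y - z)"
 using nn_triangle[of k "x - y" "y - z"] by simp
lemma nn_commute: "nn k (x - y) = nn k (y - x)" by (simp add: nn_def norm_minus_commute)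
lemma nn_mono: "norm x \<le> norm y ==> nn k x \<le> nn k y" by (simp add: nn_def divide_right_mono)
text \<open>The filter is a parameter because conditional estimates are tested along filters of
  pairs, and hypothetical failures along subsequences.\<close>

definition aeq :: "'i filter => ('i => nat) => ('i => fmat) => ('i => fmat) => bool" where
 "aeq F k X Y \<longleftrightarrow> ((\<lambda>i. nn (k i) (X i - Y i)) \<longlongrightarrow> 0) F"

abbreviation aeqs :: "(nat => nat) => (nat => fmat) => (nat => fmat) => bool" where "aeqs == aeq sequentially"

lemma aeq_refl [simp, intro]: "aeq F k X X" by (simp add: aeq_def)
lemma aeq_sym: "aeq F k X Y ==> aeq F k Y X" by (simp add: aeq_def nn_commute)

lemma tendsto_0_le_ev:
 fixes f g :: "'i => real"
 assumes "(g \<longlongrightarrow> 0) F" "\<forall>\<^sub>F i in F. 0 \<le> f i \<and> f i \<le> g i"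
 shows "(f \<longlongrightarrow> 0) F"
 by (rule tendsto_sandwich[of "\<lambda>_. 0" f F g]) (use assms in \<open>auto elim: eventually_mono\<close>)

lemma aeq_trans [trans]: "aeq F k X Y ==> aeq F k Y Z ==> aeq F k X Z"
 unfolding aeq_def
 by (rule tendsto_0_le_ev[OF tendsto_add_zero[of "\<lambda>i. nn (k i) (X i - Y i)" F "\<lambda>i. nn (k i) (Y i - Z i)"]])
  (assumption+, intro always_eventually allI conjI nn_nonneg nn_diff_triangle)

lemma aeq_sandwich: "aeq F k X X' ==> aeq F k Y Y' ==> aeq F k X' Y' ==> aeq F k X Y"
 by (rule aeq_trans[OF _ aeq_trans[OF _ aeq_sym]])

lemma aeq_sandwich': "aeq F k X X' ==> aeq F k Y Y' ==> aeq F k X Y ==> aeq F k X' Y'"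
 by (rule aeq_sandwich[OF aeq_sym aeq_sym])

lemma aeq_mono:
 assumes "aeq F k X Y" "\<forall>\<^sub>F i in F. norm (X' i - Y' i) \<le> norm (X i - Y i)"
 shows "aeq F k X' Y'"
 using assms unfolding aeq_def
 by (elim tendsto_0_le_ev) (auto elim!: eventually_mono intro: nn_mono)

lemma aeq_ev_eq: "\<forall>\<^sub>F i in F. X i = Y i ==> aeq F k X Y"
 by (rule aeq_mono[OF aeq_refl]) (auto elim: eventually_mono)

lemma aeq_left:
 assumes "aeq F k X Y" "\<forall>\<^sub>F i in F. con (C i)"
 shows "aeq F k (\<lambda>i. C i * X i) (\<lambda>i. C i * Y i)"
 using assms(1) by (rule aeq_mono) (use assms(2) in \<open>rule eventually_mono; simp add: con_def flip: right_diff_distrib\<close>)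

lemma aeq_right:
 assumes "aeq F k X Y" "\<forall>\<^sub>F i in F. con (C i)"
 shows "aeq F k (\<lambda>i. X i * C i) (\<lambda>i. Y i * C i)"
 using assms(1) by (rule aeq_mono) (use assms(2) in \<open>rule eventually_mono; simp add: con_def flip: left_diff_distrib\<close>)

lemma aeq_mult:
 assumes "aeq F k X X'" "aeq F k Y Y'" "\<forall>\<^sub>F i in F. con (Y i)" "\<forall>\<^sub>F i in F. con (X' i)"
 shows "aeq F k (\<lambda>i. X i * Y i) (\<lambda>i. X' i * Y' i)"
 using aeq_trans[OF aeq_right[OF assms(1,3)] aeq_left[OF assms(2,4)]] .

lemma aeq_adj: "aeq F k X Y ==> aeq F k (\<lambda>i. adj (X i)) (\<lambda>i. adj (Y i))"
 by (erule aeq_mono) (simp flip: adj_diff)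

lemma aeq_csc:
 assumes "aeq F k X Y" "\<forall>\<^sub>F i in F. cmod (c i) \<le> 1"
 shows "aeq F k (\<lambda>i. csc (c i) (X i)) (\<lambda>i. csc (c i) (Y i))"
 using assms(1) by (rule aeq_mono)
  (use assms(2) in \<open>rule eventually_mono; simp add: mult_left_le_one_le flip: csc_diff_right\<close>)

lemma aeq_scale:
 assumes X: "aeq F k X Y" and C: "\<forall>\<^sub>F i in F. 0 < k i \<and> real (k i) \<le> C * real (l i)"
 shows "aeq F l X Y"
 unfolding aeq_def
proof (rule tendsto_0_le_ev)
 show "((\<lambda>i. sqrt \<bar>C\<bar> * nn (k i) (X i - Y i)) \<longlongrightarrow> 0) F"
  using tendsto_mult_right_zero[OF X[unfolded aeq_def]] .
 have *: "nn l z \<le> sqrt \<bar>C\<bar> * nn k z" if "0 < k" "real k \<le> C * real l" for z k l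
 proof (cases "l = 0")
  case False
  have "C * real l \<le> \<bar>C\<bar> * real l" by (intro mult_right_mono) auto
  then have "real k \<le> \<bar>C\<bar> * real l" using that by linarith
  then have "sqrt k \<le> sqrt \<bar>C\<bar> * sqrt l" by (metis real_sqrt_le_mono real_sqrt_mult)
  then have "norm z * sqrt k \<le> norm z * (sqrt \<bar>C\<bar> * sqrt l)" by (intro mult_left_mono) auto
  then show ?thesis using False that(1) by (simp add: nn_def field_simps)
 qed (simp add: nn_def)
 show "\<forall>\<^sub>F i in F. 0 \<le> nn (l i) (X i - Y i) \<and> nn (l i) (X i - Y i) \<le> sqrt \<bar>C\<bar> * nn (k i) (X i - Y i)"
  using C by (rule eventually_mono) (use * in auto)
qed

definition U0 :: "'i filter => ('i => 'x set) => ('i => 'x => real) => bool" where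
 "U0 F S f \<longleftrightarrow> (\<forall>e>0. \<forall>\<^sub>F i in F. \<forall>x\<in>S i. f i x < e)"

text \<open>With distances before and after a map for \<open>g\<close> and \<open>f\<close> this is
  asymptotic equicontinuity; with the two exchanged it is asymptotic uniform injectivity.\<close>

definition C0 :: "'i filter => ('i => 'x set) => ('i => 'x => real) => ('i => 'x => real) => bool" where
 "C0 F S g f \<longleftrightarrow> (\<forall>e>0. \<exists>d>0. \<forall>\<^sub>F i in F. \<forall>x\<in>S i. g i x < d \<longrightarrow> f i x < e)"

text \<open>The reparametrisation \<open>p\<close> makes one uniform estimate usable along
  subsequences and along the filters of pairs.\<close>

lemma U0_seq:
 assumes "U0 F S f" "filterlim p F G" "\<forall>\<^sub>F j in G. x j \<in> S (p j)" "\<And>i x. 0 \<le> f i x"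
 shows "((\<lambda>j. f (p j) (x j)) \<longlongrightarrow> 0) G"
proof (rule tendstoI)
 fix e :: real assume "e > 0"
 then have "\<forall>\<^sub>F i in F. \<forall>x\<in>S i. f i x < e" using assms(1) by (simp add: U0_def)
 from filterlim_iff[THEN iffD1, OF assms(2), rule_format, OF this]
 have "\<forall>\<^sub>F j in G. \<forall>x\<in>S (p j). f (p j) x < e" .
 with assms(3) show "\<forall>\<^sub>F j in G. dist (f (p j) (x j)) 0 < e"
  by eventually_elim (use assms(4) in \<open>auto simp: dist_real_def\<close>)
qed

text \<open>A point with \<open>f i x\<close> at least \<open>e\<close> is selected at every index
  that has one; if uniformity failed at \<open>e\<close>, this single section would already violate
  the hypothesis.\<close>

lemma U0_I:
 assumes *: "\<And>x. (\<And>i. x i \<in> S i) ==> ((\<lambda>i. f i (x i)) \<longlongrightarrow> 0) F" and ne: "\<And>i. S i \<noteq> {}"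
 shows "U0 F S f"
 unfolding U0_def
proof (intro allI impI)
 fix e :: real assume e: "e > 0"
 define x where "x i = (if \<exists>x\<in>S i. e \<le> f i x then SOME x. x \<in> S i \<and> e \<le> f i x else SOME x. x \<in> S i)" for i
 have 1: "x i \<in> S i \<and> e \<le> f i (x i)" if "\<exists>x\<in>S i. e \<le> f i x" for i
  using someI_ex[of "\<lambda>x. x \<in> S i \<and> e \<le> f i x"] that by (auto simp: x_def)
 have "x i \<in> S i" for i
 proof (cases "\<exists>x\<in>S i. e \<le> f i x")
  case False
  then show ?thesis using ne[of i] by (simp add: x_def some_in_eq)
 qed (use 1 in blast)
 then have "((\<lambda>i. f i (x i)) \<longlongrightarrow> 0) F" using * by blast
 then have "\<forall>\<^sub>F i in F. f i (x i) < e" using e order_tendstoD(2) by blast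
 then show "\<forall>\<^sub>F i in F. \<forall>x\<in>S i. f i x < e"
  by (rule eventually_mono) (use 1 in \<open>meson leD le_less_linear\<close>)
qed

lemma C0_seq:
 assumes "C0 F S g f" "filterlim p F G" "\<forall>\<^sub>F j in G. x j \<in> S (p j)" "\<And>i x. 0 \<le> f i x"
  "((\<lambda>j. g (p j) (x j)) \<longlongrightarrow> 0) G"
 shows "((\<lambda>j. f (p j) (x j)) \<longlongrightarrow> 0) G"
proof (rule tendstoI)
 fix e :: real assume "e > 0"
 then obtain d where d: "d > 0" "\<forall>\<^sub>F i in F. \<forall>x\<in>S i. g i x < d \<longrightarrow> f i x < e" using assms(1) by (auto simp: C0_def)
 from filterlim_iff[THEN iffD1, OF assms(2), rule_format, OF d(2)]
 have "\<forall>\<^sub>F j in G. \<forall>x\<in>S (p j). g (p j) x < d \<longrightarrow> f (p j) x < e" .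
 moreover have "\<forall>\<^sub>F j in G. g (p j) (x j) < d" using assms(5) d(1) order_tendstoD(2) by blast
 ultimately show "\<forall>\<^sub>F j in G. dist (f (p j) (x j)) 0 < e"
  using assms(3) by eventually_elim (use assms(4) in \<open>auto simp: dist_real_def\<close>)
qed

definition CF :: "'i filter => ('i => 'x set) => ('i => 'x => real) => ('i \<times> 'x) filter" where
 "CF F S g = inf (filtercomap fst F) (inf (principal {(i, x). x \<in> S i}) (filtercomap (\<lambda>(i, x). g i x) (nhds 0)))"

lemma CF_fst: "filterlim fst F (CF F S g)"
 unfolding CF_def filterlim_iff_le_filtercomap by simp

lemma CF_S: "\<forall>\<^sub>F j in CF F S g. snd j \<in> S (fst j)"
proof -
 have "\<forall>\<^sub>F j in principal {(i, x). x \<in> S i}. snd j \<in> S (fst j)" by (auto simp: eventually_principal)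
 then show ?thesis unfolding CF_def by (rule filter_leD[rotated]) (simp add: le_infI1 le_infI2)
qed

lemma CF_g: "((\<lambda>j. g (fst j) (snd j)) \<longlongrightarrow> 0) (CF F S g)"
 unfolding CF_def filterlim_iff_le_filtercomap by (simp add: case_prod_unfold le_infI2)

text \<open>A conditional uniform estimate is a limit along the filter of pairs \<open>(i, x)\<close> with \<open>x \<in> S i\<close>
 and \<open>g i x\<close> tending to 0; this lets such estimates be handled by the same calculus as sequences.\<close>

lemma C0_I:
 assumes lim: "((\<lambda>j. f (fst j) (snd j)) \<longlongrightarrow> 0) (CF F S g)" and g: "\<And>i x. 0 \<le> g i x"
 shows "C0 F S g f"
 unfolding C0_def
proof (intro allI impI)
 fix e :: real assume "e > 0"
 then have "\<forall>\<^sub>F j in CF F S g. f (fst j) (snd j) < e" using lim order_tendstoD(2) by blast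
 then obtain A B C where ABC: "eventually A (filtercomap fst F)"
   "eventually B (principal {(i, x). x \<in> S i})" "eventually C (filtercomap (\<lambda>(i, x). g i x) (nhds 0))"
   "\<And>j. A j ==> B j ==> C j ==> f (fst j) (snd j) < e"
  unfolding CF_def eventually_inf by meson
 obtain A' where A': "eventually A' F" "\<And>j. A' (fst j) ==> A j" using ABC(1) by (auto simp: eventually_filtercomap)
 obtain C' where C': "eventually C' (nhds (0::real))" "\<And>j. C' (g (fst j) (snd j)) ==> C j"
  using ABC(3) by (auto simp: eventually_filtercomap case_prod_unfold)
 obtain d where d: "d > 0" "\<And>y. dist y 0 < d ==> C' y" using C'(1) by (auto simp: eventually_nhds_metric)
 have "\<forall>\<^sub>F i in F. \<forall>x\<in>S i. g i x < d \<longrightarrow> f i x < e"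
  using A'(1)
 proof (rule eventually_mono, intro ballI impI)
  fix i x assume "A' i" "x \<in> S i" "g i x < d"
  then show "f i x < e"
   using ABC(4)[of "(i, x)"] A'(2)[of "(i, x)"] C'(2)[of "(i, x)"] d(2)[of "g i x"] g[of i x] ABC(2)
   by (auto simp: eventually_principal dist_real_def)
 qed
 then show "\<exists>r>0. \<forall>\<^sub>F i in F. \<forall>x\<in>S i. g i x < r \<longrightarrow> f i x < e" using d(1) by blast
qed

lemma eventually_reindex: "filterlim p F G ==> eventually P F ==> \<forall>\<^sub>F j in G. P (p j)"
 by (simp add: filterlim_iff)

lemma U0_reindex: "U0 F S f ==> filterlim p F G ==> U0 G (\<lambda>j. S (p j)) (\<lambda>j. f (p j))"
 unfolding U0_def using eventually_reindex[of p F G "\<lambda>i. \<forall>x\<in>S i. f i x < e" for e] by simp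

lemma C0_reindex:
 assumes "C0 F S g f" "filterlim p F G"
 shows "C0 G (\<lambda>j. S (p j)) (\<lambda>j. g (p j)) (\<lambda>j. f (p j))"
 unfolding C0_def
proof (intro allI impI)
 fix e :: real assume "e > 0"
 then obtain d where d: "d > 0" "\<forall>\<^sub>F i in F. \<forall>x\<in>S i. g i x < d \<longrightarrow> f i x < e"
  using assms(1) unfolding C0_def by auto
 show "\<exists>d>0. \<forall>\<^sub>F j in G. \<forall>x\<in>S (p j). g (p j) x < d \<longrightarrow> f (p j) x < e"
  using d(1) eventually_reindex[OF assms(2) d(2)] by blast
qed

declare UU_csc [simp]

section \<open>Asymptotic embeddings and their calculus\<close>

text \<open>An asymptotic embedding of unitary groups: multiplicative up to a uniform o(1), and
  uniformly continuous in both directions in the same sense. At a single index it is only a map of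
  sets from unitaries to unitaries.\<close>

definition amap :: "'i filter => ('i => nat) => ('i => nat) => ('i => fmat => fmat) => bool" where
 "amap F k l h \<longleftrightarrow> (\<forall>i. \<forall>u\<in>UU (k i). h i u \<in> UU (l i)) \<and>
   U0 F (\<lambda>i. UU (k i) \<times> UU (k i)) (\<lambda>i p. nn (l i) (h i (fst p * snd p) - h i (fst p) * h i (snd p))) \<and>
   C0 F (\<lambda>i. UU (k i) \<times> UU (k i)) (\<lambda>i p. nn (k i) (fst p - snd p)) (\<lambda>i p. nn (l i) (h i (fst p) - h i (snd p))) \<and>
   C0 F (\<lambda>i. UU (k i) \<times> UU (k i)) (\<lambda>i p. nn (l i) (h i (fst p) - h i (snd p))) (\<lambda>i p. nn (k i) (fst p - snd p))"

text \<open>This compatibility with phases is what excludes entrywise complex conjugation;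
  \<open>conj_fix\<close> secures it.\<close>

definition acent :: "'i filter => ('i => nat) => ('i => nat) => ('i => fmat => fmat) => bool" where
 "acent F k l h \<longleftrightarrow> U0 F (\<lambda>i. {c. cmod c = 1} \<times> UU (k i))
   (\<lambda>i p. nn (l i) (h i (csc (fst p) (snd p)) - csc (fst p) (h i (snd p))))"

definition anear :: "'i filter => ('i => nat) => ('i => nat) => ('i => fmat => fmat) => ('i => fmat => fmat) => bool" where
 "anear F k l h g \<longleftrightarrow> U0 F (\<lambda>i. UU (k i)) (\<lambda>i u. nn (l i) (h i u - g i u))"

lemma anear_seq:
 assumes "anear F k l h g" "filterlim p F G" "\<forall>\<^sub>F j in G. u j \<in> UU (k (p j))"
 shows "aeq G (\<lambda>j. l (p j)) (\<lambda>j. h (p j) (u j)) (\<lambda>j. g (p j) (u j))"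
 using U0_seq[OF assms(1)[unfolded anear_def] assms(2,3)] by (simp add: aeq_def)

lemma anear_I:
 assumes "\<And>u. (\<And>i. u i \<in> UU (k i)) ==> aeq F l (\<lambda>i. h i (u i)) (\<lambda>i. g i (u i))"
 shows "anear F k l h g"
 unfolding anear_def by (rule U0_I) (use assms UU_fid in \<open>auto simp: aeq_def\<close>)

lemma acent_seq:
 assumes "acent F k l h" "filterlim p F G" "\<forall>\<^sub>F j in G. u j \<in> UU (k (p j))" "\<forall>\<^sub>F j in G. cmod (c j) = 1"
 shows "aeq G (\<lambda>j. l (p j)) (\<lambda>j. h (p j) (csc (c j) (u j))) (\<lambda>j. csc (c j) (h (p j) (u j)))"
 using U0_seq[OF assms(1)[unfolded acent_def] assms(2), of "\<lambda>j. (c j, u j)"] eventually_conj[OF assms(3,4)]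
 by (simp add: aeq_def eventually_conj_iff conj_commute)

lemma acent_I:
 assumes "\<And>c u. (\<And>i. cmod (c i) = 1) ==> (\<And>i. u i \<in> UU (k i)) ==>
  aeq F l (\<lambda>i. h i (csc (c i) (u i))) (\<lambda>i. csc (c i) (h i (u i)))"
 shows "acent F k l h"
 unfolding acent_def
proof (rule U0_I)
 fix x assume *: "\<And>i. x i \<in> {c. cmod c = 1} \<times> UU (k i)"
 have "aeq F l (\<lambda>i. h i (csc (fst (x i)) (snd (x i)))) (\<lambda>i. csc (fst (x i)) (h i (snd (x i))))"
  by (rule assms) (use * in \<open>auto simp: mem_Times_iff\<close>)
 then show "((\<lambda>i. nn (l i) (h i (csc (fst (x i)) (snd (x i))) - csc (fst (x i)) (h i (snd (x i))))) \<longlongrightarrow> 0) F"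
  by (simp add: aeq_def)
next
 fix i show "{c. cmod c = 1} \<times> UU (k i) \<noteq> {}"
  using UU_fid[of "k i"] norm_one by blast
qed

context
 fixes F :: "'i filter" and k l h
 assumes A: "amap F k l h"
begin

lemma amap_maps: "u \<in> UU (k i) ==> h i u \<in> UU (l i)"
 using A by (simp add: amap_def)

lemma amap_UU: "\<forall>\<^sub>F j in G. u j \<in> UU (k (p j)) ==> \<forall>\<^sub>F j in G. h (p j) (u j) \<in> UU (l (p j))"
 by (erule eventually_mono) (rule amap_maps)

lemma amap_con: "\<forall>\<^sub>F j in G. u j \<in> UU (k (p j)) ==> \<forall>\<^sub>F j in G. con (h (p j) (u j))"
 by (erule eventually_mono) (use amap_maps in blast)

lemma amap_mult:
 assumes "filterlim p F G" "\<forall>\<^sub>F j in G. u j \<in> UU (k (p j))" "\<forall>\<^sub>F j in G. v j \<in> UU (k (p j))"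
 shows "aeq G (\<lambda>j. l (p j)) (\<lambda>j. h (p j) (u j * v j)) (\<lambda>j. h (p j) (u j) * h (p j) (v j))"
proof -
 have "U0 F (\<lambda>i. UU (k i) \<times> UU (k i)) (\<lambda>i p. nn (l i) (h i (fst p * snd p) - h i (fst p) * h i (snd p)))"
  using A by (simp add: amap_def)
 from U0_seq[OF this assms(1), of "\<lambda>j. (u j, v j)"] assms(2,3) show ?thesis
  by (simp add: aeq_def eventually_conj_iff)
qed

lemma amap_cont:
 assumes "filterlim p F G" "\<forall>\<^sub>F j in G. u j \<in> UU (k (p j))" "\<forall>\<^sub>F j in G. v j \<in> UU (k (p j))"
  "aeq G (\<lambda>j. k (p j)) u v"
 shows "aeq G (\<lambda>j. l (p j)) (\<lambda>j. h (p j) (u j)) (\<lambda>j. h (p j) (v j))"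
proof -
 have "C0 F (\<lambda>i. UU (k i) \<times> UU (k i)) (\<lambda>i p. nn (k i) (fst p - snd p)) (\<lambda>i p. nn (l i) (h i (fst p) - h i (snd p)))"
  using A by (simp add: amap_def)
 from C0_seq[OF this assms(1), of "\<lambda>j. (u j, v j)"] assms(2-) show ?thesis
  by (simp add: aeq_def eventually_conj_iff)
qed

lemma amap_inj:
 assumes "filterlim p F G" "\<forall>\<^sub>F j in G. u j \<in> UU (k (p j))" "\<forall>\<^sub>F j in G. v j \<in> UU (k (p j))"
  "aeq G (\<lambda>j. l (p j)) (\<lambda>j. h (p j) (u j)) (\<lambda>j. h (p j) (v j))"
 shows "aeq G (\<lambda>j. k (p j)) u v"
proof -
 have "C0 F (\<lambda>i. UU (k i) \<times> UU (k i)) (\<lambda>i p. nn (l i) (h i (fst p) - h i (snd p))) (\<lambda>i p. nn (k i) (fst p - snd p))"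
  using A by (simp add: amap_def)
 from C0_seq[OF this assms(1), of "\<lambda>j. (u j, v j)"] assms(2-) show ?thesis
  by (simp add: aeq_def eventually_conj_iff)
qed

lemma amap_reindex: "filterlim p F G ==> amap G (\<lambda>j. k (p j)) (\<lambda>j. l (p j)) (\<lambda>j. h (p j))"
 using A unfolding amap_def by (auto intro: U0_reindex C0_reindex)

text \<open>The image of 1 is almost equal to its own square, and a unitary factor can be
  cancelled.\<close>

lemma amap_fid:
 assumes p: "filterlim p F G"
 shows "aeq G (\<lambda>j. l (p j)) (\<lambda>j. h (p j) (fid (k (p j)))) (\<lambda>j. fid (l (p j)))"
proof -
 let ?f = "\<lambda>j. h (p j) (fid (k (p j)))"
 have U: "?f j \<in> UU (l (p j))" for j by (rule amap_maps) simp
 have "aeq G (\<lambda>j. l (p j)) (\<lambda>j. h (p j) (fid (k (p j)) * fid (k (p j)))) (\<lambda>j. ?f j * ?f j)"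
  by (rule amap_mult[OF p]) auto
 then have "aeq G (\<lambda>j. l (p j)) ?f (\<lambda>j. ?f j * ?f j)" by simp
 then have "aeq G (\<lambda>j. l (p j)) (\<lambda>j. adj (?f j) * ?f j) (\<lambda>j. adj (?f j) * (?f j * ?f j))"
  by (rule aeq_left) (use U in \<open>auto intro!: always_eventually\<close>)
 then show ?thesis using U by (simp add: UU_D[OF U] UU_canc(1)[OF U] aeq_sym)
qed

lemma amap_adj:
 assumes p: "filterlim p F G" and u: "\<forall>\<^sub>F j in G. u j \<in> UU (k (p j))"
 shows "aeq G (\<lambda>j. l (p j)) (\<lambda>j. h (p j) (adj (u j))) (\<lambda>j. adj (h (p j) (u j)))"
proof -
 let ?f = "\<lambda>j. h (p j) (u j)" and ?g = "\<lambda>j. h (p j) (adj (u j))"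
 have u': "\<forall>\<^sub>F j in G. adj (u j) \<in> UU (k (p j))" using u by (rule eventually_mono) auto
 have "aeq G (\<lambda>j. l (p j)) (\<lambda>j. h (p j) (u j * adj (u j))) (\<lambda>j. ?f j * ?g j)"
  by (rule amap_mult[OF p u u'])
 from aeq_sym[OF this]
 have "aeq G (\<lambda>j. l (p j)) (\<lambda>j. ?f j * ?g j) (\<lambda>j. h (p j) (fid (k (p j))))"
  by (rule aeq_trans[OF _ aeq_ev_eq]) (use u in \<open>rule eventually_mono; simp add: UU_D\<close>)
 also note amap_fid[OF p]
 finally have r1: "aeq G (\<lambda>j. l (p j)) (\<lambda>j. adj (?f j) * (?f j * ?g j)) (\<lambda>j. adj (?f j) * fid (l (p j)))"
  by (rule aeq_left) (use amap_UU[OF u] in \<open>rule eventually_mono; blast\<close>)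
 have r2: "aeq G (\<lambda>j. l (p j)) (\<lambda>j. adj (?f j) * (?f j * ?g j)) ?g"
  by (rule aeq_ev_eq, use amap_UU[OF u] amap_UU[OF u'] in eventually_elim) (simp add: UU_canc)
 have r3: "aeq G (\<lambda>j. l (p j)) (\<lambda>j. adj (?f j) * fid (l (p j))) (\<lambda>j. adj (?f j))"
  by (rule aeq_ev_eq, use amap_UU[OF u] in eventually_elim) simp
 from aeq_sandwich'[OF r2 r3 r1] show ?thesis .
qed

end

text \<open>The filters \<open>G\<close> live on triples because the conditional estimates are
  tested along the filter \<open>CF\<close> of an index together with a pair of points.\<close>

lemma amap_I:
 fixes F :: "'i filter"
 assumes maps: "\<And>i u. u \<in> UU (k i) ==> t i u \<in> UU (l i)"
  and mult: "\<And>u v. (\<And>i. u i \<in> UU (k i)) ==> (\<And>i. v i \<in> UU (k i)) ==>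
   aeq F l (\<lambda>i. t i (u i * v i)) (\<lambda>i. t i (u i) * t i (v i))"
  and cont: "\<And>(G :: ('i \<times> fmat \<times> fmat) filter) u v. filterlim fst F G ==>
   \<forall>\<^sub>F j in G. u j \<in> UU (k (fst j)) ==> \<forall>\<^sub>F j in G. v j \<in> UU (k (fst j)) ==>
   aeq G (\<lambda>j. k (fst j)) u v ==> aeq G (\<lambda>j. l (fst j)) (\<lambda>j. t (fst j) (u j)) (\<lambda>j. t (fst j) (v j))"
  and inj: "\<And>(G :: ('i \<times> fmat \<times> fmat) filter) u v. filterlim fst F G ==>
   \<forall>\<^sub>F j in G. u j \<in> UU (k (fst j)) ==> \<forall>\<^sub>F j in G. v j \<in> UU (k (fst j)) ==>
   aeq G (\<lambda>j. l (fst j)) (\<lambda>j. t (fst j) (u j)) (\<lambda>j. t (fst j) (v j)) ==> aeq G (\<lambda>j. k (fst j)) u v"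
 shows "amap F k l t"
 unfolding amap_def
proof (intro conjI allI ballI)
 show "U0 F (\<lambda>i. UU (k i) \<times> UU (k i)) (\<lambda>i p. nn (l i) (t i (fst p * snd p) - t i (fst p) * t i (snd p)))"
 proof (rule U0_I)
  fix x assume *: "\<And>i. x i \<in> UU (k i) \<times> UU (k i)"
  have "aeq F l (\<lambda>i. t i (fst (x i) * snd (x i))) (\<lambda>i. t i (fst (x i)) * t i (snd (x i)))"
   by (rule mult) (use * in \<open>auto simp: mem_Times_iff\<close>)
  then show "((\<lambda>i. nn (l i) (t i (fst (x i) * snd (x i)) - t i (fst (x i)) * t i (snd (x i)))) \<longlongrightarrow> 0) F"
   by (simp add: aeq_def)
 qed (use UU_fid in blast)
 let ?S = "\<lambda>i. UU (k i) \<times> UU (k i)"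
 let ?g = "\<lambda>i p. nn (k i) (fst p - snd p)" and ?f = "\<lambda>i p. nn (l i) (t i (fst p) - t i (snd p))"
 have mem: "\<forall>\<^sub>F j in CF F ?S h. fst (snd j) \<in> UU (k (fst j))" "\<forall>\<^sub>F j in CF F ?S h. snd (snd j) \<in> UU (k (fst j))" for h
  by (rule eventually_mono[OF CF_S[where F = F and S = ?S]]; force)+
 show "C0 F ?S ?g ?f"
  by (rule C0_I) (use cont[OF CF_fst mem] CF_g[of ?g F ?S] in \<open>auto simp: aeq_def\<close>)
 show "C0 F ?S ?f ?g"
  by (rule C0_I) (use inj[OF CF_fst mem] CF_g[of ?f F ?S] in \<open>auto simp: aeq_def\<close>)
qed (rule maps)

lemma amap_comp:
 assumes A: "amap F k l h" and B: "amap F l m g"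
 shows "amap F k m (\<lambda>i u. g i (h i u))"
proof (rule amap_I)
 fix u v assume uv: "\<And>i. u i \<in> UU (k i)" "\<And>i. v i \<in> UU (k i)"
 note id = filterlim_ident[of F]
 have "aeq F m (\<lambda>i. g i (h i (u i * v i))) (\<lambda>i. g i (h i (u i) * h i (v i)))"
  by (rule amap_cont[OF B id _ _ amap_mult[OF A id]]) (use uv amap_maps[OF A] in auto)
 also have "aeq F m \<dots> (\<lambda>i. g i (h i (u i)) * g i (h i (v i)))"
  by (rule amap_mult[OF B id]) (use uv amap_maps[OF A] in auto)
 finally show "aeq F m (\<lambda>i. g i (h i (u i * v i))) (\<lambda>i. g i (h i (u i)) * g i (h i (v i)))" .
next
 fix G :: "('a \<times> fmat \<times> fmat) filter" and u v
 assume G: "filterlim fst F G" "\<forall>\<^sub>F j in G. u j \<in> UU (k (fst j))" "\<forall>\<^sub>F j in G. v j \<in> UU (k (fst j))"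
 note mem = amap_UU[OF A G(2)] amap_UU[OF A G(3)]
 show "aeq G (\<lambda>j. m (fst j)) (\<lambda>j. g (fst j) (h (fst j) (u j))) (\<lambda>j. g (fst j) (h (fst j) (v j)))"
  if "aeq G (\<lambda>j. k (fst j)) u v"
  by (rule amap_cont[OF B G(1) mem amap_cont[OF A G that]])
 show "aeq G (\<lambda>j. k (fst j)) u v"
  if "aeq G (\<lambda>j. m (fst j)) (\<lambda>j. g (fst j) (h (fst j) (u j))) (\<lambda>j. g (fst j) (h (fst j) (v j)))"
  by (rule amap_inj[OF A G amap_inj[OF B G(1) mem that]])
qed (use amap_maps[OF A] amap_maps[OF B] in blast)

text \<open>Meant for maps found pointwise by choice, such as quasi-inverses and reductions to a
  tensor factor: the properties of \<open>h\<close> pull back through the embedding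
  \<open>j\<close>, whichever values were chosen.\<close>

lemma amap_pull:
 assumes A: "amap F k l h" and B: "amap F l1 l j" and maps: "\<And>i u. u \<in> UU (k i) ==> g i u \<in> UU (l1 i)"
  and N: "anear F k l (\<lambda>i u. j i (g i u)) h"
 shows "amap F k l1 g"
proof (rule amap_I)
 fix u v assume uv: "\<And>i. u i \<in> UU (k i)" "\<And>i. v i \<in> UU (k i)"
 note id = filterlim_ident[of F]
 show "aeq F l1 (\<lambda>i. g i (u i * v i)) (\<lambda>i. g i (u i) * g i (v i))"
 proof (rule amap_inj[OF B id])
  have "aeq F l (\<lambda>i. j i (g i (u i * v i))) (\<lambda>i. h i (u i * v i))"
   by (rule anear_seq[OF N id]) (use uv in auto)
  also have "aeq F l \<dots> (\<lambda>i. h i (u i) * h i (v i))"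
   by (rule amap_mult[OF A id]) (use uv in auto)
  also have "aeq F l \<dots> (\<lambda>i. j i (g i (u i)) * j i (g i (v i)))"
   by (rule aeq_sym, rule aeq_mult[OF anear_seq[OF N id] anear_seq[OF N id]])
    (use uv con_UU[OF amap_maps[OF A uv(1)]] con_UU[OF amap_maps[OF B maps[OF uv(2)]]] in auto)
  also have "aeq F l \<dots> (\<lambda>i. j i (g i (u i) * g i (v i)))"
   by (rule aeq_sym, rule amap_mult[OF B id]) (use uv maps in auto)
  finally show "aeq F l (\<lambda>i. j i (g i (u i * v i))) (\<lambda>i. j i (g i (u i) * g i (v i)))" .
 qed (use uv maps in auto)
next
 fix G :: "('a \<times> fmat \<times> fmat) filter" and u v
 assume G: "filterlim fst F G" "\<forall>\<^sub>F j in G. u j \<in> UU (k (fst j))" "\<forall>\<^sub>F j in G. v j \<in> UU (k (fst j))"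
 have mem: "\<forall>\<^sub>F j in G. g (fst j) (u j) \<in> UU (l1 (fst j))" "\<forall>\<^sub>F j in G. g (fst j) (v j) \<in> UU (l1 (fst j))"
  by (rule eventually_mono[OF G(2)], erule maps) (rule eventually_mono[OF G(3)], erule maps)
 note n = anear_seq[OF N G(1) G(2)] anear_seq[OF N G(1) G(3)]
 show "aeq G (\<lambda>j. l1 (fst j)) (\<lambda>j. g (fst j) (u j)) (\<lambda>j. g (fst j) (v j))" if "aeq G (\<lambda>j. k (fst j)) u v"
  by (rule amap_inj[OF B G(1) mem], rule aeq_sandwich[OF n], rule amap_cont[OF A G that])
 show "aeq G (\<lambda>j. k (fst j)) u v" if "aeq G (\<lambda>j. l1 (fst j)) (\<lambda>j. g (fst j) (u j)) (\<lambda>j. g (fst j) (v j))"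
  by (rule amap_inj[OF A G], rule aeq_sandwich'[OF n], rule amap_cont[OF B G(1) mem that])
qed (rule maps)

lemma acent_comp:
 fixes F :: "'i filter"
 assumes A: "acent F k l h" "acent F l m g" "amap F k l h" "amap F l m g"
 shows "acent F k m (\<lambda>i u. g i (h i u))"
proof (rule acent_I)
 fix c :: "'i => complex" and u assume uv: "\<And>i. cmod (c i) = 1" "\<And>i. u i \<in> UU (k i)"
 note id = filterlim_ident[of F]
 have "aeq F m (\<lambda>i. g i (h i (csc (c i) (u i)))) (\<lambda>i. g i (csc (c i) (h i (u i))))"
  by (rule amap_cont[OF A(4) id _ _ acent_seq[OF A(1) id]]) (use uv amap_maps[OF A(3)] in auto)
 also have "aeq F m \<dots> (\<lambda>i. csc (c i) (g i (h i (u i))))"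
  by (rule acent_seq[OF A(2) id]) (use uv amap_maps[OF A(3)] in auto)
 finally show "aeq F m (\<lambda>i. g i (h i (csc (c i) (u i)))) (\<lambda>i. csc (c i) (g i (h i (u i))))" .
qed

lemma acent_pull:
 fixes F :: "'i filter"
 assumes A: "acent F k l h" "acent F l1 l j" and B: "amap F l1 l j" and maps: "\<And>i u. u \<in> UU (k i) ==> g i u \<in> UU (l1 i)"
  and N: "anear F k l (\<lambda>i u. j i (g i u)) h"
 shows "acent F k l1 g"
proof (rule acent_I)
 fix c :: "'i => complex" and u assume uv: "\<And>i. cmod (c i) = 1" "\<And>i. u i \<in> UU (k i)"
 note id = filterlim_ident[of F]
 show "aeq F l1 (\<lambda>i. g i (csc (c i) (u i))) (\<lambda>i. csc (c i) (g i (u i)))"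
 proof (rule amap_inj[OF B id])
  have "aeq F l (\<lambda>i. j i (g i (csc (c i) (u i)))) (\<lambda>i. h i (csc (c i) (u i)))"
   by (rule anear_seq[OF N id]) (use uv in auto)
  also have "aeq F l \<dots> (\<lambda>i. csc (c i) (h i (u i)))"
   by (rule acent_seq[OF A(1) id]) (use uv in auto)
  also have "aeq F l \<dots> (\<lambda>i. csc (c i) (j i (g i (u i))))"
   by (rule aeq_sym, rule aeq_csc[OF anear_seq[OF N id]]) (use uv in auto)
  also have "aeq F l \<dots> (\<lambda>i. j i (csc (c i) (g i (u i))))"
   by (rule aeq_sym, rule acent_seq[OF A(2) id]) (use uv maps in auto)
  finally show "aeq F l (\<lambda>i. j i (g i (csc (c i) (u i)))) (\<lambda>i. j i (csc (c i) (g i (u i))))" .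
 qed (use uv maps in auto)
qed

lemma amap_exact:
 assumes "\<And>i u. u \<in> UU (k i) ==> g i u \<in> UU (l i)"
  and "\<And>i u v. u \<in> UU (k i) ==> v \<in> UU (k i) ==> g i (u * v) = g i u * g i v"
  and iso: "\<And>i u v. u \<in> UU (k i) ==> v \<in> UU (k i) ==> nn (l i) (g i u - g i v) = nn (k i) (u - v)"
 shows "amap F k l g"
proof (rule amap_I)
 fix u v assume uv: "\<And>i. u i \<in> UU (k i)" "\<And>i. v i \<in> UU (k i)"
 show "aeq F l (\<lambda>i. g i (u i * v i)) (\<lambda>i. g i (u i) * g i (v i))"
  by (rule aeq_ev_eq) (use uv assms in auto)
next
 fix G :: "('a \<times> fmat \<times> fmat) filter" and u v
 assume G: "\<forall>\<^sub>F j in G. u j \<in> UU (k (fst j))" "\<forall>\<^sub>F j in G. v j \<in> UU (k (fst j))"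
 have "\<forall>\<^sub>F j in G. nn (l (fst j)) (g (fst j) (u j) - g (fst j) (v j)) = nn (k (fst j)) (u j - v j)"
  using G by eventually_elim (rule iso)
 then have "aeq G (\<lambda>j. l (fst j)) (\<lambda>j. g (fst j) (u j)) (\<lambda>j. g (fst j) (v j)) \<longleftrightarrow> aeq G (\<lambda>j. k (fst j)) u v"
  unfolding aeq_def by (rule tendsto_cong)
 then show "aeq G (\<lambda>j. k (fst j)) u v ==> aeq G (\<lambda>j. l (fst j)) (\<lambda>j. g (fst j) (u j)) (\<lambda>j. g (fst j) (v j))"
  "aeq G (\<lambda>j. l (fst j)) (\<lambda>j. g (fst j) (u j)) (\<lambda>j. g (fst j) (v j)) ==> aeq G (\<lambda>j. k (fst j)) u v" by blast+
qed (use assms in auto)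

lemma acent_exact:
 assumes "\<And>i u c. u \<in> UU (k i) ==> cmod c = 1 ==> g i (csc c u) = csc c (g i u)"
 shows "acent F k l g"
 by (rule acent_I, rule aeq_ev_eq) (use assms in auto)

lemma amap_id: "amap F k k (\<lambda>i u. u)" by (rule amap_exact) auto

section \<open>Resizing unitaries\<close>

text \<open>Enlarging is the explicit sum with an identity, as in \<open>updown\<close>; shrinking
  picks some nearby unitary provided by \<open>resize_exists\<close>.\<close>

definition rs :: "nat => nat => fmat => fmat" where
 "rs k l u = (if k \<le> l then u + (fid l - fid k)
   else SOME v. v \<in> UU l \<and> norm (u - v) \<le> 3 * sqrt \<bar>real k - real l\<bar>)"

lemma rs_UU: "u \<in> UU k ==> rs k l u \<in> UU l"
 and rs_near: "u \<in> UU k ==> norm (u - rs k l u) \<le> 3 * sqrt \<bar>real k - real l\<bar>"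
proof -
 assume u: "u \<in> UU k"
 have "rs k l u \<in> UU l \<and> norm (u - rs k l u) \<le> 3 * sqrt \<bar>real k - real l\<bar>"
 proof (cases "k \<le> l")
  case True
  have "norm (fid l - fid k) = sqrt \<bar>real k - real l\<bar>"
   using fid_diff_proj(3)[OF True] True by (simp add: real_sqrt_unique)
  then show ?thesis using UU_extend[OF u True] True by (simp add: rs_def norm_minus_commute)
 next
  case False
  have "\<exists>v. v \<in> UU l \<and> norm (u - v) \<le> 3 * sqrt \<bar>real k - real l\<bar>"
   using resize_exists[OF u, of l] by blast
  from someI_ex[OF this] show ?thesis using False by (simp add: rs_def)
 qed
 then show "rs k l u \<in> UU l" "norm (u - rs k l u) \<le> 3 * sqrt \<bar>real k - real l\<bar>" by auto
qed

definition asim :: "'i filter => ('i => nat) => ('i => nat) => bool" where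
 "asim F k l \<longleftrightarrow> (\<forall>i. 0 < k i \<and> 0 < l i) \<and> ((\<lambda>i. real (k i) / real (l i)) \<longlongrightarrow> 1) F"

lemma asim_sym: "asim F k l ==> asim F l k"
 unfolding asim_def using tendsto_inverse[of "\<lambda>i. real (k i) / real (l i)" 1 F] by simp

lemma asim_le: "asim F k l ==> \<forall>\<^sub>F i in F. 0 < k i \<and> real (k i) \<le> 2 * real (l i)"
proof -
 assume A: "asim F k l"
 then have "\<forall>\<^sub>F i in F. real (k i) / real (l i) < 2" unfolding asim_def using order_tendstoD(2) by fastforce
 then show ?thesis by (rule eventually_mono) (use A in \<open>auto simp: asim_def field_simps\<close>)
qed

lemma asim_aeq: "asim F k l ==> aeq F k X Y \<longleftrightarrow> aeq F l X Y"
 using aeq_scale[OF _ asim_le, of F k X Y l] aeq_scale[OF _ asim_le[OF asim_sym], of F l X Y k] by blast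

lemma asim_reindex: "asim F k l ==> filterlim p F G ==> asim G (\<lambda>j. k (p j)) (\<lambda>j. l (p j))"
 unfolding asim_def using filterlim_compose[of "\<lambda>i. real (k i) / real (l i)" "nhds 1" F p G] by auto

lemma asim_rs:
 assumes A: "asim F k l" and u: "\<forall>\<^sub>F i in F. u i \<in> UU (k i)"
 shows "aeq F l (\<lambda>i. rs (k i) (l i) (u i)) u"
 unfolding aeq_def
proof (rule tendsto_0_le_ev)
 have "((\<lambda>i. 3 * sqrt \<bar>real (k i) / real (l i) - 1\<bar>) \<longlongrightarrow> 3 * sqrt \<bar>1 - 1\<bar>) F"
  using A unfolding asim_def by (intro tendsto_intros) auto
 then show "((\<lambda>i. 3 * sqrt \<bar>real (k i) / real (l i) - 1\<bar>) \<longlongrightarrow> 0) F" by simp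
 show "\<forall>\<^sub>F i in F. 0 \<le> nn (l i) (rs (k i) (l i) (u i) - u i) \<and>
   nn (l i) (rs (k i) (l i) (u i) - u i) \<le> 3 * sqrt \<bar>real (k i) / real (l i) - 1\<bar>"
  using u
 proof eventually_elim
  case (elim i)
  have l: "l i > 0" using A by (simp add: asim_def)
  have "\<bar>real (k i) / real (l i) - 1\<bar> = \<bar>real (k i) - real (l i)\<bar> / real (l i)"
  proof -
   have "real (k i) / real (l i) - 1 = (real (k i) - real (l i)) / real (l i)" using l by (simp add: field_simps)
   then show ?thesis by (simp add: abs_divide)
  qed
  then show ?case using rs_near[OF elim, of "l i"] l
   by (simp add: nn_def norm_minus_commute real_sqrt_divide divide_right_mono)
 qed
qed

lemma amap_rs: assumes A: "asim F k l" shows "amap F k l (\<lambda>i. rs (k i) (l i))"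
proof (rule amap_I)
 fix u v assume uv: "\<And>i. u i \<in> UU (k i)" "\<And>i. v i \<in> UU (k i)"
 have "aeq F l (\<lambda>i. rs (k i) (l i) (u i * v i)) (\<lambda>i. u i * v i)"
  by (rule asim_rs[OF A]) (use uv in auto)
 also have "aeq F l \<dots> (\<lambda>i. rs (k i) (l i) (u i) * rs (k i) (l i) (v i))"
  by (rule aeq_sym, rule aeq_mult[OF asim_rs[OF A] asim_rs[OF A]])
   (use uv con_UU[OF uv(1)] con_UU[OF rs_UU[OF uv(2)]] in auto)
 finally show "aeq F l (\<lambda>i. rs (k i) (l i) (u i * v i)) (\<lambda>i. rs (k i) (l i) (u i) * rs (k i) (l i) (v i))" .
next
 fix G :: "('a \<times> fmat \<times> fmat) filter" and u v
 assume G: "filterlim fst F G" "\<forall>\<^sub>F j in G. u j \<in> UU (k (fst j))" "\<forall>\<^sub>F j in G. v j \<in> UU (k (fst j))"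
 note A' = asim_reindex[OF A G(1)]
 note n = asim_rs[OF A' G(2)] asim_rs[OF A' G(3)]
 show "aeq G (\<lambda>j. k (fst j)) u v ==> aeq G (\<lambda>j. l (fst j)) (\<lambda>j. rs (k (fst j)) (l (fst j)) (u j)) (\<lambda>j. rs (k (fst j)) (l (fst j)) (v j))"
  unfolding asim_aeq[OF A'] by (rule aeq_sandwich[OF n])
 show "aeq G (\<lambda>j. l (fst j)) (\<lambda>j. rs (k (fst j)) (l (fst j)) (u j)) (\<lambda>j. rs (k (fst j)) (l (fst j)) (v j)) ==> aeq G (\<lambda>j. k (fst j)) u v"
  unfolding asim_aeq[OF A'] by (rule aeq_sandwich'[OF n])
qed (rule rs_UU)

lemma acent_rs: fixes F :: "'i filter" assumes A: "asim F k l" shows "acent F k l (\<lambda>i. rs (k i) (l i))"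
proof (rule acent_I)
 fix c :: "'i => complex" and u assume uv: "\<And>i. cmod (c i) = 1" "\<And>i. u i \<in> UU (k i)"
 have "aeq F l (\<lambda>i. rs (k i) (l i) (csc (c i) (u i))) (\<lambda>i. csc (c i) (u i))"
  by (rule asim_rs[OF A]) (use uv in auto)
 also have "aeq F l \<dots> (\<lambda>i. csc (c i) (rs (k i) (l i) (u i)))"
  by (rule aeq_sym, rule aeq_csc[OF asim_rs[OF A]]) (use uv in auto)
 finally show "aeq F l (\<lambda>i. rs (k i) (l i) (csc (c i) (u i))) (\<lambda>i. csc (c i) (rs (k i) (l i) (u i)))" .
qed

text \<open>The quantitative lemmas need one number per index as their error; the supremum over
  \<open>S i\<close>, finite because of \<open>C\<close>, provides it.\<close>

lemma U0_bound:
 assumes U: "U0 F S f" and f: "\<And>i x. x \<in> S i ==> 0 \<le> f i x \<and> f i x \<le> C" and ne: "\<And>i. S i \<noteq> {}"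
 obtains D where "(D \<longlongrightarrow> 0) F" "\<And>i x. x \<in> S i ==> f i x \<le> D i" "\<And>i. 0 \<le> D i"
proof
 define D where "D i = (SUP x\<in>S i. f i x)" for i
 have bdd: "bdd_above (f i ` S i)" for i using f by (intro bdd_aboveI2[of _ _ C]) auto
 show le: "f i x \<le> D i" if "x \<in> S i" for i x
  unfolding D_def by (rule cSUP_upper[OF that bdd])
 show pos: "0 \<le> D i" for i
 proof -
  obtain x where "x \<in> S i" using ne by blast
  then show ?thesis using le[of x i] f[of x i] by linarith
 qed
 show "(D \<longlongrightarrow> 0) F"
 proof (rule tendstoI)
  fix e :: real assume e: "e > 0"
  have "\<forall>\<^sub>F i in F. \<forall>x\<in>S i. f i x < e / 2"
   by (rule U[unfolded U0_def, rule_format]) (use e in simp)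
  then show "\<forall>\<^sub>F i in F. dist (D i) 0 < e"
  proof eventually_elim
   case (elim i)
   then have "D i \<le> e / 2" unfolding D_def using ne[of i] by (intro cSUP_least) (auto intro: less_imp_le)
   then show ?case using e pos[of i] by (simp add: dist_real_def)
  qed
 qed
qed

lemma nn_UU_le: "x \<in> UU k ==> nn k x \<le> 1"
 by (simp add: nn_def norm_UU divide_le_eq_1)

lemma nn_diff_le: "nn k (x - y) \<le> nn k x + nn k y"
 using nn_triangle[of k x "- y"] by (simp add: nn_def)

lemma nn_diff_UU_le: "x \<in> UU k ==> y \<in> UU k ==> nn k (x - y) \<le> 2"
 using nn_diff_le[of k x y] nn_UU_le[of x k] nn_UU_le[of y k] by linarith

lemma U0_bound_nn:
 assumes U: "U0 F S (\<lambda>i x. nn (l i) (f i x - g i x))" and ne: "\<And>i. S i \<noteq> {}"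
  and fg: "\<And>i x. x \<in> S i ==> f i x \<in> UU (l i) \<and> g i x \<in> UU (l i)"
 obtains D where "(D \<longlongrightarrow> 0) F" "\<And>i x. x \<in> S i ==> nn (l i) (f i x - g i x) \<le> D i" "\<And>i. 0 \<le> D i"
proof (rule U0_bound[OF U _ ne])
 show "0 \<le> nn (l i) (f i x - g i x) \<and> nn (l i) (f i x - g i x) \<le> 2" if "x \<in> S i" for i x
  using fg[OF that] nn_diff_UU_le by simp
qed (rule that)

lemma nn_le_iff: "k > 0 ==> nn k x \<le> c \<longleftrightarrow> norm x \<le> c * sqrt k"
 by (simp add: nn_def pos_divide_le_eq)

definition phs :: "fmat set => fmat set" where "phs B = {csc c b | c b. cmod c = 1 \<and> b \<in> B}"

lemma phs_sub: "b \<in> B ==> b \<in> phs B"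
 unfolding phs_def by (auto intro!: exI[of _ 1] exI[of _ b])

text \<open>Left multiplication by \<open>b\<close> permutes the basis up to phases, so some basis
  element \<open>x\<close> satisfies b x = z b, and this \<open>x\<close> is a phase times the
  identity.\<close>

lemma phs_fid: assumes B: "neb n B" shows "fid n \<in> phs B"
proof -
 obtain b where b: "b \<in> B" using neb_ne[OF B] by blast
 obtain z d where zd: "bij_betw d B B" "\<And>x. x \<in> B ==> cmod (z x) = 1" "\<And>x. x \<in> B ==> b * x = csc (z x) (d x)"
  by (rule neb_left[OF B b], rule that)
 have "b \<in> d ` B" using zd(1) b by (simp add: bij_betw_def)
 then obtain x where x: "x \<in> B" "d x = b" by blast
 have U: "b \<in> UU n" "x \<in> UU n" using nebD(3)[OF B] b x by auto
 have "x = adj b * (b * x)" using UU_canc(1)[OF U(1)] U by simp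
 also have "\<dots> = csc (z x) (fid n)" using zd(3)[OF x(1)] x(2) U by (simp add: UU_D)
 finally have xz: "x = csc (z x) (fid n)" .
 have "csc (cnj (z x)) x = csc (cnj (z x) * z x) (fid n)" by (subst xz) simp
 also have "cnj (z x) * z x = 1" using zd(2)[OF x(1)] by (simp add: mult.commute complex_norm_square[symmetric])
 finally show ?thesis unfolding phs_def using x(1) zd(2)[OF x(1)]
  by (auto intro!: exI[of _ "cnj (z x)"] exI[of _ x])
qed

lemma phs_kr: "f \<in> phs A ==> g \<in> phs B ==> m > 0 ==> kr m f g \<in> phs (krset m A B)"
proof -
 assume "f \<in> phs A" "g \<in> phs B" and m: "m > 0"
 then obtain c a d b where "cmod c = 1" "a \<in> A" "f = csc c a" "cmod d = 1" "b \<in> B" "g = csc d b"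
  unfolding phs_def by auto
 then show ?thesis unfolding phs_def krset_def using m
  by (auto simp: kr_csc_left kr_csc_right norm_mult intro!: exI[of _ "d * c"] exI[of _ "kr m a b"])
qed

lemma phs_UU: "neb n B ==> b \<in> phs B ==> b \<in> UU n"
 unfolding phs_def using nebD(3) by auto

lemma amap_defect:
 assumes A: "amap F k l t" and Ce: "acent F k l t" and l: "\<And>i. l i > 0"
 obtains D where "(D \<longlongrightarrow> 0) F" "\<And>i. 0 \<le> D i"
  "\<And>i b c z d. b \<in> UU (k i) ==> c \<in> UU (k i) ==> d \<in> UU (k i) ==> cmod z = 1 ==> b * c = csc z d ==>
   norm (t i b * t i c - csc z (t i d)) \<le> D i * sqrt (l i)"
proof -
 have U1: "U0 F (\<lambda>i. UU (k i) \<times> UU (k i)) (\<lambda>i p. nn (l i) (t i (fst p * snd p) - t i (fst p) * t i (snd p)))"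
  using A by (simp add: amap_def)
 obtain D1 where D1: "(D1 \<longlongrightarrow> 0) F" "\<And>i x. x \<in> UU (k i) \<times> UU (k i) ==>
   nn (l i) (t i (fst x * snd x) - t i (fst x) * t i (snd x)) \<le> D1 i" "\<And>i. 0 \<le> D1 i"
 proof (rule U0_bound_nn[OF U1])
  fix i show "UU (k i) \<times> UU (k i) \<noteq> {}" using UU_fid[of "k i"] by blast
 qed (use amap_maps[OF A] in \<open>auto intro!: that\<close>)
 obtain D2 where D2: "(D2 \<longlongrightarrow> 0) F" "\<And>i x. x \<in> {c. cmod c = 1} \<times> UU (k i) ==>
   nn (l i) (t i (csc (fst x) (snd x)) - csc (fst x) (t i (snd x))) \<le> D2 i" "\<And>i. 0 \<le> D2 i"
 proof (rule U0_bound_nn[OF Ce[unfolded acent_def]])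
  fix i show "{c. cmod c = 1} \<times> UU (k i) \<noteq> {}" using UU_fid[of "k i"] norm_one by blast
 qed (use amap_maps[OF A] in \<open>auto intro!: that\<close>)
 show ?thesis
 proof (rule that[of "\<lambda>i. D1 i + D2 i"])
  show "((\<lambda>i. D1 i + D2 i) \<longlongrightarrow> 0) F" by (rule tendsto_add_zero[OF D1(1) D2(1)])
  show "0 \<le> D1 i + D2 i" for i using D1(3) D2(3) by simp
  fix i b c z d assume h: "b \<in> UU (k i)" "c \<in> UU (k i)" "d \<in> UU (k i)" "cmod z = 1" "b * c = csc z d"
  have "nn (l i) (t i b * t i c - csc z (t i d)) \<le> nn (l i) (t i b * t i c - t i (b * c)) + nn (l i) (t i (csc z d) - csc z (t i d))"
   unfolding h(5) by (rule nn_diff_triangle)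
  also have "\<dots> \<le> D1 i + D2 i"
   using D1(2)[of "(b, c)" i] D2(2)[of "(z, d)" i] h by (intro add_mono) (auto simp: nn_commute)
  finally show "norm (t i b * t i c - csc z (t i d)) \<le> (D1 i + D2 i) * sqrt (l i)"
   using l by (simp add: nn_le_iff)
 qed
qed

section \<open>Anchoring on a basis and reduction to a tensor factor\<close>

theorem anchor:
 assumes A: "amap F k k h" and Ce: "acent F k k h" and B: "\<And>i. neb (k i) (B i)"
 obtains W where "\<And>i. W i \<in> UU (k i)"
  "\<And>b. (\<And>i. b i \<in> phs (B i)) ==> aeq F k (\<lambda>i. h i (b i) * W i) (\<lambda>i. W i * b i)"
proof -
 have kp: "k i > 0" for i using nebD(1)[OF B] .
 obtain D where D: "(D \<longlongrightarrow> 0) F" and D0: "\<And>i. 0 \<le> D i" and def: "\<And>i b c z d. b \<in> UU (k i) ==> c \<in> UU (k i) ==>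
  d \<in> UU (k i) ==> cmod z = 1 ==> b * c = csc z d ==> norm (h i b * h i c - csc z (h i d)) \<le> D i * sqrt (k i)"
  by (rule amap_defect[OF A Ce kp], rule that)
 \<comment> \<open>\<open>W\<close> must serve all basis elements of an index at once, so it is
   chosen from the uniform defect \<open>D i\<close>. Where \<open>D i\<close> exceeds 1, which
   eventually does not happen, the default is the identity.\<close>
 have ex: "\<exists>W\<in>UU (k i). D i \<le> 1 \<longrightarrow> (\<forall>c\<in>B i. norm (h i c * W - W * c) \<le> 13 * sqrt (D i) * sqrt (k i))" for i
 proof (cases "D i \<le> 1")
  case True
  obtain W where W: "W \<in> UU (k i)" "\<And>c. c \<in> B i ==> norm (h i c * W - W * c) \<le> 13 * sqrt (D i) * sqrt (k i)"
  proof (rule anchor_unitary[OF B[of i], of "h i" "D i"])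
   show "h i b \<in> UU (k i)" if "b \<in> B i" for b using amap_maps[OF A] nebD(3)[OF B that] by blast
   show "0 \<le> D i" "D i \<le> 1" using D0 True by auto
   show "norm (h i b * h i c - csc z (h i d)) \<le> D i * sqrt (k i)"
    if "b \<in> B i" "c \<in> B i" "d \<in> B i" "cmod z = 1" "b * c = csc z d" for b c z d
    using that nebD(3)[OF B] by (intro def)
  qed (rule that)
  then show ?thesis by blast
 qed (use UU_fid in blast)
 then obtain W where W: "\<And>i. W i \<in> UU (k i)"
  "\<And>i c. D i \<le> 1 ==> c \<in> B i ==> norm (h i c * W i - W i * c) \<le> 13 * sqrt (D i) * sqrt (k i)" by metis
 show ?thesis
 proof (rule that[OF W(1)])
  fix b assume b: "\<And>i. b i \<in> phs (B i)"
  then have "\<forall>i. \<exists>c d. cmod c = 1 \<and> d \<in> B i \<and> b i = csc c d" unfolding phs_def by blast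
  then obtain c d where cd: "\<And>i. cmod (c i) = 1" "\<And>i. d i \<in> B i" "\<And>i. b i = csc (c i) (d i)" by metis
  have dU: "d i \<in> UU (k i)" for i using nebD(3)[OF B cd(2)] .
  have "aeq F k (\<lambda>i. h i (d i) * W i) (\<lambda>i. W i * d i)"
   unfolding aeq_def
  proof (rule tendsto_0_le_ev)
   have "((\<lambda>i. 13 * sqrt (D i)) \<longlongrightarrow> 13 * sqrt 0) F" by (intro tendsto_intros D)
   then show "((\<lambda>i. 13 * sqrt (D i)) \<longlongrightarrow> 0) F" by simp
   have "\<forall>\<^sub>F i in F. D i < 1" by (rule order_tendstoD(2)[OF D]) simp
   then show "\<forall>\<^sub>F i in F. 0 \<le> nn (k i) (h i (d i) * W i - W i * d i) \<and> nn (k i) (h i (d i) * W i - W i * d i) \<le> 13 * sqrt (D i)"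
    by (rule eventually_mono) (use W(2)[OF _ cd(2)] kp in \<open>auto simp: nn_le_iff\<close>)
  qed
  then have e1: "aeq F k (\<lambda>i. csc (c i) (h i (d i) * W i)) (\<lambda>i. csc (c i) (W i * d i))"
   by (rule aeq_csc) (simp add: cd)
  have "aeq F k (\<lambda>i. h i (b i) * W i) (\<lambda>i. csc (c i) (h i (d i)) * W i)"
   unfolding cd(3)
   by (rule aeq_right, rule acent_seq[OF Ce filterlim_ident]) (use cd dU W(1) con_UU[OF W(1)] in auto)
  then show "aeq F k (\<lambda>i. h i (b i) * W i) (\<lambda>i. W i * b i)"
   by (rule aeq_trans) (use e1 in \<open>simp add: cd(3)\<close>)
 qed
qed

theorem self_correct_asym:
 assumes A: "amap F m m h" and B: "\<And>i. neb (m i) (B i)"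
  and an: "\<And>b. (\<And>i. b i \<in> B i) ==> aeq F m (\<lambda>i. h i (b i)) b"
  and cl: "\<forall>\<^sub>F i in F. \<forall>u\<in>UU (m i). nn (m i) (h i u - u) \<le> 1"
 shows "anear F m m h (\<lambda>i u. u)"
 unfolding anear_def U0_def
proof (intro allI impI)
 fix e :: real assume e: "e > 0"
 \<comment> \<open>Chosen so that 34 times its root, the error left by \<open>self_correct\<close>,
   stays below \<open>e\<close>; the cap 1 is the hypothesis there on \<open>r\<close>.\<close>
 define \<epsilon> where "\<epsilon> = min 1 ((e / 35)\<^sup>2)"
 have \<epsilon>: "0 < \<epsilon>" "\<epsilon> \<le> 1" "34 * sqrt \<epsilon> < e"
 proof -
  have "sqrt \<epsilon> \<le> sqrt ((e / 35)\<^sup>2)" unfolding \<epsilon>_def by (intro real_sqrt_le_mono) auto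
  then show "34 * sqrt \<epsilon> < e" using e by simp
 qed (use e in \<open>auto simp: \<epsilon>_def\<close>)
 have mp: "m i > 0" for i using nebD(1)[OF B] .
 have "\<forall>\<^sub>F i in F. \<forall>x\<in>UU (m i) \<times> UU (m i). nn (m i) (h i (fst x * snd x) - h i (fst x) * h i (snd x)) < \<epsilon>"
  using A \<epsilon>(1) unfolding amap_def U0_def by blast
 moreover have "U0 F B (\<lambda>i b. nn (m i) (h i b - b))"
  by (rule U0_I) (use an neb_ne[OF B] in \<open>auto simp: aeq_def\<close>)
 then have "\<forall>\<^sub>F i in F. \<forall>b\<in>B i. nn (m i) (h i b - b) < \<epsilon>" using \<epsilon>(1) unfolding U0_def by blast
 ultimately show "\<forall>\<^sub>F i in F. \<forall>u\<in>UU (m i). nn (m i) (h i u - u) < e"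
  using cl
 proof eventually_elim
  case (elim i)
  show ?case
  proof
   fix v assume v: "v \<in> UU (m i)"
   have "norm (h i v - v) \<le> 34 * sqrt \<epsilon> * sqrt (m i)"
   proof (rule self_correct[OF B[of i] _ \<epsilon>(1,2) _ _ _ v])
    show "h i u \<in> UU (m i)" if "u \<in> UU (m i)" for u using amap_maps[OF A that] .
    fix u w assume uw: "u \<in> UU (m i)" "w \<in> UU (m i)"
    have "nn (m i) (h i (u * w) - h i u * h i w) \<le> \<epsilon>" using elim(1) uw by fastforce
    then show "norm (h i (u * w) - h i u * h i w) \<le> \<epsilon> * sqrt (m i)" using mp by (simp add: nn_le_iff)
   next
    show "norm (h i b - b) \<le> \<epsilon> * sqrt (m i)" if "b \<in> B i" for b
     using elim(2) that nn_le_iff[OF mp] by (meson less_imp_le)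
    show "norm (h i u - u) \<le> sqrt (m i)" if "u \<in> UU (m i)" for u
     using elim(3) that nn_le_iff[OF mp, of i _ 1] by simp
   qed
   then have "nn (m i) (h i v - v) \<le> 34 * sqrt \<epsilon>" using mp by (simp add: nn_le_iff)
   then show "nn (m i) (h i v - v) < e" using \<epsilon>(3) by linarith
  qed
 qed
qed

definition iot :: "nat => nat => fmat => fmat" where "iot q m u = kr m (fid q) u"

lemma iot_UU [intro, simp]: "m > 0 ==> u \<in> UU m ==> iot q m u \<in> UU (q * m)"
 unfolding iot_def by (rule UU_kr) auto

lemma iot_mult: "m > 0 ==> u \<in> MM m ==> iot q m u * iot q m v = iot q m (u * v)"
 unfolding iot_def by (simp add: kr_mult)

lemma iot_diff: "m > 0 ==> iot q m u - iot q m v = iot q m (u - v)"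
 unfolding iot_def by (simp add: kr_diff_right)

lemma iot_csc: "m > 0 ==> iot q m (csc c u) = csc c (iot q m u)"
 unfolding iot_def by (simp add: kr_csc_right)

lemma nn_iot: "m > 0 ==> q > 0 ==> x \<in> MM m ==> nn (q * m) (iot q m x) = nn m x"
 using norm_UU[OF UU_fid[of q]] by (simp add: nn_def iot_def norm_kr real_sqrt_mult)

lemma amap_iot:
 assumes "\<And>i. 0 < q i \<and> 0 < m i"
 shows "amap F m (\<lambda>i. q i * m i) (\<lambda>i. iot (q i) (m i))"
 by (rule amap_exact) (use assms in \<open>auto simp: iot_mult iot_diff nn_iot\<close>)

lemma acent_iot:
 assumes "\<And>i. 0 < q i \<and> 0 < m i"
 shows "acent F m (\<lambda>i. q i * m i) (\<lambda>i. iot (q i) (m i))"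
 by (rule acent_exact) (use assms in \<open>auto simp: iot_csc\<close>)

lemma amap_conj:
 assumes W: "\<And>i. W i \<in> UU (k i)"
 shows "amap F k k (\<lambda>i u. adj (W i) * u * W i)"
proof (rule amap_exact)
 fix i u v assume uv: "u \<in> UU (k i)" "v \<in> UU (k i)"
 have "adj (W i) * u * W i * (adj (W i) * v * W i) = adj (W i) * u * (W i * adj (W i)) * v * W i" by (simp add: mult.assoc)
 then show "adj (W i) * (u * v) * W i = adj (W i) * u * W i * (adj (W i) * v * W i)"
  using uv by (simp add: UU_D(3)[OF W] mult.assoc)
 have "adj (W i) * u * W i - adj (W i) * v * W i = adj (W i) * (u - v) * W i" by (simp add: algebra_simps)
 then show "nn (k i) (adj (W i) * u * W i - adj (W i) * v * W i) = nn (k i) (u - v)"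
  using norm_conj_UU[OF UU_adj[OF W] W, of "u - v"] uv by (simp add: nn_def)
qed (use W in auto)

lemma acent_conj: "acent F k k (\<lambda>i u. adj (W i) * u * W i)"
 by (rule acent_exact) simp

corollary anchor_conj:
 fixes F :: "'i filter"
 assumes A: "amap F k k h" and Ce: "acent F k k h" and B: "\<And>i. neb (k i) (B i)"
 obtains W where "\<And>i. W i \<in> UU (k i)"
  "amap F k k (\<lambda>i u. adj (W i) * h i u * W i)" "acent F k k (\<lambda>i u. adj (W i) * h i u * W i)"
  "\<And>b. (\<And>i. b i \<in> phs (B i)) ==> aeq F k (\<lambda>i. adj (W i) * h i (b i) * W i) b"
proof (rule anchor[OF A Ce B])
 fix W assume W: "\<And>i. W i \<in> UU (k i)"
  "\<And>b. (\<And>i. b i \<in> phs (B i)) ==> aeq F k (\<lambda>i. h i (b i) * W i) (\<lambda>i. W i * b i)"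
 show ?thesis
 proof (rule that[OF W(1)])
  show "amap F k k (\<lambda>i u. adj (W i) * h i u * W i)" by (rule amap_comp[OF A amap_conj[OF W(1)]])
  show "acent F k k (\<lambda>i u. adj (W i) * h i u * W i)"
   by (rule acent_comp[OF Ce acent_conj A amap_conj[OF W(1)]])
  fix b assume b: "\<And>i. b i \<in> phs (B i)"
  have "aeq F k (\<lambda>i. adj (W i) * (h i (b i) * W i)) (\<lambda>i. adj (W i) * (W i * b i))"
   by (rule aeq_left[OF W(2)[OF b]]) (use con_adj[OF con_UU[OF W(1)]] in auto)
  moreover have "adj (W i) * (W i * b i) = b i" for i
   using UU_canc(1)[OF W(1)] phs_UU[OF B b] by simp
  ultimately show "aeq F k (\<lambda>i. adj (W i) * h i (b i) * W i) b" by (simp add: mult.assoc)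
 qed
qed

lemma norm_twirl_term:
 assumes "E \<in> UU k" "X \<in> MM k"
 shows "norm (X - E * X * adj E) = norm (X * E - E * X)"
proof -
 have "X - E * X * adj E = (X * E - E * X) * adj E"
  using assms by (simp add: algebra_simps UU_D)
 then show ?thesis using norm_UU_right[OF UU_adj[OF assms(1)], of "X * E - E * X"] assms by simp
qed

text \<open>The copy of U(m) commutes with the basis of the other factor, which \<open>t\<close>
  fixes up to o(1), so its image almost commutes with that basis. The average over the basis is the
  copy of some \<open>x\<close>, and \<open>near_unitary_kr\<close> replaces \<open>x\<close> by a
  unitary, the value of \<open>\<theta>\<close>. The properties of \<open>\<theta>\<close> then come
  from \<open>amap_pull\<close> and \<open>acent_pull\<close>.\<close>

theorem reduce:
 fixes F :: "'i filter"
 assumes A: "amap F k k t" and Ce: "acent F k k t"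
  and k: "\<And>i. k i = q i * m i" and q: "\<And>i. q i > 0" and G: "\<And>i. neb (m i) (G i)"
  and an: "\<And>b. (\<And>i. b i \<in> phs (krset (m i) (heis (q i)) (G i))) ==> aeq F k (\<lambda>i. t i (b i)) b"
 obtains \<theta> where "amap F m m \<theta>" "acent F m m \<theta>"
  "anear F m k (\<lambda>i u. t i (iot (q i) (m i) u)) (\<lambda>i u. iot (q i) (m i) (\<theta> i u))"
  "\<And>g. (\<And>i. g i \<in> phs (G i)) ==> aeq F m (\<lambda>i. \<theta> i (g i)) g"
proof -
 note m = nebD(1)[OF G]
 have H: "neb (q i) (heis (q i))" for i by (rule neb_heis[OF q])
 have kp: "k i > 0" for i using k q m by simp
 define T where "T i u = t i (iot (q i) (m i) u)" for i u
 have iU: "u \<in> UU (m i) ==> iot (q i) (m i) u \<in> UU (k i)" for i u using m k by simp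
 have TU: "u \<in> UU (m i) ==> T i u \<in> UU (k i)" for i u unfolding T_def by (rule amap_maps[OF A iU])
 have iotA: "amap F m k (\<lambda>i. iot (q i) (m i))" and iotC: "acent F m k (\<lambda>i. iot (q i) (m i))"
  using amap_iot[of q m F] acent_iot[of q m F] m q k by (simp_all add: ext[of k, OF k])
 have TA: "amap F m k T" and TC: "acent F m k T"
  unfolding T_def using amap_comp[OF iotA A] acent_comp[OF iotC Ce iotA A] by (simp_all add: eta_contract_eq)
 define E where "E i f = kr (m i) f (fid (m i))" for i f
 have EU: "f \<in> heis (q i) ==> E i f \<in> UU (k i)" for i f
  unfolding E_def k using nebD(3)[OF H] m by auto
 have U: "U0 F (\<lambda>i. UU (m i) \<times> heis (q i)) (\<lambda>i p. nn (k i) (T i (fst p) * E i (snd p) - E i (snd p) * T i (fst p)))"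
 proof (rule U0_I)
  fix x :: "'i => fmat \<times> fmat" assume x: "\<And>i. x i \<in> UU (m i) \<times> heis (q i)"
  define u f where "u = fst \<circ> x" and "f = snd \<circ> x"
  have u: "u i \<in> UU (m i)" and f: "f i \<in> heis (q i)" for i using x[of i] by (auto simp: u_def f_def)
  let ?E = "\<lambda>i. E i (f i)" and ?I = "\<lambda>i. iot (q i) (m i) (u i)"
  have EA: "aeq F k (\<lambda>i. t i (?E i)) ?E"
  proof (rule an)
   fix i show "?E i \<in> phs (krset (m i) (heis (q i)) (G i))"
    unfolding E_def by (rule phs_kr[OF phs_sub[OF f] phs_fid[OF G] m])
  qed
  have Uev: "\<forall>\<^sub>F i in F. ?E i \<in> UU (k i)" "\<forall>\<^sub>F i in F. ?I i \<in> UU (k i)"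
   using EU[OF f] iU[OF u] by (auto intro!: always_eventually)
  have con: "\<forall>\<^sub>F i in F. con (?E i)" "\<forall>\<^sub>F i in F. con (T i (u i))"
   using con_UU[OF EU[OF f]] con_UU[OF TU[OF u]] by (auto intro!: always_eventually)
  have comm: "?E i * ?I i = ?I i * ?E i" for i
   using u[of i] m[of i] by (simp add: E_def iot_def kr_mult) (metis UU_MM fid_mult(1) fid_mult(2) nebD(3) f H)
  have "aeq F k (\<lambda>i. T i (u i) * ?E i) (\<lambda>i. T i (u i) * t i (?E i))"
   by (rule aeq_left[OF aeq_sym[OF EA] con(2)])
  also have "aeq F k \<dots> (\<lambda>i. t i (?I i * ?E i))"
   unfolding T_def by (rule aeq_sym, rule amap_mult[OF A filterlim_ident Uev(2,1)])
  also have "aeq F k \<dots> (\<lambda>i. t i (?E i) * T i (u i))"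
   unfolding T_def comm[symmetric] by (rule amap_mult[OF A filterlim_ident Uev])
  also have "aeq F k \<dots> (\<lambda>i. ?E i * T i (u i))"
   by (rule aeq_right[OF EA con(2)])
  finally show "((\<lambda>i. nn (k i) (T i (fst (x i)) * E i (snd (x i)) - E i (snd (x i)) * T i (fst (x i)))) \<longlongrightarrow> 0) F"
   by (simp add: aeq_def u_def f_def)
 next
  fix i show "UU (m i) \<times> heis (q i) \<noteq> {}" using UU_fid[of "m i"] neb_ne[OF H[of i]] by blast
 qed
 obtain D where D: "(D \<longlongrightarrow> 0) F"
  "\<And>i p. p \<in> UU (m i) \<times> heis (q i) ==> nn (k i) (T i (fst p) * E i (snd p) - E i (snd p) * T i (fst p)) \<le> D i"
  "\<And>i. 0 \<le> D i"
 proof (rule U0_bound_nn[OF U])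
  fix i show "UU (m i) \<times> heis (q i) \<noteq> {}" using UU_fid[of "m i"] neb_ne[OF H[of i]] by blast
 qed (use EU TU in \<open>auto intro!: that\<close>)
 \<comment> \<open>\<open>D i\<close> is the price of averaging and \<open>sqrt (2 * D i)\<close>
   that of passing to a unitary.\<close>
 define D' where "D' i = D i + sqrt (2 * D i)" for i
 have "((\<lambda>i. D i + sqrt (2 * D i)) \<longlongrightarrow> 0 + sqrt (2 * 0)) F" by (intro tendsto_intros D(1))
 then have D': "(D' \<longlongrightarrow> 0) F" by (simp add: D'_def[abs_def])
 have ex: "\<exists>y. y \<in> UU (m i) \<and> nn (k i) (iot (q i) (m i) y - T i u) \<le> D' i" if u: "u \<in> UU (m i)" for i u
 proof -
  let ?X = "T i u" and ?B = "heis (q i)"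
  have XM: "?X \<in> UU (q i * m i)" using TU[OF u] k by simp
  obtain x where x: "x \<in> MM (m i)" "(\<Sum>f\<in>?B. E i f * ?X * adj (E i f)) = kr (m i) (fid (q i)) x"
   unfolding E_def by (rule twirl_outer[OF H _ m, of ?X]) (use XM in auto)
  let ?c = "1 / real (card ?B)"
  have fin: "finite ?B" "?B \<noteq> {}" using nebD(2)[OF H] neb_ne[OF H] by auto
  define Y where "Y = kr (m i) (fid (q i)) (csc (of_real ?c) x)"
  have Y: "Y = ?c *\<^sub>R (\<Sum>f\<in>?B. E i f * ?X * adj (E i f))"
   unfolding Y_def x(2) by (simp add: kr_csc_right[OF m] scaleR_csc)
  have YK: "Y \<in> KK (q i * m i)"
  proof -
   have "E i f * ?X * adj (E i f) \<in> KK (q i * m i)" if "f \<in> ?B" for f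
    using EU[OF that] XM unfolding k by (blast intro: UU_KK UU_mult UU_adj)
   then have "(\<Sum>f\<in>?B. ?c *\<^sub>R (E i f * ?X * adj (E i f))) \<in> KK (q i * m i)"
    using fin by (intro convex_sum KK_convex) auto
   then show ?thesis unfolding Y by (simp add: scaleR_sum_right)
  qed
  have "norm (?X - E i f * ?X * adj (E i f)) \<le> D i * sqrt (k i)" if "f \<in> ?B" for f
   using D(2)[of "(u, f)" i] that u norm_twirl_term[OF EU[OF that], of ?X] TU[OF u] nn_le_iff[OF kp]
   by auto
  then have XY: "norm (?X - Y) \<le> D i * sqrt (k i)" unfolding Y by (rule avg_near[OF fin])
  obtain y where y: "y \<in> UU (m i)"
   "(norm (Y - kr (m i) (fid (q i)) y))\<^sup>2 \<le> 2 * sqrt (q i * m i) * norm (Y - ?X)"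
   unfolding Y_def by (rule near_unitary_kr[OF m q, of "csc (of_real ?c) x" i i ?X]) (use x(1) YK XM in \<open>auto simp: Y_def\<close>)
  have "(norm (Y - kr (m i) (fid (q i)) y))\<^sup>2 \<le> 2 * sqrt (k i) * (D i * sqrt (k i))"
   using y(2) XY by (simp add: k norm_minus_commute) (rule order_trans, assumption, rule mult_left_mono, auto)
  also have "\<dots> = (sqrt (2 * D i) * sqrt (k i))\<^sup>2" using D(3)[of i] by (simp add: power_mult_distrib)
  finally have "norm (Y - kr (m i) (fid (q i)) y) \<le> sqrt (2 * D i) * sqrt (k i)"
   using D(3)[of i] by (simp add: power2_le_iff_abs_le)
  then have "nn (k i) (Y - iot (q i) (m i) y) \<le> sqrt (2 * D i)" "nn (k i) (?X - Y) \<le> D i"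
   using XY kp by (simp_all add: iot_def nn_le_iff)
  then have "nn (k i) (?X - iot (q i) (m i) y) \<le> D' i"
   using nn_diff_triangle[of "k i" ?X "iot (q i) (m i) y" Y] by (simp add: D'_def)
  then show ?thesis using y(1) by (auto simp: nn_commute)
 qed
 define \<theta> where "\<theta> i u = (SOME y. y \<in> UU (m i) \<and> nn (k i) (iot (q i) (m i) y - T i u) \<le> D' i)" for i u
 have \<theta>: "u \<in> UU (m i) ==> \<theta> i u \<in> UU (m i)"
  "u \<in> UU (m i) ==> nn (k i) (iot (q i) (m i) (\<theta> i u) - T i u) \<le> D' i" for i u
  using someI_ex[OF ex] by (simp_all add: \<theta>_def)
 have near: "anear F m k (\<lambda>i u. iot (q i) (m i) (\<theta> i u)) T"
 proof (rule anear_I)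
  fix u assume u: "\<And>i. u i \<in> UU (m i)"
  show "aeq F k (\<lambda>i. iot (q i) (m i) (\<theta> i (u i))) (\<lambda>i. T i (u i))"
   unfolding aeq_def by (rule tendsto_0_le_ev[OF D']) (use \<theta>(2)[OF u] in auto)
 qed
 show ?thesis
 proof (rule that[of \<theta>])
  show "amap F m m \<theta>" by (rule amap_pull[OF TA iotA \<theta>(1) near])
  show "acent F m m \<theta>" by (rule acent_pull[OF TC iotC iotA \<theta>(1) near])
  show "anear F m k (\<lambda>i u. t i (iot (q i) (m i) u)) (\<lambda>i u. iot (q i) (m i) (\<theta> i u))"
   using near by (simp add: anear_def T_def nn_commute)
  fix g assume g: "\<And>i. g i \<in> phs (G i)"
  have gU: "g i \<in> UU (m i)" for i by (rule phs_UU[OF G g])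
  have "aeq F k (\<lambda>i. iot (q i) (m i) (\<theta> i (g i))) (\<lambda>i. T i (g i))"
   by (rule anear_seq[OF near filterlim_ident]) (use gU in auto)
  also have "aeq F k \<dots> (\<lambda>i. iot (q i) (m i) (g i))"
   unfolding T_def
  proof (rule an)
   fix i show "iot (q i) (m i) (g i) \<in> phs (krset (m i) (heis (q i)) (G i))"
    unfolding iot_def by (rule phs_kr[OF phs_fid[OF H] g m])
  qed
  finally show "aeq F m (\<lambda>i. \<theta> i (g i)) g"
   by (rule amap_inj[OF iotA filterlim_ident, rotated 2]) (use gU \<theta>(1)[OF gU] in auto)
 qed
qed

text \<open>Two anchorings of one map may differ. Here \<open>f\<close> almost fixes the basis
  \<open>G\<close> of the copy of U(m), and \<open>Y\<close> intertwines the whole copy up to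
  \<open>d\<close>; so \<open>Y\<close> almost commutes with \<open>G\<close>, its average
  \<open>Z\<close> over \<open>G\<close> commutes exactly with the copy, and \<open>Y\<close>
  cancels. The bound is \<open>d\<close> for the intertwining plus twice \<open>d + e / 2\<close>
  for comparing \<open>Y\<close> with \<open>Z\<close>.\<close>

theorem re_anchor:
 fixes F :: "'i filter"
 assumes A: "amap F k k f" and k: "\<And>i. k i = q i * m i" and q: "\<And>i. q i > 0" and G: "\<And>i. neb (m i) (G i)"
  and an: "\<And>g. (\<And>i. g i \<in> G i) ==> aeq F k (\<lambda>i. f i (iot (q i) (m i) (g i))) (\<lambda>i. iot (q i) (m i) (g i))"
  and Y: "\<And>i. Y i \<in> UU (k i)"
  and cl: "\<forall>\<^sub>F i in F. \<forall>v\<in>UU (m i). nn (k i) (f i (iot (q i) (m i) v) * Y i - Y i * iot (q i) (m i) v) \<le> d"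
  and e: "e > 0"
 shows "\<forall>\<^sub>F i in F. \<forall>v\<in>UU (m i). nn (k i) (f i (iot (q i) (m i) v) - iot (q i) (m i) v) \<le> 3 * d + e"
proof -
 note m = nebD(1)[OF G]
 have kp: "k i > 0" for i using k q m by simp
 have iU: "u \<in> UU (m i) ==> iot (q i) (m i) u \<in> UU (k i)" for i u using m k by simp
 have "U0 F G (\<lambda>i g. nn (k i) (f i (iot (q i) (m i) g) - iot (q i) (m i) g))"
  by (rule U0_I) (use an neb_ne[OF G] in \<open>auto simp: aeq_def\<close>)
 from this[unfolded U0_def, rule_format, of "e / 2"] e
 have "\<forall>\<^sub>F i in F. \<forall>g\<in>G i. nn (k i) (f i (iot (q i) (m i) g) - iot (q i) (m i) g) < e / 2" by simp
 then show ?thesis using cl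
 proof eventually_elim
  case (elim i)
  let ?\<iota> = "iot (q i) (m i)" and ?B = "G i" and ?Y = "Y i"
  have YM: "?Y \<in> MM (q i * m i)" using Y[of i] k by auto
  have fin: "finite ?B" "?B \<noteq> {}" using nebD(2)[OF G] neb_ne[OF G] by auto
  obtain z where z: "z \<in> MM (q i)" "(\<Sum>g\<in>?B. ?\<iota> g * ?Y * adj (?\<iota> g)) = kr (m i) z (fid (m i))"
   by (rule twirl_inner[OF G YM], rule that) (simp_all add: iot_def)
  let ?c = "1 / real (card ?B)"
  define Z where "Z = ?c *\<^sub>R (\<Sum>g\<in>?B. ?\<iota> g * ?Y * adj (?\<iota> g))"
  have Z: "Z = kr (m i) (csc (of_real ?c) z) (fid (m i))"
   unfolding Z_def z(2) by (simp add: kr_csc_left[OF m] scaleR_csc)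
  have t: "norm (?Y - ?\<iota> g * ?Y * adj (?\<iota> g)) \<le> (d + e / 2) * sqrt (k i)" if g: "g \<in> ?B" for g
  proof -
   have gU: "g \<in> UU (m i)" using nebD(3)[OF G g] .
   have "norm (?Y - ?\<iota> g * ?Y * adj (?\<iota> g)) = norm (?Y * ?\<iota> g - ?\<iota> g * ?Y)"
    by (rule norm_twirl_term[OF iU[OF gU]]) (use Y[of i] in auto)
   moreover have "nn (k i) (?Y * ?\<iota> g - ?\<iota> g * ?Y) \<le> nn (k i) (?Y * ?\<iota> g - f i (?\<iota> g) * ?Y) + nn (k i) (f i (?\<iota> g) * ?Y - ?\<iota> g * ?Y)"
    by (rule nn_diff_triangle)
   moreover have "norm (f i (?\<iota> g) * ?Y - ?\<iota> g * ?Y) \<le> norm (f i (?\<iota> g) - ?\<iota> g)"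
    using con_UU[OF Y[of i]] unfolding con_def left_diff_distrib[symmetric] by blast
   then have "nn (k i) (f i (?\<iota> g) * ?Y - ?\<iota> g * ?Y) \<le> nn (k i) (f i (?\<iota> g) - ?\<iota> g)" by (rule nn_mono)
   moreover have "nn (k i) (?Y * ?\<iota> g - f i (?\<iota> g) * ?Y) \<le> d" using elim(2) gU by (simp add: nn_commute)
   moreover have "nn (k i) (f i (?\<iota> g) - ?\<iota> g) < e / 2" using elim(1) g by blast
   ultimately have "nn (k i) (?Y * ?\<iota> g - ?\<iota> g * ?Y) \<le> d + e / 2"
    and "norm (?Y - ?\<iota> g * ?Y * adj (?\<iota> g)) = norm (?Y * ?\<iota> g - ?\<iota> g * ?Y)" by linarith+
   then show ?thesis by (simp add: nn_le_iff[OF kp])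
  qed
  have YZ: "norm (?Y - Z) \<le> (d + e / 2) * sqrt (k i)"
   unfolding Z_def by (rule avg_near[OF fin t])
  show ?case
  proof
   fix v assume v: "v \<in> UU (m i)"
   let ?I = "?\<iota> v" and ?H = "f i (?\<iota> v)"
   have IU: "?I \<in> UU (k i)" and HU: "?H \<in> UU (k i)" using iU[OF v] amap_maps[OF A] by auto
   have comm: "Z * ?I = ?I * Z"
    unfolding Z iot_def using v z(1) m[of i] by (simp add: kr_mult)
   have "?H - ?I = ((?H * ?Y - ?Y * ?I) + ((?Y - Z) * ?I - ?I * (?Y - Z))) * adj ?Y"
    using comm IU HU UU_D(3)[OF Y[of i]] by (simp add: algebra_simps)
   then have "norm (?H - ?I) \<le> norm ((?H * ?Y - ?Y * ?I) + ((?Y - Z) * ?I - ?I * (?Y - Z)))"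
    using con_adj[OF con_UU[OF Y[of i]]] unfolding con_def by metis
   also have "\<dots> \<le> norm (?H * ?Y - ?Y * ?I) + (norm ((?Y - Z) * ?I) + norm (?I * (?Y - Z)))"
    by (intro norm_triangle_le add_left_mono norm_triangle_ineq4)
   also have "\<dots> \<le> d * sqrt (k i) + ((d + e / 2) * sqrt (k i) + (d + e / 2) * sqrt (k i))"
   proof (intro add_mono)
    show "norm (?H * ?Y - ?Y * ?I) \<le> d * sqrt (k i)" using elim(2) v nn_le_iff[OF kp] by blast
    show "norm ((?Y - Z) * ?I) \<le> (d + e / 2) * sqrt (k i)" "norm (?I * (?Y - Z)) \<le> (d + e / 2) * sqrt (k i)"
     using con_UU[OF IU] YZ unfolding con_def by (meson order_trans)+
   qed
   also have "\<dots> = (3 * d + e) * sqrt (k i)" by (simp add: algebra_simps)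
   finally show "nn (k i) (?H - ?I) \<le> 3 * d + e" by (simp add: nn_le_iff[OF kp])
  qed
 qed
qed

section \<open>Almost characters of the circle\<close>

lemma cis_lipschitz: "cmod (cis a - cis b) \<le> \<bar>a - b\<bar>"
proof -
 have "cis a - cis b = cis b * (exp (\<i> * of_real (a - b)) - 1)"
  by (simp add: cis_conv_exp algebra_simps exp_diff)
 then have "cmod (cis a - cis b) = 2 * \<bar>sin ((a - b) / 2)\<bar>"
  using dist_exp_i_1[of "a - b"] by (simp add: norm_mult dist_norm)
 then show ?thesis using abs_sin_x_le_abs_x[of "(a - b) / 2"] by simp
qed

lemma cis_far:
 assumes "a \<le> x" "x \<le> pi" "0 \<le> a"
 shows "2 * sin (a / 2) \<le> cmod (cis x - 1)"
proof -
 have "cmod (cis x - 1) = 2 * \<bar>sin (x / 2)\<bar>" using dist_exp_i_1[of x] by (simp add: cis_conv_exp dist_norm)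
 moreover have "sin (a / 2) \<le> sin (x / 2)" using assms by (intro sin_monotone_2pi_le) auto
 ultimately show ?thesis by linarith
qed

text \<open>The multiples of \<open>\<phi>\<close> advance by at most pi, so they cannot leap over
  the arc from pi/2 to 3 pi/2, where the cosine is not positive.\<close>

lemma cos_pos_small:
 assumes "\<bar>\<phi>\<bar> \<le> pi" "\<And>j. j \<le> L ==> cos (real j * \<phi>) > 0"
 shows "real L * \<bar>\<phi>\<bar> \<le> pi / 2"
 using assms(2)
proof (induction L)
 case (Suc L)
 have IH: "real L * \<bar>\<phi>\<bar> \<le> pi / 2" using Suc by simp
 have pos: "cos (real (Suc L) * \<bar>\<phi>\<bar>) > 0" using Suc.prems[of "Suc L"] by (cases "\<phi> \<ge> 0") auto
 show ?case
 proof (rule ccontr)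
  assume *: "\<not> ?thesis"
  have "real (Suc L) * \<bar>\<phi>\<bar> \<le> 3 * pi / 2" using IH assms(1) by (simp add: algebra_simps)
  then have "cos (real (Suc L) * \<bar>\<phi>\<bar>) \<le> 0"
   using cos_ge_zero[of "real (Suc L) * \<bar>\<phi>\<bar> - pi"] * by simp
  then show False using pos by linarith
 qed
qed simp

locale circle_asym =
 fixes F :: "'i filter" and ch :: "'i => complex => complex" and T :: "complex set"
 defines "T \<equiv> {c. cmod c = 1}"
 assumes unit: "\<And>i c. cmod c = 1 ==> cmod (ch i c) = 1"
  and mult: "U0 F (\<lambda>_. T \<times> T) (\<lambda>i p. cmod (ch i (fst p * snd p) - ch i (fst p) * ch i (snd p)))"
  and cont: "C0 F (\<lambda>_. T \<times> T) (\<lambda>i p. cmod (fst p - snd p)) (\<lambda>i p. cmod (ch i (fst p) - ch i (snd p)))"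
  and inj: "C0 F (\<lambda>_. T \<times> T) (\<lambda>i p. cmod (ch i (fst p) - ch i (snd p))) (\<lambda>i p. cmod (fst p - snd p))"
begin

lemma multD:
 assumes "cmod a = 1" "cmod b = 1"
 shows "((\<lambda>i. cmod (ch i (a * b) - ch i a * ch i b)) \<longlongrightarrow> 0) F"
 using U0_seq[OF mult filterlim_ident, of "\<lambda>_. (a, b)"] assms by (simp add: T_def)

lemma one: "((\<lambda>i. cmod (ch i 1 - 1)) \<longlongrightarrow> 0) F"
proof -
 have "cmod (ch i (1 * 1) - ch i 1 * ch i 1) = cmod (ch i 1 - 1)" for i
 proof -
  have "ch i (1 * 1) - ch i 1 * ch i 1 = - (ch i 1 * (ch i 1 - 1))" by (simp add: algebra_simps)
  then show ?thesis using unit[of 1 i] by (simp add: norm_mult del: mult_1)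
 qed
 then show ?thesis using multD[of 1 1] by simp
qed

lemma pow:
 assumes w: "cmod w = 1"
 shows "((\<lambda>i. cmod (ch i (w ^ n) - ch i w ^ n)) \<longlongrightarrow> 0) F"
proof (induction n)
 case 0 then show ?case using one by simp
next
 case (Suc n)
 have wn: "cmod (w ^ n) = 1" using w by (simp add: norm_power)
 have "((\<lambda>i. cmod (ch i (w * w ^ n) - ch i w * ch i (w ^ n)) + cmod (ch i (w ^ n) - ch i w ^ n)) \<longlongrightarrow> 0) F"
  by (rule tendsto_add_zero[OF multD[OF w wn] Suc])
 then show ?case
 proof (rule tendsto_0_le_ev)
  show "\<forall>\<^sub>F i in F. 0 \<le> cmod (ch i (w ^ Suc n) - ch i w ^ Suc n) \<and> cmod (ch i (w ^ Suc n) - ch i w ^ Suc n)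
   \<le> cmod (ch i (w * w ^ n) - ch i w * ch i (w ^ n)) + cmod (ch i (w ^ n) - ch i w ^ n)"
  proof (intro always_eventually allI conjI)
   fix i
   have "ch i (w ^ Suc n) - ch i w ^ Suc n = (ch i (w * w ^ n) - ch i w * ch i (w ^ n)) + ch i w * (ch i (w ^ n) - ch i w ^ n)"
    by (simp add: algebra_simps)
   then have "cmod (ch i (w ^ Suc n) - ch i w ^ Suc n)
    \<le> cmod (ch i (w * w ^ n) - ch i w * ch i (w ^ n)) + cmod (ch i w * (ch i (w ^ n) - ch i w ^ n))"
    by (metis norm_triangle_ineq)
   then show "cmod (ch i (w ^ Suc n) - ch i w ^ Suc n)
    \<le> cmod (ch i (w * w ^ n) - ch i w * ch i (w ^ n)) + cmod (ch i (w ^ n) - ch i w ^ n)"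
    using unit[OF w, of i] by (simp add: norm_mult del: power_Suc)
  qed simp
 qed
qed

definition rt :: "nat => nat => complex" where "rt N j = cis (2 * pi * real j / real N)"

definition rtz :: "nat => int => nat => complex" where "rtz N p j = cis (2 * pi * real_of_int p * real j / real N)"

lemma rt_1 [simp]: "cmod (rt N j) = 1" by (simp add: rt_def)
lemma rt_pow: "rt N j = rt N 1 ^ j" unfolding rt_def Complex.DeMoivre by (rule arg_cong[of _ _ cis]) simp
lemma pow_rt: "((\<lambda>i. cmod (ch i (rt N j) - ch i (rt N 1) ^ j)) \<longlongrightarrow> 0) F"
 using pow[OF rt_1[of N 1], of j] by (simp only: rt_pow[symmetric])
lemma rt_small: "N > 0 ==> cmod (rt N j - 1) \<le> 2 * pi * real j / real N"
 using cis_lipschitz[of "2 * pi * real j / real N" 0] by (simp add: rt_def)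

text \<open>Equicontinuity keeps the images of the first \<open>L\<close> powers of the root of
  unity, a number proportional to \<open>N\<close>, within distance 1 of 1 and hence in the right
  half plane; by \<open>cos_pos_small\<close> the angle of the image of the root is O(1/N).\<close>

lemma degree_bound:
 obtains C N0 where "C > 0" "\<And>N. N \<ge> N0 ==> N > 0 ==> \<forall>\<^sub>F i in F. real N * \<bar>Arg (ch i (rt N 1))\<bar> \<le> C"
proof -
 obtain \<delta> where \<delta>: "\<delta> > 0" "\<forall>\<^sub>F i in F. \<forall>x\<in>T \<times> T. cmod (fst x - snd x) < \<delta> \<longrightarrow> cmod (ch i (fst x) - ch i (snd x)) < 1 / 2"
  using cont[unfolded C0_def, rule_format, of "1 / 2"] by auto
 show ?thesis
 proof (rule that[of "7 * pi / \<delta>" "nat \<lceil>14 / \<delta>\<rceil>"])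
  show "7 * pi / \<delta> > 0" using \<delta>(1) by simp
  fix N :: nat assume N: "N \<ge> nat \<lceil>14 / \<delta>\<rceil>" "N > 0"
  \<comment> \<open>As 2 pi / 7 < 1, the first \<open>L\<close> powers are within
    \<open>\<delta>\<close> of 1. Rounding down loses at most half, because
    \<open>\<delta> * N\<close> is at least 14.\<close>
  define L where "L = nat \<lfloor>\<delta> * N / 7\<rfloor>"
  have L: "real L \<le> \<delta> * N / 7" "\<delta> * N / 14 \<le> real L"
  proof -
   have "14 / \<delta> \<le> real N" using N(1) by linarith
   then have *: "\<delta> * N / 14 \<ge> 1" using \<delta>(1) by (simp add: field_simps)
   show "real L \<le> \<delta> * N / 7" unfolding L_def using \<delta>(1) of_int_floor_le[of "\<delta> * N / 7"] by (simp del: of_int_floor_le)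
   have "\<delta> * N / 7 - 1 \<le> real L" unfolding L_def by linarith
   then show "\<delta> * N / 14 \<le> real L" using * by simp
  qed
  have lt: "cmod (rt N j - 1) < \<delta>" if "j \<le> L" for j
  proof -
   have "2 * pi * real j / real N \<le> 2 * pi * (\<delta> * N / 7) / real N"
    using that L(1) by (intro divide_right_mono mult_left_mono) auto
   also have "\<dots> = (2 * pi / 7) * \<delta>" using N(2) by simp
   also have "\<dots> < 1 * \<delta>" using \<delta>(1) pi_less_4 pi_approx by (intro mult_strict_right_mono) (auto simp: abs_if split: if_splits)
   finally show ?thesis using rt_small[OF N(2), of j] by simp
  qed
  have "\<forall>\<^sub>F i in F. \<forall>j\<in>{..L}. cmod (ch i (rt N j) - ch i (rt N 1) ^ j) < 1 / 4"
   by (intro eventually_ball_finite ballI order_tendstoD(2)[OF pow_rt]) auto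
  moreover have "\<forall>\<^sub>F i in F. cmod (ch i 1 - 1) < 1 / 4" by (rule order_tendstoD(2)[OF one]) simp
  ultimately show "\<forall>\<^sub>F i in F. real N * \<bar>Arg (ch i (rt N 1))\<bar> \<le> 7 * pi / \<delta>"
   using \<delta>(2)
  proof eventually_elim
   case (elim i)
   let ?c = "ch i (rt N 1)" let ?\<phi> = "Arg ?c"
   have c: "?c = cis ?\<phi>" using unit[OF rt_1[of N 1], of i] rcis_cmod_Arg[of ?c] by (simp add: rcis_def)
   have "cos (real j * ?\<phi>) > 0" if j: "j \<le> L" for j
   proof -
    have "cmod (ch i (rt N j) - ch i 1) < 1 / 2"
     using elim(3)[rule_format, of "(rt N j, 1)"] lt[OF j] by (simp add: T_def)
    moreover have "cmod (ch i (rt N j) - ?c ^ j) < 1 / 4" using elim(1) j by simp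
    moreover have "?c ^ j - 1 = - (ch i (rt N j) - ?c ^ j) + (ch i (rt N j) - ch i 1) + (ch i 1 - 1)" by simp
    then have "cmod (?c ^ j - 1) \<le> cmod (ch i (rt N j) - ?c ^ j) + cmod (ch i (rt N j) - ch i 1) + cmod (ch i 1 - 1)"
     by (metis (no_types, opaque_lifting) norm_minus_cancel norm_triangle_mono order_refl norm_triangle_ineq)
    ultimately have "cmod (?c ^ j - 1) < 1" using elim(2) by linarith
    then have "Re (1 - ?c ^ j) < 1" using complex_Re_le_cmod[of "1 - ?c ^ j"] by (simp add: norm_minus_commute)
    moreover have "Re (?c ^ j) = cos (real j * ?\<phi>)" by (subst c) (simp add: Complex.DeMoivre)
    ultimately show ?thesis by simp
   qed
   then have "real L * \<bar>?\<phi>\<bar> \<le> pi / 2" using Arg_bounded[of ?c] by (intro cos_pos_small) auto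
   moreover have "\<delta> * N / 14 * \<bar>?\<phi>\<bar> \<le> real L * \<bar>?\<phi>\<bar>" using L(2) by (intro mult_right_mono) auto
   ultimately have "\<delta> * N / 14 * \<bar>?\<phi>\<bar> \<le> pi / 2" by simp
   then show ?case using \<delta>(1) by (simp add: field_simps)
  qed
 qed
qed

text \<open>The image of a primitive root has an \<open>N\<close>-th power close to 1, so its angle
  is close to a multiple of 2 pi / \<open>N\<close>; \<open>r i\<close> is that multiple, the degree
  at the index.\<close>

lemma power_map:
 assumes N: "N > 0"
 obtains r :: "'i => int" where "\<And>j. ((\<lambda>i. cmod (ch i (rt N j) - rtz N (r i) j)) \<longlongrightarrow> 0) F"
  "\<And>i. 2 * pi * \<bar>real_of_int (r i)\<bar> \<le> real N * \<bar>Arg (ch i (rt N 1))\<bar> + pi"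
proof -
 define c where "c i = ch i (rt N 1)" for i
 define \<phi> where "\<phi> i = Arg (c i)" for i
 define x where "x i = Arg (c i ^ N)" for i
 have cu: "cmod (c i) = 1" for i by (simp add: c_def unit)
 have c: "c i = cis (\<phi> i)" for i using rcis_cmod_Arg[of "c i"] cu[of i] by (simp add: rcis_def \<phi>_def)
 have cN: "c i ^ N = cis (x i)" for i using rcis_cmod_Arg[of "c i ^ N"] cu[of i] by (simp add: rcis_def x_def norm_power)
 have "\<exists>n::int. real N * \<phi> i = x i + 2 * pi * real_of_int n" for i
 proof -
  have "cis (real N * \<phi> i) = cis (x i)" using cN[of i] c[of i] by (simp add: Complex.DeMoivre)
  then have "exp (\<i> * complex_of_real (real N * \<phi> i)) = exp (\<i> * complex_of_real (x i))" by (simp add: cis_conv_exp)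
  then obtain n :: int where "\<i> * complex_of_real (real N * \<phi> i) = \<i> * complex_of_real (x i) + (of_int (2 * n) * pi) * \<i>"
   unfolding exp_eq by blast
  then have "complex_of_real (real N * \<phi> i) = complex_of_real (x i + 2 * pi * real_of_int n)"
   by (simp add: complex_eq_iff)
  then show ?thesis using of_real_eq_iff by blast
 qed
 then obtain r :: "'i => int" where r: "\<And>i. real N * \<phi> i = x i + 2 * pi * real_of_int (r i)" by metis
 have "rt N 1 ^ N = 1" using N by (simp only: rt_pow[symmetric]) (simp add: rt_def)
 then have "((\<lambda>i. cmod (ch i 1 - c i ^ N)) \<longlongrightarrow> 0) F" using pow[OF rt_1[of N 1], of N] by (simp add: c_def)
 then have "((\<lambda>i. cmod (ch i 1 - 1) + cmod (ch i 1 - c i ^ N)) \<longlongrightarrow> 0) F" by (rule tendsto_add_zero[OF one])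
 then have "((\<lambda>i. cmod (c i ^ N - 1)) \<longlongrightarrow> 0) F"
 proof (rule tendsto_0_le_ev)
  show "\<forall>\<^sub>F i in F. 0 \<le> cmod (c i ^ N - 1) \<and> cmod (c i ^ N - 1) \<le> cmod (ch i 1 - 1) + cmod (ch i 1 - c i ^ N)"
   using norm_triangle_ineq4[of "ch i 1 - 1" "ch i 1 - c i ^ N" for i] by (auto intro!: always_eventually)
 qed
 then have "((\<lambda>i. c i ^ N) \<longlongrightarrow> 1) F" by (rule LIM_zero_cancel[OF tendsto_norm_zero_cancel])
 then have "((\<lambda>i. Arg (c i ^ N)) \<longlongrightarrow> Arg 1) F" by (rule tendsto_compose[OF continuous_at_Arg[of 1, unfolded continuous_at], rotated]) auto
 then have x0: "(x \<longlongrightarrow> 0) F" by (simp add: x_def[abs_def])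
 show ?thesis
 proof (rule that[of r])
  fix j
  have "((\<lambda>i. cmod (ch i (rt N j) - c i ^ j) + real j * \<bar>x i\<bar> / real N) \<longlongrightarrow> 0 + real j * \<bar>0\<bar> / real N) F"
   unfolding c_def by (intro tendsto_intros x0 pow_rt) (use N in auto)
  then have "((\<lambda>i. cmod (ch i (rt N j) - c i ^ j) + real j * \<bar>x i\<bar> / real N) \<longlongrightarrow> 0) F" by simp
  then show "((\<lambda>i. cmod (ch i (rt N j) - rtz N (r i) j)) \<longlongrightarrow> 0) F"
  proof (rule tendsto_0_le_ev)
   have "cmod (ch i (rt N j) - rtz N (r i) j) \<le> cmod (ch i (rt N j) - c i ^ j) + real j * \<bar>x i\<bar> / real N" for i
   proof -
    have "c i ^ j = cis (real j * \<phi> i)" by (simp add: c[of i] Complex.DeMoivre)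
    moreover have "real j * \<phi> i - 2 * pi * real_of_int (r i) * real j / real N = real j * x i / real N"
     using r[of i] N by (simp add: field_simps) (metis distrib_left mult.commute mult.left_commute)
    ultimately have "cmod (c i ^ j - rtz N (r i) j) \<le> real j * \<bar>x i\<bar> / real N"
     using cis_lipschitz[of "real j * \<phi> i" "2 * pi * real_of_int (r i) * real j / real N"] by (simp add: rtz_def abs_mult)
    then show ?thesis using norm_triangle_ineq[of "ch i (rt N j) - c i ^ j" "c i ^ j - rtz N (r i) j"]
     by simp
   qed
   then show "\<forall>\<^sub>F i in F. 0 \<le> cmod (ch i (rt N j) - rtz N (r i) j) \<and>
     cmod (ch i (rt N j) - rtz N (r i) j) \<le> cmod (ch i (rt N j) - c i ^ j) + real j * \<bar>x i\<bar> / real N"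
    by (auto intro!: always_eventually)
  qed
 next
  fix i
  have "2 * pi * \<bar>real_of_int (r i)\<bar> = \<bar>real N * \<phi> i - x i\<bar>" using r[of i] by (simp add: abs_mult)
  also have "\<dots> \<le> real N * \<bar>\<phi> i\<bar> + \<bar>x i\<bar>" using abs_triangle_ineq4[of "real N * \<phi> i" "x i"] by (simp add: abs_mult)
  also have "\<bar>x i\<bar> \<le> pi" using Arg_bounded[of "c i ^ N"] by (auto simp: x_def abs_le_iff)
  finally show "2 * pi * \<bar>real_of_int (r i)\<bar> \<le> real N * \<bar>Arg (ch i (rt N 1))\<bar> + pi" by (simp add: \<phi>_def c_def)
 qed
qed

text \<open>Degree 0 sends -1 close to 1, and a degree of modulus \<open>R\<close> \<ge> 2 sends a
  root of unity with angle near 2 pi / \<open>R\<close> close to 1. Both contradict injectivity, and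
  uniformly so, since the degrees are bounded by \<open>M\<close>.\<close>

lemma degree_one:
 obtains N1 where "\<And>N. N \<ge> N1 ==> N > 0 ==> even N ==> \<exists>r :: 'i => int.
  (\<forall>j. ((\<lambda>i. cmod (ch i (rt N j) - rtz N (r i) j)) \<longlongrightarrow> 0) F) \<and>
  (\<forall>\<^sub>F i in F. \<bar>r i\<bar> = 1)"
proof -
 obtain C N0 where C: "C > 0" "\<And>N. N \<ge> N0 ==> N > 0 ==> \<forall>\<^sub>F i in F. real N * \<bar>Arg (ch i (rt N 1))\<bar> \<le> C"
  by (rule degree_bound) (rule that; simp)
 \<comment> \<open>The degree satisfies 2 pi |r| \<le> C + pi, hence |r| \<le>
   \<open>M\<close>.\<close>
 define M where "M = C + 2"
 have M: "M > 2" using C(1) by (simp add: M_def)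
 \<comment> \<open>No point of the circle with angle between \<open>pi / M\<close> and pi is closer
   to 1 than \<open>\<eta>\<close>; the root that spoils injectivity has such an angle.\<close>
 define \<eta> where "\<eta> = min 1 (2 * sin (pi / M / 2))"
 have "sin (pi / M / 2) > 0" using M by (intro sin_gt_zero) (auto simp: field_simps)
 then have \<eta>: "\<eta> > 0" by (simp add: \<eta>_def)
 obtain \<delta> where \<delta>: "\<delta> > 0" "\<forall>\<^sub>F i in F. \<forall>x\<in>T \<times> T. cmod (ch i (fst x) - ch i (snd x)) < \<delta> \<longrightarrow> cmod (fst x - snd x) < \<eta>"
  using inj[unfolded C0_def, rule_format, OF \<eta>] by auto
 show ?thesis
 proof (rule that[of "max N0 (nat \<lceil>max (2 * M) (4 * pi * M / \<delta>)\<rceil> + 1)"])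
  fix N assume N: "max N0 (nat \<lceil>max (2 * M) (4 * pi * M / \<delta>)\<rceil> + 1) \<le> N" "N > 0" "even N"
  have Nb: "N0 \<le> N" "2 * M < N" "4 * pi * M / \<delta> < N" using N(1) by linarith+
  obtain r :: "'i => int" where r: "\<And>j. ((\<lambda>i. cmod (ch i (rt N j) - rtz N (r i) j)) \<longlongrightarrow> 0) F"
   "\<And>i. 2 * pi * \<bar>real_of_int (r i)\<bar> \<le> real N * \<bar>Arg (ch i (rt N 1))\<bar> + pi"
   by (rule power_map[OF N(2)], rule that)
  have "\<forall>\<^sub>F i in F. \<forall>j\<in>{..N}. cmod (ch i (rt N j) - rtz N (r i) j) < \<delta> / 4"
   using \<delta>(1) by (intro eventually_ball_finite ballI order_tendstoD(2)[OF r(1)]) auto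
  moreover have "\<forall>\<^sub>F i in F. cmod (ch i 1 - 1) < \<delta> / 4" by (rule order_tendstoD(2)[OF one]) (use \<delta>(1) in simp)
  ultimately have "\<forall>\<^sub>F i in F. \<bar>r i\<bar> = 1"
   using C(2)[OF Nb(1) N(2)] \<delta>(2)
  proof eventually_elim
   case (elim i)
   have key: "cmod (rt N j - 1) < \<eta>" if j: "j \<le> N" and s: "cmod (rtz N (r i) j - 1) < \<delta> / 2" for j
   proof -
    let ?z = "rtz N (r i) j"
    have "cmod (ch i (rt N j) - ch i 1) \<le> cmod (ch i (rt N j) - ?z) + cmod (?z - 1) + cmod (ch i 1 - 1)"
     using norm_triangle_ineq[of "ch i (rt N j) - ?z" "?z - 1"] norm_triangle_ineq4[of "ch i (rt N j) - 1" "ch i 1 - 1"] by simp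
    moreover have "cmod (ch i (rt N j) - ?z) < \<delta> / 4" using elim(1) j by simp
    ultimately have "cmod (ch i (rt N j) - ch i 1) < \<delta>" using s elim(2) by linarith
    then show ?thesis using elim(4)[rule_format, of "(rt N j, 1)"] by (simp add: T_def)
   qed
   have rM: "\<bar>real_of_int (r i)\<bar> \<le> M"
   proof -
    have "2 * pi * \<bar>real_of_int (r i)\<bar> \<le> C + pi" using r(2)[of i] elim(3) by linarith
    also have "\<dots> \<le> 2 * pi * M" proof -
     have "C * 1 \<le> C * (2 * pi)" using C(1) pi_gt3 by (intro mult_left_mono) auto
     then show ?thesis using pi_gt3 by (simp add: M_def algebra_simps)
    qed
    finally show ?thesis by simp
   qed
   show ?case
   proof (rule ccontr)
    assume ne: "\<bar>r i\<bar> \<noteq> 1"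
    consider "r i = 0" | "\<bar>r i\<bar> \<ge> 2" using ne by linarith
    then show False
    proof cases
     case 1
     have "cmod (rt N (N div 2) - 1) < \<eta>" by (rule key) (use 1 \<delta>(1) in \<open>auto simp: rtz_def\<close>)
     moreover have "rt N (N div 2) = -1" using N(2,3) by (simp add: rt_def real_of_nat_div)
     ultimately show False by (simp add: \<eta>_def)
    next
     case 2
     define R where "R = nat \<bar>r i\<bar>"
     have R: "real R = \<bar>real_of_int (r i)\<bar>" "R \<ge> 2" "real R \<le> M" using 2 rM by (auto simp: R_def)
     define j where "j = N div R"
     have jN: "real N - real R < real R * real j" "real R * real j \<le> real N"
     proof -
      have "N = R * j + N mod R" "N mod R < R" using R(2) by (simp_all add: j_def)
      then have "real N = real R * real j + real (N mod R)" "real (N mod R) < real R" by (metis of_nat_add of_nat_mult, simp)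
      then show "real N - real R < real R * real j" "real R * real j \<le> real N" by linarith+
     qed
     have "j \<le> N" by (simp add: j_def)
     have "cmod (rtz N (r i) j - 1) = cmod (cis (2 * pi * real R * real j / real N) - 1)"
     proof (cases "r i \<ge> 0")
      case True then show ?thesis using R(1) by (simp add: rtz_def)
     next
      case False
      then have "real_of_int (r i) = - real R" using R(1) by simp
      then have "cis (2 * pi * real_of_int (r i) * real j / real N) - 1 = cnj (cis (2 * pi * real R * real j / real N) - 1)"
       by (simp add: cis_cnj)
      then show ?thesis unfolding rtz_def by (metis complex_mod_cnj)
     qed
     also have "\<dots> = cmod (cis (2 * pi * real R * real j / real N) - cis (2 * pi))" by simp
     also have "\<dots> \<le> \<bar>2 * pi * real R * real j / real N - 2 * pi\<bar>" by (rule cis_lipschitz)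
     also have "\<dots> = 2 * pi * (real N - real R * real j) / real N"
     proof -
      have "2 * pi * real R * real j / real N - 2 * pi = - (2 * pi * (real N - real R * real j) / real N)"
       using N(2) by (simp add: field_simps)
      moreover have "0 \<le> 2 * pi * (real N - real R * real j) / real N" using jN(2) by simp
      ultimately show ?thesis by linarith
     qed
     also have "\<dots> \<le> 2 * pi * M / real N" using jN R(3) by (intro divide_right_mono mult_left_mono) auto
     also have "\<dots> < \<delta> / 2" using Nb(3) \<delta>(1) N(2) by (simp add: field_simps)
     finally have "cmod (rt N j - 1) < \<eta>" by (rule key[OF \<open>j \<le> N\<close>])
     moreover have "2 * sin (pi / M / 2) \<le> cmod (rt N j - 1)"
      unfolding rt_def
     proof (rule cis_far)
      have "2 * real j \<le> real R * real j" using R(2) by (intro mult_right_mono) auto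
      then have "2 * real j \<le> real N" using jN(2) by linarith
      then show "2 * pi * real j / real N \<le> pi" using N(2) by (simp add: field_simps)
      have "real N / 2 \<le> real N - M" using Nb(2) by simp
      also have "\<dots> \<le> real R * real j" using jN(1) R(3) by linarith
      also have "\<dots> \<le> M * real j" using R(3) by (intro mult_right_mono) auto
      finally have "real N \<le> 2 * (M * real j)" by simp
      then have "pi * real N \<le> pi * (2 * (M * real j))" by (intro mult_left_mono) auto
      then show "pi / M \<le> 2 * pi * real j / real N" using N(2) M by (simp add: field_simps)
     qed (use M in auto)
     ultimately show False by (simp add: \<eta>_def)
    qed
   qed
  qed
  then show "\<exists>r :: 'i => int.
   (\<forall>j. ((\<lambda>i. cmod (ch i (rt N j) - rtz N (r i) j)) \<longlongrightarrow> 0) F) \<and>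
   (\<forall>\<^sub>F i in F. \<bar>r i\<bar> = 1)" using r(1) by blast
 qed
qed

lemma rt_dense:
 assumes "cmod z = 1" "N > 0"
 obtains j where "j < N" "cmod (z - rt N j) \<le> 2 * pi / real N"
proof -
 define t where "t = Arg2pi z"
 have t: "0 \<le> t" "t < 2 * pi" "z = cis t"
  using Arg2pi[of z] assms(1) by (auto simp: t_def is_Arg_def cis_conv_exp)
 define j where "j = nat \<lfloor>t * N / (2 * pi)\<rfloor>"
 have jr: "real j \<le> t * N / (2 * pi)" "t * N / (2 * pi) < real j + 1"
  using t(1) by (simp_all add: j_def)
 have "t * N / (2 * pi) < N" using t(2) assms(2) by (simp add: field_simps)
 then have "j < N" using jr(1) by linarith
 moreover have "cmod (z - rt N j) \<le> 2 * pi / real N"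
 proof -
  have "\<bar>t - 2 * pi * real j / real N\<bar> \<le> 2 * pi / real N"
  proof -
   have "t - 2 * pi * real j / real N = (t * N / (2 * pi) - j) * (2 * pi / real N)"
    using assms(2) by (simp add: field_simps)
   then have "\<bar>t - 2 * pi * real j / real N\<bar> = \<bar>t * N / (2 * pi) - j\<bar> * (2 * pi / real N)"
    by (simp add: abs_mult)
   also have "\<dots> \<le> 1 * (2 * pi / real N)" using jr by (intro mult_right_mono) auto
   finally show ?thesis by simp
  qed
  then show ?thesis using cis_lipschitz[of t "2 * pi * real j / real N"] by (simp add: t(3) rt_def)
 qed
 ultimately show ?thesis by (rule that)
qed

text \<open>The choice between the identity and the conjugation may change with the index; the image
  of the imaginary unit records it.\<close>

theorem circle_id_or_cnj: "U0 F (\<lambda>_. T) (\<lambda>i z. cmod (ch i z - (if 0 \<le> Im (ch i \<i>) then z else cnj z)))"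
 unfolding U0_def
proof (intro allI impI)
 fix e :: real assume e: "e > 0"
 obtain \<delta> where \<delta>: "\<delta> > 0" "\<forall>\<^sub>F i in F. \<forall>x\<in>T \<times> T. cmod (fst x - snd x) < \<delta> \<longrightarrow> cmod (ch i (fst x) - ch i (snd x)) < e / 3"
  using cont[unfolded C0_def, rule_format, of "e / 3"] e by auto
 obtain N1 where N1: "\<And>N. N \<ge> N1 ==> N > 0 ==> even N ==> \<exists>r :: 'i => int.
  (\<forall>j. ((\<lambda>i. cmod (ch i (rt N j) - rtz N (r i) j)) \<longlongrightarrow> 0) F) \<and>
  (\<forall>\<^sub>F i in F. \<bar>r i\<bar> = 1)" by (rule degree_one) (rule that; fast)
 define M where "M = N1 + nat \<lceil>2 * pi / min \<delta> (e / 3)\<rceil> + 1"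
 \<comment> \<open>A multiple of 4, so that the imaginary unit is one of the roots of unity;
   \<open>M\<close> makes the roots dense enough for both tolerances.\<close>
 define N where "N = 4 * M"
 have N: "N \<ge> N1" "N > 0" "even N" by (auto simp: N_def M_def)
 have NM: "2 * pi / min \<delta> (e / 3) < N" by (simp add: N_def M_def) linarith
 have small: "2 * pi / N < \<delta>" "2 * pi / N < e / 3"
 proof -
  have m: "min \<delta> (e / 3) > 0" using e \<delta>(1) by simp
  have "2 * pi / N < min \<delta> (e / 3)" using NM N(2) unfolding pos_divide_less_eq[OF m] by (subst pos_divide_less_eq) (auto simp: mult.commute)
  then show "2 * pi / N < \<delta>" "2 * pi / N < e / 3" by auto
 qed
 obtain r :: "'i => int" where r: "\<And>j. ((\<lambda>i. cmod (ch i (rt N j) - rtz N (r i) j)) \<longlongrightarrow> 0) F"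
  "\<forall>\<^sub>F i in F. \<bar>r i\<bar> = 1" using N1[OF N] by blast
 have "\<forall>\<^sub>F i in F. \<forall>j\<in>{..N}. cmod (ch i (rt N j) - rtz N (r i) j) < min (e / 3) 1"
  using e by (intro eventually_ball_finite ballI order_tendstoD(2)[OF r(1)]) auto
 with r(2) \<delta>(2) show "\<forall>\<^sub>F i in F. \<forall>z\<in>T. cmod (ch i z - (if 0 \<le> Im (ch i \<i>) then z else cnj z)) < e"
 proof eventually_elim
  case (elim i)
  define s where "s w = (if r i = 1 then w else cnj w)" for w :: complex
  have cis_s: "rtz N (r i) j = s (rt N j)" for j
   using elim(1) by (auto simp: s_def rtz_def rt_def cis_cnj abs_if split: if_splits)
  have "2 * pi * real M / real N = pi / 2" using N(2) by (simp add: N_def)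
  then have "rt N M = \<i>" unfolding rt_def by (simp only: cis_pi_half)
  then have "cmod (ch i \<i> - s \<i>) < 1" using bspec[OF elim(3), of M] unfolding cis_s by (simp add: N_def)
  then have "\<bar>Im (ch i \<i>) - Im (s \<i>)\<bar> < 1" using abs_Im_le_cmod[of "ch i \<i> - s \<i>"] by simp
  then have s: "s z = (if 0 \<le> Im (ch i \<i>) then z else cnj z)" for z by (auto simp: s_def split: if_splits)
  show ?case
  proof
   fix z assume z: "z \<in> T"
   obtain j where j: "j < N" "cmod (z - rt N j) \<le> 2 * pi / real N"
    by (rule rt_dense[of z N]) (use z N in \<open>auto simp: T_def\<close>)
   have "cmod (ch i z - ch i (rt N j)) < e / 3"
    using elim(2)[rule_format, of "(z, rt N j)"] z j(2) small(1) by (simp add: T_def)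
   moreover have "cmod (ch i (rt N j) - s (rt N j)) < e / 3"
    using bspec[OF elim(3), of j] j(1) unfolding cis_s by simp
   moreover have "cmod (s (rt N j) - s z) < e / 3"
   proof -
    have "cmod (s (rt N j) - s z) = cmod (z - rt N j)"
     using complex_mod_cnj[of "rt N j - z"] by (simp add: s_def norm_minus_commute)
    then show ?thesis using j(2) small(2) by linarith
   qed
   ultimately have "cmod (ch i z - s z) < e"
    using norm_triangle_ineq[of "ch i z - ch i (rt N j)" "ch i (rt N j) - s z"]
     norm_triangle_ineq[of "ch i (rt N j) - s (rt N j)" "s (rt N j) - s z"] by simp
   then show "cmod (ch i z - (if 0 \<le> Im (ch i \<i>) then z else cnj z)) < e" by (simp add: s)
  qed
 qed
qed

end

section \<open>Scalars, complex conjugation and comparison of dimensions\<close>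

definition cj :: "fmat => fmat" where "cj x = mk (bnd x) (\<lambda>i j. cnj (ent x i j))"

lemma ent_cj [simp]: "ent (cj x) i j = cnj (ent x i j)"
 by (auto simp: cj_def ent_mk ent_outside)
lemma cj_MM [simp]: "x \<in> MM n ==> cj x \<in> MM n"
 by (rule MM_I) (auto simp: MM_zero)
lemma cj_cj [simp]: "cj (cj x) = x" by (rule fmat_eqI) simp
lemma cj_diff: "cj (x - y) = cj x - cj y" by (rule fmat_eqI) simp
lemma cj_csc [simp]: "cj (csc c x) = csc (cnj c) (cj x)" by (rule fmat_eqI) simp
lemma cj_fid [simp]: "cj (fid n) = fid n" by (rule fmat_eqI) simp
lemma cj_adj: "cj (adj x) = adj (cj x)" by (rule fmat_eqI) simp
lemma cj_mult: "cj (x * y) = cj x * cj y"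
proof -
 obtain n where n: "x \<in> MM n" using MM_bnd by blast
 show ?thesis by (rule fmat_eqI) (simp add: ent_mult[of _ n] n)
qed
lemma norm_cj [simp]: "norm (cj x) = norm x"
proof -
 obtain n where n: "x \<in> MM n" using MM_bnd by blast
 have "(norm (cj x))\<^sup>2 = (norm x)\<^sup>2" using n by (simp add: norm_sq_sum[of _ n])
 then show ?thesis by simp
qed
lemma cj_UU [simp]: "u \<in> UU n ==> cj u \<in> UU n"
 by (rule UU_I) (simp_all add: cj_adj[symmetric] cj_mult[symmetric] UU_D)

definition cjs :: "bool => fmat => fmat" where "cjs b x = (if b then x else cj x)"

lemma cjs_simps [simp]: "cjs b (cjs b x) = x" "u \<in> UU n ==> cjs b u \<in> UU n" "norm (cjs b x) = norm x"
 "cjs b (x * y) = cjs b x * cjs b y" "cjs b (fid n) = fid n"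
 by (simp_all add: cjs_def cj_mult)
lemma cjs_diff: "cjs b (x - y) = cjs b x - cjs b y" by (simp add: cjs_def cj_diff)
lemma cjs_csc: "cjs b (csc c x) = csc (if b then c else cnj c) (cjs b x)" by (simp add: cjs_def)

lemma amap_cjs: "amap F l l (\<lambda>i. cjs (s i))"
 by (rule amap_exact) (auto simp: cjs_diff[symmetric] nn_def)

definition csgn :: "complex => complex" where "csgn z = (if z = 0 then 1 else sgn z)"

lemma csgn: "cmod (csgn z) = 1" "cmod (z - csgn z) = \<bar>1 - cmod z\<bar>"
proof -
 show "cmod (csgn z) = 1" by (simp add: csgn_def norm_sgn)
 show "cmod (z - csgn z) = \<bar>1 - cmod z\<bar>"
 proof (cases "z = 0")
  case False
  have "z - csgn z = of_real (cmod z - 1) * sgn z"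
   using False by (simp add: csgn_def sgn_div_norm scaleR_conv_of_real algebra_simps)
  then have "cmod (z - csgn z) = \<bar>cmod z - 1\<bar> * cmod (sgn z)" by (simp only: norm_mult norm_of_real)
  then show ?thesis using False by (simp add: norm_sgn)
 qed (simp add: csgn_def)
qed

lemma nn_csc_fid: "l > 0 ==> nn l (csc a (fid l)) = cmod a"
 using norm_UU[OF UU_fid[of l]] by (simp add: nn_def)

text \<open>The average over the basis is \<open>t\<close> times the identity. As \<open>X\<close>
  is unitary, the modulus of \<open>t\<close> is within the same error of 1, and replacing
  \<open>t\<close> by its phase doubles the bound.\<close>

lemma near_scalar:
 assumes H: "neb l B" and X: "X \<in> UU l" and D: "\<And>b. b \<in> B ==> nn l (X - b * X * adj b) \<le> D"
 shows "nn l (X - csc (csgn (ftr X / of_nat l)) (fid l)) \<le> 2 * D"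
proof -
 note l = nebD(1)[OF H]
 define t where "t = ftr X / of_nat l"
 have XM: "X \<in> MM l" using X by simp
 have "norm (X - (1 / real (card (B))) *\<^sub>R (\<Sum>b\<in>B. b * X * adj b)) \<le> D * sqrt l"
  by (rule avg_near[OF nebD(2)[OF H] neb_ne[OF H]]) (use D l in \<open>simp add: nn_le_iff\<close>)
 also have "(1 / real (card (B))) *\<^sub>R (\<Sum>b\<in>B. b * X * adj b) = csc t (fid l)"
  using l unfolding neb_twirl[OF H XM] neb_card[OF H] by (simp add: scaleR_csc t_def power2_eq_square)
 finally have 1: "nn l (X - csc t (fid l)) \<le> D" using l by (simp add: nn_le_iff)
 have "\<bar>1 - cmod t\<bar> = \<bar>nn l X - nn l (csc t (fid l))\<bar>"
  using norm_UU[OF X] l by (simp add: nn_csc_fid) (simp add: nn_def)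
 also have "\<dots> \<le> nn l (X - csc t (fid l))"
  unfolding nn_def diff_divide_distrib[symmetric] abs_divide using norm_triangle_ineq3[of X "csc t (fid l)"] by (simp add: divide_right_mono)
 finally have "nn l (csc t (fid l) - csc (csgn t) (fid l)) \<le> nn l (X - csc t (fid l))"
  using csgn(2)[of t] l by (simp add: csc_diff_left[symmetric] nn_csc_fid)
 then show ?thesis using 1 nn_diff_triangle[of l X "csc (csgn t) (fid l)" "csc t (fid l)"] by (simp add: t_def)
qed

lemma approx_scalar:
 assumes B: "\<And>i. neb (l i) (B i)" and XU: "\<And>i. X i \<in> UU (l i)"
  and comm: "\<And>b. (\<And>i. b i \<in> B i) ==> aeq F l (\<lambda>i. X i * b i) (\<lambda>i. b i * X i)"
 shows "aeq F l X (\<lambda>i. csc (csgn (ftr (X i) / of_nat (l i))) (fid (l i)))"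
proof -
 have "U0 F B (\<lambda>i b. nn (l i) (X i - b * X i * adj b))"
 proof (rule U0_I)
  fix b assume b: "\<And>i. b i \<in> B i"
  have "((\<lambda>i. nn (l i) (X i * b i - b i * X i)) \<longlongrightarrow> 0) F" using comm[OF b] by (simp add: aeq_def)
  moreover have "nn (l i) (X i - b i * X i * adj (b i)) = nn (l i) (X i * b i - b i * X i)" for i
   unfolding nn_def using norm_twirl_term[OF nebD(3)[OF B b] UU_MM[OF XU]] by simp
  ultimately show "((\<lambda>i. nn (l i) (X i - b i * X i * adj (b i))) \<longlongrightarrow> 0) F" by simp
 next
  fix i show "B i \<noteq> {}" by (rule neb_ne[OF B])
 qed
 then obtain D where D: "(D \<longlongrightarrow> 0) F" "\<And>i b. b \<in> B i ==> nn (l i) (X i - b * X i * adj b) \<le> D i"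
 proof (rule U0_bound_nn)
  show "B i \<noteq> {}" for i by (rule neb_ne[OF B])
 qed (use nebD(3)[OF B] XU in \<open>auto intro!: that\<close>)
 have "((\<lambda>i. 2 * D i) \<longlongrightarrow> 0) F" using tendsto_mult_right_zero[OF D(1), of 2] by simp
 then show ?thesis
  unfolding aeq_def by (rule tendsto_0_le_ev)
   (use near_scalar[OF B XU D(2)] in \<open>auto intro!: always_eventually\<close>)
qed

definition asurj :: "'i filter => ('i => nat) => ('i => nat) => ('i => fmat => fmat) => bool" where
 "asurj F k l h \<longleftrightarrow> (\<forall>w. (\<forall>i. w i \<in> UU (l i)) \<longrightarrow> (\<exists>u. (\<forall>i. u i \<in> UU (k i)) \<and> aeq F l (\<lambda>i. h i (u i)) w))"

text \<open>By surjectivity the Weyl basis consists of images up to o(1), and the image of a scalar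
  almost commutes with every image; so it almost commutes with the basis and is almost a
  scalar.\<close>

theorem centre_scalar:
 fixes F :: "'i filter"
 assumes A: "amap F k l h" and S: "asurj F k l h" and l: "\<And>i. l i > 0"
 obtains ch where "\<And>i c. cmod (ch i c) = 1"
  "U0 F (\<lambda>i. {c. cmod c = 1}) (\<lambda>i c. nn (l i) (h i (csc c (fid (k i))) - csc (ch i c) (fid (l i))))"
proof -
 define ch where "ch i c = csgn (ftr (h i (csc c (fid (k i)))) / of_nat (l i))" for i c
 have "U0 F (\<lambda>i. {c. cmod c = 1}) (\<lambda>i c. nn (l i) (h i (csc c (fid (k i))) - csc (ch i c) (fid (l i))))"
 proof (rule U0_I)
  fix c :: "'i => complex" assume "\<And>i. c i \<in> {c. cmod c = 1}"
  then have c: "cmod (c i) = 1" for i by simp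
  define z where "z i = csc (c i) (fid (k i))" for i
  have zU: "z i \<in> UU (k i)" for i using c by (simp add: z_def)
  define X where "X i = h i (z i)" for i
  have XU: "X i \<in> UU (l i)" for i unfolding X_def by (rule amap_maps[OF A zU])
  have "aeq F l X (\<lambda>i. csc (csgn (ftr (X i) / of_nat (l i))) (fid (l i)))"
  proof (rule approx_scalar[OF neb_heis[OF l] XU])
   fix b assume b: "\<And>i. b i \<in> heis (l i)"
   have bU: "b i \<in> UU (l i)" for i using nebD(3)[OF neb_heis[OF l] b] .
   obtain u where u: "\<And>i. u i \<in> UU (k i)" "aeq F l (\<lambda>i. h i (u i)) b"
    using S bU unfolding asurj_def by blast
   have con: "\<forall>\<^sub>F i in F. con (b i)" "\<forall>\<^sub>F i in F. con (X i)" "\<forall>\<^sub>F i in F. con (adj (b i))"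
    using con_UU[OF bU] con_UU[OF XU] con_adj[OF con_UU[OF bU]] by auto
   have U: "\<forall>\<^sub>F i in F. z i \<in> UU (k i)" "\<forall>\<^sub>F i in F. u i \<in> UU (k i)" using zU u(1) by auto
   have "aeq F l (\<lambda>i. X i * b i) (\<lambda>i. X i * h i (u i))" by (rule aeq_left[OF aeq_sym[OF u(2)] con(2)])
   also have "aeq F l \<dots> (\<lambda>i. h i (z i * u i))"
    unfolding X_def by (rule aeq_sym, rule amap_mult[OF A filterlim_ident U])
   also have "\<dots> = (\<lambda>i. h i (u i * z i))" using UU_MM[OF u(1)] by (simp add: z_def)
   also have "aeq F l \<dots> (\<lambda>i. h i (u i) * X i)"
    unfolding X_def by (rule amap_mult[OF A filterlim_ident U(2,1)])
   also have "aeq F l \<dots> (\<lambda>i. b i * X i)" by (rule aeq_right[OF u(2) con(2)])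
   finally show "aeq F l (\<lambda>i. X i * b i) (\<lambda>i. b i * X i)" .
  qed
  then show "((\<lambda>i. nn (l i) (h i (csc (c i) (fid (k i))) - csc (ch i (c i)) (fid (l i)))) \<longlongrightarrow> 0) F"
   by (simp add: aeq_def X_def z_def ch_def)
 next
  show "{c. cmod c = 1} \<noteq> ({} :: complex set)" using norm_one by blast
 qed
 then show ?thesis using that[of ch] by (simp add: ch_def csgn)
qed

text \<open>\<open>Z\<close> and \<open>Y\<close> are isometric copies of the circle in the two
  groups: the scalars in \<open>conj_fix\<close>, and the matrices diag(c, cnj c) in
  \<open>near_id_2\<close>.\<close>

lemma circle_of_embed:
 fixes F :: "'i filter"
 assumes A: "amap F k l h"
  and ch: "\<And>i c. cmod (ch i c) = 1" "U0 F (\<lambda>i. {c. cmod c = 1}) (\<lambda>i c. nn (l i) (h i (Z i c) - Y i (ch i c)))"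
  and ZU: "\<And>i c. cmod c = 1 ==> Z i c \<in> UU (k i)" and YU: "\<And>i c. cmod c = 1 ==> Y i c \<in> UU (l i)"
  and Zm: "\<And>i a b. cmod a = 1 ==> cmod b = 1 ==> Z i a * Z i b = Z i (a * b)"
  and Ym: "\<And>i a b. cmod a = 1 ==> cmod b = 1 ==> Y i a * Y i b = Y i (a * b)"
  and dist: "\<And>i a b. nn (k i) (Z i a - Z i b) = cmod (a - b)" "\<And>i a b. nn (l i) (Y i a - Y i b) = cmod (a - b)"
 shows "circle_asym F ch"
proof -
 let ?T = "{c. cmod c = 1}"
 have sc: "aeq G (\<lambda>j. l (p j)) (\<lambda>j. h (p j) (Z (p j) (c j))) (\<lambda>j. Y (p j) (ch (p j) (c j)))"
  if "filterlim p F G" "\<forall>\<^sub>F j in G. cmod (c j) = 1" for G :: "'j filter" and p c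
  unfolding aeq_def by (rule U0_seq[OF ch(2) that(1)]) (use that(2) in auto)
 have ZE: "\<forall>\<^sub>F j in G. Z (p j) (c j) \<in> UU (k (p j))" if "\<forall>\<^sub>F j in G. cmod (c j) = 1" for G :: "'j filter" and p c
  using that by eventually_elim (rule ZU)
 show ?thesis
 proof
  show "cmod (ch i c) = 1" for i c by (rule ch(1))
  show "U0 F (\<lambda>_. ?T \<times> ?T) (\<lambda>i p. cmod (ch i (fst p * snd p) - ch i (fst p) * ch i (snd p)))"
  proof (rule U0_I)
   fix x :: "'i => complex \<times> complex" assume x: "\<And>i. x i \<in> ?T \<times> ?T"
   define a b where "a = fst \<circ> x" and "b = snd \<circ> x"
   have ab: "cmod (a i) = 1" "cmod (b i) = 1" for i using x[of i] by (auto simp: a_def b_def)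
   have ev: "\<forall>\<^sub>F i in F. cmod (a i) = 1" "\<forall>\<^sub>F i in F. cmod (b i) = 1" "\<forall>\<^sub>F i in F. cmod (a i * b i) = 1"
    using ab by (auto simp: norm_mult)
   have con: "\<forall>\<^sub>F i in F. con (h i (Z i (b i)))" "\<forall>\<^sub>F i in F. con (Y i (ch i (a i)))"
    using amap_con[OF A ZE[OF ev(2)]] con_UU[OF YU[OF ch(1)]] by auto
   have "aeq F l (\<lambda>i. Y i (ch i (a i * b i))) (\<lambda>i. h i (Z i (a i * b i)))"
    by (rule aeq_sym, rule sc[OF filterlim_ident ev(3)])
   also have "\<dots> = (\<lambda>i. h i (Z i (a i) * Z i (b i)))" by (simp add: Zm ab)
   also have "aeq F l \<dots> (\<lambda>i. h i (Z i (a i)) * h i (Z i (b i)))"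
    by (rule amap_mult[OF A filterlim_ident ZE[OF ev(1)] ZE[OF ev(2)]])
   also have "aeq F l \<dots> (\<lambda>i. Y i (ch i (a i)) * Y i (ch i (b i)))"
    by (rule aeq_mult[OF sc[OF filterlim_ident ev(1)] sc[OF filterlim_ident ev(2)] con])
   finally have "aeq F l (\<lambda>i. Y i (ch i (a i * b i))) (\<lambda>i. Y i (ch i (a i) * ch i (b i)))" by (simp add: Ym ch ab)
   then show "((\<lambda>i. cmod (ch i (fst (x i) * snd (x i)) - ch i (fst (x i)) * ch i (snd (x i)))) \<longlongrightarrow> 0) F"
    by (simp add: aeq_def dist a_def b_def)
  qed (use norm_one in blast)
  let ?P = "\<lambda>i p. cmod (ch i (fst p) - ch i (snd p))" and ?Q = "\<lambda>i::'i. \<lambda>p. cmod (fst p - snd p)"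
  have T: "\<forall>\<^sub>F j in CF F (\<lambda>_. ?T \<times> ?T) g. cmod (fst (snd j)) = 1" "\<forall>\<^sub>F j in CF F (\<lambda>_. ?T \<times> ?T) g. cmod (snd (snd j)) = 1" for g
   by (rule eventually_mono[OF CF_S[where F = F and S = "\<lambda>_. ?T \<times> ?T"]]; force)+
  show "C0 F (\<lambda>_. ?T \<times> ?T) ?Q ?P"
  proof (rule C0_I)
   let ?G = "CF F (\<lambda>_. ?T \<times> ?T) ?Q"
   note sc1 = sc[OF CF_fst T(1)] and sc2 = sc[OF CF_fst T(2)]
   have "aeq ?G (\<lambda>j. k (fst j)) (\<lambda>j. Z (fst j) (fst (snd j))) (\<lambda>j. Z (fst j) (snd (snd j)))"
    unfolding aeq_def dist by (rule CF_g)
   then have "aeq ?G (\<lambda>j. l (fst j)) (\<lambda>j. h (fst j) (Z (fst j) (fst (snd j)))) (\<lambda>j. h (fst j) (Z (fst j) (snd (snd j))))"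
    by (rule amap_cont[OF A CF_fst ZE[OF T(1)] ZE[OF T(2)]])
   from aeq_sandwich'[OF sc1 sc2 this] show "((\<lambda>j. ?P (fst j) (snd j)) \<longlongrightarrow> 0) ?G" by (simp add: aeq_def dist)
  qed simp
  show "C0 F (\<lambda>_. ?T \<times> ?T) ?P ?Q"
  proof (rule C0_I)
   let ?G = "CF F (\<lambda>_. ?T \<times> ?T) ?P"
   note sc1 = sc[OF CF_fst T(1)] and sc2 = sc[OF CF_fst T(2)]
   have "aeq ?G (\<lambda>j. l (fst j)) (\<lambda>j. Y (fst j) (ch (fst j) (fst (snd j)))) (\<lambda>j. Y (fst j) (ch (fst j) (snd (snd j))))"
    unfolding aeq_def dist by (rule CF_g)
   from aeq_sandwich[OF sc1 sc2 this]
   have "aeq ?G (\<lambda>j. k (fst j)) (\<lambda>j. Z (fst j) (fst (snd j))) (\<lambda>j. Z (fst j) (snd (snd j)))"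
    by (rule amap_inj[OF A CF_fst ZE[OF T(1)] ZE[OF T(2)]])
   then show "((\<lambda>j. ?Q (fst j) (snd j)) \<longlongrightarrow> 0) ?G" by (simp add: aeq_def dist)
  qed simp
 qed
qed

text \<open>The almost character on the scalars decides at each index whether to conjugate
  entrywise. Compatibility with phases follows, because a phase times \<open>u\<close> is a scalar
  matrix times \<open>u\<close>.\<close>

theorem conj_fix:
 fixes F :: "'i filter"
 assumes A: "amap F k l h" and S: "asurj F k l h" and l: "\<And>i. l i > 0" and k: "\<And>i. k i > 0"
 obtains s where "amap F k l (\<lambda>i u. cjs (s i) (h i u))" "acent F k l (\<lambda>i u. cjs (s i) (h i u))"
proof -
 let ?T = "{c. cmod c = 1}" let ?Z = "\<lambda>i c. csc c (fid (k i))" let ?Y = "\<lambda>i c. csc c (fid (l i))"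
 obtain ch where ch: "\<And>i c. cmod (ch i c) = 1"
  "U0 F (\<lambda>i. ?T) (\<lambda>i c. nn (l i) (h i (?Z i c) - ?Y i (ch i c)))"
  by (rule centre_scalar[OF A S l], rule that)
 have sc: "aeq G (\<lambda>j. l (p j)) (\<lambda>j. h (p j) (?Z (p j) (c j))) (\<lambda>j. ?Y (p j) (ch (p j) (c j)))"
  if "filterlim p F G" "\<forall>\<^sub>F j in G. cmod (c j) = 1" for G :: "'j filter" and p c
  unfolding aeq_def by (rule U0_seq[OF ch(2) that(1)]) (use that(2) in auto)
 have dist: "nn (l i) (?Y i a - ?Y i b) = cmod (a - b)" "nn (k i) (?Z i a - ?Z i b) = cmod (a - b)" for i a b
  using l k by (simp_all add: csc_diff_left[symmetric] nn_csc_fid)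
 have ZU: "\<forall>\<^sub>F j in G. ?Z (p j) (c j) \<in> UU (k (p j))" if "\<forall>\<^sub>F j in G. cmod (c j) = 1" for G :: "'j filter" and p c
  using that by eventually_elim simp
 have C: "circle_asym F ch"
  by (rule circle_of_embed[OF A ch])
   (use dist in \<open>auto simp: mult.commute\<close>)
 define s where "s i = (0 \<le> Im (ch i \<i>))" for i
 have hcA: "amap F k l (\<lambda>i u. cjs (s i) (h i u))" by (rule amap_comp[OF A amap_cjs])
 have "acent F k l (\<lambda>i u. cjs (s i) (h i u))"
 proof (rule acent_I)
  fix c :: "'i => complex" and u assume cu: "\<And>i. cmod (c i) = 1" "\<And>i. u i \<in> UU (k i)"
  let ?h = "\<lambda>i u. cjs (s i) (h i u)"
  have ev: "\<forall>\<^sub>F i in F. cmod (c i) = 1" "\<forall>\<^sub>F i in F. u i \<in> UU (k i)" using cu by auto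
  have con: "\<forall>\<^sub>F i in F. con (?h i (u i))" by (rule amap_con[OF hcA ev(2)])
  have 1: "aeq F l (\<lambda>i. ?Y i (ch i (c i))) (\<lambda>i. ?Y i (if s i then c i else cnj (c i)))"
   unfolding aeq_def dist s_def by (rule U0_seq[OF circle_asym.circle_id_or_cnj[OF C] filterlim_ident]) (use cu(1) in auto)
  have "aeq F l (\<lambda>i. h i (?Z i (c i))) (\<lambda>i. ?Y i (if s i then c i else cnj (c i)))"
   by (rule aeq_trans[OF sc[OF filterlim_ident ev(1)] 1])
  then have 2: "aeq F l (\<lambda>i. ?h i (?Z i (c i))) (\<lambda>i. ?Y i (c i))"
  proof (rule aeq_mono)
   have "?Y i (c i) = cjs (s i) (?Y i (if s i then c i else cnj (c i)))" for i by (simp add: cjs_csc)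
   then show "\<forall>\<^sub>F i in F. norm (?h i (?Z i (c i)) - ?Y i (c i)) \<le> norm (h i (?Z i (c i)) - ?Y i (if s i then c i else cnj (c i)))"
    by (simp add: cjs_diff[symmetric] del: cjs_csc)
  qed
  have "aeq F l (\<lambda>i. ?h i (?Z i (c i) * u i)) (\<lambda>i. ?h i (?Z i (c i)) * ?h i (u i))"
   by (rule amap_mult[OF hcA filterlim_ident ZU[OF ev(1)] ev(2)])
  also have "aeq F l \<dots> (\<lambda>i. ?Y i (c i) * ?h i (u i))"
   by (rule aeq_right[OF 2 con])
  finally show "aeq F l (\<lambda>i. ?h i (csc (c i) (u i))) (\<lambda>i. csc (c i) (?h i (u i)))"
   using UU_MM[OF cu(2)] UU_MM[OF amap_maps[OF hcA cu(2)]] by simp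
 qed
 then show ?thesis using that[of s] hcA by simp
qed

text \<open>\<open>f i w\<close> is the distance from \<open>w\<close> to the image. Asymptotic
  surjectivity makes it tend to 0 uniformly, and \<open>h'\<close> picks a preimage that is optimal
  up to 1/(i + 1).\<close>

lemma quasi_inverse:
 fixes k l :: "nat => nat"
 assumes A: "amap sequentially k l h" and S: "asurj sequentially k l h"
 obtains h' where "amap sequentially l k h'" "asurj sequentially l k h'"
proof -
 define f where "f i w = (INF u\<in>UU (k i). nn (l i) (h i u - w))" for i w
 have bd: "bdd_below ((\<lambda>u. nn (l i) (h i u - w)) ` UU (k i))" for i w by (rule bdd_belowI2[of _ 0]) simp
 have ne: "UU (k i) \<noteq> {}" for i using UU_fid by blast
 have f0: "0 \<le> f i w" for i w unfolding f_def by (rule cINF_greatest[OF ne]) simp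
 have U: "U0 sequentially (\<lambda>i. UU (l i)) f"
 proof (rule U0_I)
  fix w assume w: "\<And>i. w i \<in> UU (l i)"
  then obtain u where u: "\<And>i. u i \<in> UU (k i)" "aeqs l (\<lambda>i. h i (u i)) w" using S unfolding asurj_def by blast
  show "(\<lambda>i. f i (w i)) \<longlonglongrightarrow> 0"
  proof (rule tendsto_0_le_ev[OF u(2)[unfolded aeq_def]])
   show "\<forall>\<^sub>F i in sequentially. 0 \<le> f i (w i) \<and> f i (w i) \<le> nn (l i) (h i (u i) - w i)"
    using f0 by (auto intro!: always_eventually simp: f_def intro: cINF_lower[OF bd u(1)])
  qed
 qed (use UU_fid in blast)
 have "\<exists>u. u \<in> UU (k i) \<and> nn (l i) (h i u - w) < f i w + inverse (Suc i)" for i w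
 proof -
  have "f i w < f i w + inverse (Suc i)" by simp
  then show ?thesis unfolding f_def cINF_less_iff[OF ne bd] by blast
 qed
 then obtain h' where h': "\<And>i w. h' i w \<in> UU (k i)" "\<And>i w. nn (l i) (h i (h' i w) - w) < f i w + inverse (Suc i)" by metis
 have near: "anear sequentially l l (\<lambda>i w. h i (h' i w)) (\<lambda>i w. w)"
 proof (rule anear_I)
  fix w assume w: "\<And>i. w i \<in> UU (l i)"
  have "(\<lambda>i. f i (w i)) \<longlonglongrightarrow> 0" by (rule U0_seq[OF U filterlim_ident]) (use w f0 in auto)
  from tendsto_add_zero[OF this LIMSEQ_inverse_real_of_nat]
  show "aeqs l (\<lambda>i. h i (h' i (w i))) w"
   unfolding aeq_def by (rule tendsto_0_le_ev) (use h'(2) in \<open>auto intro!: always_eventually less_imp_le\<close>)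
 qed
 have A': "amap sequentially l k h'" by (rule amap_pull[OF amap_id A h'(1) near])
 have "asurj sequentially l k h'"
  unfolding asurj_def
 proof (intro allI impI exI conjI)
  fix u i assume u: "\<forall>i. u i \<in> UU (k i)"
  show "h i (u i) \<in> UU (l i)" using amap_maps[OF A] u by blast
  have ev: "\<forall>\<^sub>F i in sequentially. h i (u i) \<in> UU (l i)" using amap_maps[OF A] u by simp
  have "aeqs l (\<lambda>i. h i (h' i (h i (u i)))) (\<lambda>i. h i (u i))"
   by (rule anear_seq[OF near filterlim_ident ev])
  then show "aeqs k (\<lambda>i. h' i (h i (u i))) u"
   by (rule amap_inj[OF A filterlim_ident, rotated 2]) (use h'(1) u in auto)
 qed
 then show ?thesis using that A' by blast
qed

text \<open>The Weyl basis of U(k) is mapped to an almost projective representation in U(l), which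
  \<open>anchor_dim\<close> allows only if \<open>l\<close> is not much smaller than
  \<open>k\<close>.\<close>

lemma dim_half:
 assumes A: "amap F k l h" and Ce: "acent F k l h" and k: "\<And>i. k i > 0" and l: "\<And>i. l i > 0"
 obtains D where "(D \<longlongrightarrow> 0) F" "\<And>i. real (k i) - real (l i) \<le> D i * real (k i)"
proof -
 obtain D where D: "(D \<longlongrightarrow> 0) F" "\<And>i. 0 \<le> D i"
  "\<And>i b c z d. b \<in> UU (k i) ==> c \<in> UU (k i) ==> d \<in> UU (k i) ==> cmod z = 1 ==> b * c = csc z d ==>
   norm (h i b * h i c - csc z (h i d)) \<le> D i * sqrt (l i)"
  by (rule amap_defect[OF A Ce l], rule that)
 have "real (k i) - real (l i) \<le> 2 * D i * real (k i)" for i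
 proof (cases "l i \<le> k i")
  case True
  note H = neb_heis[OF k[of i]]
  show ?thesis
   by (rule anchor_dim[OF H l True, of "h i"]) (use amap_maps[OF A] nebD(3)[OF H] D(2,3) in auto)
 next
  case False
  then have "real (k i) - real (l i) \<le> 0" by simp
  also have "0 \<le> 2 * D i * real (k i)" using D(2)[of i] by simp
  finally show ?thesis .
 qed
 moreover have "((\<lambda>i. 2 * D i) \<longlongrightarrow> 0) F" using tendsto_mult_right_zero[OF D(1), of 2] by simp
 ultimately show ?thesis by (rule that[rotated])
qed

theorem dims_asym:
 fixes k l :: "nat => nat"
 assumes A: "amap sequentially k l h" and S: "asurj sequentially k l h" and k: "\<And>i. k i > 0" and l: "\<And>i. l i > 0"
 shows "asim sequentially k l"
proof -
 obtain s where s: "amap sequentially k l (\<lambda>i u. cjs (s i) (h i u))" "acent sequentially k l (\<lambda>i u. cjs (s i) (h i u))"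
  by (rule conj_fix[OF A S l k], rule that)
 obtain D where D: "(D \<longlongrightarrow> 0) sequentially" "\<And>i. real (k i) - real (l i) \<le> D i * real (k i)"
  by (rule dim_half[OF s k l], rule that)
 obtain h' where h': "amap sequentially l k h'" "asurj sequentially l k h'" by (rule quasi_inverse[OF A S])
 obtain s' where s': "amap sequentially l k (\<lambda>i u. cjs (s' i) (h' i u))" "acent sequentially l k (\<lambda>i u. cjs (s' i) (h' i u))"
  by (rule conj_fix[OF h' k l], rule that)
 obtain D' where D': "(D' \<longlongrightarrow> 0) sequentially" "\<And>i. real (l i) - real (k i) \<le> D' i * real (l i)"
  by (rule dim_half[OF s' l k], rule that)
 have "(\<lambda>i. real (k i) / real (l i)) \<longlonglongrightarrow> 1"
 proof (rule tendsto_sandwich)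
  have "(\<lambda>i. 1 - D' i) \<longlonglongrightarrow> 1 - 0" by (intro tendsto_intros D')
  then show "(\<lambda>i. 1 - D' i) \<longlonglongrightarrow> 1" by simp
  have "(\<lambda>i. 1 / (1 - D i)) \<longlonglongrightarrow> 1 / (1 - 0)" by (intro tendsto_intros D) simp
  then show "(\<lambda>i. 1 / (1 - D i)) \<longlonglongrightarrow> 1" by simp
  have "1 - D' i \<le> real (k i) / real (l i)" for i using D'(2)[of i] l[of i] by (simp add: field_simps)
  then show "\<forall>\<^sub>F i in sequentially. 1 - D' i \<le> real (k i) / real (l i)" by simp
  have "\<forall>\<^sub>F i in sequentially. D i < 1" by (rule order_tendstoD(2)[OF D(1)]) simp
  then show "\<forall>\<^sub>F i in sequentially. real (k i) / real (l i) \<le> 1 / (1 - D i)"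
  proof eventually_elim
   case (elim i)
   have "real (k i) * (1 - D i) \<le> real (l i)" using D(2)[of i] by (simp add: algebra_simps)
   then show ?case using elim l[of i] by (simp add: field_simps)
  qed
 qed
 then show ?thesis using k l by (simp add: asim_def)
qed

section \<open>Two by two blocks and the cosine-sine decomposition\<close>

definition B2 :: "nat => fmat => fmat => fmat => fmat => fmat" where
 "B2 m a b c d = kr m (eu 0 0) a + kr m (eu 0 1) b + kr m (eu 1 0) c + kr m (eu 1 1) d"

context
 fixes m :: nat assumes m: "m > 0"
begin

lemma ent_B2: "ent (B2 m a b c d) i j =
 (if i div m = 0 then (if j div m = 0 then ent a (i mod m) (j mod m) else if j div m = 1 then ent b (i mod m) (j mod m) else 0)
  else if i div m = 1 then (if j div m = 0 then ent c (i mod m) (j mod m) else if j div m = 1 then ent d (i mod m) (j mod m) else 0) else 0)"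
 unfolding B2_def using m by (auto simp: ent_kr)

lemma B2_MM [simp]: "B2 m a b c d \<in> MM (2 * m)"
proof -
 have "kr m (eu p q) x \<in> MM (2 * m)" if "p < 2" "q < 2" for p q x
  by (rule kr_MM[OF MM_eu[OF that] m])
 then show ?thesis unfolding B2_def by simp
qed

lemma B2_mult:
 assumes "a \<in> MM m" "b \<in> MM m" "c \<in> MM m" "d \<in> MM m"
 shows "B2 m a b c d * B2 m a' b' c' d' = B2 m (a * a' + b * c') (a * b' + b * d') (c * a' + d * c') (c * b' + d * d')"
 unfolding B2_def using assms m
 by (simp add: distrib_left distrib_right kr_mult eu_mult kr_0 kr_add_right)

lemma B2_add: "B2 m a b c d + B2 m a' b' c' d' = B2 m (a + a') (b + b') (c + c') (d + d')"
 unfolding B2_def by (simp add: kr_add_right m)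
lemma B2_uminus: "- B2 m a b c d = B2 m (- a) (- b) (- c) (- d)"
 unfolding B2_def by (simp add: kr_uminus m)
lemma B2_csc: "csc z (B2 m a b c d) = B2 m (csc z a) (csc z b) (csc z c) (csc z d)"
 unfolding B2_def by (simp add: kr_csc_right csc_add_right m)
lemma B2_adj: "adj (B2 m a b c d) = B2 m (adj a) (adj c) (adj b) (adj d)"
 unfolding B2_def by (simp add: adj_kr m)
lemma B2_0: "B2 m 0 0 0 0 = 0" unfolding B2_def by (simp add: kr_0 m)
lemma fid_2: "fid 2 = eu 0 0 + eu 1 1" by (rule fmat_eqI) auto
lemma B2_diag: "B2 m x 0 0 x = kr m (fid 2) x"
 unfolding B2_def fid_2 by (simp add: kr_0 kr_add_left m)
lemma B2_fid: "B2 m (fid m) 0 0 (fid m) = fid (2 * m)"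
 unfolding B2_diag by (rule kr_fid[OF m])

lemma B2_inj:
 assumes "B2 m a b c d = B2 m a' b' c' d'" "a \<in> MM m" "b \<in> MM m" "c \<in> MM m" "d \<in> MM m"
  "a' \<in> MM m" "b' \<in> MM m" "c' \<in> MM m" "d' \<in> MM m"
 shows "a = a' \<and> b = b' \<and> c = c' \<and> d = d'"
proof -
 have e: "(if p = 0 then (if q = 0 then ent a i j else ent b i j) else (if q = 0 then ent c i j else ent d i j)) =
  (if p = 0 then (if q = 0 then ent a' i j else ent b' i j) else (if q = 0 then ent c' i j else ent d' i j))"
  if "i < m" "j < m" "p < 2" "q < 2" for p q i j :: nat
 proof -
  have r: "p = 0 \<or> p = 1" "q = 0 \<or> q = 1" using that by auto
  have "ent (B2 m a b c d) (p * m + i) (q * m + j) = ent (B2 m a' b' c' d') (p * m + i) (q * m + j)"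
   using assms(1) by simp
  then show ?thesis using that(1,2) r by (auto simp: ent_B2)
 qed
 show ?thesis
 proof (intro conjI)
  show "a = a'" by (rule MM_eqI[OF assms(2,6)]) (use e[of _ _ 0 0] in simp)
  show "b = b'" by (rule MM_eqI[OF assms(3,7)]) (use e[of _ _ 0 1] in simp)
  show "c = c'" by (rule MM_eqI[OF assms(4,8)]) (use e[of _ _ 1 0] in simp)
  show "d = d'" by (rule MM_eqI[OF assms(5,9)]) (use e[of _ _ 1 1] in simp)
 qed
qed

lemma B2_ex:
 assumes "x \<in> MM (2 * m)"
 obtains a b c d where "a \<in> MM m" "b \<in> MM m" "c \<in> MM m" "d \<in> MM m" "x = B2 m a b c d"
proof -
 have "x = B2 m (mk m (\<lambda>i j. ent x i j)) (mk m (\<lambda>i j. ent x i (m + j)))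
  (mk m (\<lambda>i j. ent x (m + i) j)) (mk m (\<lambda>i j. ent x (m + i) (m + j)))"
  by (subst decomp_outer[OF assms m]) (simp add: numeral_2_eq_2 B2_def)
 then show ?thesis by (rule that[rotated 4]) simp_all
qed

lemma B2_UU_diag: "a \<in> UU m ==> d \<in> UU m ==> B2 m a 0 0 d \<in> UU (2 * m)"
 by (rule UU_I) (simp_all add: B2_adj B2_mult UU_D B2_fid)

end

text \<open>The Hadamard matrix on the outer qubit; conjugation by it exchanges the Pauli matrices
  \<open>PX\<close> and \<open>PZ\<close>.\<close>

definition had :: "nat => fmat" where
 "had m = csc (of_real (1 / sqrt 2)) (B2 m (fid m) (fid m) (fid m) (- fid m))"

lemma csc_half: "csc (1 / 2) (x + x) = x" by (rule fmat_eqI) simp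

lemma had_sq: "complex_of_real (1 / sqrt 2) * complex_of_real (1 / sqrt 2) = 1 / 2"
proof -
 have "complex_of_real (1 / sqrt 2) * complex_of_real (1 / sqrt 2) = complex_of_real ((1 / sqrt 2) * (1 / sqrt 2))"
  by (rule of_real_mult[symmetric])
 also have "(1 / sqrt 2) * (1 / sqrt 2) = (1 / 2 :: real)" by simp
 finally show ?thesis by simp
qed

lemma had_sandwich:
 assumes m: "m > 0" and "a \<in> MM m" "b \<in> MM m" "c \<in> MM m" "d \<in> MM m"
 shows "had m * B2 m a b c d * had m = B2 m (csc (1 / 2) (a + b + c + d)) (csc (1 / 2) (a - b + c - d))
  (csc (1 / 2) (a + b - c - d)) (csc (1 / 2) (a - b - c + d))"
proof -
 have "had m * B2 m a b c d * had m = csc (1 / 2) (B2 m (fid m) (fid m) (fid m) (- fid m) * B2 m a b c d * B2 m (fid m) (fid m) (fid m) (- fid m))"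
  unfolding had_def using had_sq by simp
 also have "\<dots> = csc (1 / 2) (B2 m (a + b + c + d) (a - b + c - d) (a + b - c - d) (a - b - c + d))"
  using assms by (simp add: B2_mult algebra_simps)
 finally show ?thesis using m by (simp add: B2_csc)
qed

lemma had_adj: "m > 0 ==> adj (had m) = had m" by (simp add: had_def B2_adj)

lemma had_UU: assumes m: "m > 0" shows "had m \<in> UU (2 * m)"
proof -
 have "had m * had m = fid (2 * m)"
  using had_sandwich[OF m, of "fid m" 0 0 "fid m"] m by (simp add: B2_fid csc_half) (simp add: had_def)
 then show ?thesis using m by (intro UU_I) (simp_all add: had_adj, simp add: had_def)
qed

text \<open>If the upper left block is x S y* by singular values, the lower left block times
  \<open>y\<close> is x' y'* T with T the root of 1 - S^2. The rotation \<open>R\<close> with blocks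
  S, iT, iT, S is the Hadamard conjugate of the diagonal unitaries S + iT and S - iT. Once it is
  removed, the first block column is that of the identity, so unitarity leaves only a block
  \<open>G\<close> in the lower right corner.\<close>

theorem cs_decomposition:
 assumes m: "m > 0" and u: "u \<in> UU (2 * m)"
 obtains x1 x2 d1 d2 w y where "x1 \<in> UU m" "x2 \<in> UU m" "d1 \<in> UU m" "d2 \<in> UU m" "w \<in> UU m" "y \<in> UU m"
  "u = B2 m x1 0 0 x2 * (had m * B2 m d1 0 0 d2 * had m) * B2 m (fid m) 0 0 w * B2 m y 0 0 (fid m)"
proof -
 obtain A Bb C D where M: "A \<in> MM m" "Bb \<in> MM m" "C \<in> MM m" "D \<in> MM m" and uB: "u = B2 m A Bb C D"
  by (rule B2_ex[OF m UU_MM[OF u]])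
 have "adj u * u = fid (2 * m)" using u by (simp add: UU_D)
 then have "B2 m (adj A * A + adj C * C) (adj A * Bb + adj C * D) (adj Bb * A + adj D * C) (adj Bb * Bb + adj D * D) = B2 m (fid m) 0 0 (fid m)"
  using m M by (simp add: uB B2_adj B2_mult B2_fid)
 from B2_inj[OF m this] have AC: "adj A * A + adj C * C = fid m" using M by simp
 obtain x y s where xy: "x \<in> UU m" "y \<in> UU m" "\<And>i. 0 \<le> s i" "A = x * dg m (\<lambda>i. of_real (s i)) * adj y"
  by (rule svd[OF M(1)], rule that)
 obtain x' y' r where xy': "x' \<in> UU m" "y' \<in> UU m" "\<And>i. 0 \<le> r i" "C * y = x' * dg m (\<lambda>i. of_real (r i)) * adj y'"
  by (rule svd[OF MM_mult[OF M(3) UU_MM[OF xy(2)]]], rule that)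
 let ?S = "dg m (\<lambda>i. of_real (s i))" and ?R = "dg m (\<lambda>i. of_real (r i))"
 have Ay: "A * y = x * ?S" using xy M by (simp add: mult.assoc UU_D)
 have "adj y * (adj A * A + adj C * C) * y = adj y * y" using xy(2) AC by simp
 then have "adj (A * y) * (A * y) + adj (C * y) * (C * y) = fid m"
  using xy(2) by (simp add: algebra_simps UU_D)
 moreover have "adj (A * y) * (A * y) = ?S * ?S"
 proof -
  have "adj (x * ?S) * (x * ?S) = adj ?S * (adj x * (x * ?S))" by (simp add: mult.assoc)
  then show ?thesis using xy(1) by (simp add: Ay UU_canc adj_dg)
 qed
 moreover have "adj (C * y) * (C * y) = y' * (?R * ?R) * adj y'"
 proof -
  have "adj (x' * ?R * adj y') * (x' * ?R * adj y') = y' * adj ?R * (adj x' * (x' * (?R * adj y')))" by (simp add: mult.assoc)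
  then show ?thesis using xy'(1,2) by (simp add: xy'(4) UU_canc adj_dg mult.assoc)
 qed
 ultimately have "?S * ?S + y' * (?R * ?R) * adj y' = fid m" by metis
 then have "y' * (?R * ?R) * adj y' = fid m - ?S * ?S" by (metis add_diff_cancel_left')
 also have "\<dots> = dg m (\<lambda>i. of_real (1 - (s i)\<^sup>2))"
  unfolding dg_mult by (rule fmat_eqI) (simp add: power2_eq_square)
 finally have SR: "y' * (?R * ?R) * adj y' = dg m (\<lambda>i. of_real (1 - (s i)\<^sup>2))" .
 define t where "t i = sqrt (1 - (s i)\<^sup>2)" for i
 have eq: "y' * (?R * ?R) = dg m (\<lambda>i. of_real (1 - (s i)\<^sup>2)) * y'"
 proof -
  have "y' * (?R * ?R) = (y' * (?R * ?R) * adj y') * y'" using xy'(2) by (simp add: mult.assoc UU_D)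
  then show ?thesis unfolding SR .
 qed
 have dgl: "ent (dg m f * z) i j = (if i < m then f i * ent z i j else 0)" for f z i j
 proof -
  have "ent (dg m f * z) i j = (\<Sum>k<m. if k = i then f i * ent z i j else 0)"
   unfolding ent_mult[of "dg m f" m z, OF disjI1[OF dg_MM]] using MM_zero by (intro sum.cong) auto
  then show ?thesis by simp
 qed
 have dgr: "ent (z * dg m f) i j = (if j < m then ent z i j * f j else 0)" for f z i j
 proof -
  have "ent (z * dg m f) i j = (\<Sum>k<m. if k = j then ent z i j * f j else 0)"
   unfolding ent_mult[of z m "dg m f", OF disjI2[OF dg_MM]] by (intro sum.cong) auto
  then show ?thesis by simp
 qed
 \<comment> \<open>\<open>y'\<close> intertwines the squares of two nonnegative diagonals, so an
   entry of \<open>y'\<close> is nonzero only where the squares agree, and there the roots agree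
   too.\<close>
 have key: "ent y' i j = 0 \<or> (s i)\<^sup>2 \<le> 1 \<and> r j = t i" if ij: "i < m" "j < m" for i j
 proof (rule disjCI)
  assume nz: "\<not> ((s i)\<^sup>2 \<le> 1 \<and> r j = t i)"
  have "ent y' i j * of_real (r j * r j) = of_real (1 - (s i)\<^sup>2) * ent y' i j"
   using arg_cong[OF eq, of "\<lambda>z. ent z i j"] ij by (simp add: dg_mult dgl dgr)
  then have "ent y' i j * of_real (r j * r j - (1 - (s i)\<^sup>2)) = 0" by (simp add: algebra_simps)
  then consider "ent y' i j = 0" | "r j * r j = 1 - (s i)\<^sup>2" by (auto simp del: of_real_diff of_real_mult)
  then show "ent y' i j = 0"
  proof cases
   case 2
   have "0 \<le> r j * r j" by simp
   then have "(s i)\<^sup>2 \<le> 1" using 2 by linarith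
   moreover have "r j = t i" unfolding t_def 2[symmetric] using xy'(3)[of j] by simp
   ultimately show ?thesis using nz by blast
  qed
 qed
 let ?T = "dg m (\<lambda>i. of_real (t i))"
 have "y' * ?R = ?T * y'"
 proof (rule MM_eqI[of _ m])
  fix i j assume "i < m" "j < m"
  then show "ent (y' * ?R) i j = ent (?T * y') i j" using key[of i j] by (auto simp: dgl dgr mult.commute)
 qed (use xy' in auto)
 then have "adj (y' * ?R) = adj (?T * y')" by simp
 then have "?R * adj y' = adj y' * ?T" by (simp add: adj_dg)
 then have Cy: "C * y = x' * adj y' * ?T" unfolding xy'(4) by (simp add: mult.assoc)
 have s1: "(s i)\<^sup>2 \<le> 1" if i: "i < m" for i
 proof (rule ccontr)
  assume n: "\<not> (s i)\<^sup>2 \<le> 1"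
  have "ent y' i j = 0" for j using key[OF i, of j] n MM_zero[OF UU_MM[OF xy'(2)], of i j] by blast
  then have "ent (y' * adj y') i i = 0" by (simp add: ent_mult[of y' m "adj y'"] xy'(2))
  then show False using i xy'(2) by (simp add: UU_D)
 qed
 then have st: "(s i)\<^sup>2 + (t i)\<^sup>2 = 1" if "i < m" for i using that by (simp add: t_def)
 \<comment> \<open>The factor -i compensates the i in the off-diagonal block iT of the
   rotation.\<close>
 define x2 where "x2 = csc (- \<i>) (x' * adj y')"
 have x2: "x2 \<in> UU m" unfolding x2_def using xy' by auto
 define iT where "iT = dg m (\<lambda>i. \<i> * of_real (t i))"
 have Cy2: "C * y = x2 * iT"
  unfolding Cy x2_def iT_def dg_csc[symmetric] by simp
 define d1 d2 where "d1 = dg m (\<lambda>i. of_real (s i) + \<i> * of_real (t i))" and "d2 = dg m (\<lambda>i. of_real (s i) - \<i> * of_real (t i))"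
 have cm: "cmod (of_real (s i) + \<i> * of_real (t i)) = 1" "cmod (of_real (s i) - \<i> * of_real (t i)) = 1" if "i < m" for i
  using st[OF that] by (simp_all add: cmod_def)
 have d: "d1 \<in> UU m" "d2 \<in> UU m" unfolding d1_def d2_def by (rule UU_dg, erule cm)+
 have dd: "d1 + d2 = csc 2 ?S" "d1 - d2 = csc 2 iT" unfolding d1_def d2_def iT_def
  by (simp_all add: dg_add dg_diff dg_csc)
 define R where "R = had m * B2 m d1 0 0 d2 * had m"
 have R: "R = B2 m ?S iT iT ?S"
  unfolding R_def using had_sandwich[OF m, of d1 0 0 d2] d dd by simp
 have RU: "R \<in> UU (2 * m)" unfolding R_def using had_UU[OF m] B2_UU_diag[OF m d] by auto
 define N where "N = adj R * (adj (B2 m x 0 0 x2) * (u * B2 m y 0 0 (fid m)))"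
 have XU: "B2 m x 0 0 x2 \<in> UU (2 * m)" "B2 m y 0 0 (fid m) \<in> UU (2 * m)"
  using B2_UU_diag[OF m] xy x2 by auto
 have NU: "N \<in> UU (2 * m)" unfolding N_def using RU XU u by auto
 have uN: "u = B2 m x 0 0 x2 * R * N * adj (B2 m y 0 0 (fid m))"
 proof -
  have "B2 m x 0 0 x2 * R * N = u * B2 m y 0 0 (fid m)"
   unfolding N_def using RU XU u by (simp add: mult.assoc UU_canc)
  then show ?thesis using XU(2) u by (simp add: mult.assoc UU_D)
 qed
 have "u * B2 m y 0 0 (fid m) = B2 m (x * ?S) Bb (x2 * iT) D"
  using M m Ay Cy2 by (simp add: uB B2_mult)
 then have L: "adj (B2 m x 0 0 x2) * (u * B2 m y 0 0 (fid m)) = B2 m ?S (adj x * Bb) iT (adj x2 * D)"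
  using m xy(1) x2 by (simp add: B2_adj B2_mult UU_canc iT_def)
 have iTM: "iT \<in> MM m" by (simp add: iT_def)
 have aT: "adj iT = - iT" unfolding iT_def adj_dg by (rule fmat_eqI) auto
 have aS: "adj ?S = ?S" by (simp add: adj_dg)
 have n1: "?S * ?S + - iT * iT = fid m"
 proof -
  have "?S * ?S + - iT * iT = dg m (\<lambda>i. of_real ((s i)\<^sup>2 + (t i)\<^sup>2))"
   unfolding iT_def by (simp add: dg_mult) (rule fmat_eqI, simp add: power2_eq_square complex_eq_iff)
  also have "\<dots> = fid m" unfolding dg_1[symmetric] by (rule dg_cong) (simp only: st of_real_1)
  finally show ?thesis .
 qed
 have n2: "- iT * ?S + ?S * iT = 0" unfolding iT_def by (simp add: dg_mult mult.commute)
 define E where "E = ?S * (adj x * Bb) + - iT * (adj x2 * D)"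
 define G where "G = - iT * (adj x * Bb) + ?S * (adj x2 * D)"
 have EG: "E \<in> MM m" "G \<in> MM m" unfolding E_def G_def using M xy(1) x2 iTM by simp_all
 have "N = B2 m (?S * ?S + - iT * iT) E (- iT * ?S + ?S * iT) G"
  unfolding N_def L unfolding R B2_adj[OF m] aT aS E_def G_def by (rule B2_mult[OF m]) (use iTM in simp_all)
 then have N: "N = B2 m (fid m) E 0 G" unfolding n1 n2 .
 have "B2 m (fid m) E (adj E) (adj E * E + adj G * G) = B2 m (fid m) 0 0 (fid m)"
  using UU_D(2)[OF NU] m EG by (simp add: N B2_adj B2_mult B2_fid)
 then have "fid m = fid m \<and> E = 0 \<and> adj E = 0 \<and> adj E * E + adj G * G = fid m"
  by (rule B2_inj[OF m]) (use EG in simp_all)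
 then have EG': "E = 0" "adj G * G = fid m" by auto
 then have G: "G \<in> UU m" using left_inv_right_inv[OF EG(2)] by simp
 show ?thesis
  by (rule that[OF xy(1) x2 d G UU_adj[OF xy(2)]])
   (subst uN, simp add: R_def[symmetric] N EG' B2_adj m)
qed

abbreviation PX :: "nat => fmat" where "PX m \<equiv> B2 m 0 (fid m) (fid m) 0"
abbreviation PZ :: "nat => fmat" where "PZ m \<equiv> B2 m (fid m) 0 0 (- fid m)"

lemma PX_UU: "m > 0 ==> PX m \<in> UU (2 * m)"
 by (rule UU_I) (simp_all add: B2_mult B2_adj B2_fid)

lemma PZ_UU: "m > 0 ==> PZ m \<in> UU (2 * m)"
 by (rule UU_I) (simp_all add: B2_mult B2_adj B2_fid)

lemma csc_half_neg: "csc (1 / 2) (- x - x) = - x" by (rule fmat_eqI) simp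

lemma had_conj:
 assumes m: "m > 0"
 shows "had m * PX m * had m = PZ m" "had m * PZ m * had m = PX m"
  "g \<in> MM m ==> had m * B2 m g 0 0 g * had m = B2 m g 0 0 g"
 using m by (simp_all add: had_sandwich csc_half csc_half_neg)

lemma kr_heis_2:
 assumes m: "m > 0" and p: "p \<in> heis 2" and y: "y \<in> MM m"
 shows "\<exists>a c. kr m p y = (if a then PX m else fid (2 * m)) * (if c then PZ m else fid (2 * m)) * B2 m y 0 0 y"
proof -
 obtain a c :: nat where ac: "a < 2" "c < 2" "p = hb 2 a c" using p unfolding heis_def by auto
 have hb: "hb 2 0 0 = eu 0 0 + eu 1 1" "hb 2 1 0 = eu 0 1 + eu 1 0" "hb 2 0 1 = eu 0 0 - eu 1 1" "hb 2 1 1 = eu 1 0 - eu 0 1"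
 proof -
  have c2: "i = 0 \<or> i = 1" if "i < 2" for i :: nat using that by auto
  have e: "x = y" if "x \<in> MM 2" "y \<in> MM 2" "ent x 0 0 = ent y 0 0" "ent x 0 1 = ent y 0 1" "ent x 1 0 = ent y 1 0" "ent x 1 1 = ent y 1 1" for x y
   by (rule MM_eqI[OF that(1,2)]) (use c2 that in blast)
  show "hb 2 0 0 = eu 0 0 + eu 1 1" "hb 2 1 0 = eu 0 1 + eu 1 0" "hb 2 0 1 = eu 0 0 - eu 1 1" "hb 2 1 1 = eu 1 0 - eu 0 1"
   by (rule e; simp add: ent_hb MM_eu)+
 qed
 have "kr m p y = (if a = 1 then PX m else fid (2 * m)) * (if c = 1 then PZ m else fid (2 * m)) * B2 m y 0 0 y"
  using ac(1,2) m y unfolding ac(3) less_2_cases_iff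
  by (elim disjE; simp only: hb One_nat_def[symmetric])
   (simp_all add: B2_mult, simp_all add: B2_def kr_add_left kr_diff_left kr_0 kr_uminus add.commute)
 then show ?thesis by blast
qed

text \<open>An induction principle for the tensored basis. Closure under conditionals enters because
  the exponents of \<open>PX\<close> and \<open>PZ\<close> may change with the index.\<close>

lemma pauli_split:
 assumes M: "\<And>i. M i > 0" and G: "\<And>i. neb (M i) (G i)"
  and mul: "\<And>u v. R u ==> R v ==> R (\<lambda>i. u i * v i)"
  and ifc: "\<And>P u v. R u ==> R v ==> R (\<lambda>i. if P i then u i else v i)"
  and one: "R (\<lambda>i. fid (2 * M i))" and X: "R (\<lambda>i. PX (M i))" and Z: "R (\<lambda>i. PZ (M i))"
  and RG: "\<And>g. (\<And>i. g i \<in> G i) ==> R (\<lambda>i. B2 (M i) (g i) 0 0 (g i))"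
  and b: "\<And>i. b i \<in> krset (M i) (heis 2) (G i)"
 shows "R b"
proof -
 have "\<exists>p g. p \<in> heis 2 \<and> g \<in> G i \<and> b i = kr (M i) p g" for i using b[of i] unfolding krset_def by auto
 then obtain p g where pg: "\<And>i. p i \<in> heis 2" "\<And>i. g i \<in> G i" "\<And>i. b i = kr (M i) (p i) (g i)" by metis
 have "\<exists>a c. b i = (if a then PX (M i) else fid (2 * M i)) * (if c then PZ (M i) else fid (2 * M i)) * B2 (M i) (g i) 0 0 (g i)" for i
  unfolding pg(3) by (rule kr_heis_2[OF M pg(1)]) (use nebD(3)[OF G pg(2)] in auto)
 then obtain a c where "\<And>i. b i = (if a i then PX (M i) else fid (2 * M i)) * (if c i then PZ (M i) else fid (2 * M i)) * B2 (M i) (g i) 0 0 (g i)" by metis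
 then have "b = (\<lambda>i. (if a i then PX (M i) else fid (2 * M i)) * (if c i then PZ (M i) else fid (2 * M i)) * B2 (M i) (g i) 0 0 (g i))" by (rule ext)
 then show ?thesis
  by (simp only:) (rule mul[OF mul[OF ifc[OF X one] ifc[OF Z one]] RG[OF pg(2)]])
qed

lemma aeq_if:
 assumes "aeq F k u u'" "aeq F k v v'"
 shows "aeq F k (\<lambda>i. if P i then u i else v i) (\<lambda>i. if P i then u' i else v' i)"
 unfolding aeq_def
 by (rule tendsto_0_le_ev[OF tendsto_add_zero[OF assms[unfolded aeq_def]]]) (auto intro!: always_eventually)

section \<open>Known elements, normalisers and the doubling step\<close>

locale self_amap =
 fixes F :: "'i filter" and k :: "'i => nat" and \<theta> :: "'i => fmat => fmat"
 assumes A: "amap F k k \<theta>" and Ce: "acent F k k \<theta>"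
begin

text \<open>The sequences of unitaries that the map fixes up to o(1). They are closed under products
  and phases, so the map is near the identity as soon as they contain generators of bounded word
  length.\<close>

definition kn :: "('i => fmat) => bool" where
 "kn u \<longleftrightarrow> (\<forall>i. u i \<in> UU (k i)) \<and> aeq F k (\<lambda>i. \<theta> i (u i)) u"

lemma knU: "kn u ==> u i \<in> UU (k i)" by (simp add: kn_def)
lemma kna: "kn u ==> aeq F k (\<lambda>i. \<theta> i (u i)) u" by (simp add: kn_def)
lemma ev_U: "(\<And>i. u i \<in> UU (k i)) ==> \<forall>\<^sub>F i in F. u i \<in> UU (k i)" by simp
lemma ev_con: "(\<And>i. u i \<in> UU (k i)) ==> \<forall>\<^sub>F i in F. con (u i)" using con_UU by (auto intro!: always_eventually)
lemma ev_con_\<theta>: "(\<And>i. u i \<in> UU (k i)) ==> \<forall>\<^sub>F i in F. con (\<theta> i (u i))"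
 by (rule amap_con[OF A ev_U])

lemma multA: "(\<And>i. u i \<in> UU (k i)) ==> (\<And>i. v i \<in> UU (k i)) ==>
 aeq F k (\<lambda>i. \<theta> i (u i * v i)) (\<lambda>i. \<theta> i (u i) * \<theta> i (v i))"
 by (rule amap_mult[OF A filterlim_ident ev_U ev_U])

lemma kn_mult: assumes u: "kn u" and v: "kn v" shows "kn (\<lambda>i. u i * v i)"
 unfolding kn_def
proof
 show "\<forall>i. u i * v i \<in> UU (k i)" using knU[OF u] knU[OF v] by blast
 have "aeq F k (\<lambda>i. \<theta> i (u i) * \<theta> i (v i)) (\<lambda>i. u i * v i)"
  by (rule aeq_mult[OF kna[OF u] kna[OF v] ev_con_\<theta>[OF knU[OF v]] ev_con[OF knU[OF u]]])
 then show "aeq F k (\<lambda>i. \<theta> i (u i * v i)) (\<lambda>i. u i * v i)"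
  by (rule aeq_trans[OF multA[OF knU[OF u] knU[OF v]]])
qed

lemma kn_csc: assumes u: "kn u" and c: "\<And>i. cmod (c i) = 1" shows "kn (\<lambda>i. csc (c i) (u i))"
 unfolding kn_def
proof
 show "\<forall>i. csc (c i) (u i) \<in> UU (k i)" using knU[OF u] c by blast
 show "aeq F k (\<lambda>i. \<theta> i (csc (c i) (u i))) (\<lambda>i. csc (c i) (u i))"
  by (rule aeq_trans[OF acent_seq[OF Ce filterlim_ident ev_U[OF knU[OF u]]] aeq_csc[OF kna[OF u]]]) (simp_all add: c)
qed

lemma kn_fid: "kn (\<lambda>i. fid (k i))"
 using amap_fid[OF A filterlim_ident] by (simp add: kn_def)

lemma kn_if: assumes u: "kn u" and v: "kn v" shows "kn (\<lambda>i. if P i then u i else v i)"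
 using aeq_if[OF kna[OF u] kna[OF v], of P] knU[OF u] knU[OF v] by (simp add: kn_def if_distrib[of "\<theta> _"] cong: if_cong)

text \<open>\<open>u\<close> and its conjugate by \<open>c\<close> are both known; having this for a
  basis expresses that \<open>c\<close> normalises what is known.\<close>

definition Q :: "('i => fmat) => ('i => fmat) => bool" where
 "Q c u \<longleftrightarrow> kn u \<and> kn (\<lambda>i. c i * u i * adj (c i))"

lemma Q_mult:
 assumes c: "\<And>i. c i \<in> UU (k i)" and u: "Q c u" and v: "Q c v" shows "Q c (\<lambda>i. u i * v i)"
proof -
 have uv: "kn u" "kn v" using u v by (auto simp: Q_def)
 have "c i * u i * adj (c i) * (c i * v i * adj (c i)) = c i * (u i * v i) * adj (c i)" for i
 proof -
  have "c i * u i * adj (c i) * (c i * v i * adj (c i)) = c i * u i * (adj (c i) * (c i * (v i * adj (c i))))" by (simp add: mult.assoc)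
  then show ?thesis using c[of i] knU[OF uv(2), of i] by (simp add: UU_canc mult.assoc)
 qed
 then show ?thesis using u v kn_mult[of u v] kn_mult[of "\<lambda>i. c i * u i * adj (c i)" "\<lambda>i. c i * v i * adj (c i)"]
  by (simp add: Q_def)
qed

lemma Q_if: assumes "Q c u" "Q c v" shows "Q c (\<lambda>i. if P i then u i else v i)"
proof -
 have "(\<lambda>i. c i * (if P i then u i else v i) * adj (c i)) = (\<lambda>i. if P i then c i * u i * adj (c i) else c i * v i * adj (c i))"
  by auto
 then show ?thesis using assms kn_if by (simp add: Q_def)
qed

lemma Q_fid: assumes c: "\<And>i. c i \<in> UU (k i)" shows "Q c (\<lambda>i. fid (k i))"
 using kn_fid UU_MM[OF c] by (simp add: Q_def UU_D(3)[OF c])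

text \<open>If \<open>c\<close> normalises a known error basis, then \<open>\<theta> c\<close> is a phase times \<open>c\<close>, and the phase
 disappears on conjugating with \<open>c\<close>.\<close>

lemma normaliser_conj:
 assumes B: "\<And>i. neb (k i) (B i)" and c: "\<And>i. c i \<in> UU (k i)" and Qb: "\<And>b. (\<And>i. b i \<in> B i) ==> Q c b"
  and u: "kn u"
 shows "kn (\<lambda>i. c i * u i * adj (c i))"
proof -
 define V where "V i = adj (c i) * \<theta> i (c i)" for i
 have \<theta>c: "\<theta> i (c i) \<in> UU (k i)" for i by (rule amap_maps[OF A c])
 have VU: "V i \<in> UU (k i)" for i using c[of i] \<theta>c[of i] by (simp add: V_def UU_mult UU_adj)
 have ac: "adj (c i) \<in> UU (k i)" for i using c by blast
 note cc = ev_con[OF ac] and ct = ev_con[OF \<theta>c]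
 define lam where "lam i = csgn (ftr (V i) / of_nat (k i))" for i
 have V: "aeq F k V (\<lambda>i. csc (lam i) (fid (k i)))"
  unfolding lam_def
 proof (rule approx_scalar[OF B VU])
  fix b assume b: "\<And>i. b i \<in> B i"
  have bU: "b i \<in> UU (k i)" for i using nebD(3)[OF B b] .
  have kb: "kn b" "kn (\<lambda>i. c i * b i * adj (c i))" using Qb[OF b] by (auto simp: Q_def)
  have "aeq F k (\<lambda>i. \<theta> i (c i) * b i) (\<lambda>i. \<theta> i (c i) * \<theta> i (b i))"
   by (rule aeq_left[OF aeq_sym[OF kna[OF kb(1)]] ct])
  also have "aeq F k \<dots> (\<lambda>i. \<theta> i (c i * b i))" by (rule aeq_sym[OF multA[OF c bU]])
  also have "\<dots> = (\<lambda>i. \<theta> i ((c i * b i * adj (c i)) * c i))"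
   using UU_MM[OF bU] by (simp add: mult.assoc UU_D(2)[OF c])
  also have "aeq F k \<dots> (\<lambda>i. \<theta> i (c i * b i * adj (c i)) * \<theta> i (c i))"
   by (rule multA[OF knU[OF kb(2)] c])
  also have "aeq F k \<dots> (\<lambda>i. (c i * b i * adj (c i)) * \<theta> i (c i))"
   by (rule aeq_right[OF kna[OF kb(2)] ct])
  finally have "aeq F k (\<lambda>i. adj (c i) * (\<theta> i (c i) * b i)) (\<lambda>i. adj (c i) * ((c i * b i * adj (c i)) * \<theta> i (c i)))"
   by (rule aeq_left[OF _ cc])
  moreover have "adj (c i) * ((c i * b i * adj (c i)) * \<theta> i (c i)) = b i * V i" for i
   using c[of i] bU[of i] VU[of i] by (simp add: V_def mult.assoc UU_canc)
  ultimately show "aeq F k (\<lambda>i. V i * b i) (\<lambda>i. b i * V i)" by (simp add: V_def mult.assoc)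
 qed
 have lc: "csc (lam i) (c i) \<in> UU (k i)" for i using c by (simp add: lam_def csgn)
 have "aeq F k (\<lambda>i. c i * V i) (\<lambda>i. c i * csc (lam i) (fid (k i)))" by (rule aeq_left[OF V ev_con[OF c]])
 then have t: "aeq F k (\<lambda>i. \<theta> i (c i)) (\<lambda>i. csc (lam i) (c i))"
  using UU_MM[OF c] by (simp add: V_def UU_canc(2)[OF c UU_MM[OF \<theta>c]])
 have cu: "c i * u i \<in> UU (k i)" for i using c knU[OF u] by blast
 have "aeq F k (\<lambda>i. \<theta> i (c i * u i * adj (c i))) (\<lambda>i. \<theta> i (c i * u i) * \<theta> i (adj (c i)))" by (rule multA[OF cu ac])
 also have "aeq F k \<dots> (\<lambda>i. (csc (lam i) (c i) * u i) * adj (csc (lam i) (c i)))"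
 proof (rule aeq_mult)
  have "aeq F k (\<lambda>i. \<theta> i (c i) * \<theta> i (u i)) (\<lambda>i. csc (lam i) (c i) * u i)"
   by (rule aeq_mult[OF t kna[OF u] ev_con_\<theta>[OF knU[OF u]] ev_con[OF lc]])
  then show "aeq F k (\<lambda>i. \<theta> i (c i * u i)) (\<lambda>i. csc (lam i) (c i) * u i)" by (rule aeq_trans[OF multA[OF c knU[OF u]]])
  show "aeq F k (\<lambda>i. \<theta> i (adj (c i))) (\<lambda>i. adj (csc (lam i) (c i)))"
   by (rule aeq_trans[OF amap_adj[OF A filterlim_ident ev_U[OF c]] aeq_adj[OF t]])
  show "\<forall>\<^sub>F i in F. con (\<theta> i (adj (c i)))" by (rule ev_con_\<theta>[OF ac])
  show "\<forall>\<^sub>F i in F. con (csc (lam i) (c i) * u i)" by (rule ev_con) (use lc knU[OF u] in blast)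
 qed
 also have "(\<lambda>i. (csc (lam i) (c i) * u i) * adj (csc (lam i) (c i))) = (\<lambda>i. c i * u i * adj (c i))"
 proof
  fix i
  have "lam i * cnj (lam i) = 1" by (simp add: complex_norm_square[symmetric] lam_def csgn)
  then show "(csc (lam i) (c i) * u i) * adj (csc (lam i) (c i)) = c i * u i * adj (c i)" by (simp add: mult.commute)
 qed
 finally show ?thesis using c cu by (auto simp: kn_def intro!: UU_mult UU_adj knU[OF u])
qed

context
 fixes M :: "'i => nat" assumes M: "\<And>i. M i > 0" and k: "\<And>i. k i = 2 * M i"
begin

lemma pauli_normaliser:
 assumes G: "\<And>i. neb (M i) (G i)" and c: "\<And>i. c i \<in> UU (k i)"
  and X: "Q c (\<lambda>i. PX (M i))" and Z: "Q c (\<lambda>i. PZ (M i))"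
  and QG: "\<And>g. (\<And>i. g i \<in> G i) ==> Q c (\<lambda>i. B2 (M i) (g i) 0 0 (g i))" and u: "kn u"
 shows "kn (\<lambda>i. c i * u i * adj (c i))"
proof (rule normaliser_conj[OF _ c _ u])
 show "neb (k i) (krset (M i) (heis 2) (G i))" for i unfolding k by (rule neb_kr[OF neb_heis G]) simp
 fix b assume b: "\<And>i. b i \<in> krset (M i) (heis 2) (G i)"
 show "Q c b"
 proof (rule pauli_split[where R = "Q c", OF M G Q_mult[OF c] Q_if _ X Z QG b])
  show "Q c (\<lambda>i. fid (2 * M i))" using Q_fid[OF c] by (simp only: k[symmetric])
 qed
qed

text \<open>\<open>PZ\<close> is block diagonal, hence known. The Hadamard matrix exchanges it with
  \<open>PX\<close> and commutes with the copies of the inner basis, so conjugation by it preserves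
  known sequences, and the cosine-sine decomposition writes every unitary as a product of four known
  factors.\<close>

lemma near_id_of_blocks:
 assumes X: "kn (\<lambda>i. PX (M i))"
  and blk: "\<And>v w. (\<And>i. v i \<in> UU (M i)) ==> (\<And>i. w i \<in> UU (M i)) ==> kn (\<lambda>i. B2 (M i) (v i) 0 0 (w i))"
 shows "anear F k k \<theta> (\<lambda>i u. u)"
proof (rule anear_I)
 let ?H = "\<lambda>i. had (M i)"
 have HU: "?H i \<in> UU (k i)" for i using had_UU[OF M] by (simp add: k)
 have mf: "- fid (M i) \<in> UU (M i)" for i by (rule UU_I) simp_all
 have Z: "kn (\<lambda>i. PZ (M i))" by (rule blk) (auto simp: mf)
 have HXH: "?H i * PX (M i) * adj (?H i) = PZ (M i)" "?H i * PZ (M i) * adj (?H i) = PX (M i)"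
  "g \<in> MM (M i) ==> ?H i * B2 (M i) g 0 0 g * adj (?H i) = B2 (M i) g 0 0 g" for i g
  using M[of i] by (simp_all add: had_adj had_conj)
 have H: "kn (\<lambda>i. ?H i * u i * adj (?H i))" if "kn u" for u
 proof (rule pauli_normaliser[OF neb_heis[OF M] HU _ _ _ that])
  show "Q ?H (\<lambda>i. PX (M i))" "Q ?H (\<lambda>i. PZ (M i))" using X Z by (simp_all add: Q_def HXH)
  fix g assume "\<And>i. g i \<in> heis (M i)"
  then have g: "g i \<in> UU (M i)" for i using nebD(3)[OF neb_heis[OF M]] by blast
  show "Q ?H (\<lambda>i. B2 (M i) (g i) 0 0 (g i))" using blk[OF g g] UU_MM[OF g] by (simp add: Q_def HXH)
 qed
 fix u assume u: "\<And>i. u i \<in> UU (k i)"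
 have "\<exists>x1 x2 d1 d2 w y. x1 \<in> UU (M i) \<and> x2 \<in> UU (M i) \<and> d1 \<in> UU (M i) \<and> d2 \<in> UU (M i) \<and> w \<in> UU (M i) \<and> y \<in> UU (M i) \<and>
  u i = B2 (M i) x1 0 0 x2 * (?H i * B2 (M i) d1 0 0 d2 * ?H i) * B2 (M i) (fid (M i)) 0 0 w * B2 (M i) y 0 0 (fid (M i))" for i
  using cs_decomposition[OF M, of "u i" i] u[of i, unfolded k] by metis
 then obtain x1 x2 d1 d2 w y where d: "\<And>i. x1 i \<in> UU (M i)" "\<And>i. x2 i \<in> UU (M i)" "\<And>i. d1 i \<in> UU (M i)" "\<And>i. d2 i \<in> UU (M i)"
  "\<And>i. w i \<in> UU (M i)" "\<And>i. y i \<in> UU (M i)"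
  "\<And>i. u i = B2 (M i) (x1 i) 0 0 (x2 i) * (?H i * B2 (M i) (d1 i) 0 0 (d2 i) * ?H i) * B2 (M i) (fid (M i)) 0 0 (w i) * B2 (M i) (y i) 0 0 (fid (M i))"
  by metis
 have HH: "kn (\<lambda>i. ?H i * B2 (M i) (d1 i) 0 0 (d2 i) * ?H i)"
  using H[OF blk[OF d(3,4)]] M by (simp add: had_adj)
 have "kn (\<lambda>i. B2 (M i) (x1 i) 0 0 (x2 i) * (?H i * B2 (M i) (d1 i) 0 0 (d2 i) * ?H i) * B2 (M i) (fid (M i)) 0 0 (w i) * B2 (M i) (y i) 0 0 (fid (M i)))"
  by (rule kn_mult[OF kn_mult[OF kn_mult[OF blk[OF d(1,2)] HH] blk[OF UU_fid d(5)]] blk[OF d(6) UU_fid]])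
 then show "aeq F k (\<lambda>i. \<theta> i (u i)) u" unfolding d(7)[symmetric] by (rule kna)
qed

end

end

lemma dg_split: "m > 0 ==> dg (2 * m) d = B2 m (dg m d) 0 0 (dg m (\<lambda>j. d (m + j)))"
proof (rule MM_eqI[of _ "2 * m"])
 fix i j assume m: "m > 0" and ij: "i < 2 * m" "j < 2 * m"
 have dm: "r div m = (if r < m then 0 else 1)" "r mod m = (if r < m then r else r - m)" if "r < 2 * m" for r
  using that m by (auto simp: div_nat_eqI mod_if)
 show "ent (dg (2 * m) d) i j = ent (B2 m (dg m d) 0 0 (dg m (\<lambda>j. d (m + j)))) i j"
  using ij by (auto simp: ent_B2[OF m] dm)
qed simp_all

context self_amap
begin

context
 fixes m :: "'i => nat" assumes m: "\<And>i. m i > 0" and k: "\<And>i. k i = 2 * (2 * m i)"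
begin

text \<open>By \<open>near_id_of_blocks\<close> it is enough to know diag(v, w). The known copies
  diag(v, v) and the diagonalisation of w*v reduce this to diag(d, 1) with \<open>d\<close>
  diagonal. Controlled-not and swap normalise the tensored Pauli basis, so conjugation by them
  preserves known sequences; applied to copies, they produce diagonal matrices that are no longer
  copies.\<close>

theorem doubling:
 assumes X: "kn (\<lambda>i. PX (2 * m i))" and Z: "kn (\<lambda>i. PZ (2 * m i))"
  and D: "\<And>v. (\<And>i. v i \<in> UU (2 * m i)) ==> kn (\<lambda>i. B2 (2 * m i) (v i) 0 0 (v i))"
 shows "anear F k k \<theta> (\<lambda>i u. u)"
proof -
 let ?M = "\<lambda>i. 2 * m i" let ?B = "\<lambda>i. B2 (2 * m i)" and ?b = "\<lambda>i. B2 (m i)" and ?J = "\<lambda>i. fid (m i)" and ?I = "\<lambda>i. fid (2 * m i)"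
 have M: "?M i > 0" for i using m by simp
 have Xb: "PX (m i) \<in> UU (2 * m i)" and Zb: "PZ (m i) \<in> UU (2 * m i)" for i using PX_UU[OF m] PZ_UU[OF m] by auto
 define G where "G i = krset (m i) (heis 2) (heis (m i))" for i
 have G: "neb (2 * m i) (G i)" for i unfolding G_def by (rule neb_kr[OF neb_heis neb_heis[OF m]]) simp
 have QG: "Q c (\<lambda>i. ?B i (g i) 0 0 (g i))"
  if c: "\<And>i. c i \<in> UU (k i)" and cX: "Q c (\<lambda>i. ?B i (PX (m i)) 0 0 (PX (m i)))" and cZ: "Q c (\<lambda>i. ?B i (PZ (m i)) 0 0 (PZ (m i)))"
  and cg: "\<And>g. (\<And>i. g i \<in> UU (m i)) ==> Q c (\<lambda>i. ?B i (?b i (g i) 0 0 (g i)) 0 0 (?b i (g i) 0 0 (g i)))"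
  and g: "\<And>i. g i \<in> G i" for c g
 proof -
  define R where "R y \<longleftrightarrow> (\<forall>i. y i \<in> MM (2 * m i)) \<and> Q c (\<lambda>i. ?B i (y i) 0 0 (y i))" for y
  have "R g"
  proof (rule pauli_split[where R = R and G = "\<lambda>i. heis (m i)", OF m neb_heis[OF m] _ _ _ _ _ _ g[unfolded G_def]])
   fix u v assume uv: "R u" "R v"
   then have uvM: "u i \<in> MM (2 * m i)" "v i \<in> MM (2 * m i)" for i by (auto simp: R_def)
   have "?B i (u i) 0 0 (u i) * ?B i (v i) 0 0 (v i) = ?B i (u i * v i) 0 0 (u i * v i)" for i
    using uvM[of i] m[of i] by (simp add: B2_mult)
   then show "R (\<lambda>i. u i * v i)" using uv Q_mult[OF c, of "\<lambda>i. ?B i (u i) 0 0 (u i)" "\<lambda>i. ?B i (v i) 0 0 (v i)"] uvM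
    by (simp add: R_def)
   fix P
   have "?B i (if P i then u i else v i) 0 0 (if P i then u i else v i) = (if P i then ?B i (u i) 0 0 (u i) else ?B i (v i) 0 0 (v i))" for i
    by simp
   then show "R (\<lambda>i. if P i then u i else v i)"
    using uv Q_if[of c "\<lambda>i. ?B i (u i) 0 0 (u i)" "\<lambda>i. ?B i (v i) 0 0 (v i)" P] by (auto simp: R_def)
  next
   have "Q c (\<lambda>i. fid (2 * (2 * m i)))" using Q_fid[OF c] by (simp only: k[symmetric])
   then show "R (\<lambda>i. fid (2 * m i))" by (simp add: R_def B2_fid[OF M])
   show "R (\<lambda>i. PX (m i))" "R (\<lambda>i. PZ (m i))" using cX cZ m by (simp_all add: R_def)
   fix g assume "\<And>i. g i \<in> heis (m i)"
   then have gU: "g i \<in> UU (m i)" for i using nebD(3)[OF neb_heis[OF m]] by blast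
   show "R (\<lambda>i. ?b i (g i) 0 0 (g i))" using cg[OF gU] m by (simp add: R_def)
  qed
  then show ?thesis by (simp add: R_def)
 qed
 have gg: "?b i g 0 0 g \<in> UU (2 * m i)" if "g \<in> UU (m i)" for i g by (rule B2_UU_diag[OF m that that])
 have D': "kn (\<lambda>i. ?B i (?b i (g i) 0 0 (g i)) 0 0 (?b i (g i) 0 0 (g i)))" if "\<And>i. g i \<in> UU (m i)" for g
  by (rule D) (rule gg[OF that])
 \<comment> \<open>controlled-not\<close>
 define C where "C i = ?B i (?I i) 0 0 (PX (m i))" for i
 have CU: "C i \<in> UU (k i)" for i unfolding C_def k by (rule B2_UU_diag[OF M UU_fid Xb])
 have XX: "PX (m i) * PX (m i) = ?I i" "adj (PX (m i)) = PX (m i)" for i using m[of i] by (simp_all add: B2_mult B2_fid B2_adj)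
 have aC: "adj (C i) = C i" for i using m[of i] by (simp add: C_def B2_adj XX)
 have CC: "C i * ?B i v 0 0 w * adj (C i) = ?B i v 0 0 (PX (m i) * w * PX (m i))" if "v \<in> MM (2 * m i)" "w \<in> MM (2 * m i)" for i v w
  unfolding aC using m[of i] that by (simp add: C_def B2_mult[OF M])
 have Cc: "kn (\<lambda>i. C i * u i * adj (C i))" if u: "kn u" for u
 proof (rule pauli_normaliser[where M = ?M, OF M k G CU _ _ QG[OF CU] u])
  have "C i * PX (2 * m i) * adj (C i) = PX (2 * m i) * ?B i (PX (m i)) 0 0 (PX (m i))" for i
   unfolding aC using m[of i] by (simp add: C_def B2_mult[OF M])
  then show "Q C (\<lambda>i. PX (2 * m i))" using X kn_mult[OF X D[OF Xb]] by (simp add: Q_def)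
  show "Q C (\<lambda>i. PZ (2 * m i))" using Z m by (simp add: Q_def CC XX)
  show "Q C (\<lambda>i. ?B i (PX (m i)) 0 0 (PX (m i)))" using D[OF Xb] m by (simp add: Q_def CC XX)
  have "PX (m i) * PZ (m i) * PX (m i) = - PZ (m i)" for i using m[of i] by (simp add: B2_mult B2_uminus)
  then have "C i * ?B i (PZ (m i)) 0 0 (PZ (m i)) * adj (C i) = PZ (2 * m i) * ?B i (PZ (m i)) 0 0 (PZ (m i))" for i
   using m[of i] by (simp add: CC B2_mult[OF M])
  then show "Q C (\<lambda>i. ?B i (PZ (m i)) 0 0 (PZ (m i)))" using D[OF Zb] kn_mult[OF Z D[OF Zb]] by (simp add: Q_def)
  fix g assume g: "\<And>i. g i \<in> UU (m i)"
  have "PX (m i) * ?b i (g i) 0 0 (g i) * PX (m i) = ?b i (g i) 0 0 (g i)" for i using m[of i] UU_MM[OF g[of i]] by (simp add: B2_mult)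
  then show "Q C (\<lambda>i. ?B i (?b i (g i) 0 0 (g i)) 0 0 (?b i (g i) 0 0 (g i)))" using D'[OF g] m by (simp add: Q_def CC)
 qed
 \<comment> \<open>swap of the two qubits\<close>
 define S where "S i = ?B i (?b i (?J i) 0 0 0) (?b i 0 0 (?J i) 0) (?b i 0 (?J i) 0 0) (?b i 0 0 0 (?J i))" for i
 have aS: "adj (S i) = S i" for i using m[of i] by (simp add: S_def B2_adj)
 have S2: "S i * S i = fid (2 * (2 * m i))" for i
  unfolding B2_fid[OF M, symmetric] S_def using m[of i] by (simp add: B2_mult B2_add B2_0 B2_fid)
 have SU: "S i \<in> UU (k i)" for i unfolding k
  by (rule UU_I) (unfold aS S2, unfold S_def, rule B2_MM[OF M], simp_all)
 have SS: "S i * ?B i (?b i a b c d) 0 0 (?b i a b c d) * adj (S i) = ?B i (?b i a 0 0 a) (?b i b 0 0 b) (?b i c 0 0 c) (?b i d 0 0 d)"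
  if "a \<in> MM (m i)" "b \<in> MM (m i)" "c \<in> MM (m i)" "d \<in> MM (m i)" for i a b c d
  unfolding aS using m[of i] that by (simp add: S_def B2_mult B2_add B2_0)
 have SS': "S i * ?B i (?b i a 0 0 a) (?b i b 0 0 b) (?b i c 0 0 c) (?b i d 0 0 d) * adj (S i) = ?B i (?b i a b c d) 0 0 (?b i a b c d)"
  if "a \<in> MM (m i)" "b \<in> MM (m i)" "c \<in> MM (m i)" "d \<in> MM (m i)" for i a b c d
  unfolding aS using m[of i] that by (simp add: S_def B2_mult B2_add B2_0)
 have P: "PX (2 * m i) = ?B i (?b i 0 0 0 0) (?b i (?J i) 0 0 (?J i)) (?b i (?J i) 0 0 (?J i)) (?b i 0 0 0 0)"
  "PZ (2 * m i) = ?B i (?b i (?J i) 0 0 (?J i)) (?b i 0 0 0 0) (?b i 0 0 0 0) (?b i (- ?J i) 0 0 (- ?J i))" for i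
  using B2_uminus[OF m, of i "?J i" 0 0 "?J i"] m[of i] by (simp_all add: B2_fid B2_0)
 have Sc: "kn (\<lambda>i. S i * u i * adj (S i))" if u: "kn u" for u
 proof (rule pauli_normaliser[where M = ?M, OF M k G SU _ _ QG[OF SU] u])
  have "S i * PX (2 * m i) * adj (S i) = ?B i (PX (m i)) 0 0 (PX (m i))" "S i * PZ (2 * m i) * adj (S i) = ?B i (PZ (m i)) 0 0 (PZ (m i))" for i
   unfolding P by (rule SS'; simp)+
  then show "Q S (\<lambda>i. PX (2 * m i))" "Q S (\<lambda>i. PZ (2 * m i))" using X Z D[OF Xb] D[OF Zb] by (simp_all add: Q_def)
  have "S i * ?B i (PX (m i)) 0 0 (PX (m i)) * adj (S i) = PX (2 * m i)" "S i * ?B i (PZ (m i)) 0 0 (PZ (m i)) * adj (S i) = PZ (2 * m i)" for i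
   unfolding P by (rule SS; simp)+
  then show "Q S (\<lambda>i. ?B i (PX (m i)) 0 0 (PX (m i)))" "Q S (\<lambda>i. ?B i (PZ (m i)) 0 0 (PZ (m i)))"
   using X Z D[OF Xb] D[OF Zb] by (simp_all add: Q_def)
  fix g assume g: "\<And>i. g i \<in> UU (m i)"
  have "S i * ?B i (?b i (g i) 0 0 (g i)) 0 0 (?b i (g i) 0 0 (g i)) * adj (S i) = ?B i (?b i (g i) 0 0 (g i)) 0 0 (?b i (g i) 0 0 (g i))" for i
   using SS[of "g i" i 0 0 "g i"] UU_MM[OF g[of i]] m[of i] by (simp add: B2_0)
  then show "Q S (\<lambda>i. ?B i (?b i (g i) 0 0 (g i)) 0 0 (?b i (g i) 0 0 (g i)))" using D'[OF g] by (simp add: Q_def)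
 qed
 \<comment> \<open>With P^2 = D1 D0* and Q the adjoint of P, the three factors have diagonal blocks
   (D1, D1, P, P), (Q, 1, Q, 1) and (Q, 1, 1, Q), with product (D0, D1, 1, 1). The first comes from
   a known copy by the swap, the third from the second by controlled-not.\<close>
 have diag: "kn (\<lambda>i. ?B i (dg (2 * m i) (d i)) 0 0 (?I i))" if d: "\<And>i j. j < 2 * m i ==> cmod (d i j) = 1" for d
 proof -
  define D0 D1 where "D0 i = dg (m i) (d i)" and "D1 i = dg (m i) (\<lambda>j. d i (m i + j))" for i
  define p where "p i j = csqrt (d i (m i + j) * cnj (d i j))" for i j
  have p: "cmod (p i j) = 1" "d i (m i + j) * cnj (p i j) * cnj (p i j) = d i j" if j: "j < m i" for i j
  proof -
   have dj: "cmod (d i j) = 1" "cmod (d i (m i + j)) = 1" using d j by auto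
   then show "cmod (p i j) = 1" by (simp add: p_def norm_mult)
   have "cnj (p i j) * cnj (p i j) = cnj ((p i j)\<^sup>2)" by (simp add: power2_eq_square)
   also have "\<dots> = cnj (d i (m i + j)) * d i j" by (simp add: p_def)
   finally have "d i (m i + j) * (cnj (p i j) * cnj (p i j)) = (d i (m i + j) * cnj (d i (m i + j))) * d i j" by (simp add: mult.assoc)
   also have "d i (m i + j) * cnj (d i (m i + j)) = 1" using dj(2) by (simp add: complex_norm_square[symmetric])
   finally show "d i (m i + j) * cnj (p i j) * cnj (p i j) = d i j" by (simp add: mult.assoc)
  qed
  define P where "P i = dg (m i) (p i)" for i
  have PU: "P i \<in> UU (m i)" for i unfolding P_def by (rule UU_dg) (rule p(1))
  have D1U: "D1 i \<in> UU (m i)" for i unfolding D1_def by (rule UU_dg) (use d in auto)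
  have aP: "adj (P i) \<in> UU (m i)" for i using PU by blast
  have DP: "D1 i * adj (P i) * adj (P i) = D0 i" for i
   unfolding D0_def D1_def P_def adj_dg dg_mult by (rule dg_cong) (rule p(2))
  have f1: "kn (\<lambda>i. ?B i (?b i (D1 i) 0 0 (D1 i)) 0 0 (?b i (P i) 0 0 (P i)))"
  proof -
   have "kn (\<lambda>i. S i * ?B i (?b i (D1 i) 0 0 (P i)) 0 0 (?b i (D1 i) 0 0 (P i)) * adj (S i))"
    by (rule Sc[OF D], rule B2_UU_diag[OF m D1U PU])
   moreover have "S i * ?B i (?b i (D1 i) 0 0 (P i)) 0 0 (?b i (D1 i) 0 0 (P i)) * adj (S i) = ?B i (?b i (D1 i) 0 0 (D1 i)) 0 0 (?b i (P i) 0 0 (P i))" for i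
    using SS[of "D1 i" i 0 0 "P i"] UU_MM[OF D1U[of i]] UU_MM[OF PU[of i]] m[of i] by (simp add: B2_0)
   ultimately show ?thesis by simp
  qed
  have f2: "kn (\<lambda>i. ?B i (?b i (adj (P i)) 0 0 (?J i)) 0 0 (?b i (adj (P i)) 0 0 (?J i)))"
   by (rule D, rule B2_UU_diag[OF m aP UU_fid])
  have f3: "kn (\<lambda>i. ?B i (?b i (adj (P i)) 0 0 (?J i)) 0 0 (?b i (?J i) 0 0 (adj (P i))))"
  proof -
   have "C i * ?B i (?b i (adj (P i)) 0 0 (?J i)) 0 0 (?b i (adj (P i)) 0 0 (?J i)) * adj (C i) = ?B i (?b i (adj (P i)) 0 0 (?J i)) 0 0 (?b i (?J i) 0 0 (adj (P i)))" for i
    using m[of i] UU_MM[OF aP[of i]] by (simp add: CC B2_mult)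
   then show ?thesis using Cc[OF f2] by simp
  qed
  have "?B i (?b i (D1 i) 0 0 (D1 i)) 0 0 (?b i (P i) 0 0 (P i)) * ?B i (?b i (adj (P i)) 0 0 (?J i)) 0 0 (?b i (adj (P i)) 0 0 (?J i)) *
   ?B i (?b i (adj (P i)) 0 0 (?J i)) 0 0 (?b i (?J i) 0 0 (adj (P i))) = ?B i (?b i (D0 i) 0 0 (D1 i)) 0 0 (?I i)" for i
   using m[of i] UU_MM[OF aP[of i]] UU_MM[OF D1U[of i]] UU_MM[OF PU[of i]] UU_D(3)[OF PU[of i]]
   by (simp add: B2_mult DP B2_fid)
  then show ?thesis using kn_mult[OF kn_mult[OF f1 f2] f3] m by (simp add: dg_split D0_def D1_def)
 qed
 show ?thesis
 proof (rule near_id_of_blocks[where M = ?M, OF M k X])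
  fix v w assume vw: "\<And>i. v i \<in> UU (2 * m i)" "\<And>i. w i \<in> UU (2 * m i)"
  \<comment> \<open>If w*v = x d x*, then diag(v, w) is the product of the copies of
    \<open>w\<close> and \<open>x\<close>, of diag(d, 1) and of the copy of the adjoint of
    \<open>x\<close>.\<close>
  have "\<exists>x d. x \<in> UU (2 * m i) \<and> adj (w i) * v i = x * dg (2 * m i) d * adj x \<and> (\<forall>j<2 * m i. cmod (d j) = 1)" for i
  proof -
   have U: "adj (w i) * v i \<in> UU (2 * m i)" using vw[of i] by blast
   obtain x d where x: "x \<in> UU (2 * m i)" "adj (w i) * v i = x * dg (2 * m i) d * adj x"
    by (rule spectral_normal[of "adj (w i) * v i" "2 * m i"]) (use UU_D[OF U] in auto)
   have "adj x * (adj (w i) * v i) * x = dg (2 * m i) d" unfolding x(2) using x(1) by (simp add: mult.assoc UU_D UU_canc)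
   then have dU: "dg (2 * m i) d \<in> UU (2 * m i)" using U x(1) by (metis UU_adj UU_mult)
   have "cmod (d j) = 1" if j: "j < 2 * m i" for j
   proof -
    have "ent (adj (dg (2 * m i) d) * dg (2 * m i) d) j j = 1" using UU_D(2)[OF dU] j by simp
    then have "cnj (d j) * d j = 1" using j by (simp add: adj_dg dg_mult)
    then have "(cmod (d j))\<^sup>2 = 1" by (metis complex_norm_square mult.commute of_real_eq_1_iff)
    then show ?thesis by (simp add: power2_eq_1_iff) (use norm_ge_zero[of "d j"] in linarith)
   qed
   then show ?thesis using x by blast
  qed
  then obtain x d where x: "\<And>i. x i \<in> UU (2 * m i)" "\<And>i. adj (w i) * v i = x i * dg (2 * m i) (d i) * adj (x i)"
   "\<And>i j. j < 2 * m i ==> cmod (d i j) = 1" by metis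
  have ax: "adj (x i) \<in> UU (2 * m i)" for i using x(1) by blast
  have "?B i (w i) 0 0 (w i) * ?B i (x i) 0 0 (x i) * ?B i (dg (2 * m i) (d i)) 0 0 (?I i) * ?B i (adj (x i)) 0 0 (adj (x i)) = ?B i (v i) 0 0 (w i)" for i
  proof -
   have "w i * x i * dg (2 * m i) (d i) * adj (x i) = w i * (adj (w i) * v i)" unfolding x(2) by (simp add: mult.assoc)
   also have "\<dots> = v i" using vw[of i] by (simp add: UU_canc)
   moreover have "w i * x i * adj (x i) = w i" using x(1)[of i] vw(2)[of i] by (simp add: mult.assoc UU_D)
   ultimately show ?thesis using M[of i] UU_MM[OF x(1)[of i]] UU_MM[OF ax[of i]] UU_MM[OF vw(2)[of i]] by (simp add: B2_mult)
  qed
  moreover have "kn (\<lambda>i. ?B i (w i) 0 0 (w i) * ?B i (x i) 0 0 (x i) * ?B i (dg (2 * m i) (d i)) 0 0 (?I i) * ?B i (adj (x i)) 0 0 (adj (x i)))"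
   by (rule kn_mult[OF kn_mult[OF kn_mult[OF D[OF vw(2)] D[OF x(1)]] diag[OF x(3)]] D[OF ax]])
  ultimately show "kn (\<lambda>i. ?B i (v i) 0 0 (w i))" by simp
 qed
qed

end

end

section \<open>The base case U(2)\<close>

lemma hb_2: "hb 2 1 0 = eu 0 1 + eu 1 0" "hb 2 0 1 = eu 0 0 - eu 1 1"
proof -
 have c2: "i = 0 \<or> i = 1" if "i < 2" for i :: nat using that by auto
 have e: "x = y" if "x \<in> MM 2" "y \<in> MM 2" "ent x 0 0 = ent y 0 0" "ent x 0 1 = ent y 0 1" "ent x 1 0 = ent y 1 0" "ent x 1 1 = ent y 1 1" for x y
  by (rule MM_eqI[OF that(1,2)]) (use c2 that in blast)
 show "hb 2 1 0 = eu 0 1 + eu 1 0" "hb 2 0 1 = eu 0 0 - eu 1 1"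
  by (rule e; simp add: ent_hb MM_eu)+
qed

lemma PX_kr: "m > 0 ==> PX m = kr m (hb 2 1 0) (fid m)"
 and PZ_kr: "m > 0 ==> PZ m = kr m (hb 2 0 1) (fid m)"
 unfolding hb_2 by (simp_all add: B2_def kr_add_left kr_diff_left kr_0 kr_uminus)

lemma heis_2: "hb 2 1 0 \<in> heis 2" "hb 2 0 1 \<in> heis 2"
 using imageI[of "(1, 0)" "{..<2} \<times> {..<2}" "\<lambda>(a, c). hb 2 a c"] imageI[of "(0, 1)" "{..<2} \<times> {..<2}" "\<lambda>(a, c). hb 2 a c"]
 by (simp_all add: heis_def)

lemma kr_1_right [simp]: "kr 1 x (fid 1) = x"
 by (rule fmat_eqI) (simp add: ent_kr)

lemma norm_ent_le: "cmod (ent x i j) \<le> norm x"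
proof -
 obtain n where n: "x \<in> MM n" using MM_bnd by blast
 show ?thesis
 proof (cases "i < n \<and> j < n")
  case True
  have "(cmod (ent x i j))\<^sup>2 \<le> (\<Sum>j<n. (cmod (ent x i j))\<^sup>2)" using True by (intro member_le_sum) auto
  also have "\<dots> \<le> (norm x)\<^sup>2" unfolding norm_sq_sum[OF n] using True by (intro member_le_sum[of i] sum_nonneg) auto
  finally show ?thesis by (rule power2_le_imp_le) simp
 next
  case False
  then show ?thesis by (simp add: MM_zero[OF n])
 qed
qed

lemma aeq_ent:
 assumes "aeq F (\<lambda>_. n) X Y" "n > 0"
 shows "((\<lambda>i. cmod (ent (X i) a b - ent (Y i) a b)) \<longlongrightarrow> 0) F"
proof (rule tendsto_0_le_ev)
 show "((\<lambda>i. nn n (X i - Y i) * sqrt n) \<longlongrightarrow> 0) F"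
  using tendsto_mult_left_zero[OF assms(1)[unfolded aeq_def]] .
 show "\<forall>\<^sub>F i in F. 0 \<le> cmod (ent (X i) a b - ent (Y i) a b) \<and> cmod (ent (X i) a b - ent (Y i) a b) \<le> nn n (X i - Y i) * sqrt n"
  using norm_ent_le[of "X i - Y i" a b for i] assms(2) by (simp add: nn_def)
qed

text \<open>The diagonal torus of SU(2). Up to a phase it contains every diagonal unitary of size 2,
  and \<open>nn 2\<close> induces on it the distance of the circle.\<close>

definition ph :: "complex => fmat" where "ph c = B2 1 (csc c (fid 1)) 0 0 (csc (cnj c) (fid 1))"

lemma ph_UU: "cmod c = 1 ==> ph c \<in> UU 2"
 using B2_UU_diag[of 1 "csc c (fid 1)" "csc (cnj c) (fid 1)"] by (simp add: ph_def)
lemma ph_mult: "ph a * ph b = ph (a * b)" by (simp add: ph_def B2_mult mult.commute)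
lemma ph_MM: "ph a \<in> MM 2" using B2_MM[of 1] by (simp add: ph_def)
lemma ent_ph: "ent (ph a) 0 0 = a" "ent (ph a) 0 1 = 0" "ent (ph a) 1 0 = 0" "ent (ph a) 1 1 = cnj a"
 by (simp_all add: ph_def ent_B2)
lemma lessThan_2: "{..<2::nat} = {0, 1}" by auto
lemma norm_2: "x \<in> MM 2 ==> (norm x)\<^sup>2 = (cmod (ent x 0 0))\<^sup>2 + (cmod (ent x 0 1))\<^sup>2 + (cmod (ent x 1 0))\<^sup>2 + (cmod (ent x 1 1))\<^sup>2"
 by (simp add: norm_sq_sum[of x 2] lessThan_2)
lemma nn_ph: "nn 2 (ph a - ph b) = cmod (a - b)"
proof -
 have "(norm (ph a - ph b))\<^sup>2 = 2 * (cmod (a - b))\<^sup>2"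
  using complex_mod_cnj[of "a - b"] by (simp add: norm_2[OF MM_diff[OF ph_MM ph_MM]] ent_ph[unfolded One_nat_def] ent_ph del: complex_mod_cnj)
 then have "norm (ph a - ph b) = sqrt (2 * (cmod (a - b))\<^sup>2)" by (metis norm_ge_zero real_sqrt_unique)
 then show ?thesis by (simp add: nn_def real_sqrt_mult)
qed

lemma UU_1:
 assumes "v \<in> UU 1"
 shows "v = csc (ent v 0 0) (fid 1)" "cmod (ent v 0 0) = 1"
proof -
 show v: "v = csc (ent v 0 0) (fid 1)" by (rule MM_eqI[of _ 1]) (use assms in auto)
 have "norm v = 1" using norm_UU[OF assms] by simp
 moreover have "norm v = cmod (ent v 0 0) * norm (fid 1)" by (subst v) simp
 ultimately show "cmod (ent v 0 0) = 1" using norm_UU[OF UU_fid[of 1]] by simp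
qed

text \<open>The image of diag(c, cnj c) almost commutes with Z, hence is almost diagonal, and
  conjugation by X almost inverts it, hence it is almost of the same form. This defines an almost
  character, which is eventually the identity because diag(i, -i) = i Z is known. Phases supply the
  other diagonal unitaries, and \<open>near_id_of_blocks\<close> with blocks of size 1 the
  rest.\<close>

theorem near_id_2:
 fixes F :: "'i filter"
 assumes S: "self_amap F (\<lambda>_. 2) \<theta>" and X: "self_amap.kn F (\<lambda>_. 2) \<theta> (\<lambda>_. PX 1)" and Z: "self_amap.kn F (\<lambda>_. 2) \<theta> (\<lambda>_. PZ 1)"
 shows "anear F (\<lambda>_. 2) (\<lambda>_. 2) \<theta> (\<lambda>i u. u)"
proof -
 interpret self_amap F "\<lambda>_. 2" \<theta> by (rule S)
 let ?k = "\<lambda>_::'i. 2::nat"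
 note am = A
 define ch where "ch i c = csgn (ent (\<theta> i (ph c)) 0 0)" for i c
 have dch: "U0 F (\<lambda>i. {c. cmod c = 1}) (\<lambda>i c. nn 2 (\<theta> i (ph c) - ph (ch i c)))"
 proof (rule U0_I)
  fix c :: "'i => complex" assume "\<And>i. c i \<in> {c. cmod c = 1}"
  then have c: "cmod (c i) = 1" for i by simp
  have U: "ph (c i) \<in> UU 2" for i by (rule ph_UU[OF c])
  define Y where "Y i = \<theta> i (ph (c i))" for i
  have YU: "Y i \<in> UU 2" for i unfolding Y_def using amap_maps[OF am, of "ph (c i)" i] U by simp
  have YM: "Y i \<in> MM 2" for i using YU by simp
  have cY: "\<forall>\<^sub>F i in F. con (Y i)" using ev_con[OF YU] .
  have ZM: "PZ 1 \<in> MM 2" "PX 1 \<in> MM 2" using B2_MM[of 1] by simp_all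
  have cX: "\<forall>\<^sub>F i in F. con (PX 1)" using ev_con[of "\<lambda>_. PX 1"] PX_UU[of 1] by simp
  have ZU: "ph (c i) * PZ 1 = PZ 1 * ph (c i)" for i by (simp add: ph_def B2_mult csc_uminus)
  have "aeq F ?k (\<lambda>i. Y i * PZ 1) (\<lambda>i. Y i * \<theta> i (PZ 1))" by (rule aeq_left[OF aeq_sym[OF kna[OF Z]] cY])
  also have "aeq F ?k \<dots> (\<lambda>i. \<theta> i (ph (c i) * PZ 1))"
   unfolding Y_def by (rule aeq_sym, rule multA[OF U]) (rule knU[OF Z])
  also have "aeq F ?k \<dots> (\<lambda>i. \<theta> i (PZ 1) * Y i)"
   unfolding Y_def ZU by (rule multA[OF _ U]) (rule knU[OF Z])
  also have "aeq F ?k \<dots> (\<lambda>i. PZ 1 * Y i)" by (rule aeq_right[OF kna[OF Z] cY])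
  finally have comm: "aeq F ?k (\<lambda>i. Y i * PZ 1) (\<lambda>i. PZ 1 * Y i)" .
  have e0: "ent (Y i * PZ 1) 0 1 - ent (PZ 1 * Y i) 0 1 = - 2 * ent (Y i) 0 1"
   "ent (Y i * PZ 1) 1 0 - ent (PZ 1 * Y i) 1 0 = 2 * ent (Y i) 1 0" for i
   using ent_mult[of "Y i" 2 "PZ 1"] ent_mult[of "PZ 1" 2 "Y i"] YM ZM by (simp_all add: lessThan_2 ent_B2)
  have "((\<lambda>i. cmod (- 2 * ent (Y i) 0 1) / 2) \<longlongrightarrow> 0 / 2) F" "((\<lambda>i. cmod (2 * ent (Y i) 1 0) / 2) \<longlongrightarrow> 0 / 2) F"
   using aeq_ent[OF comm, of 0 1] aeq_ent[OF comm, of 1 0] unfolding e0 by (intro tendsto_divide tendsto_const; simp)+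
  then have o: "((\<lambda>i. cmod (ent (Y i) 0 1)) \<longlongrightarrow> 0) F" "((\<lambda>i. cmod (ent (Y i) 1 0)) \<longlongrightarrow> 0) F" by (simp_all add: norm_mult)
  have XUX: "PX 1 * ph (c i) * PX 1 = adj (ph (c i))" for i by (simp add: ph_def B2_mult B2_adj)
  have XU: "PX 1 * ph (c i) \<in> UU 2" for i using PX_UU[of 1] U by (auto intro!: UU_mult)
  have "aeq F ?k (\<lambda>i. PX 1 * Y i) (\<lambda>i. \<theta> i (PX 1) * Y i)" by (rule aeq_right[OF aeq_sym[OF kna[OF X]] cY])
  also have "aeq F ?k \<dots> (\<lambda>i. \<theta> i (PX 1 * ph (c i)))"
   unfolding Y_def by (rule aeq_sym, rule multA[OF _ U]) (rule knU[OF X])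
  finally have "aeq F ?k (\<lambda>i. (PX 1 * Y i) * PX 1) (\<lambda>i. \<theta> i (PX 1 * ph (c i)) * \<theta> i (PX 1))"
   by (rule aeq_mult[OF _ aeq_sym[OF kna[OF X]] cX ev_con_\<theta>[OF XU]])
  also have "aeq F ?k \<dots> (\<lambda>i. \<theta> i (PX 1 * ph (c i) * PX 1))"
   by (rule aeq_sym, rule multA[OF XU]) (rule knU[OF X])
  also have "aeq F ?k \<dots> (\<lambda>i. adj (Y i))"
   unfolding XUX Y_def by (rule amap_adj[OF am filterlim_ident ev_U[OF U]])
  finally have "aeq F ?k (\<lambda>i. (PX 1 * Y i) * PX 1) (\<lambda>i. adj (Y i))" .
  from aeq_ent[OF this, of 0 0]
  have "((\<lambda>i. cmod (ent (PX 1 * Y i * PX 1) 0 0 - ent (adj (Y i)) 0 0)) \<longlongrightarrow> 0) F" by simp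
  moreover have "ent (PX 1 * Y i * PX 1) 0 0 = ent (Y i) 1 1" for i
   using ent_mult[of "PX 1 * Y i" 2 "PX 1"] ent_mult[of "PX 1" 2 "Y i"] YM ZM by (simp add: lessThan_2 ent_B2)
  ultimately have d: "((\<lambda>i. cmod (ent (Y i) 1 1 - cnj (ent (Y i) 0 0))) \<longlongrightarrow> 0) F" by simp
  have c1: "(cmod (ent (Y i) 0 0))\<^sup>2 + (cmod (ent (Y i) 1 0))\<^sup>2 = 1" for i
  proof -
   have "ent (adj (Y i) * Y i) 0 0 = 1" using UU_D(2)[OF YU[of i]] by simp
   then have "cnj (ent (Y i) 0 0) * ent (Y i) 0 0 + cnj (ent (Y i) 1 0) * ent (Y i) 1 0 = 1"
    using ent_mult[of "adj (Y i)" 2 "Y i"] YM by (simp add: lessThan_2)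
   then have "complex_of_real ((cmod (ent (Y i) 0 0))\<^sup>2 + (cmod (ent (Y i) 1 0))\<^sup>2) = 1"
    unfolding of_real_add complex_norm_square by (simp add: mult.commute)
   then show ?thesis by (simp only: of_real_eq_1_iff)
  qed
  define s where "s i = ch i (c i)" for i
  \<comment> \<open>1 - |a| is at most 1 - |a|^2, which by unitarity is the squared modulus of the
    other entry of the column.\<close>
  have g: "cmod (ent (Y i) 0 0 - s i) \<le> (cmod (ent (Y i) 1 0))\<^sup>2" for i
  proof -
   let ?a = "cmod (ent (Y i) 0 0)"
   have a: "?a \<le> 1" using c1[of i] abs_square_le_1[of ?a] zero_le_power2[of "cmod (ent (Y i) 1 0)"] by linarith
   then have "?a * ?a \<le> 1 * ?a" by (intro mult_right_mono) auto
   then have "1 - ?a \<le> 1 - ?a\<^sup>2" by (simp add: power2_eq_square)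
   then show ?thesis using csgn(2)[of "ent (Y i) 0 0"] a c1[of i] by (simp add: s_def ch_def Y_def[symmetric])
  qed
  have g0: "((\<lambda>i. (cmod (ent (Y i) 1 0))\<^sup>2) \<longlongrightarrow> 0) F" using tendsto_power[OF o(2), of 2] by simp
  have s0: "((\<lambda>i. cmod (ent (Y i) 0 0 - s i)) \<longlongrightarrow> 0) F"
   by (rule tendsto_0_le_ev[OF g0]) (use g in auto)
  have s1: "((\<lambda>i. cmod (ent (Y i) 1 1 - cnj (s i))) \<longlongrightarrow> 0) F"
  proof (rule tendsto_0_le_ev[OF tendsto_add_zero[OF d s0]])
   have "cmod (ent (Y i) 1 1 - cnj (s i)) \<le> cmod (ent (Y i) 1 1 - cnj (ent (Y i) 0 0)) + cmod (ent (Y i) 0 0 - s i)" for i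
    using norm_triangle_ineq[of "ent (Y i) 1 1 - cnj (ent (Y i) 0 0)" "cnj (ent (Y i) 0 0 - s i)"]
    by (simp add: del: complex_mod_cnj) (metis complex_mod_cnj complex_cnj_diff)
   then show "\<forall>\<^sub>F i in F. 0 \<le> cmod (ent (Y i) 1 1 - cnj (s i)) \<and> cmod (ent (Y i) 1 1 - cnj (s i)) \<le> cmod (ent (Y i) 1 1 - cnj (ent (Y i) 0 0)) + cmod (ent (Y i) 0 0 - s i)"
    by simp
  qed
  have nrm: "nn 2 (Y i - ph (s i)) = sqrt (((cmod (ent (Y i) 0 0 - s i))\<^sup>2 + (cmod (ent (Y i) 0 1))\<^sup>2 + (cmod (ent (Y i) 1 0))\<^sup>2 + (cmod (ent (Y i) 1 1 - cnj (s i)))\<^sup>2) / 2)" for i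
  proof -
   have "norm (Y i - ph (s i)) = sqrt ((cmod (ent (Y i) 0 0 - s i))\<^sup>2 + (cmod (ent (Y i) 0 1))\<^sup>2 + (cmod (ent (Y i) 1 0))\<^sup>2 + (cmod (ent (Y i) 1 1 - cnj (s i)))\<^sup>2)"
    using norm_2[OF MM_diff[OF YM ph_MM], of i "s i"] real_sqrt_unique[OF _ norm_ge_zero[of "Y i - ph (s i)"]]
    by (simp add: ent_ph ent_ph[unfolded One_nat_def])
   then show ?thesis by (simp add: nn_def real_sqrt_divide)
  qed
  have "((\<lambda>i. nn 2 (Y i - ph (s i))) \<longlongrightarrow> sqrt ((0\<^sup>2 + 0\<^sup>2 + 0\<^sup>2 + 0\<^sup>2) / 2)) F"
   unfolding nrm by (intro tendsto_intros s0 s1 o) simp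
  then show "((\<lambda>i. nn 2 (\<theta> i (ph (c i)) - ph (ch i (c i)))) \<longlongrightarrow> 0) F" by (simp add: Y_def s_def)
 next
  show "{c. cmod c = 1} \<noteq> ({} :: complex set)" using norm_one by blast
 qed
 have ch1: "cmod (ch i c) = 1" for i c by (simp add: ch_def csgn)
 have C: "circle_asym F ch"
  by (rule circle_of_embed[OF am ch1 dch]) (simp_all add: ph_UU ph_mult nn_ph)
 have nr: "aeq F ?k (\<lambda>i. \<theta> i (ph (c i))) (\<lambda>i. ph (ch i (c i)))" if "\<And>i. cmod (c i) = 1" for c
  unfolding aeq_def by (rule U0_seq[OF dch filterlim_ident]) (use that in auto)
 have phi: "ph \<i> = csc \<i> (PZ 1)" unfolding ph_def by (simp add: B2_csc csc_uminus)
 have "aeq F ?k (\<lambda>i. \<theta> i (ph \<i>)) (\<lambda>i. ph \<i>)"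
  unfolding phi by (rule kna[OF kn_csc[OF Z]]) simp
 from aeq_sandwich'[OF nr[of "\<lambda>_. \<i>"] aeq_refl this]
 have "((\<lambda>i. cmod (ch i \<i> - \<i>)) \<longlongrightarrow> 0) F" by (simp add: aeq_def nn_ph)
 then have "\<forall>\<^sub>F i in F. cmod (ch i \<i> - \<i>) < 1" by (rule order_tendstoD(2)) simp
 then have im: "\<forall>\<^sub>F i in F. 0 \<le> Im (ch i \<i>)"
 proof eventually_elim
  case (elim i)
  then show ?case using abs_Im_le_cmod[of "ch i \<i> - \<i>"] by simp
 qed
 have ph: "kn (\<lambda>i. ph (c i))" if c: "\<And>i. cmod (c i) = 1" for c
  unfolding kn_def
 proof
  show "\<forall>i. ph (c i) \<in> UU 2" using ph_UU[OF c] by blast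
  have "((\<lambda>i. cmod (ch i (c i) - (if 0 \<le> Im (ch i \<i>) then c i else cnj (c i)))) \<longlongrightarrow> 0) F"
   by (rule U0_seq[OF circle_asym.circle_id_or_cnj[OF C] filterlim_ident]) (use c in auto)
  then have "((\<lambda>i. cmod (ch i (c i) - c i)) \<longlongrightarrow> 0) F"
   by (rule Lim_transform_eventually) (use im in eventually_elim, simp)
  then have "aeq F ?k (\<lambda>i. ph (ch i (c i))) (\<lambda>i. ph (c i))" by (simp add: aeq_def nn_ph)
  then show "aeq F ?k (\<lambda>i. \<theta> i (ph (c i))) (\<lambda>i. ph (c i))" by (rule aeq_trans[OF nr[OF c]])
 qed
 show ?thesis
 proof (rule near_id_of_blocks[of "\<lambda>_. 1"])
  fix v w :: "'i => fmat" assume vw: "\<And>i. v i \<in> UU 1" "\<And>i. w i \<in> UU 1"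
  define a b where "a i = ent (v i) 0 0" and "b i = ent (w i) 0 0" for i
  have ab: "v i = csc (a i) (fid 1)" "w i = csc (b i) (fid 1)" "cmod (a i) = 1" "cmod (b i) = 1" for i
   using UU_1[OF vw(1)] UU_1[OF vw(2)] by (simp_all add: a_def b_def)
  \<comment> \<open>diag(a, b) is \<open>y\<close> times diag(z, cnj z) when z^2 = a cnj(b) and y =
    a cnj(z).\<close>
  define z where "z i = csqrt (a i * cnj (b i))" for i
  have z: "cmod (z i) = 1" "z i * z i = a i * cnj (b i)" for i
   using ab(3,4)[of i] power2_csqrt[of "a i * cnj (b i)"] by (simp_all add: z_def norm_mult power2_eq_square)
  define y where "y i = a i * cnj (z i)" for i
  have y: "cmod (y i) = 1" for i using ab(3) z(1) by (simp add: y_def norm_mult)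
  have zz: "z i * cnj (z i) = 1" and aa: "a i * cnj (a i) = 1" for i
   using z(1)[of i] ab(3)[of i] complex_norm_square[of "z i"] complex_norm_square[of "a i"] by simp_all
  have "y i * z i = a i * (z i * cnj (z i))" for i by (simp add: y_def)
  then have yz: "y i * z i = a i" for i by (simp add: zz)
  have "y i * cnj (z i) = a i * cnj (z i * z i)" for i by (simp add: y_def)
  also have "a i * cnj (z i * z i) = (a i * cnj (a i)) * b i" for i by (simp add: z(2))
  finally have yz': "y i * cnj (z i) = b i" for i by (simp add: aa)
  have "B2 1 (v i) 0 0 (w i) = csc (y i) (ph (z i))" for i by (simp add: ph_def B2_csc ab yz yz')
  then show "kn (\<lambda>i. B2 1 (v i) 0 0 (w i))" using kn_csc[OF ph[OF z(1)] y] by simp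
 qed (use X in simp_all)
qed

section \<open>Closeness on block copies and its doubling\<close>

text \<open>The conjugating unitaries are part of the relation, because every enlargement of the
  basis produces new ones.\<close>

definition Cl :: "'i filter => ('i => nat) => ('i => fmat => fmat) => ('i => nat) => ('i => nat) => ('i => fmat) => bool" where
 "Cl F k h q m W \<longleftrightarrow> (\<forall>i. W i \<in> UU (k i)) \<and>
   anear F m k (\<lambda>i v. adj (W i) * h i (iot (q i) (m i) v) * W i) (\<lambda>i v. iot (q i) (m i) v)"

lemma Cl_of_reduce:
 assumes W: "\<And>i. W i \<in> UU (k i)" and k: "\<And>i. k i = q i * m i" and pos: "\<And>i. 0 < q i \<and> 0 < m i"
  and red: "anear F m k (\<lambda>i u. adj (W i) * \<theta> i (iot (q i) (m i) u) * W i) (\<lambda>i u. iot (q i) (m i) (\<theta>1 i u))"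
  and near: "anear F m m \<theta>1 (\<lambda>i u. u)" and A1: "amap F m m \<theta>1"
 shows "Cl F k \<theta> q m W"
 unfolding Cl_def
proof (intro conjI allI W anear_I)
 fix u assume u: "\<And>i. u i \<in> UU (m i)"
 have ev: "\<forall>\<^sub>F i in F. u i \<in> UU (m i)" using u by simp
 have "aeq F k (\<lambda>i. iot (q i) (m i) (\<theta>1 i (u i))) (\<lambda>i. iot (q i) (m i) (u i))"
  using anear_seq[OF near filterlim_ident ev] unfolding aeq_def
 proof (rule Lim_transform_eventually)
  show "\<forall>\<^sub>F i in F. nn (m i) (\<theta>1 i (u i) - u i) = nn (k i) (iot (q i) (m i) (\<theta>1 i (u i)) - iot (q i) (m i) (u i))"
   using pos UU_MM[OF u] UU_MM[OF amap_maps[OF A1 u]] by (simp add: iot_diff k nn_iot)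
 qed
 then show "aeq F k (\<lambda>i. adj (W i) * \<theta> i (iot (q i) (m i) (u i)) * W i) (\<lambda>i. iot (q i) (m i) (u i))"
  by (rule aeq_trans[OF anear_seq[OF red filterlim_ident ev]])
qed

theorem Cl_2:
 fixes F :: "'i filter"
 assumes A: "amap F k k \<theta>" and Ce: "acent F k k \<theta>" and k: "\<And>i. k i = q i * 2" and q: "\<And>i. q i > 0"
 obtains W where "Cl F k \<theta> q (\<lambda>_. 2) W"
proof (rule anchor_conj[OF A Ce])
 have H: "neb 2 (heis 2)" by (rule neb_heis) simp
 show "neb (k i) (krset 2 (heis (q i)) (heis 2))" for i unfolding k by (rule neb_kr[OF neb_heis[OF q] H])
 fix W assume W: "\<And>i. W i \<in> UU (k i)"
  and cA: "amap F k k (\<lambda>i u. adj (W i) * \<theta> i u * W i)" and cC: "acent F k k (\<lambda>i u. adj (W i) * \<theta> i u * W i)"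
  and an: "\<And>b. (\<And>i. b i \<in> phs (krset 2 (heis (q i)) (heis 2))) ==> aeq F k (\<lambda>i. adj (W i) * \<theta> i (b i) * W i) b"
 show thesis
 proof (rule reduce[OF cA cC k q H an])
  fix \<theta>1 assume t: "amap F (\<lambda>_. 2) (\<lambda>_. 2) \<theta>1" "acent F (\<lambda>_. 2) (\<lambda>_. 2) \<theta>1"
   and red: "anear F (\<lambda>_. 2) k (\<lambda>i u. adj (W i) * \<theta> i (iot (q i) 2 u) * W i) (\<lambda>i u. iot (q i) 2 (\<theta>1 i u))"
   and g: "\<And>g :: 'i => fmat. (\<And>i. g i \<in> phs (heis 2)) ==> aeq F (\<lambda>_. 2) (\<lambda>i. \<theta>1 i (g i)) g"
  have S: "self_amap F (\<lambda>_. 2) \<theta>1" using t by (simp add: self_amap_def)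
  have P1: "PX 1 = hb 2 1 0" "PZ 1 = hb 2 0 1" using PX_kr[of 1] PZ_kr[of 1] unfolding kr_1_right by simp_all
  have p: "hb 2 1 0 \<in> phs (heis 2)" "hb 2 0 1 \<in> phs (heis 2)" using heis_2 phs_sub by blast+
  have "anear F (\<lambda>_. 2) (\<lambda>_. 2) \<theta>1 (\<lambda>i u. u)"
  proof (rule near_id_2[OF S])
   show "self_amap.kn F (\<lambda>_. 2) \<theta>1 (\<lambda>_. PX 1)" "self_amap.kn F (\<lambda>_. 2) \<theta>1 (\<lambda>_. PZ 1)"
    using g[of "\<lambda>_. hb 2 1 0"] g[of "\<lambda>_. hb 2 0 1"] p phs_UU[OF H p(1)] phs_UU[OF H p(2)]
    unfolding self_amap.kn_def[OF S] P1 by simp_all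
  qed
  then show thesis by (intro that[of W] Cl_of_reduce[OF W k _ red _ t(1)]) (use q in auto)
 qed
qed

text \<open>Anchoring on the larger basis gives a new \<open>W\<close>, for which the closeness
  known for \<open>W0\<close> on the copies of U(2m) must be recovered; \<open>re_anchor\<close>
  with \<open>adj (W i) * W0 i\<close> does this. The copies diag(v, v) are then known to the
  reduced map, so \<open>self_amap.doubling\<close> applies.\<close>

theorem Cl_double:
 fixes F :: "'i filter"
 assumes A: "amap F k k \<theta>" and Ce: "acent F k k \<theta>" and k: "\<And>i. k i = q i * (2 * (2 * m i))" and q: "\<And>i. q i > 0"
  and m: "\<And>i. m i > 0" and cl: "Cl F k \<theta> (\<lambda>i. q i * 2) (\<lambda>i. 2 * m i) W0"
 obtains W where "Cl F k \<theta> q (\<lambda>i. 2 * (2 * m i)) W"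
proof (rule anchor_conj[OF A Ce])
 let ?M = "\<lambda>i. 2 * m i"
 have M: "?M i > 0" for i using m by simp
 define G where "G i = krset (?M i) (heis 2) (heis (?M i))" for i
 have H: "neb 2 (heis 2)" by (rule neb_heis) simp
 have G: "neb (2 * (2 * m i)) (G i)" for i unfolding G_def by (rule neb_kr[OF H neb_heis[OF M]])
 show "neb (k i) (krset (2 * (2 * m i)) (heis (q i)) (G i))" for i unfolding k by (rule neb_kr[OF neb_heis[OF q] G])
 fix W assume W: "\<And>i. W i \<in> UU (k i)"
  and cA: "amap F k k (\<lambda>i u. adj (W i) * \<theta> i u * W i)" and cC: "acent F k k (\<lambda>i u. adj (W i) * \<theta> i u * W i)"
  and an: "\<And>b. (\<And>i. b i \<in> phs (krset (2 * (2 * m i)) (heis (q i)) (G i))) ==> aeq F k (\<lambda>i. adj (W i) * \<theta> i (b i) * W i) b"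
 let ?\<eta> = "\<lambda>i u. adj (W i) * \<theta> i u * W i"
 show thesis
 proof (rule reduce[OF cA cC k q G an])
  fix \<theta>1 assume t: "amap F (\<lambda>i. 2 * (2 * m i)) (\<lambda>i. 2 * (2 * m i)) \<theta>1" "acent F (\<lambda>i. 2 * (2 * m i)) (\<lambda>i. 2 * (2 * m i)) \<theta>1"
   and red: "anear F (\<lambda>i. 2 * (2 * m i)) k (\<lambda>i u. ?\<eta> i (iot (q i) (2 * (2 * m i)) u)) (\<lambda>i u. iot (q i) (2 * (2 * m i)) (\<theta>1 i u))"
   and g: "\<And>g. (\<And>i. g i \<in> phs (G i)) ==> aeq F (\<lambda>i. 2 * (2 * m i)) (\<lambda>i. \<theta>1 i (g i)) g"
  have S: "self_amap F (\<lambda>i. 2 * (2 * m i)) \<theta>1" using t by (simp add: self_amap_def)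
  have fM: "fid (?M i) \<in> phs (heis (?M i))" for i by (rule phs_fid[OF neb_heis[OF M]])
  have pg: "PX (2 * m i) \<in> phs (G i)" "PZ (2 * m i) \<in> phs (G i)" for i
   unfolding G_def PX_kr[OF M] PZ_kr[OF M] by (intro phs_kr phs_sub heis_2 fM M)+
  have io: "iot (q i) (2 * (2 * m i)) (B2 (2 * m i) v 0 0 v) = iot (q i * 2) (2 * m i) v" for i v
   unfolding iot_def B2_diag[OF M] using kr_assoc[of 2 "?M i" "fid (q i)" "fid 2" v] kr_fid[of 2 "q i"] M[of i] by simp
  have k2: "k i = (q i * 2) * (2 * m i)" for i by (simp add: k)
  have "anear F ?M k (\<lambda>i v. ?\<eta> i (iot (q i * 2) (?M i) v)) (\<lambda>i v. iot (q i * 2) (?M i) v)"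
   unfolding anear_def U0_def
  proof (intro allI impI)
   fix e :: real assume e: "e > 0"
   have W0: "\<And>i. W0 i \<in> UU (k i)" using cl by (simp add: Cl_def)
   have "\<forall>\<^sub>F i in F. \<forall>v\<in>UU (2 * m i). nn (k i) (?\<eta> i (iot (q i * 2) (2 * m i) v) - iot (q i * 2) (2 * m i) v) \<le> 3 * (e / 8) + e / 2"
   proof (rule re_anchor[OF cA k2 _ neb_heis[OF M], where Y = "\<lambda>i. adj (W i) * W0 i"])
    fix g assume g: "\<And>i. g i \<in> heis (2 * m i)"
    show "aeq F k (\<lambda>i. ?\<eta> i (iot (q i * 2) (2 * m i) (g i))) (\<lambda>i. iot (q i * 2) (2 * m i) (g i))"
     unfolding io[symmetric]
    proof (rule an)
     fix i
     show "iot (q i) (2 * (2 * m i)) (B2 (2 * m i) (g i) 0 0 (g i)) \<in> phs (krset (2 * (2 * m i)) (heis (q i)) (G i))"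
      unfolding iot_def B2_diag[OF M] G_def
      by (intro phs_kr phs_fid[OF neb_heis[OF q]] phs_fid[OF H] phs_sub g) (use m in auto)
    qed
   next
    show "adj (W i) * W0 i \<in> UU (k i)" for i using W W0 by blast
    have "\<forall>\<^sub>F i in F. \<forall>v\<in>UU (2 * m i). nn (k i) (adj (W0 i) * \<theta> i (iot (q i * 2) (2 * m i) v) * W0 i - iot (q i * 2) (2 * m i) v) < e / 8"
     using cl e unfolding Cl_def anear_def U0_def by (elim conjE allE[of _ "e / 8"]) simp
    then show "\<forall>\<^sub>F i in F. \<forall>v\<in>UU (2 * m i). nn (k i) (?\<eta> i (iot (q i * 2) (2 * m i) v) * (adj (W i) * W0 i) - adj (W i) * W0 i * iot (q i * 2) (2 * m i) v) \<le> e / 8"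
    proof (rule eventually_mono, intro ballI)
     fix i v assume h: "\<forall>v\<in>UU (2 * m i). nn (k i) (adj (W0 i) * \<theta> i (iot (q i * 2) (2 * m i) v) * W0 i - iot (q i * 2) (2 * m i) v) < e / 8"
      and v: "v \<in> UU (2 * m i)"
     let ?I = "iot (q i * 2) (2 * m i) v" let ?T = "\<theta> i ?I"
     have IU: "?I \<in> UU (k i)" unfolding k2 by (rule iot_UU[OF M v])
     have TU: "?T \<in> UU (k i)" by (rule amap_maps[OF A IU])
     have "?\<eta> i ?I * (adj (W i) * W0 i) - adj (W i) * W0 i * ?I = (adj (W i) * W0 i) * (adj (W0 i) * ?T * W0 i - ?I)"
     proof -
      have "?\<eta> i ?I * (adj (W i) * W0 i) = adj (W i) * (?T * W0 i)"
       using W[of i] W0[of i] TU by (simp add: mult.assoc UU_canc)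
      moreover have "(adj (W i) * W0 i) * (adj (W0 i) * ?T * W0 i) = adj (W i) * (?T * W0 i)"
       using W[of i] W0[of i] TU by (simp add: mult.assoc UU_canc)
      ultimately show ?thesis by (simp add: right_diff_distrib)
     qed
     then have "norm (?\<eta> i ?I * (adj (W i) * W0 i) - adj (W i) * W0 i * ?I) = norm (adj (W0 i) * ?T * W0 i - ?I)"
      using norm_UU_left[of "adj (W i) * W0 i" "k i" "adj (W0 i) * ?T * W0 i - ?I"] W[of i] W0[of i] TU IU by (simp add: UU_mult UU_adj)
     then show "nn (k i) (?\<eta> i ?I * (adj (W i) * W0 i) - adj (W i) * W0 i * ?I) \<le> e / 8"
      using h v by (simp add: nn_def less_imp_le)
    qed
   qed (use q e in auto)
   then show "\<forall>\<^sub>F i in F. \<forall>v\<in>UU (2 * m i). nn (k i) (?\<eta> i (iot (q i * 2) (2 * m i) v) - iot (q i * 2) (2 * m i) v) < e"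
    by eventually_elim (use e in fastforce)
  qed
  note c1 = this
  have A1: "amap F (\<lambda>i. 2 * (2 * m i)) k (\<lambda>i. iot (q i) (2 * (2 * m i)))"
   using amap_iot[of q "\<lambda>i. 2 * (2 * m i)" F] q m by (simp add: ext[of k, OF k])
  have "anear F (\<lambda>i. 2 * (2 * m i)) (\<lambda>i. 2 * (2 * m i)) \<theta>1 (\<lambda>i u. u)"
  proof (rule self_amap.doubling[OF S m])
   show "self_amap.kn F (\<lambda>i. 2 * (2 * m i)) \<theta>1 (\<lambda>i. PX (2 * m i))" "self_amap.kn F (\<lambda>i. 2 * (2 * m i)) \<theta>1 (\<lambda>i. PZ (2 * m i))"
    unfolding self_amap.kn_def[OF S] by (intro conjI allI PX_UU PZ_UU M g pg)+
   fix v assume v: "\<And>i. v i \<in> UU (2 * m i)"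
   let ?v = "\<lambda>i. B2 (2 * m i) (v i) 0 0 (v i)"
   have vU: "?v i \<in> UU (2 * (2 * m i))" for i by (rule B2_UU_diag[OF M v v])
   have "aeq F k (\<lambda>i. iot (q i) (2 * (2 * m i)) (\<theta>1 i (?v i))) (\<lambda>i. ?\<eta> i (iot (q i) (2 * (2 * m i)) (?v i)))"
    by (rule aeq_sym, rule anear_seq[OF red filterlim_ident]) (use vU in simp)
   also have "aeq F k \<dots> (\<lambda>i. iot (q i) (2 * (2 * m i)) (?v i))"
    unfolding io by (rule anear_seq[OF c1 filterlim_ident]) (use v in simp)
   finally have "aeq F (\<lambda>i. 2 * (2 * m i)) (\<lambda>i. \<theta>1 i (?v i)) ?v"
    by (rule amap_inj[OF A1 filterlim_ident, rotated 2]) (use vU amap_maps[OF t(1) vU] in simp_all)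
   then show "self_amap.kn F (\<lambda>i. 2 * (2 * m i)) \<theta>1 ?v" unfolding self_amap.kn_def[OF S] using vU by blast
  qed simp
  then show thesis by (intro that[of W] Cl_of_reduce[OF W k _ red _ t(1)]) (use q m in auto)
 qed
qed

section \<open>From U(m) to U(m + 1)\<close>

text \<open>When \<open>q * m\<close> is at most \<open>k\<close>, this is the block sum of
  \<open>q\<close> copies of \<open>u\<close> with an identity on the remaining coordinates.\<close>

definition JJ :: "nat => nat => nat => fmat => fmat" where "JJ k q m u = rs (q * m) k (iot q m u)"

lemma JJ_eq: "q * m \<le> k ==> JJ k q m u = iot q m u + (fid k - fid (q * m))"
 by (simp add: JJ_def rs_def)

lemma JJ_UU: "m > 0 ==> u \<in> UU m ==> JJ k q m u \<in> UU k"
 unfolding JJ_def by (rule rs_UU) simp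

text \<open>\<open>T\<close> is a partial isometry with initial projection \<open>fid n\<close>; for
  multiplication from the other side its final projection \<open>T * adj T\<close> is used.\<close>

lemma isometry_con:
 assumes T: "adj T * T = fid n" "T * fid n = T"
 shows "con T"
 unfolding con_def
proof (intro allI conjI)
 fix y
 have "(norm (T * y))\<^sup>2 = Re (ftr (adj y * (adj T * T) * y))" by (simp add: norm_sq mult.assoc)
 also have "\<dots> = Re (ftr (adj y * (fid n * (fid n * y))))" using fid_mult(1)[OF MM_fid[OF order_refl], of n] by (simp add: T mult.assoc flip: mult.assoc[of "fid n" "fid n"])
 also have "\<dots> = (norm (fid n * y))\<^sup>2" by (simp add: norm_sq mult.assoc)
 finally have "norm (T * y) = norm (fid n * y)" by simp
 then show "norm (T * y) \<le> norm y" using norm_fid_mult[of n y] by simp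
 let ?P = "T * adj T"
 have P: "?P * ?P = ?P"
 proof -
  have "?P * ?P = T * (adj T * T) * adj T" by (simp add: mult.assoc)
  then show ?thesis by (simp add: T)
 qed
 have "(norm (y * T))\<^sup>2 = (norm (adj (y * T)))\<^sup>2" by (simp only: norm_adj)
 also have "\<dots> = Re (ftr (y * ?P * adj y))" unfolding norm_sq by (simp add: mult.assoc)
 also have "\<dots> = Re (ftr (y * (?P * ?P) * adj y))" by (simp add: P)
 also have "\<dots> = (norm (?P * adj y))\<^sup>2" unfolding norm_sq by (simp add: mult.assoc)
 finally have "norm (y * T) = norm (?P * adj y)" by simp
 also have "\<dots> \<le> norm (adj y)" by (rule proj_norm[OF P]) simp
 finally show "norm (y * T) \<le> norm y" by simp
qed

text \<open>The isometry \<open>T\<close> drops the last coordinate of every block, and \<open>v\<close> is close to the compression of \<open>u\<close>.\<close>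

lemma JJ_step:
 assumes m: "m \<ge> 1" and mk: "m + 1 \<le> k" and q: "q = k div m" and q': "q' = k div (m + 1)"
 obtains W where "W \<in> UU k" "\<And>u. u \<in> UU (m + 1) ==>
  \<exists>v\<in>UU m. norm (JJ k q' (m + 1) u - W * JJ k q m v * adj W) \<le> 8 * sqrt (real m + real k / real m)"
proof -
 define N where "N = q' * m"
 \<comment> \<open>\<open>f\<close> embeds \<open>q'\<close> blocks of length \<open>m\<close> into
   blocks of length \<open>m + 1\<close>, leaving out the last place of each.\<close>
 define f where "f c = (c div m) * (m + 1) + c mod m" for c
 have k': "q' * (m + 1) \<le> k" unfolding q' by (rule div_times_less_eq_dividend)
 have Nk: "N \<le> k" using k' by (simp add: N_def)
 have fd: "f c div (m + 1) = c div m" "f c mod (m + 1) = c mod m" for c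
 proof -
  have "c mod m < m + 1" using m mod_less_divisor[of m c] by linarith
  moreover have "(a * n + b) div n = a" "(a * n + b) mod n = b" if "b < n" for a b n :: nat using that by simp_all
  ultimately show "f c div (m + 1) = c div m" "f c mod (m + 1) = c mod m" unfolding f_def by blast+
 qed
 have finj: "c = c'" if "f c = f c'" for c c'
  using fd[of c] fd[of c'] that by (metis div_mult_mod_eq)
 have fk: "f c < k" if c: "c < N" for c
 proof -
  have "c div m < q'" using c by (simp add: N_def less_mult_imp_div_less)
  then have "c div m + 1 \<le> q'" by simp
  then have "(c div m + 1) * (m + 1) \<le> q' * (m + 1)" by (rule mult_right_mono) simp
  moreover have g: "a * (m + 1) + b < (a + 1) * (m + 1)" if "b < m" for a b using that by (simp add: add_mult_distrib)
  have "f c < (c div m + 1) * (m + 1)" unfolding f_def by (rule g) (use m in simp)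
  ultimately show ?thesis using k' by linarith
 qed
 define T where "T = mk k (\<lambda>r c. if c < N \<and> r = f c then 1 else 0)"
 have TM: "T \<in> MM k" by (simp add: T_def)
 have eT: "ent T r c = (if c < N \<and> r = f c then 1 else 0)" for r c
  using fk[of c] Nk by (auto simp: T_def ent_mk)
 have XT: "ent (X * T) r c = (if c < N then ent X r (f c) else 0)" for X r c
 proof -
  have "ent (X * T) r c = (\<Sum>s<k. if s = f c then (if c < N then ent X r (f c) else 0) else 0)"
   unfolding ent_mult[of X k T, OF disjI2[OF TM]] by (intro sum.cong) (auto simp: eT)
  then show ?thesis using fk by simp
 qed
 have TY: "ent (adj T * Y) c r = (if c < N then ent Y (f c) r else 0)" for Y r c
 proof -
  have "ent (adj T * Y) c r = (\<Sum>s<k. if s = f c then (if c < N then ent Y (f c) r else 0) else 0)"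
   unfolding ent_mult[of "adj T" k Y, OF disjI1[OF MM_adj[OF TM]]] by (intro sum.cong) (auto simp: eT)
  then show ?thesis using fk by simp
 qed
 have TT: "adj T * T = fid N"
  by (rule fmat_eqI) (auto simp: TY eT dest: finj)
 have TN: "T * fid N = T"
 proof (rule fmat_eqI)
  fix r c
  have "ent (T * fid N) r c = (\<Sum>s<k. if s = c then ent T r c else 0)"
   unfolding ent_mult[of T k, OF disjI1[OF TM]] by (intro sum.cong) (auto simp: eT)
  then show "ent (T * fid N) r c = ent T r c" using Nk by (auto simp: eT)
 qed
 have cT: "con T" by (rule isometry_con[OF TT TN])
 \<comment> \<open>\<open>T\<close> misses being unitary by a projection of rank
   \<open>k - N\<close>, and the coordinates left out number at most
   \<open>m + k / m\<close>.\<close>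
 obtain W where W: "W \<in> UU k" "(norm (T - W))\<^sup>2 \<le> real k - real N"
 proof (rule polar_near[OF TM, of "real k - real N"])
  fix S assume S: "S \<in> UU k"
  let ?p = "fid k - fid N"
  note p = fid_diff_proj[OF Nk]
  have "S * (adj T * T - fid k) = - (S * (?p * ?p))" unfolding p(1) TT by (simp add: algebra_simps)
  then have "cmod (ftr (S * (adj T * T - fid k))) = cmod (ftr (S * (?p * ?p)))" by simp
  also have "ftr (S * (?p * ?p)) = ftr (adj ?p * (S * ?p))" unfolding p(2) using ftr_comm[of "S * ?p" ?p] by (simp add: mult.assoc)
  also have "cmod \<dots> \<le> norm ?p * norm (S * ?p)" by (rule ftr_CS)
  also have "norm (S * ?p) = norm ?p" by (rule norm_UU_left[OF S]) (simp add: MM_fid Nk)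
  also have "norm ?p * norm ?p = real k - real N" using p(3) by (simp add: power2_eq_square)
  finally show "cmod (ftr (S * (adj T * T - fid k))) \<le> real k - real N" .
 qed (rule that)
 define s where "s = sqrt (real m + real k / real m)"
 have q'k: "real q' \<le> real k / real m"
 proof -
  have "q' * m \<le> k" using Nk by (simp add: N_def)
  then have "real q' * real m \<le> real k" by (metis of_nat_le_iff of_nat_mult)
  then show ?thesis using m by (simp add: field_simps)
 qed
 have kk': "real k - real (q' * (m + 1)) \<le> real m"
 proof -
  have "k - q' * (m + 1) = k mod (m + 1)" unfolding q' by (rule minus_div_mult_eq_mod)
  then have "k - q' * (m + 1) \<le> m" using mod_less_divisor[of "m + 1" k] by simp
  then show ?thesis by linarith
 qed
 have kN: "real k - real N \<le> real m + real k / real m"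
  using kk' q'k by (simp add: N_def algebra_simps)
 have qk: "q * m \<le> k" unfolding q by (rule div_times_less_eq_dividend)
 have kq: "real k - real (q * m) \<le> real m"
 proof -
  have "k - q * m = k mod m" unfolding q by (rule minus_div_mult_eq_mod)
  then have "k - q * m \<le> m" using mod_less_divisor[of m k] m by simp
  then show ?thesis by linarith
 qed
 have qq': "q' \<le> q" unfolding q q' using m by (intro div_le_mono2) auto
 have sm: "sqrt x \<le> s" if "x \<le> real m \<or> x \<le> real k / real m \<or> x \<le> real m + real k / real m" for x
 proof -
  have "0 \<le> real k / real m" by simp
  then show ?thesis unfolding s_def using that by (intro real_sqrt_le_mono) linarith
 qed
 have TW: "norm (T - W) \<le> s"
  using real_sqrt_le_mono[OF W(2)] sm[of "real k - real N"] kN by simp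
 show ?thesis
 proof (rule that[OF W(1)])
  fix u assume u: "u \<in> UU (m + 1)"
  obtain v where v: "v \<in> UU m" "norm (u - v) \<le> 3"
   using resize_exists[OF u, of m] by auto
  have m1: "m + 1 > 0" "m > 0" using m by auto
  let ?U = "iot q' (m + 1) u" and ?X = "iot q' (m + 1) v" and ?Z = "iot q' m v"
  have vM: "v \<in> MM m" "v \<in> MM (m + 1)" using v(1) MM_mono[of v m "m + 1"] by auto
  have UU: "?U \<in> UU (q' * (m + 1))" by (rule iot_UU[OF m1(1) u])
  have UM: "?U \<in> MM k" using UU k' MM_mono by blast
  have ZM: "?Z \<in> MM N" unfolding N_def iot_def by (rule kr_MM) (use m in auto)
  have TXT: "adj T * (?X * T) = ?Z"
  proof (rule fmat_eqI)
   fix a b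
   show "ent (adj T * (?X * T)) a b = ent ?Z a b"
   proof (cases "a < N \<and> b < N")
    case True
    then show ?thesis unfolding TY XT iot_def ent_kr[OF m1(1)] ent_kr[OF m1(2)] fd by simp
   next
    case False
    then show ?thesis using MM_zero[OF ZM, of a b] by (auto simp: TY XT)
   qed
  qed
  have cW: "con W" "con ?U" "con (adj W)" using W(1) con_UU[OF UU] by auto
  have d1: "norm (?U - ?X) \<le> 3 * sqrt (real q')"
  proof -
   have "norm (?U - ?X) = norm (fid q') * norm (u - v)"
    unfolding iot_diff[OF m1(1)] unfolding iot_def by (rule norm_kr[OF m1(1)]) (use u vM in auto)
   also have "\<dots> \<le> sqrt (real q') * 3" using norm_UU[OF UU_fid[of q']] v(2) by (intro mult_mono) auto
   finally show ?thesis by simp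
  qed
  have d2: "norm (adj W * ?U * W - ?Z) \<le> 2 * s + 3 * s"
  proof -
   have "adj W * ?U * W - ?Z = adj (W - T) * (?U * W) + adj T * (?U * (W - T)) + adj T * ((?U - ?X) * T)"
    unfolding TXT[symmetric] by (simp add: algebra_simps)
   then have "norm (adj W * ?U * W - ?Z) \<le> norm (adj (W - T) * (?U * W)) + norm (adj T * (?U * (W - T))) + norm (adj T * ((?U - ?X) * T))"
    by (metis norm_triangle_ineq norm_triangle_le add_right_mono)
   also have "\<dots> \<le> norm (adj (W - T)) + norm (W - T) + norm (?U - ?X)"
    using con_mult[OF cW(2,1)] con_adj[OF cT] cT cW(2) unfolding con_def by (intro add_mono) (meson order_trans)+
   also have "\<dots> \<le> s + s + 3 * s"
    using TW d1 sm[of "real q'"] q'k unfolding norm_adj by (simp add: norm_minus_commute)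
   finally show ?thesis by simp
  qed
  have eq: "adj W * (?U - W * ?Z * adj W) * W = adj W * ?U * W - ?Z"
  proof -
   have "?Z \<in> MM k" using ZM Nk MM_mono by blast
   then have "adj W * (W * ?Z * adj W) * W = ?Z" using W(1) by (simp add: mult.assoc UU_canc UU_D)
   then show ?thesis by (simp add: algebra_simps)
  qed
  have ZMk: "?Z \<in> MM k" using ZM Nk MM_mono by blast
  have d3: "norm (?U - W * ?Z * adj W) \<le> 5 * s"
   using d2 eq norm_conj_UU[OF UU_adj[OF W(1)] W(1), of "?U - W * ?Z * adj W"] UM ZMk W(1) by simp
  have d4: "norm (JJ k q' (m + 1) u - ?U) \<le> s"
  proof -
   have "(norm (JJ k q' (m + 1) u - ?U))\<^sup>2 = real k - real (q' * (m + 1))"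
    unfolding JJ_eq[OF k'] using fid_diff_proj(3)[OF k'] by simp
   then have "norm (JJ k q' (m + 1) u - ?U) = sqrt (real k - real (q' * (m + 1)))" by (metis norm_ge_zero real_sqrt_unique)
   then show ?thesis using sm kk' by simp
  qed
  have d5: "norm (?Z - JJ k q m v) \<le> s + s"
  proof -
   have "?Z - JJ k q m v = kr m (fid q' - fid q) v - (fid k - fid (q * m))"
    unfolding JJ_eq[OF qk] by (simp add: iot_def kr_diff_left[OF m1(2)])
   then have "norm (?Z - JJ k q m v) \<le> norm (kr m (fid q' - fid q) v) + norm (fid k - fid (q * m))"
    by (metis norm_triangle_ineq4)
   moreover have "norm (fid k - fid (q * m)) \<le> s"
    using real_sqrt_unique[OF fid_diff_proj(3)[OF qk] norm_ge_zero] sm[of "real k - real (q * m)"] kq by simp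
   moreover have "norm (kr m (fid q' - fid q) v) \<le> s"
   proof -
    have "norm (kr m (fid q' - fid q) v) = norm (fid q - fid q') * norm v"
     by (subst norm_kr[OF m1(2) vM(1)]) (simp add: norm_minus_commute)
    also have "\<dots> = sqrt (real q - real q') * sqrt (real m)"
     using real_sqrt_unique[OF fid_diff_proj(3)[OF qq'] norm_ge_zero] norm_UU[OF v(1)] by simp
    also have "\<dots> = sqrt ((real q - real q') * real m)" by (simp add: real_sqrt_mult)
    also have "\<dots> \<le> s"
    proof (rule sm)
     have "real q * real m \<le> real k" using qk by (metis of_nat_le_iff of_nat_mult)
     then have "(real q - real q') * real m \<le> real k - real N" by (simp add: N_def algebra_simps)
     then show "(real q - real q') * real m \<le> real m \<or> (real q - real q') * real m \<le> real k / real m \<or> (real q - real q') * real m \<le> real m + real k / real m"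
      using kN by linarith
    qed
    finally show ?thesis .
   qed
   ultimately show ?thesis by linarith
  qed
  have JM: "JJ k q m v \<in> MM k" using JJ_UU[OF m1(2) v(1)] by auto
  have d6: "norm (W * ?Z * adj W - W * JJ k q m v * adj W) \<le> s + s"
  proof -
   have "W * ?Z * adj W - W * JJ k q m v * adj W = W * (?Z - JJ k q m v) * adj W" by (simp add: algebra_simps)
   then show ?thesis using norm_conj_UU[OF W(1) UU_adj[OF W(1)], of "?Z - JJ k q m v"] ZMk JM d5 by simp
  qed
  have "JJ k q' (m + 1) u - W * JJ k q m v * adj W =
   (JJ k q' (m + 1) u - ?U) + (?U - W * ?Z * adj W) + (W * ?Z * adj W - W * JJ k q m v * adj W)" by simp
  then have "norm (JJ k q' (m + 1) u - W * JJ k q m v * adj W) \<le> norm (JJ k q' (m + 1) u - ?U) + norm (?U - W * ?Z * adj W) + norm (W * ?Z * adj W - W * JJ k q m v * adj W)"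
   by (metis norm_triangle_ineq norm_triangle_le add_right_mono)
  \<comment> \<open>1 for the identity on the rest, 5 for \<open>d3\<close> (2 for \<open>W\<close>
    in place of \<open>T\<close>, 3 for \<open>v\<close> in place of \<open>u\<close>), and 2 for
    passing from \<open>q'\<close> to \<open>q\<close> blocks.\<close>
  also have "\<dots> \<le> 8 * s" using d3 d4 d6 by linarith
  finally show "\<exists>v\<in>UU m. norm (JJ k q' (m + 1) u - W * JJ k q m v * adj W) \<le> 8 * sqrt (real m + real k / real m)"
   using v(1) unfolding s_def by blast
 qed
qed

section \<open>Closeness with a fixed error and the climb in m\<close>

text \<open>Closeness at one index with a fixed number as error. Unlike \<open>Cl\<close>, it can be
  carried through an induction on \<open>m\<close> whose length depends on the index.\<close>

definition Pc :: "nat => (fmat => fmat) => nat => nat => real => bool" where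
 "Pc k h q m d \<longleftrightarrow> (\<exists>W\<in>UU k. \<forall>u\<in>UU m. nn k (h (JJ k q m u) * W - W * JJ k q m u) \<le> d)"

lemma Pc_mono: "Pc k h q m \<delta> ==> \<delta> \<le> \<delta>' ==> Pc k h q m \<delta>'"
 unfolding Pc_def by (meson order_trans)

lemma nn_perturb: "nn k (X - Y) \<le> nn k (X' - Y') + (nn k (X - X') + nn k (Y - Y'))"
proof -
 have "nn k (X - Y) \<le> nn k (X - X') + nn k (X' - Y)" by (rule nn_diff_triangle)
 also have "nn k (X' - Y) \<le> nn k (X' - Y') + nn k (Y' - Y)" by (rule nn_diff_triangle)
 finally show ?thesis by (simp add: nn_commute[of k Y' Y])
qed

lemma nn_rescale: "k > 0 ==> k' > 0 ==> nn k' x = nn k x * sqrt (real k / real k')"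
 by (simp add: nn_def real_sqrt_divide)

text \<open>The map is transported to a size \<open>k'\<close> divisible by \<open>m\<close>, where
  exact block copies exist.\<close>

definition rz :: "('i => nat) => ('i => nat) => ('i => fmat => fmat) => 'i => fmat => fmat" where
 "rz k k' h i u = rs (k i) (k' i) (h i (rs (k' i) (k i) u))"

text \<open>Rounding down to a multiple of \<open>m\<close> loses fewer than \<open>m\<close>
  coordinates. The maximum with 1 keeps the size positive at indices with
  \<open>k i < m i\<close>.\<close>

lemma asim_div:
 assumes pos: "\<And>i. 0 < k i" "\<And>i. 0 < m i" and lim: "((\<lambda>i. real (m i) / real (k i)) \<longlongrightarrow> 0) F"
 shows "asim F k (\<lambda>i. max 1 (k i div m i) * m i)"
proof (rule asim_sym, unfold asim_def, intro conjI allI)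
 show "0 < max 1 (k i div m i) * m i" "0 < k i" for i using pos by (simp_all add: max_def)
 have "\<forall>\<^sub>F i in F. real (m i) / real (k i) < 1" by (rule order_tendstoD(2)[OF lim]) simp
 then have b: "\<forall>\<^sub>F i in F. 1 - real (m i) / real (k i) \<le> real (max 1 (k i div m i) * m i) / real (k i) \<and>
   real (max 1 (k i div m i) * m i) / real (k i) \<le> 1"
 proof eventually_elim
  case (elim i)
  then have "m i < k i" using pos[of i] by simp
  then have "1 \<le> k i div m i" using pos(2)[of i] by (simp add: Suc_leI div_greater_zero_iff)
  then have mx: "max 1 (k i div m i) = k i div m i" by simp
  have "k i = k i div m i * m i + k i mod m i" "k i mod m i < m i" using pos(2)[of i] by simp_all
  then have "k i \<le> k i div m i * m i + m i" "k i div m i * m i \<le> k i" by linarith+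
  then have "real (k i) \<le> real (k i div m i * m i) + real (m i)" "real (k i div m i * m i) \<le> real (k i)"
   by (metis of_nat_add of_nat_le_iff)+
  moreover have "1 - real (m i) / real (k i) = (real (k i) - real (m i)) / real (k i)" using pos(1)[of i] by (simp add: diff_divide_distrib)
  ultimately show ?case unfolding mx using pos(1)[of i] by (auto intro!: divide_right_mono simp: divide_le_eq_1)
 qed
 have "((\<lambda>i. 1 - real (m i) / real (k i)) \<longlongrightarrow> 1 - 0) F" by (intro tendsto_intros lim)
 then have "((\<lambda>i. 1 - real (m i) / real (k i)) \<longlongrightarrow> 1) F" by simp
 then show "((\<lambda>i. real (max 1 (k i div m i) * m i) / real (k i)) \<longlongrightarrow> 1) F"
  by (rule tendsto_sandwich[OF _ _ _ tendsto_const, rotated 2]) (use b in \<open>auto elim: eventually_mono\<close>)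
qed

context
 fixes F :: "'i filter" and k k' q m :: "'i => nat" and \<theta> :: "'i => fmat => fmat"
 assumes A: "amap F k k \<theta>" and Ce: "acent F k k \<theta>" and s: "asim F k k'"
  and k': "\<And>i. k' i = q i * m i" and q: "\<And>i. 0 < q i" and m: "\<And>i. 0 < m i"
begin

lemma rz_amap: "amap F k' k' (rz k k' \<theta>)"
 unfolding rz_def[abs_def] by (rule amap_comp[OF amap_comp[OF amap_rs[OF asim_sym[OF s]] A] amap_rs[OF s]])

lemma rz_acent: "acent F k' k' (rz k k' \<theta>)"
 unfolding rz_def[abs_def]
 by (rule acent_comp[OF acent_comp[OF acent_rs[OF asim_sym[OF s]] Ce amap_rs[OF asim_sym[OF s]] A] acent_rs[OF s]
   amap_comp[OF amap_rs[OF asim_sym[OF s]] A] amap_rs[OF s]])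

lemma kpos: "0 < k i" "0 < k' i" using s by (auto simp: asim_def)

lemma iU: "u \<in> UU (m i) ==> iot (q i) (m i) u \<in> UU (k' i)"
 unfolding k' by (rule iot_UU[OF m])

lemma JU: "u \<in> UU (m i) ==> JJ (k i) (q i) (m i) u \<in> UU (k i)"
 by (rule JJ_UU[OF m])

lemma JJ_near: "(\<And>i. u i \<in> UU (m i)) ==> aeq F k' (\<lambda>i. JJ (k i) (q i) (m i) (u i)) (\<lambda>i. iot (q i) (m i) (u i))"
 using asim_rs[OF asim_sym[OF s], of "\<lambda>i. iot (q i) (m i) (u i)"] iU
 unfolding JJ_def k'[symmetric] asim_aeq[OF s, symmetric] by simp

lemma rz_near:
 assumes u: "\<And>i. u i \<in> UU (m i)"
 shows "aeq F k' (\<lambda>i. rz k k' \<theta> i (iot (q i) (m i) (u i))) (\<lambda>i. \<theta> i (JJ (k i) (q i) (m i) (u i)))"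
 unfolding rz_def JJ_def k'[symmetric]
 by (rule asim_rs[OF s]) (use amap_maps[OF A rs_UU[OF iU[OF u]]] in simp)

lemma intertwine_near:
 assumes W: "\<And>i. W i \<in> UU (k i)" and W': "\<And>i. W' i \<in> UU (k' i)" and WW: "aeq F k' W' W" and u: "\<And>i. u i \<in> UU (m i)"
 shows "aeq F k' (\<lambda>i. rz k k' \<theta> i (iot (q i) (m i) (u i)) * W' i) (\<lambda>i. \<theta> i (JJ (k i) (q i) (m i) (u i)) * W i)"
  and "aeq F k' (\<lambda>i. W' i * iot (q i) (m i) (u i)) (\<lambda>i. W i * JJ (k i) (q i) (m i) (u i))"
proof -
 have c: "\<forall>\<^sub>F i in F. con (W' i)" "\<forall>\<^sub>F i in F. con (W i)" "\<forall>\<^sub>F i in F. con (\<theta> i (JJ (k i) (q i) (m i) (u i)))" "\<forall>\<^sub>F i in F. con (iot (q i) (m i) (u i))"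
  using con_UU[OF W] con_UU[OF W'] con_UU[OF amap_maps[OF A JU[OF u]]] con_UU[OF iU[OF u]] by (auto intro!: always_eventually)
 show "aeq F k' (\<lambda>i. rz k k' \<theta> i (iot (q i) (m i) (u i)) * W' i) (\<lambda>i. \<theta> i (JJ (k i) (q i) (m i) (u i)) * W i)"
  by (rule aeq_mult[OF rz_near[OF u] WW c(1,3)])
 show "aeq F k' (\<lambda>i. W' i * iot (q i) (m i) (u i)) (\<lambda>i. W i * JJ (k i) (q i) (m i) (u i))"
  by (rule aeq_mult[OF WW aeq_sym[OF JJ_near[OF u]] c(4,2)])
qed

text \<open>From a fixed error to o(1). The constants fit exactly: 7/24 (1 + 1/28) + 2/192 = 5/16
  after resizing, and 3 (5/16) + 1/32 + 1/32 = 1 after \<open>re_anchor\<close> and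
  \<open>reduce\<close>, the largest error that \<open>self_correct_asym\<close> accepts.\<close>

theorem close_imp_Cl:
 assumes cl: "\<forall>\<^sub>F i in F. Pc (k i) (\<theta> i) (q i) (m i) (7 / 24)"
 obtains W where "Cl F k' (rz k k' \<theta>) q m W"
proof -
 have "\<exists>W. W \<in> UU (k i) \<and> (Pc (k i) (\<theta> i) (q i) (m i) (7 / 24) \<longrightarrow>
  (\<forall>u\<in>UU (m i). nn (k i) (\<theta> i (JJ (k i) (q i) (m i) u) * W - W * JJ (k i) (q i) (m i) u) \<le> 7 / 24))" for i
 proof (cases "Pc (k i) (\<theta> i) (q i) (m i) (7 / 24)")
  case True then show ?thesis unfolding Pc_def by blast
 next
  case False then show ?thesis using UU_fid by blast
 qed
 then obtain W0 where W0: "\<And>i. W0 i \<in> UU (k i)"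
  "\<And>i. Pc (k i) (\<theta> i) (q i) (m i) (7 / 24) ==> \<forall>u\<in>UU (m i). nn (k i) (\<theta> i (JJ (k i) (q i) (m i) u) * W0 i - W0 i * JJ (k i) (q i) (m i) u) \<le> 7 / 24"
  by metis
 let ?W' = "\<lambda>i. rs (k i) (k' i) (W0 i)" and ?I = "\<lambda>i. iot (q i) (m i)" and ?T = "rz k k' \<theta>"
 have W': "?W' i \<in> UU (k' i)" for i by (rule rs_UU[OF W0(1)])
 have WW: "aeq F k' ?W' W0" by (rule asim_rs[OF s]) (use W0(1) in simp)
 note near = intertwine_near[OF W0(1) W' WW]
 have ne: "UU (m i) \<noteq> {}" for i using UU_fid by blast
 have u1: "U0 F (\<lambda>i. UU (m i)) (\<lambda>i u. nn (k' i) (?T i (?I i u) * ?W' i - \<theta> i (JJ (k i) (q i) (m i) u) * W0 i))"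
  by (rule U0_I[OF near(1)[unfolded aeq_def] ne])
 have u2: "U0 F (\<lambda>i. UU (m i)) (\<lambda>i u. nn (k' i) (?W' i * ?I i u - W0 i * JJ (k i) (q i) (m i) u))"
  by (rule U0_I[OF near(2)[unfolded aeq_def] ne])
 have "((\<lambda>i. sqrt (real (k i) / real (k' i))) \<longlongrightarrow> sqrt 1) F" using s unfolding asim_def by (intro tendsto_real_sqrt) auto
 then have sq: "\<forall>\<^sub>F i in F. sqrt (real (k i) / real (k' i)) < 1 + 1 / 28" by (rule order_tendstoD(2)) simp
 have e1: "\<forall>\<^sub>F i in F. \<forall>u\<in>UU (m i). nn (k' i) (?T i (?I i u) * ?W' i - \<theta> i (JJ (k i) (q i) (m i) u) * W0 i) < 1 / 192"
  by (rule u1[unfolded U0_def, rule_format]) simp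
 have e2: "\<forall>\<^sub>F i in F. \<forall>u\<in>UU (m i). nn (k' i) (?W' i * ?I i u - W0 i * JJ (k i) (q i) (m i) u) < 1 / 192"
  by (rule u2[unfolded U0_def, rule_format]) simp
 have c1: "\<forall>\<^sub>F i in F. \<forall>v\<in>UU (m i). nn (k' i) (?T i (?I i v) * ?W' i - ?W' i * ?I i v) \<le> 5 / 16"
  using cl sq e1 e2
 proof eventually_elim
  case (elim i)
  show ?case
  proof
   fix v assume v: "v \<in> UU (m i)"
   let ?d = "\<theta> i (JJ (k i) (q i) (m i) v) * W0 i - W0 i * JJ (k i) (q i) (m i) v"
   have "nn (k' i) ?d = nn (k i) ?d * sqrt (real (k i) / real (k' i))" by (rule nn_rescale[OF kpos])
   also have "\<dots> \<le> 7 / 24 * (1 + 1 / 28)"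
    by (intro mult_mono) (use W0(2)[OF elim(1)] v elim(2) in auto)
   finally have "nn (k' i) ?d \<le> 7 / 24 + 1 / 96" by simp
   then show "nn (k' i) (?T i (?I i v) * ?W' i - ?W' i * ?I i v) \<le> 5 / 16"
    using nn_perturb[of "k' i" "?T i (?I i v) * ?W' i" "?W' i * ?I i v" "\<theta> i (JJ (k i) (q i) (m i) v) * W0 i" "W0 i * JJ (k i) (q i) (m i) v"]
     elim(3)[rule_format, OF v] elim(4)[rule_format, OF v] by linarith
  qed
 qed
 have H: "neb (m i) (heis (m i))" "neb (q i) (heis (q i))" for i by (rule neb_heis[OF m], rule neb_heis[OF q])
 show thesis
 proof (rule anchor_conj[OF rz_amap rz_acent])
  show "neb (k' i) (krset (m i) (heis (q i)) (heis (m i)))" for i unfolding k' by (rule neb_kr[OF H(2,1)])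
  fix W assume W: "\<And>i. W i \<in> UU (k' i)"
   and cA: "amap F k' k' (\<lambda>i u. adj (W i) * ?T i u * W i)" and cC: "acent F k' k' (\<lambda>i u. adj (W i) * ?T i u * W i)"
   and an: "\<And>b. (\<And>i. b i \<in> phs (krset (m i) (heis (q i)) (heis (m i)))) ==> aeq F k' (\<lambda>i. adj (W i) * ?T i (b i) * W i) b"
  let ?f = "\<lambda>i u. adj (W i) * ?T i u * W i"
  show thesis
  proof (rule reduce[OF cA cC k' q H(1) an])
   fix \<theta>1 assume t: "amap F m m \<theta>1" "acent F m m \<theta>1"
    and red: "anear F m k' (\<lambda>i u. ?f i (?I i u)) (\<lambda>i u. ?I i (\<theta>1 i u))"
    and g: "\<And>g. (\<And>i. g i \<in> phs (heis (m i))) ==> aeq F m (\<lambda>i. \<theta>1 i (g i)) g"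
   have "\<forall>\<^sub>F i in F. \<forall>v\<in>UU (m i). nn (k' i) (?f i (?I i v) - ?I i v) \<le> 3 * (5 / 16) + 1 / 32"
   proof (rule re_anchor[OF cA k' q H(1), where Y = "\<lambda>i. adj (W i) * ?W' i"])
    fix g assume g: "\<And>i. g i \<in> heis (m i)"
    show "aeq F k' (\<lambda>i. ?f i (?I i (g i))) (\<lambda>i. ?I i (g i))"
    proof (rule an)
     show "?I i (g i) \<in> phs (krset (m i) (heis (q i)) (heis (m i)))" for i
      unfolding iot_def by (rule phs_kr[OF phs_fid[OF H(2)] phs_sub[OF g] m])
    qed
   next
    show "adj (W i) * ?W' i \<in> UU (k' i)" for i using W W' by blast
    show "\<forall>\<^sub>F i in F. \<forall>v\<in>UU (m i). nn (k' i) (?f i (?I i v) * (adj (W i) * ?W' i) - adj (W i) * ?W' i * ?I i v) \<le> 5 / 16"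
     using c1
    proof eventually_elim
     case (elim i)
     show ?case
     proof
      fix v assume v: "v \<in> UU (m i)"
      have TU: "?T i (?I i v) \<in> UU (k' i)" by (rule amap_maps[OF rz_amap iU[OF v]])
      have "?f i (?I i v) * (adj (W i) * ?W' i) = adj (W i) * (?T i (?I i v) * ?W' i)"
       using W[of i] W'[of i] TU by (simp add: mult.assoc UU_canc)
      then have "?f i (?I i v) * (adj (W i) * ?W' i) - adj (W i) * ?W' i * ?I i v = adj (W i) * (?T i (?I i v) * ?W' i - ?W' i * ?I i v)"
       by (simp add: algebra_simps)
      then have "norm (?f i (?I i v) * (adj (W i) * ?W' i) - adj (W i) * ?W' i * ?I i v) = norm (?T i (?I i v) * ?W' i - ?W' i * ?I i v)"
       using norm_UU_left[OF UU_adj[OF W], of "?T i (?I i v) * ?W' i - ?W' i * ?I i v" i] TU W'[of i] iU[OF v] by simp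
      then show "nn (k' i) (?f i (?I i v) * (adj (W i) * ?W' i) - adj (W i) * ?W' i * ?I i v) \<le> 5 / 16"
       using elim v by (simp add: nn_def)
     qed
    qed
   qed simp
   moreover have "\<forall>\<^sub>F i in F. \<forall>v\<in>UU (m i). nn (k' i) (?f i (?I i v) - ?I i (\<theta>1 i v)) < 1 / 32"
    using red unfolding anear_def U0_def by (elim allE[of _ "1 / 32"]) simp
   ultimately have "\<forall>\<^sub>F i in F. \<forall>v\<in>UU (m i). nn (m i) (\<theta>1 i v - v) \<le> 1"
   proof eventually_elim
    case (elim i)
    show ?case
    proof
     fix v assume v: "v \<in> UU (m i)"
     have "nn (k' i) (?I i (\<theta>1 i v) - ?I i v) \<le> nn (k' i) (?f i (?I i v) - ?I i (\<theta>1 i v)) + nn (k' i) (?f i (?I i v) - ?I i v)"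
      using nn_diff_triangle[of "k' i" "?I i (\<theta>1 i v)" "?I i v" "?f i (?I i v)"] by (simp add: nn_commute)
     moreover have "nn (k' i) (?I i (\<theta>1 i v) - ?I i v) = nn (m i) (\<theta>1 i v - v)"
      using nn_iot[OF m q, of "\<theta>1 i v - v" i i] amap_maps[OF t(1) v] v by (simp add: iot_diff[OF m] k')
     ultimately show "nn (m i) (\<theta>1 i v - v) \<le> 1" using elim v by fastforce
    qed
   qed
   then have "anear F m m \<theta>1 (\<lambda>i u. u)"
    by (rule self_correct_asym[OF t(1) H(1), rotated]) (rule g, rule phs_sub)
   then show thesis by (intro that[of W] Cl_of_reduce[OF W k' _ red _ t(1)]) (use q m in auto)
  qed
 qed
qed

text \<open>The value 1/4 leaves a margin of 1/24 below the 7/24 of \<open>close_imp_Cl\<close>; the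
  increment of \<open>m\<close> uses this margin.\<close>

theorem Cl_imp_close:
 assumes cl: "Cl F k' (rz k k' \<theta>) q m W"
 shows "\<forall>\<^sub>F i in F. Pc (k i) (\<theta> i) (q i) (m i) (1 / 4)"
proof -
 have W: "W i \<in> UU (k' i)" for i using cl by (simp add: Cl_def)
 let ?V = "\<lambda>i. rs (k' i) (k i) (W i)" and ?I = "\<lambda>i. iot (q i) (m i)" and ?T = "rz k k' \<theta>"
 have V: "?V i \<in> UU (k i)" for i by (rule rs_UU[OF W])
 have "aeq F k ?V W" by (rule asim_rs[OF asim_sym[OF s]]) (use W in simp)
 then have WV: "aeq F k' W ?V" unfolding asim_aeq[OF s] by (rule aeq_sym)
 note near = intertwine_near[OF V W WV]
 have "U0 F (\<lambda>i. UU (m i)) (\<lambda>i u. nn (k i) (\<theta> i (JJ (k i) (q i) (m i) u) * ?V i - ?V i * JJ (k i) (q i) (m i) u))"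
 proof (rule U0_I)
  fix u assume u: "\<And>i. u i \<in> UU (m i)"
  have "aeq F k' (\<lambda>i. adj (W i) * ?T i (?I i (u i)) * W i) (\<lambda>i. ?I i (u i))"
   by (rule anear_seq[OF cl[unfolded Cl_def, THEN conjunct2] filterlim_ident]) (use u in simp)
  then have "aeq F k' (\<lambda>i. W i * (adj (W i) * ?T i (?I i (u i)) * W i)) (\<lambda>i. W i * ?I i (u i))"
   by (rule aeq_left) (use con_UU[OF W] in simp)
  moreover have "W i * (adj (W i) * ?T i (?I i (u i)) * W i) = ?T i (?I i (u i)) * W i" for i
   using W[of i] amap_maps[OF rz_amap iU[OF u]] by (simp add: mult.assoc UU_canc)
  ultimately have "aeq F k' (\<lambda>i. ?T i (?I i (u i)) * W i) (\<lambda>i. W i * ?I i (u i))" by simp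
  from aeq_sandwich'[OF near(1)[OF u] near(2)[OF u] this]
  have "aeq F k (\<lambda>i. \<theta> i (JJ (k i) (q i) (m i) (u i)) * ?V i) (\<lambda>i. ?V i * JJ (k i) (q i) (m i) (u i))"
   unfolding asim_aeq[OF s] .
  then show "((\<lambda>i. nn (k i) (\<theta> i (JJ (k i) (q i) (m i) (u i)) * ?V i - ?V i * JJ (k i) (q i) (m i) (u i))) \<longlongrightarrow> 0) F"
   by (simp add: aeq_def)
 qed (use UU_fid in blast)
 then have "\<forall>\<^sub>F i in F. \<forall>u\<in>UU (m i). nn (k i) (\<theta> i (JJ (k i) (q i) (m i) u) * ?V i - ?V i * JJ (k i) (q i) (m i) u) < 1 / 4"
  unfolding U0_def by (elim allE[of _ "1 / 4"]) simp
 then show ?thesis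
 proof eventually_elim
  case (elim i)
  then show ?case unfolding Pc_def using V[of i] less_imp_le by blast
 qed
qed

end

text \<open>Each doubling moves one factor 2 from the multiplicity into the block. The number
  \<open>s\<close> is the same for all indices, so the limits survive.\<close>

lemma Cl_pow:
 fixes F :: "'i filter"
 assumes A: "amap F k k h" and Ce: "acent F k k h" and m: "\<And>i. m i > 0"
 shows "(\<And>i. k i = q i * (2 ^ s * (2 * m i))) ==> (\<And>i. q i > 0) ==> Cl F k h (\<lambda>i. q i * 2 ^ s) (\<lambda>i. 2 * m i) W0 ==>
  \<exists>W. Cl F k h q (\<lambda>i. 2 ^ s * (2 * m i)) W"
proof (induction s arbitrary: q)
 case 0 then show ?case by auto
next
 case (Suc s)
 have "\<exists>W. Cl F k h (\<lambda>i. q i * 2) (\<lambda>i. 2 ^ s * (2 * m i)) W"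
  by (rule Suc.IH) (use Suc.prems in \<open>simp_all add: mult.assoc\<close>)
 then obtain W where W: "Cl F k h (\<lambda>i. q i * 2) (\<lambda>i. 2 * (2 ^ s * m i)) W" by (auto simp: mult.left_commute)
 have eq: "(\<lambda>i. 2 ^ Suc s * (2 * m i)) = (\<lambda>i. 2 * (2 * (2 ^ s * m i)))" by (simp add: mult_ac)
 show ?case unfolding eq
 proof (rule Cl_double[OF A Ce _ Suc.prems(2) _ W])
  show "k i = q i * (2 * (2 * (2 ^ s * m i)))" "0 < 2 ^ s * m i" for i
   using Suc.prems(1)[of i] m[of i] by simp_all
 qed (rule exI)
qed

text \<open>The start of the climb: for a fixed block size the asymptotic theory applies along the
  original sequence.\<close>

lemma close_pow2:
 fixes k :: "nat => nat"
 assumes A: "amap sequentially k k h" and Ce: "acent sequentially k k h" and kp: "\<And>n. 0 < k n"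
  and lim: "filterlim k at_top sequentially"
 shows "\<forall>\<^sub>F n in sequentially. Pc (k n) (h n) (k n div 2 ^ Suc s) (2 ^ Suc s) (1 / 4)"
proof -
 let ?m = "\<lambda>n::nat. 2 ^ Suc s :: nat"
 define q where "q n = max 1 (k n div 2 ^ Suc s)" for n
 define k' where "k' n = q n * 2 ^ Suc s" for n
 have q: "0 < q n" for n by (simp add: q_def)
 have klim: "filterlim (\<lambda>n. real (k n)) at_top sequentially"
  by (rule filterlim_compose[OF filterlim_real_sequentially lim])
 have "((\<lambda>n. real (?m n) / real (k n)) \<longlongrightarrow> 0) sequentially"
  by (rule real_tendsto_divide_at_top[OF tendsto_const klim])
 from asim_div[OF kp _ this] have sm: "asim sequentially k k'" by (simp add: k'_def[abs_def] q_def)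
 have mp: "0 < (2::nat) ^ Suc s" for n :: nat by simp
 note rA = rz_amap[OF A Ce sm k'_def q mp] and rC = rz_acent[OF A Ce sm k'_def q mp]
 have k2: "k' n = (q n * 2 ^ s) * 2" and k3: "k' n = q n * (2 ^ s * (2 * 1))" and q2: "0 < q n * 2 ^ s" for n
  using q[of n] by (simp_all add: k'_def)
 obtain W0 where W0: "Cl sequentially k' (rz k k' h) (\<lambda>n. q n * 2 ^ s) (\<lambda>_. 2) W0"
  by (rule Cl_2[OF rA rC k2 q2], rule that)
 have "\<exists>W. Cl sequentially k' (rz k k' h) q (\<lambda>n. 2 ^ s * (2 * 1)) W"
  by (rule Cl_pow[OF rA rC _ k3 q]) (use W0 in simp_all)
 moreover have "(\<lambda>n::nat. 2 ^ s * (2 * 1)) = ?m" by (simp add: mult.commute)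
 ultimately obtain W where "Cl sequentially k' (rz k k' h) q ?m W" by metis
 note c = Cl_imp_close[OF A Ce sm k'_def q mp this]
 have "\<forall>\<^sub>F n in sequentially. 2 ^ Suc s \<le> k n" using lim unfolding filterlim_at_top by blast
 with c show ?thesis
 proof eventually_elim
  case (elim n)
  then have "1 \<le> k n div 2 ^ Suc s" by (simp add: Suc_leI div_greater_zero_iff)
  then show ?case using elim(1) by (simp add: q_def)
 qed
qed

text \<open>If no \<open>j\<close> worked, there would be failing pairs along which \<open>m\<close>
  and \<open>K / m\<close> both tend to infinity. There \<open>JJ_step\<close> has relative error
  o(1), so closeness 1/4 for \<open>m\<close> gives 7/24 for \<open>m + 1\<close>, which
  \<open>close_imp_Cl\<close> and \<open>Cl_imp_close\<close> bring back to 1/4, contrary to the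
  choice of the pairs.\<close>

lemma close_step:
 fixes k :: "nat => nat"
 assumes A: "amap sequentially k k \<theta>" and Ce: "acent sequentially k k \<theta>" and kp: "\<And>n. 0 < k n"
 obtains j where "\<And>n m. n \<ge> j ==> 2 ^ j \<le> m ==> m * 2 ^ j \<le> k n ==> Pc (k n) (\<theta> n) (k n div m) m (1 / 4) ==>
  Pc (k n) (\<theta> n) (k n div (m + 1)) (m + 1) (1 / 4)"
proof (rule ccontr)
 assume "\<not> thesis"
 then have "\<exists>n m. n \<ge> Suc j \<and> 2 ^ Suc j \<le> m \<and> m * 2 ^ Suc j \<le> k n \<and> Pc (k n) (\<theta> n) (k n div m) m (1 / 4) \<and>
  \<not> Pc (k n) (\<theta> n) (k n div (m + 1)) (m + 1) (1 / 4)" for j using that[of "Suc j"] by blast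
 then obtain p m where pm: "\<And>j. p j \<ge> Suc j" "\<And>j. 2 ^ Suc j \<le> m j" "\<And>j. m j * 2 ^ Suc j \<le> k (p j)"
  "\<And>j. Pc (k (p j)) (\<theta> (p j)) (k (p j) div m j) (m j) (1 / 4)"
  "\<And>j. \<not> Pc (k (p j)) (\<theta> (p j)) (k (p j) div (m j + 1)) (m j + 1) (1 / 4)" by metis
 have plim: "filterlim p sequentially sequentially"
  unfolding filterlim_at_top
 proof
  fix Z show "\<forall>\<^sub>F j in sequentially. Z \<le> p j"
   by (rule eventually_sequentiallyI[of Z]) (use pm(1) in \<open>meson Suc_leD order_trans\<close>)
 qed
 define K where "K j = k (p j)" for j
 define T where "T j = \<theta> (p j)" for j
 have A': "amap sequentially K K T" unfolding K_def[abs_def] T_def[abs_def] by (rule amap_reindex[OF A plim])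
 have Ce': "acent sequentially K K T"
  unfolding K_def[abs_def] T_def[abs_def] acent_def
  using U0_reindex[OF Ce[unfolded acent_def] plim] .
 have Kp: "0 < K j" for j by (simp add: K_def kp)
 note pm = pm[folded K_def T_def]
 have m2: "2 \<le> m j" for j
 proof -
  have "(1::nat) \<le> 2 ^ j" by simp
  then show ?thesis using pm(2)[of j] unfolding power_Suc by linarith
 qed
 have mK: "m j * 2 \<le> K j" for j
 proof -
  have "m j * 2 \<le> m j * 2 ^ Suc j" by (intro mult_left_mono) auto
  then show ?thesis using pm(3)[of j] by linarith
 qed
 have m1K: "m j + 1 \<le> K j" for j using m2[of j] mK[of j] by linarith
 define q q' where "q j = K j div m j" and "q' j = K j div (m j + 1)" for j
 have q': "0 < q' j" and q: "0 < q j" for j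
  using m1K[of j] m2[of j] by (simp_all add: q'_def q_def div_greater_zero_iff)
 have pw: "(\<lambda>j. 1 / 2 ^ j :: real) \<longlonglongrightarrow> 0"
  using LIMSEQ_power_zero[of "1 / 2 :: real"] by (simp add: power_one_over)
 have b1: "real (m j) / real (K j) \<le> 1 / 2 ^ j" "1 / real (m j) \<le> 1 / 2 ^ j" for j
 proof -
  have "m j * 2 ^ j \<le> m j * 2 ^ Suc j" by simp
  then have "m j * 2 ^ j \<le> K j" using pm(3)[of j] by linarith
  then have "real (m j) * 2 ^ j \<le> real (K j)"
   using of_nat_le_iff[where 'a = real, of "m j * 2 ^ j" "K j"] by simp
  then show "real (m j) / real (K j) \<le> 1 / 2 ^ j" using Kp[of j] by (simp add: field_simps)
  have "2 ^ j \<le> m j" using pm(2)[of j] by simp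
  then have "(2::real) ^ j \<le> real (m j)"
   using of_nat_le_iff[where 'a = real, of "2 ^ j" "m j"] by simp
  then show "1 / real (m j) \<le> 1 / 2 ^ j" by (intro divide_left_mono) (use m2[of j] in auto)
 qed
 have r: "(\<lambda>j. real (m j + 1) / real (K j)) \<longlonglongrightarrow> 0"
 proof (rule tendsto_0_le_ev)
  show "(\<lambda>j. 2 * (1 / 2 ^ j) :: real) \<longlonglongrightarrow> 0" using tendsto_mult_right_zero[OF pw] .
  have "real (m j + 1) / real (K j) \<le> 2 * (1 / 2 ^ j)" for j
  proof -
   have "real (m j + 1) / real (K j) \<le> (2 * real (m j)) / real (K j)" using m2[of j] by (intro divide_right_mono) auto
   then show ?thesis using b1(1)[of j] by simp
  qed
  then show "\<forall>\<^sub>F j in sequentially. 0 \<le> real (m j + 1) / real (K j) \<and> real (m j + 1) / real (K j) \<le> 2 * (1 / 2 ^ j)" by simp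
 qed
 define K' where "K' j = q' j * (m j + 1)" for j
 have "max 1 (K j div (m j + 1)) = q' j" for j using q'[of j] by (simp add: q'_def)
 then have sm: "asim sequentially K K'" using asim_div[OF Kp _ r] by (simp add: K'_def[abs_def])
 have "\<exists>W. W \<in> UU (K j) \<and> (\<forall>u\<in>UU (m j + 1). \<exists>v\<in>UU (m j). norm (JJ (K j) (q' j) (m j + 1) u - W * JJ (K j) (q j) (m j) v * adj W) \<le> 8 * sqrt (real (m j) + real (K j) / real (m j)))" for j
  by (rule JJ_step[OF _ m1K q_def q'_def]) (use m2[of j] in auto)
 then obtain R where R: "\<And>j. R j \<in> UU (K j)" "\<And>j u. u \<in> UU (m j + 1) ==> \<exists>v\<in>UU (m j). norm (JJ (K j) (q' j) (m j + 1) u - R j * JJ (K j) (q j) (m j) v * adj (R j)) \<le> 8 * sqrt (real (m j) + real (K j) / real (m j))"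
  by metis
 define v where "v j u = (SOME v. v \<in> UU (m j) \<and> norm (JJ (K j) (q' j) (m j + 1) u - R j * JJ (K j) (q j) (m j) v * adj (R j)) \<le> 8 * sqrt (real (m j) + real (K j) / real (m j)))" for j u
 have v: "v j u \<in> UU (m j)" "norm (JJ (K j) (q' j) (m j + 1) u - R j * JJ (K j) (q j) (m j) (v j u) * adj (R j)) \<le> 8 * sqrt (real (m j) + real (K j) / real (m j))"
  if "u \<in> UU (m j + 1)" for j u
  using someI_ex[of "\<lambda>v. v \<in> UU (m j) \<and> norm (JJ (K j) (q' j) (m j + 1) u - R j * JJ (K j) (q j) (m j) v * adj (R j)) \<le> 8 * sqrt (real (m j) + real (K j) / real (m j))"]
   R(2)[OF that] unfolding v_def by blast+
 obtain W where W: "\<And>j. W j \<in> UU (K j)" "\<And>j u. u \<in> UU (m j) ==> nn (K j) (T j (JJ (K j) (q j) (m j) u) * W j - W j * JJ (K j) (q j) (m j) u) \<le> 1 / 4"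
  using pm(4) unfolding Pc_def q_def by metis
 \<comment> \<open>\<open>W\<close> intertwines the copies of \<open>v\<close>; conjugation by
   \<open>R\<close> in the source corresponds to conjugation by \<open>T j (R j)\<close> in the
   target, so this product almost intertwines the copies of \<open>u\<close>.\<close>
 define V where "V j = T j (R j) * W j * adj (R j)" for j
 have TR: "T j (R j) \<in> UU (K j)" for j by (rule amap_maps[OF A' R(1)])
 have V: "V j \<in> UU (K j)" for j unfolding V_def using TR R(1) W(1) by (blast intro: UU_mult)
 let ?J' = "\<lambda>j u. JJ (K j) (q' j) (m j + 1) u" and ?J = "\<lambda>j u. JJ (K j) (q j) (m j) (v j u)"
 have J'U: "u \<in> UU (m j + 1) ==> ?J' j u \<in> UU (K j)" for j u by (rule JJ_UU) auto
 have JU: "u \<in> UU (m j + 1) ==> ?J j u \<in> UU (K j)" for j u using m2[of j] by (intro JJ_UU v) auto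
 have Jn: "aeqs K (\<lambda>j. ?J' j (u j)) (\<lambda>j. R j * ?J j (u j) * adj (R j))" if u: "\<And>j. u j \<in> UU (m j + 1)" for u
  unfolding aeq_def
 proof (rule tendsto_0_le_ev)
  have "(\<lambda>j. 8 * sqrt (2 * (1 / 2 ^ j)) :: real) \<longlonglongrightarrow> 8 * sqrt (2 * 0)" by (intro tendsto_intros pw)
  then show "(\<lambda>j. 8 * sqrt (2 * (1 / 2 ^ j)) :: real) \<longlonglongrightarrow> 0" by simp
  have "nn (K j) (?J' j (u j) - R j * ?J j (u j) * adj (R j)) \<le> 8 * sqrt (2 * (1 / 2 ^ j))" for j
  proof -
   have "nn (K j) (?J' j (u j) - R j * ?J j (u j) * adj (R j)) \<le> 8 * sqrt (real (m j) + real (K j) / real (m j)) / sqrt (real (K j))"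
    unfolding nn_def by (rule divide_right_mono[OF v(2)[OF u]]) simp
   also have "\<dots> = 8 * sqrt (real (m j) / real (K j) + 1 / real (m j))"
   proof -
    have "(real (m j) + real (K j) / real (m j)) / real (K j) = real (m j) / real (K j) + 1 / real (m j)"
     using Kp[of j] by (simp add: add_divide_distrib)
    then show ?thesis by (metis real_sqrt_divide times_divide_eq_right)
   qed
   also have "\<dots> \<le> 8 * sqrt (2 * (1 / 2 ^ j))" using b1[of j] by (intro mult_left_mono real_sqrt_le_mono) auto
   finally show ?thesis .
  qed
  then show "\<forall>\<^sub>F j in sequentially. 0 \<le> nn (K j) (?J' j (u j) - R j * ?J j (u j) * adj (R j)) \<and>
   nn (K j) (?J' j (u j) - R j * ?J j (u j) * adj (R j)) \<le> 8 * sqrt (2 * (1 / 2 ^ j))" by simp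
 qed
 interpret S: self_amap sequentially K T using A' Ce' by (simp add: self_amap_def)
 have near1: "aeqs K (\<lambda>j. T j (?J' j (u j)) * V j) (\<lambda>j. T j (R j) * (T j (?J j (u j)) * W j) * adj (R j))"
  if u: "\<And>j. u j \<in> UU (m j + 1)" for u
 proof -
  have ar: "adj (R j) \<in> UU (K j)" for j using R(1) by blast
  have RJ: "R j * ?J j (u j) \<in> UU (K j)" for j using R(1) JU[OF u] by blast
  have RJR: "R j * ?J j (u j) * adj (R j) \<in> UU (K j)" for j using RJ ar by blast
  have "aeqs K (\<lambda>j. T j (?J' j (u j))) (\<lambda>j. T j (R j * ?J j (u j) * adj (R j)))"
   by (rule amap_cont[OF A' filterlim_ident S.ev_U[OF J'U[OF u]] S.ev_U[OF RJR] Jn[OF u]])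
  also have "aeqs K \<dots> (\<lambda>j. T j (R j * ?J j (u j)) * T j (adj (R j)))"
   by (rule S.multA[OF RJ ar])
  also have "aeqs K \<dots> (\<lambda>j. (T j (R j) * T j (?J j (u j))) * adj (T j (R j)))"
  proof (rule aeq_mult[OF S.multA[OF R(1) JU[OF u]] amap_adj[OF A' filterlim_ident S.ev_U[OF R(1)]] S.ev_con_\<theta>[OF ar]])
   show "\<forall>\<^sub>F j in sequentially. con (T j (R j) * T j (?J j (u j)))"
    by (rule S.ev_con) (use amap_maps[OF A' R(1)] amap_maps[OF A' JU[OF u]] in blast)
  qed
  finally have "aeqs K (\<lambda>j. T j (?J' j (u j)) * V j) (\<lambda>j. ((T j (R j) * T j (?J j (u j))) * adj (T j (R j))) * V j)"
   by (rule aeq_right) (use con_UU[OF V] in simp)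
  moreover have "((T j (R j) * T j (?J j (u j))) * adj (T j (R j))) * V j = T j (R j) * (T j (?J j (u j)) * W j) * adj (R j)" for j
   using TR[of j] W(1)[of j] R(1)[of j] by (simp add: V_def mult.assoc UU_canc)
  ultimately show ?thesis by simp
 qed
 have near2: "aeqs K (\<lambda>j. V j * ?J' j (u j)) (\<lambda>j. T j (R j) * (W j * ?J j (u j)) * adj (R j))"
  if u: "\<And>j. u j \<in> UU (m j + 1)" for u
 proof -
  have "aeqs K (\<lambda>j. V j * ?J' j (u j)) (\<lambda>j. V j * (R j * ?J j (u j) * adj (R j)))"
   by (rule aeq_left[OF Jn[OF u]]) (use con_UU[OF V] in simp)
  moreover have "V j * (R j * ?J j (u j) * adj (R j)) = T j (R j) * (W j * ?J j (u j)) * adj (R j)" for j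
   using W(1)[of j] R(1)[of j] JU[OF u, of j] by (simp add: V_def mult.assoc UU_canc)
  ultimately show ?thesis by simp
 qed
 have ne: "UU (m j + 1) \<noteq> {}" for j using UU_fid by blast
 have "\<forall>\<^sub>F j in sequentially. \<forall>u\<in>UU (m j + 1). nn (K j) (T j (?J' j u) * V j - T j (R j) * (T j (?J j u) * W j) * adj (R j)) < 1 / 48"
  by (rule U0_I[OF near1[unfolded aeq_def] ne, unfolded U0_def, rule_format]) auto
 moreover have "\<forall>\<^sub>F j in sequentially. \<forall>u\<in>UU (m j + 1). nn (K j) (V j * ?J' j u - T j (R j) * (W j * ?J j u) * adj (R j)) < 1 / 48"
  by (rule U0_I[OF near2[unfolded aeq_def] ne, unfolded U0_def, rule_format]) auto
 ultimately have "\<forall>\<^sub>F j in sequentially. Pc (K j) (T j) (q' j) (m j + 1) (7 / 24)"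
 proof eventually_elim
  case (elim j)
  have "nn (K j) (T j (?J' j u) * V j - V j * ?J' j u) \<le> 7 / 24" if u: "u \<in> UU (m j + 1)" for u
  proof -
   have TJ: "T j (?J j u) \<in> UU (K j)" by (rule amap_maps[OF A' JU[OF u]])
   have "T j (R j) * (T j (?J j u) * W j) * adj (R j) - T j (R j) * (W j * ?J j u) * adj (R j) =
    T j (R j) * (T j (?J j u) * W j - W j * ?J j u) * adj (R j)" by (simp add: algebra_simps)
   then have "norm (T j (R j) * (T j (?J j u) * W j) * adj (R j) - T j (R j) * (W j * ?J j u) * adj (R j)) = norm (T j (?J j u) * W j - W j * ?J j u)"
    using norm_conj_UU[OF TR UU_adj[OF R(1)], of "T j (?J j u) * W j - W j * ?J j u" j] TJ W(1)[of j] JU[OF u] by simp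
   then have "nn (K j) (T j (R j) * (T j (?J j u) * W j) * adj (R j) - T j (R j) * (W j * ?J j u) * adj (R j)) \<le> 1 / 4"
    using W(2)[OF v(1)[OF u]] by (simp add: nn_def)
   then show ?thesis
    using nn_perturb[of "K j" "T j (?J' j u) * V j" "V j * ?J' j u" "T j (R j) * (T j (?J j u) * W j) * adj (R j)" "T j (R j) * (W j * ?J j u) * adj (R j)"]
     elim(1)[rule_format, OF u] elim(2)[rule_format, OF u] by linarith
  qed
  then show ?case unfolding Pc_def using V by blast
 qed
 note cl = this
 have m1p: "0 < m j + 1" for j by simp
 obtain W1 where "Cl sequentially K' (rz K K' T) q' (\<lambda>j. m j + 1) W1"
  by (rule close_imp_Cl[OF A' Ce' sm K'_def q' m1p cl])
 from Cl_imp_close[OF A' Ce' sm K'_def q' m1p this]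
 have "\<forall>\<^sub>F j in sequentially. Pc (K j) (T j) (q' j) (m j + 1) (1 / 4)" by simp
 then show False using pm(5) by (auto simp: q'_def eventually_sequentially)
qed

text \<open>The increments stop at about k / 2^j, since \<open>close_step\<close> asks for at least
  2^j copies. As \<open>j\<close> is fixed, the \<open>j\<close> doublings that remain are bounded
  in number, and they end with multiplicity 1, where closeness concerns the whole group.\<close>

theorem inner_of_central:
 fixes k :: "nat => nat"
 assumes A: "amap sequentially k k h" and Ce: "acent sequentially k k h" and kp: "\<And>n. 0 < k n"
  and lim: "filterlim k at_top sequentially"
 obtains W where "\<And>n. W n \<in> UU (k n)" "anear sequentially k k h (\<lambda>n u. W n * u * adj (W n))"
proof -
 obtain j0 where j0: "\<And>n m. n \<ge> j0 ==> 2 ^ j0 \<le> m ==> m * 2 ^ j0 \<le> k n ==> Pc (k n) (h n) (k n div m) m (1 / 4) ==>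
  Pc (k n) (h n) (k n div (m + 1)) (m + 1) (1 / 4)"
  by (rule close_step[OF A Ce kp]) blast
 define j where "j = Suc j0"
 have j: "Pc (k n) (h n) (k n div (m + 1)) (m + 1) (1 / 4)"
  if "n \<ge> j" "2 ^ j \<le> m" "m * 2 ^ j \<le> k n" "Pc (k n) (h n) (k n div m) m (1 / 4)" for n m
 proof (rule j0)
  show "n \<ge> j0" "2 ^ j0 \<le> m" "m * 2 ^ j0 \<le> k n" using that by (auto simp: j_def)
 qed (rule that)
 define a where "a n = max 1 (k n div 2 ^ Suc j)" for n
 define m where "m n = 2 * a n" for n
 have a: "0 < a n" for n by (simp add: a_def)
 define k' where "k' n = 2 ^ j * (2 * a n)" for n
 have klim: "filterlim (\<lambda>n. real (k n)) at_top sequentially"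
  by (rule filterlim_compose[OF filterlim_real_sequentially lim])
 have "((\<lambda>n. real (2 ^ Suc j) / real (k n)) \<longlongrightarrow> 0) sequentially"
  by (rule real_tendsto_divide_at_top[OF tendsto_const klim])
 from asim_div[OF kp _ this] have sm: "asim sequentially k k'" by (simp add: k'_def[abs_def] a_def mult_ac)
 have "\<forall>\<^sub>F n in sequentially. 2 ^ Suc j * 2 ^ j \<le> k n" using lim unfolding filterlim_at_top by blast
 with close_pow2[OF A Ce kp lim, of j0] eventually_ge_at_top[of j]
 have cl: "\<forall>\<^sub>F n in sequentially. Pc (k n) (h n) (2 ^ j) (m n) (7 / 24)"
 proof eventually_elim
  case (elim n)
  have "2 ^ j \<le> k n div 2 ^ Suc j" using elim(3) by (simp add: less_eq_div_iff_mult_less_eq mult.commute)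
  moreover have "(1::nat) \<le> 2 ^ j" by simp
  ultimately have "max 1 (k n div 2 ^ Suc j) = k n div 2 ^ Suc j" by (intro max_absorb2) linarith
  then have ab: "a n = k n div 2 ^ Suc j" "2 ^ j \<le> a n" using \<open>2 ^ j \<le> k n div 2 ^ Suc j\<close> unfolding a_def by simp_all
  have "k n = 2 ^ Suc j * a n + k n mod 2 ^ Suc j" "k n mod 2 ^ Suc j < 2 ^ Suc j" unfolding ab(1) by simp_all
  then have kn: "2 ^ Suc j * a n \<le> k n" "k n < 2 ^ Suc j * a n + 2 ^ Suc j" by linarith+
  have mk: "m n * 2 ^ j \<le> k n" using kn(1) by (simp add: m_def mult_ac)
  \<comment> \<open>Rounding \<open>a n\<close> down loses less than 2^(j+1), which is at most
    \<open>m n\<close> because \<open>a n\<close> is at least 2^j; so no further block of length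
    \<open>m n\<close> fits.\<close>
  have q: "k n div m n = 2 ^ j"
  proof (rule div_nat_eqI)
   show "m n * 2 ^ j \<le> k n" by (rule mk)
   have "2 ^ Suc j * a n + 2 ^ Suc j \<le> m n * Suc (2 ^ j)" using ab(2) by (simp add: m_def algebra_simps)
   then show "k n < m n * Suc (2 ^ j)" using kn(2) by linarith
  qed
  \<comment> \<open>The climb at a fixed index \<open>n\<close>; its length is unbounded in
    \<open>n\<close>, which the fixed threshold 1/4 tolerates.\<close>
  have "i \<le> m n \<longrightarrow> Pc (k n) (h n) (k n div i) i (1 / 4)" if "2 ^ j \<le> i" for i
   using that
  proof (induction i rule: nat_induct_at_least)
   case base
   then show ?case using elim(1) by (simp add: j_def)
  next
   case (Suc i)
   show ?case
   proof
    assume i: "Suc i \<le> m n"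
    have "i * 2 ^ j \<le> m n * 2 ^ j" using i by (intro mult_right_mono) auto
    then have "i * 2 ^ j \<le> k n" using mk by (rule order_trans)
    then have "Pc (k n) (h n) (k n div (i + 1)) (i + 1) (1 / 4)"
     by (rule j[OF elim(2) Suc.hyps]) (use Suc.IH i in simp)
    then show "Pc (k n) (h n) (k n div Suc i) (Suc i) (1 / 4)" by simp
   qed
  qed
  moreover have "2 ^ j \<le> m n" using ab(2) by (simp add: m_def)
  ultimately have "Pc (k n) (h n) (k n div m n) (m n) (1 / 4)" by blast
  then show ?case unfolding q by (rule Pc_mono) simp
 qed
 have kk: "k' n = 2 ^ j * m n" and mp: "0 < m n" and jp: "0 < (2::nat) ^ j" for n
  using a[of n] by (simp_all add: k'_def m_def)
 note rA = rz_amap[OF A Ce sm kk jp mp] and rC = rz_acent[OF A Ce sm kk jp mp]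
 obtain W0 where "Cl sequentially k' (rz k k' h) (\<lambda>_. 2 ^ j) m W0"
  by (rule close_imp_Cl[OF A Ce sm kk jp mp cl])
 then have W0: "Cl sequentially k' (rz k k' h) (\<lambda>_. 1 * 2 ^ j) (\<lambda>n. 2 * a n) W0" by (simp add: m_def[abs_def])
 have k1: "k' n = 1 * (2 ^ j * (2 * a n))" for n by (simp add: k'_def)
 have "\<exists>W. Cl sequentially k' (rz k k' h) (\<lambda>_. 1) (\<lambda>n. 2 ^ j * (2 * a n)) W"
  by (rule Cl_pow[where q = "\<lambda>_. 1", OF rA rC a k1 _ W0]) simp
 then obtain W where cW: "Cl sequentially k' (rz k k' h) (\<lambda>_. 1) k' W" unfolding k'_def[abs_def, symmetric] by blast
 have W: "W n \<in> UU (k' n)" for n using cW by (simp add: Cl_def)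
 let ?V = "\<lambda>n. rs (k' n) (k n) (W n)"
 have V: "?V n \<in> UU (k n)" for n by (rule rs_UU[OF W])
 have k'p: "0 < k' n" for n using a by (simp add: k'_def)
 show ?thesis
 proof (rule that[OF V], rule anear_I)
  fix u assume u: "\<And>n. u n \<in> UU (k n)"
  define w where "w n = rs (k n) (k' n) (u n)" for n
  have w: "w n \<in> UU (k' n)" for n unfolding w_def by (rule rs_UU[OF u])
  let ?r = "\<lambda>n. rs (k' n) (k n) (w n)"
  have r: "?r n \<in> UU (k n)" for n by (rule rs_UU[OF w])
  have wu: "aeqs k' w u" unfolding w_def[abs_def] by (rule asim_rs[OF sm]) (use u in simp)
  have "aeqs k ?r w" by (rule asim_rs[OF asim_sym[OF sm]]) (use w in simp)
  then have ru: "aeqs k ?r u" by (rule aeq_trans) (use wu in \<open>simp add: asim_aeq[OF sm]\<close>)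
  have Vw: "aeqs k' W ?V"
   by (rule aeq_sym, unfold asim_aeq[OF sm, symmetric], rule asim_rs[OF asim_sym[OF sm]]) (use W in simp)
  have "aeqs k (\<lambda>n. h n (u n)) (\<lambda>n. h n (?r n))"
   by (rule aeq_sym, rule amap_cont[OF A filterlim_ident _ _ ru]) (use u r in simp_all)
  then have "aeqs k' (\<lambda>n. h n (u n)) (\<lambda>n. h n (?r n))" by (simp add: asim_aeq[OF sm])
  also have "aeqs k' \<dots> (\<lambda>n. rz k k' h n (w n))"
   unfolding rz_def by (rule aeq_sym, rule asim_rs[OF sm]) (use amap_maps[OF A r] in simp)
  also have "aeqs k' \<dots> (\<lambda>n. W n * w n * adj (W n))"
  proof -
   have "aeqs k' (\<lambda>n. adj (W n) * rz k k' h n (iot 1 (k' n) (w n)) * W n) (\<lambda>n. iot 1 (k' n) (w n))"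
    by (rule anear_seq[OF cW[unfolded Cl_def, THEN conjunct2] filterlim_ident]) (use w in simp)
   moreover have "iot 1 (k' n) (w n) = w n" for n
    unfolding iot_def by (rule kr_1[OF UU_MM[OF w] k'p])
   ultimately have "aeqs k' (\<lambda>n. adj (W n) * rz k k' h n (w n) * W n) w" by simp
   then have "aeqs k' (\<lambda>n. W n * (adj (W n) * rz k k' h n (w n) * W n)) (\<lambda>n. W n * w n)"
    by (rule aeq_left) (use con_UU[OF W] in simp)
   then have "aeqs k' (\<lambda>n. W n * (adj (W n) * rz k k' h n (w n) * W n) * adj (W n)) (\<lambda>n. W n * w n * adj (W n))"
    by (rule aeq_right) (use con_UU[OF UU_adj[OF W]] in simp)
   moreover have "W n * (adj (W n) * rz k k' h n (w n) * W n) * adj (W n) = rz k k' h n (w n)" for n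
    using W[of n] amap_maps[OF rA w, of n] by (simp add: mult.assoc UU_canc UU_D)
   ultimately show ?thesis by simp
  qed
  also have "aeqs k' (\<lambda>n. W n * w n * adj (W n)) (\<lambda>n. ?V n * u n * adj (?V n))"
  proof (rule aeq_mult)
   show "aeqs k' (\<lambda>n. W n * w n) (\<lambda>n. ?V n * u n)"
    by (rule aeq_mult[OF Vw wu]) (use con_UU[OF w] con_UU[OF V] in simp_all)
   show "aeqs k' (\<lambda>n. adj (W n)) (\<lambda>n. adj (?V n))" by (rule aeq_adj[OF Vw])
   show "\<forall>\<^sub>F n in sequentially. con (adj (W n))" using con_UU[OF UU_adj[OF W]] by simp
   show "\<forall>\<^sub>F n in sequentially. con (?V n * u n)" using con_UU[OF UU_mult[OF V u]] by simp
  qed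
  finally show "aeqs k (\<lambda>n. h n (u n)) (\<lambda>n. ?V n * u n * adj (?V n))"
   by (simp add: asim_aeq[OF sm])
 qed
qed

section \<open>From classes of sequences to asymptotic maps\<close>

text \<open>Unlike in \<open>U0_I\<close>, the hypothesis concerns only sequences along which
  \<open>g\<close> tends to 0. If the estimate fails, bad points with \<open>g\<close> below 1/(j +
  1) exist at arbitrarily late indices; they are placed along a strictly increasing
  \<open>r\<close>, and \<open>z\<close> fills the other places.\<close>

lemma C0_seqI:
 fixes f g :: "nat => 'x => real"
 assumes lim: "\<And>x. (\<And>i. x i \<in> S i) ==> (\<lambda>i. g i (x i)) \<longlonglongrightarrow> 0 ==> (\<lambda>i. f i (x i)) \<longlonglongrightarrow> 0"
  and z: "\<And>i. z i \<in> S i" "\<And>i. g i (z i) = 0" and g: "\<And>i x. 0 \<le> g i x"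
 shows "C0 sequentially S g f"
proof (rule ccontr)
 assume "\<not> ?thesis"
 then obtain e where e: "e > 0" "\<And>d. d > 0 ==> \<not> (\<forall>\<^sub>F i in sequentially. \<forall>x\<in>S i. g i x < d \<longrightarrow> f i x < e)"
  unfolding C0_def by blast
 define bad where "bad j i x \<longleftrightarrow> x \<in> S i \<and> g i x < inverse (Suc j) \<and> \<not> f i x < e" for j i x
 have ex: "\<exists>i>n. \<exists>x. bad j i x" for j n
 proof -
  have "\<not> (\<forall>\<^sub>F i in sequentially. \<forall>x\<in>S i. g i x < inverse (Suc j) \<longrightarrow> f i x < e)" by (rule e(2)) simp
  then obtain i where "i \<ge> Suc n" "\<exists>x. bad j i x" unfolding eventually_sequentially bad_def by blast
  then show ?thesis by (auto intro!: exI[of _ i])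
 qed
 have "\<exists>r. \<forall>j. (\<exists>x. bad j (r j) x) \<and> r j < r (Suc j)"
  by (rule dependent_nat_choice) (use ex in blast)+
 then obtain r where r: "\<And>j. \<exists>x. bad j (r j) x" "strict_mono r" unfolding strict_mono_Suc_iff by blast
 obtain y where y: "\<And>j. bad j (r j) (y j)" using r(1) by metis
 define x where "x i = (if i \<in> range r then y (inv_into UNIV r i) else z i)" for i
 have xr: "x (r j) = y j" for j using strict_mono_imp_inj_on[OF r(2)] by (simp add: x_def)
 have xS: "x i \<in> S i" for i
 proof (cases "i \<in> range r")
  case True
  then obtain j where "i = r j" by blast
  then show ?thesis using y[of j] xr[of j] by (simp add: bad_def)
 qed (simp add: x_def z)
 have "(\<lambda>i. g i (x i)) \<longlonglongrightarrow> 0"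
 proof (rule LIMSEQ_I)
  fix d :: real assume d: "d > 0"
  then obtain J where J: "inverse (Suc J) < d" using reals_Archimedean by blast
  have "g i (x i) < d" if i: "i \<ge> r J" for i
  proof (cases "i \<in> range r")
   case True
   then obtain j where j: "i = r j" by blast
   have "J \<le> j" using i j r(2) by (simp add: strict_mono_less_eq)
   then have "inverse (real (Suc j)) \<le> inverse (Suc J)" by (intro le_imp_inverse_le) auto
   then show ?thesis using y[of j] J unfolding j xr bad_def by linarith
  qed (use d in \<open>simp add: x_def z\<close>)
  then show "\<exists>no. \<forall>n\<ge>no. norm (g n (x n) - 0) < d" using g by (auto intro!: exI[of _ "r J"])
 qed
 then have "(\<lambda>i. f i (x i)) \<longlonglongrightarrow> 0" by (rule lim[OF xS])
 then have "(\<lambda>j. f (r j) (x (r j))) \<longlonglongrightarrow> 0" using LIMSEQ_subseq_LIMSEQ[OF _ r(2)] by (auto simp: o_def)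
 then have "\<forall>\<^sub>F j in sequentially. f (r j) (y j) < e" unfolding xr by (rule order_tendstoD(2)[OF _ e(1)])
 then show False using y by (auto simp: bad_def eventually_sequentially)
qed

section \<open>Translation to the matrices and groups of the statement\<close>

definition fm :: "complex mat => fmat" where "fm A = mk (dim_row A) (\<lambda>i j. A $$ (i, j))"
definition jm :: "nat => fmat => complex mat" where "jm k x = mat k k (\<lambda>(i, j). ent x i j)"

lemma mat_adjoint_index:
 assumes A: "A \<in> carrier_mat k k"
 shows "mat_adjoint A \<in> carrier_mat k k" "\<And>i j. i < k ==> j < k ==> mat_adjoint A $$ (i, j) = cnj (A $$ (j, i))"
 using A unfolding mat_adjoint_def by (auto simp: mat_of_rows_def)

context
 fixes k :: nat
begin

lemma jm_carrier [simp]: "jm k x \<in> carrier_mat k k" by (simp add: jm_def)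
lemma fm_MM: "A \<in> carrier_mat k k ==> fm A \<in> MM k" by (auto simp: fm_def)
lemma ent_fm: "A \<in> carrier_mat k k ==> ent (fm A) i j = (if i < k \<and> j < k then A $$ (i, j) else 0)"
 by (auto simp: fm_def ent_mk)
lemma jm_fm: "A \<in> carrier_mat k k ==> jm k (fm A) = A" by (rule eq_matI) (auto simp: jm_def ent_fm)
lemma fm_jm: "x \<in> MM k ==> fm (jm k x) = x"
 by (rule MM_eqI[of _ k]) (auto simp: fm_MM ent_fm, simp add: jm_def)
lemma fm_mult: "A \<in> carrier_mat k k ==> B \<in> carrier_mat k k ==> fm (A * B) = fm A * fm B"
proof (rule MM_eqI[of _ k])
 fix i j assume h: "A \<in> carrier_mat k k" "B \<in> carrier_mat k k" "i < k" "j < k"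
 then show "ent (fm (A * B)) i j = ent (fm A * fm B) i j"
  by (simp add: ent_mult[of "fm A" k] fm_MM ent_fm[OF mult_carrier_mat[of A k k B k]] ent_fm scalar_prod_def atLeast0LessThan)
qed (auto intro!: fm_MM MM_mult)
lemma fm_diff: "A \<in> carrier_mat k k ==> B \<in> carrier_mat k k ==> fm (A - B) = fm A - fm B"
 by (rule fmat_eqI) (auto simp: ent_fm[OF minus_carrier_mat[of B k k A]] ent_fm)
lemma fm_adj: "A \<in> carrier_mat k k ==> fm (mat_adjoint A) = adj (fm A)"
 by (rule fmat_eqI) (auto simp: ent_fm mat_adjoint_index)
lemma fm_one: "fm (1\<^sub>m k) = fid k" by (rule fmat_eqI) (auto simp: ent_fm)
lemma fm_inj: "A \<in> carrier_mat k k ==> B \<in> carrier_mat k k ==> fm A = fm B ==> A = B" by (metis jm_fm)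

lemma ftr_fm: "A \<in> carrier_mat k k ==> ftr (fm A) = mat_trace A"
 unfolding mat_trace_def by (subst ftr_eq[OF fm_MM]) (auto simp: ent_fm)

lemma hs_norm_fm: "A \<in> carrier_mat k k ==> hs_norm k A = nn k (fm A)"
proof -
 assume A: "A \<in> carrier_mat k k"
 note AA = mult_carrier_mat[OF mat_adjoint_index(1)[OF A] A]
 have "Re (mat_trace (mat_adjoint A * A)) = (norm (fm A))\<^sup>2"
  unfolding norm_sq ftr_fm[OF AA, symmetric] fm_mult[OF mat_adjoint_index(1)[OF A] A] fm_adj[OF A] ..
 then show ?thesis by (simp add: hs_norm_def nn_def real_sqrt_divide)
qed

lemma hs_dist_fm: "A \<in> carrier_mat k k ==> B \<in> carrier_mat k k ==> hs_dist k A B = nn k (fm A - fm B)"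
 unfolding hs_dist_def using hs_norm_fm[OF minus_carrier_mat] fm_diff by simp

abbreviation "UG \<equiv> unitary_group k"

lemma UG_iff: "A \<in> carrier UG \<longleftrightarrow> A \<in> carrier_mat k k \<and> fm A \<in> UU k"
proof (cases "A \<in> carrier_mat k k")
 case True
 note aA = mat_adjoint_index(1)[OF True]
 have "mat_adjoint A * A = 1\<^sub>m k \<longleftrightarrow> adj (fm A) * fm A = fid k" "A * mat_adjoint A = 1\<^sub>m k \<longleftrightarrow> fm A * adj (fm A) = fid k"
  using fm_inj[of "mat_adjoint A * A" "1\<^sub>m k"] fm_inj[of "A * mat_adjoint A" "1\<^sub>m k"] True aA mult_carrier_mat[OF aA True] mult_carrier_mat[OF True aA]
  unfolding fm_mult[OF aA True, symmetric] fm_mult[OF True aA, symmetric] fm_adj[OF True, symmetric] fm_one[symmetric] by auto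
 then show ?thesis using True by (auto simp: unitary_group_def UU_def fm_MM simp del: UU_intros)
qed (simp add: unitary_group_def)

lemma UG_mat: "A \<in> carrier UG ==> A \<in> carrier_mat k k" by (simp add: UG_iff)
lemma UG_UU: "A \<in> carrier UG ==> fm A \<in> UU k" by (simp add: UG_iff)
lemma jm_UG: "x \<in> UU k ==> jm k x \<in> carrier UG" by (simp add: UG_iff fm_jm)
lemma UG_mult: "A \<otimes>\<^bsub>UG\<^esub> B = A * B" by (simp add: unitary_group_def)
lemma UG_one: "\<one>\<^bsub>UG\<^esub> = 1\<^sub>m k" by (simp add: unitary_group_def)
lemma UG_fm_mult: "A \<in> carrier UG ==> B \<in> carrier UG ==> fm (A * B) = fm A * fm B" by (simp add: fm_mult UG_mat)
lemma UG_closed: "A \<in> carrier UG ==> B \<in> carrier UG ==> A * B \<in> carrier UG"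
 unfolding UG_iff using fm_mult[of A B] by (auto intro!: UU_mult)
lemma UG_adj: "A \<in> carrier UG ==> mat_adjoint A \<in> carrier UG"
 unfolding UG_iff using mat_adjoint_index(1)[of A k] by (auto simp: fm_adj intro!: UU_adj)

lemma UG_group: "group UG"
proof (rule groupI; unfold UG_mult UG_one)
 show "1\<^sub>m k \<in> carrier UG" by (simp add: UG_iff fm_one)
 fix A assume A: "A \<in> carrier UG"
 show "1\<^sub>m k * A = A" using UG_mat[OF A] by simp
 show "\<exists>B\<in>carrier UG. B * A = 1\<^sub>m k" using UG_adj[OF A] A by (auto simp: unitary_group_def)
 fix B assume B: "B \<in> carrier UG"
 show "A * B \<in> carrier UG" by (rule UG_closed[OF A B])
 fix C assume C: "C \<in> carrier UG"
 show "A * B * C = A * (B * C)" by (rule assoc_mult_mat[OF UG_mat[OF A] UG_mat[OF B] UG_mat[OF C]])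
qed

lemma UG_inv: "A \<in> carrier UG ==> inv\<^bsub>UG\<^esub> A = mat_adjoint A"
 by (rule group.inv_equality[OF UG_group]) (auto simp: UG_mult UG_one UG_adj, simp add: unitary_group_def)

end

abbreviation UP :: "(nat => nat) => (nat => complex mat) set" where "UP k == carrier (unitary_prod k)"

lemma UP_iff: "u \<in> UP k \<longleftrightarrow> (\<forall>n. u n \<in> carrier (unitary_group (k n)))"
 by (auto simp: unitary_prod_def PiE_UNIV_domain)
lemma UP_mult: "u \<otimes>\<^bsub>unitary_prod k\<^esub> v = (\<lambda>n. u n * v n)"
 by (simp add: unitary_prod_def UG_mult restrict_UNIV)
lemma UP_group: "group (unitary_prod k)"
 unfolding unitary_prod_def by (rule product_group) (rule UG_group)
lemma UP_inv: "u \<in> UP k ==> inv\<^bsub>unitary_prod k\<^esub> u = (\<lambda>n. mat_adjoint (u n))"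
 unfolding unitary_prod_def by (subst inv_product_group) (auto simp: UG_group restrict_UNIV PiE_UNIV_domain intro!: UG_inv)
lemma UP_UU: "u \<in> UP k ==> fm (u n) \<in> UU (k n)" using UG_UU UP_iff by blast
lemma jm_UP: "(\<And>n. x n \<in> UU (k n)) ==> (\<lambda>n. jm (k n) (x n)) \<in> UP k"
 by (simp add: UP_iff jm_UG)
lemma UP_mult_closed: "u \<in> UP k ==> v \<in> UP k ==> (\<lambda>n. u n * v n) \<in> UP k"
 by (simp add: UP_iff UG_closed)

lemma UP_fm_mult: "u \<in> UP k ==> v \<in> UP k ==> fm (u n * v n) = fm (u n) * fm (v n)"
 unfolding UP_iff by (rule UG_fm_mult[of _ "k n"]) auto
lemma UP_fm_adj: "u \<in> UP k ==> fm (mat_adjoint (u n)) = adj (fm (u n))"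
 unfolding UP_iff by (rule fm_adj[OF UG_mat[of _ "k n"]]) auto

lemma hs_null_iff: "u \<in> hs_null k \<longleftrightarrow> u \<in> UP k \<and> aeqs k (\<lambda>n. fm (u n)) (\<lambda>n. fid (k n))"
 unfolding hs_null_def aeq_def using UG_mat hs_dist_fm[OF _ one_carrier_mat] by (auto simp: UP_iff fm_one)

lemma hs_null_normal: "hs_null k \<lhd> unitary_prod k"
 unfolding group.normal_inv_iff[OF UP_group]
proof (intro conjI ballI)
 have con: "\<forall>\<^sub>F n in sequentially. con (fm (u n))" if "u \<in> UP k" for u
  using con_UU[OF UP_UU[OF that]] by simp
 have cf: "\<forall>\<^sub>F n in sequentially. con (fid (k n))" using con_UU[OF UU_fid] by simp
 show "subgroup (hs_null k) (unitary_prod k)"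
 proof (rule group.subgroupI[OF UP_group])
  show "hs_null k \<subseteq> UP k" by (auto simp: hs_null_def)
  have "(\<lambda>n. 1\<^sub>m (k n)) \<in> hs_null k" by (simp add: hs_null_iff UP_iff UG_iff fm_one)
  then show "hs_null k \<noteq> {}" by blast
  fix u assume u: "u \<in> hs_null k"
  then have uC: "u \<in> UP k" by (simp add: hs_null_iff)
  show "inv\<^bsub>unitary_prod k\<^esub> u \<in> hs_null k"
   using u aeq_adj[of sequentially k "\<lambda>n. fm (u n)" "\<lambda>n. fid (k n)"] uC
   by (simp add: UP_inv[OF uC] hs_null_iff UP_fm_adj[OF uC]) (simp add: UP_iff UG_adj)
  fix v assume v: "v \<in> hs_null k"
  then have vC: "v \<in> UP k" by (simp add: hs_null_iff)
  have "aeqs k (\<lambda>n. fm (u n) * fm (v n)) (\<lambda>n. fid (k n) * fid (k n))"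
   by (rule aeq_mult) (use u v con[OF vC] cf in \<open>simp_all add: hs_null_iff\<close>)
  moreover have "fm (u n * v n) = fm (u n) * fm (v n)" for n by (rule UP_fm_mult[OF uC vC])
  ultimately show "u \<otimes>\<^bsub>unitary_prod k\<^esub> v \<in> hs_null k"
   using UP_mult_closed[OF uC vC] by (simp add: UP_mult hs_null_iff)
 qed
 fix x u assume x: "x \<in> UP k" and u: "u \<in> hs_null k"
 then have uC: "u \<in> UP k" by (simp add: hs_null_iff)
 have ax: "(\<lambda>n. mat_adjoint (x n)) \<in> UP k" using x by (simp add: UP_iff UG_adj)
 have f: "fm (x n * u n * mat_adjoint (x n)) = fm (x n) * fm (u n) * adj (fm (x n))" for n
  unfolding UP_fm_mult[OF UP_mult_closed[OF x uC] ax] UP_fm_mult[OF x uC] UP_fm_adj[OF x] ..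
 have "aeqs k (\<lambda>n. fm (x n) * fm (u n)) (\<lambda>n. fm (x n) * fid (k n))"
  by (rule aeq_left[OF _ con[OF x]]) (use u in \<open>simp add: hs_null_iff\<close>)
 then have "aeqs k (\<lambda>n. fm (x n) * fm (u n) * adj (fm (x n))) (\<lambda>n. fm (x n) * fid (k n) * adj (fm (x n)))"
  by (rule aeq_right) (use con_UU[OF UU_adj[OF UP_UU[OF x]]] in simp)
 moreover have "fm (x n) * fid (k n) * adj (fm (x n)) = fid (k n)" for n using UP_UU[OF x, of n] by (simp add: UU_D)
 ultimately show "x \<otimes>\<^bsub>unitary_prod k\<^esub> u \<otimes>\<^bsub>unitary_prod k\<^esub> inv\<^bsub>unitary_prod k\<^esub> x \<in> hs_null k"
  using UP_mult_closed[OF UP_mult_closed[OF x uC] ax] by (simp add: UP_mult UP_inv[OF x] hs_null_iff f)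
qed

text \<open>Right multiplication by a unitary preserves the norm, so u v* is null exactly when
  \<open>u\<close> and \<open>v\<close> are asymptotically equal.\<close>

lemma hs_class_eq:
 assumes u: "u \<in> UP k" and v: "v \<in> UP k"
 shows "hs_class k u = hs_class k v \<longleftrightarrow> aeqs k (\<lambda>n. fm (u n)) (\<lambda>n. fm (v n))"
proof -
 interpret normal "hs_null k" "unitary_prod k" by (rule hs_null_normal)
 have av: "(\<lambda>n. mat_adjoint (v n)) \<in> UP k" using v by (simp add: UP_iff UG_adj)
 have "hs_class k u = hs_class k v \<longleftrightarrow> u \<otimes>\<^bsub>unitary_prod k\<^esub> inv\<^bsub>unitary_prod k\<^esub> v \<in> hs_null k"
 proof
  assume "hs_class k u = hs_class k v"
  then show "u \<otimes>\<^bsub>unitary_prod k\<^esub> inv\<^bsub>unitary_prod k\<^esub> v \<in> hs_null k"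
   unfolding hs_class_def using coset_mult_inv2[OF _ u v subset] coset_join1[OF _ _ is_subgroup] u v by simp
 next
  assume "u \<otimes>\<^bsub>unitary_prod k\<^esub> inv\<^bsub>unitary_prod k\<^esub> v \<in> hs_null k"
  then show "hs_class k u = hs_class k v"
   unfolding hs_class_def using coset_mult_inv1[OF coset_join2[OF _ is_subgroup] u v subset] u v by simp
 qed
 also have "\<dots> \<longleftrightarrow> aeqs k (\<lambda>n. fm (u n) * adj (fm (v n))) (\<lambda>n. fid (k n))"
  using UP_mult_closed[OF u av] by (simp add: UP_mult UP_inv[OF v] hs_null_iff UP_fm_mult[OF u av] UP_fm_adj[OF v])
 also have "\<dots> \<longleftrightarrow> aeqs k (\<lambda>n. fm (u n)) (\<lambda>n. fm (v n))"
 proof -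
  have "nn (k n) (fm (u n) * adj (fm (v n)) - fid (k n)) = nn (k n) (fm (u n) - fm (v n))" for n
  proof -
   have "fm (u n) * adj (fm (v n)) - fid (k n) = (fm (u n) - fm (v n)) * adj (fm (v n))"
    using UP_UU[OF v, of n] by (simp add: left_diff_distrib UU_D)
   then show ?thesis using norm_UU_right[OF UU_adj[OF UP_UU[OF v]], of "fm (u n) - fm (v n)"] UP_UU[OF u, of n] UP_UU[OF v, of n] by (simp add: nn_def)
  qed
  then show ?thesis by (simp add: aeq_def)
 qed
 finally show ?thesis .
qed

lemma UHS_mult:
 assumes "u \<in> UP k" "v \<in> UP k"
 shows "hs_class k u \<otimes>\<^bsub>UHS k\<^esub> hs_class k v = hs_class k (\<lambda>n. u n * v n)"
 unfolding UHS_def hs_class_def FactGroup_def using normal.rcos_sum[OF hs_null_normal assms] by (simp add: UP_mult)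

lemma UHS_carrier: "carrier (UHS k) = hs_class k ` UP k"
 unfolding UHS_def hs_class_def FactGroup_def RCOSETS_def by auto

text \<open>As the image class is computed coordinatewise, well-definedness of \<open>\<phi>\<close>
  says that asymptotically equal sequences have asymptotically equal images, and injectivity gives
  the converse; \<open>C0_seqI\<close> makes both uniform. Multiplicativity and surjectivity of
  \<open>\<phi>\<close> give the remaining properties.\<close>

theorem amap_of_product_form:
 assumes iso: "\<phi> \<in> iso (UHS k) (UHS l)"
  and h: "\<And>n. h n \<in> carrier (unitary_group (k n)) \<rightarrow> carrier (unitary_group (l n))"
  and \<phi>: "\<And>u. u \<in> UP k ==> \<phi> (hs_class k u) = hs_class l (\<lambda>n. h n (u n))"
 shows "amap sequentially k l (\<lambda>n x. fm (h n (jm (k n) x)))" "asurj sequentially k l (\<lambda>n x. fm (h n (jm (k n) x)))"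
proof -
 let ?t = "\<lambda>n x. fm (h n (jm (k n) x))"
 have hom: "\<phi> \<in> hom (UHS k) (UHS l)" and bij: "bij_betw \<phi> (carrier (UHS k)) (carrier (UHS l))" using iso by (auto simp: iso_def)
 have hP: "u \<in> UP k ==> (\<lambda>n. h n (u n)) \<in> UP l" for u
  using h by (auto simp: UP_iff)
 have maps: "x \<in> UU (k n) ==> ?t n x \<in> UU (l n)" for n x using h[of n] jm_UG UG_UU by blast
 have cls: "\<phi> (hs_class k u) = \<phi> (hs_class k v) \<longleftrightarrow> aeqs l (\<lambda>n. fm (h n (u n))) (\<lambda>n. fm (h n (v n)))"
  if "u \<in> UP k" "v \<in> UP k" for u v
  using \<phi> that hs_class_eq[OF hP hP] by simp
 have inj: "\<phi> (hs_class k u) = \<phi> (hs_class k v) \<longleftrightarrow> hs_class k u = hs_class k v"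
  if "u \<in> UP k" "v \<in> UP k" for u v
  using bij_betw_imp_inj_on[OF bij] that by (auto simp: UHS_carrier inj_on_def)
 have eq: "aeqs l (\<lambda>n. ?t n (x n)) (\<lambda>n. ?t n (y n)) \<longleftrightarrow> aeqs k x y"
  if x: "\<And>n. x n \<in> UU (k n)" and y: "\<And>n. y n \<in> UU (k n)" for x y
  using cls[OF jm_UP[OF x] jm_UP[OF y]] inj[OF jm_UP[OF x] jm_UP[OF y]] hs_class_eq[OF jm_UP[OF x] jm_UP[OF y]]
   fm_jm[OF UU_MM[OF x]] fm_jm[OF UU_MM[OF y]] by simp
 show "amap sequentially k l ?t"
  unfolding amap_def
 proof (intro conjI allI ballI maps)
  show "U0 sequentially (\<lambda>n. UU (k n) \<times> UU (k n)) (\<lambda>n p. nn (l n) (?t n (fst p * snd p) - ?t n (fst p) * ?t n (snd p)))"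
  proof (rule U0_I)
   fix p :: "nat => fmat \<times> fmat" assume p: "\<And>n. p n \<in> UU (k n) \<times> UU (k n)"
   define x y where "x = fst \<circ> p" and "y = snd \<circ> p"
   have xy: "x n \<in> UU (k n)" "y n \<in> UU (k n)" for n using p[of n] by (auto simp: x_def y_def)
   let ?u = "\<lambda>n. jm (k n) (x n)" and ?v = "\<lambda>n. jm (k n) (y n)"
   note u = jm_UP[OF xy(1)] and v = jm_UP[OF xy(2)]
   have uG: "?u n \<in> carrier (unitary_group (k n))" "?v n \<in> carrier (unitary_group (k n))" for n using jm_UG xy by auto
   have uv: "?u n * ?v n = jm (k n) (x n * y n)" for n
    by (rule fm_inj[of _ "k n"]) (use xy[of n] UG_mat[OF UG_closed[OF uG]] in \<open>simp_all add: UG_fm_mult[OF uG] fm_jm\<close>)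
   have "\<phi> (hs_class k ?u \<otimes>\<^bsub>UHS k\<^esub> hs_class k ?v) = \<phi> (hs_class k ?u) \<otimes>\<^bsub>UHS l\<^esub> \<phi> (hs_class k ?v)"
    by (rule hom_mult[OF hom]) (use u v in \<open>simp_all add: UHS_carrier\<close>)
   then have "hs_class l (\<lambda>n. h n (?u n * ?v n)) = hs_class l (\<lambda>n. h n (?u n) * h n (?v n))"
    unfolding UHS_mult[OF u v] \<phi>[OF u] \<phi>[OF v] UHS_mult[OF hP[OF u] hP[OF v]] \<phi>[OF UP_mult_closed[OF u v]] .
   then have "aeqs l (\<lambda>n. fm (h n (?u n * ?v n))) (\<lambda>n. fm (h n (?u n) * h n (?v n)))"
    unfolding hs_class_eq[OF hP[OF UP_mult_closed[OF u v]] UP_mult_closed[OF hP[OF u] hP[OF v]]] .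
   moreover have "fm (h n (?u n) * h n (?v n)) = ?t n (x n) * ?t n (y n)" for n
    by (rule UP_fm_mult[OF hP[OF u] hP[OF v]])
   ultimately have "aeqs l (\<lambda>n. ?t n (x n * y n)) (\<lambda>n. ?t n (x n) * ?t n (y n))"
    by (simp only: uv)
   then show "(\<lambda>n. nn (l n) (?t n (fst (p n) * snd (p n)) - ?t n (fst (p n)) * ?t n (snd (p n)))) \<longlonglongrightarrow> 0"
    by (simp add: aeq_def x_def y_def)
  qed (use UU_fid in blast)
  let ?z = "\<lambda>n. (fid (k n), fid (k n))"
  have *: "(\<lambda>n. nn (k n) (fst (p n) - snd (p n))) \<longlonglongrightarrow> 0 \<longleftrightarrow> (\<lambda>n. nn (l n) (?t n (fst (p n)) - ?t n (snd (p n)))) \<longlonglongrightarrow> 0"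
   if p: "\<And>n. p n \<in> UU (k n) \<times> UU (k n)" for p
   using eq[of "\<lambda>n. fst (p n)" "\<lambda>n. snd (p n)"] p unfolding aeq_def mem_Times_iff by blast
  show "C0 sequentially (\<lambda>i. UU (k i) \<times> UU (k i)) (\<lambda>i p. nn (k i) (fst p - snd p)) (\<lambda>i p. nn (l i) (?t i (fst p) - ?t i (snd p)))"
   by (rule C0_seqI[where z = ?z]) (use * in simp_all)
  show "C0 sequentially (\<lambda>i. UU (k i) \<times> UU (k i)) (\<lambda>i p. nn (l i) (?t i (fst p) - ?t i (snd p))) (\<lambda>i p. nn (k i) (fst p - snd p))"
   by (rule C0_seqI[where z = ?z]) (use * in simp_all)
 qed
 show "asurj sequentially k l ?t"
  unfolding asurj_def
 proof (intro allI impI)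
  fix w assume "\<forall>n. w n \<in> UU (l n)"
  then have w: "w n \<in> UU (l n)" for n by blast
  have jw: "(\<lambda>n. jm (l n) (w n)) \<in> UP l" by (rule jm_UP[OF w])
  then have "hs_class l (\<lambda>n. jm (l n) (w n)) \<in> carrier (UHS l)" unfolding UHS_carrier by (rule imageI)
  then have "hs_class l (\<lambda>n. jm (l n) (w n)) \<in> \<phi> ` carrier (UHS k)"
   using bij_betw_imp_surj_on[OF bij] by simp
  then obtain u where u: "u \<in> UP k" "hs_class l (\<lambda>n. jm (l n) (w n)) = \<phi> (hs_class k u)"
   unfolding UHS_carrier by blast
  then have "aeqs l (\<lambda>n. fm (h n (u n))) w"
   using hs_class_eq[OF hP[OF u(1)] jw] fm_jm[OF UU_MM[OF w]] by (simp add: \<phi>)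
  moreover have "jm (k n) (fm (u n)) = u n" for n using u(1) UG_mat jm_fm by (auto simp: UP_iff)
  ultimately show "\<exists>u. (\<forall>n. u n \<in> UU (k n)) \<and> aeqs l (\<lambda>n. ?t n (u n)) w"
   by (intro exI[of _ "\<lambda>n. fm (u n)"]) (simp add: UP_UU[OF u(1)])
 qed
qed

section \<open>Automorphisms, resizing of classes and the conclusion\<close>

text \<open>Conjugation by \<open>W\<close>, followed by entrywise complex conjugation when
  \<open>s\<close> is false; the restriction to the carrier is there because \<open>auto\<close>
  consists of extensional functions.\<close>

definition conj_aut :: "nat => bool => fmat => complex mat => complex mat" where
 "conj_aut l s W = (\<lambda>A\<in>carrier (unitary_group l). jm l (cjs s (W * fm A * adj W)))"

lemma fm_conj_aut:
 assumes W: "W \<in> UU l" and A: "A \<in> carrier (unitary_group l)"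
 shows "fm (conj_aut l s W A) = cjs s (W * fm A * adj W)" "conj_aut l s W A \<in> carrier (unitary_group l)"
proof -
 have "cjs s (W * fm A * adj W) \<in> UU l" using W UG_UU[OF A] by (intro cjs_simps UU_mult UU_adj)
 then show "fm (conj_aut l s W A) = cjs s (W * fm A * adj W)" "conj_aut l s W A \<in> carrier (unitary_group l)"
  using A by (simp_all add: conj_aut_def fm_jm jm_UG)
qed

lemma conj_aut_unitary_aut:
 assumes W: "W \<in> UU l" and l: "l > 0"
 shows "conj_aut l s W \<in> unitary_aut l"
proof -
 let ?G = "unitary_group l" and ?\<alpha> = "conj_aut l s W"
 note fa = fm_conj_aut[OF W]
 have hom: "?\<alpha> \<in> hom ?G ?G"
 proof (rule homI)
  fix A B assume A: "A \<in> carrier ?G" and B: "B \<in> carrier ?G"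
  show "?\<alpha> A \<in> carrier ?G" by (rule fa(2)[OF A])
  show "?\<alpha> (A \<otimes>\<^bsub>?G\<^esub> B) = ?\<alpha> A \<otimes>\<^bsub>?G\<^esub> ?\<alpha> B"
   unfolding UG_mult
  proof (rule fm_inj[OF UG_mat[OF fa(2)[OF UG_closed[OF A B]]] UG_mat[OF UG_closed[OF fa(2)[OF A] fa(2)[OF B]]]])
   have "W * fm A * adj W * (W * fm B * adj W) = W * (fm A * fm B) * adj W"
    using W UG_UU[OF B] by (simp add: mult.assoc UU_canc)
   then show "fm (?\<alpha> (A * B)) = fm (?\<alpha> A * ?\<alpha> B)"
    unfolding UG_fm_mult[OF fa(2)[OF A] fa(2)[OF B]] fa(1)[OF A] fa(1)[OF B] fa(1)[OF UG_closed[OF A B]] UG_fm_mult[OF A B]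
    by (simp flip: cjs_simps(4))
  qed
 qed
 have bij: "?\<alpha> \<in> Bij (carrier ?G)"
  unfolding Bij_def
 proof (intro IntI CollectI)
  show "?\<alpha> \<in> extensional (carrier ?G)" by (simp add: conj_aut_def)
  let ?\<beta> = "\<lambda>B. jm l (adj W * cjs s (fm B) * W)"
  have \<beta>U: "adj W * cjs s (fm B) * W \<in> UU l" if "B \<in> carrier ?G" for B
   using W UG_UU[OF that] by (intro UU_mult UU_adj cjs_simps)
  show "bij_betw ?\<alpha> (carrier ?G) (carrier ?G)"
  proof (rule bij_betw_byWitness[where f' = ?\<beta>])
   show "?\<alpha> ` carrier ?G \<subseteq> carrier ?G" using fa(2) by blast
   show "?\<beta> ` carrier ?G \<subseteq> carrier ?G" using \<beta>U jm_UG by blast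
   show "\<forall>A\<in>carrier ?G. ?\<beta> (?\<alpha> A) = A"
   proof
    fix A assume A: "A \<in> carrier ?G"
    have "adj W * (W * fm A * adj W) * W = fm A" using W UG_UU[OF A] by (simp add: mult.assoc UU_canc UU_D)
    then show "?\<beta> (?\<alpha> A) = A" using jm_fm[OF UG_mat[OF A]] by (simp add: fa A)
   qed
   show "\<forall>B\<in>carrier ?G. ?\<alpha> (?\<beta> B) = B"
   proof
    fix B assume B: "B \<in> carrier ?G"
    note \<beta>C = jm_UG[OF \<beta>U[OF B]]
    have "W * (adj W * cjs s (fm B) * W) * adj W = cjs s (fm B)" using W UG_UU[OF B] by (simp add: mult.assoc UU_canc UU_D)
    then have "fm (?\<alpha> (?\<beta> B)) = fm B" unfolding fa(1)[OF \<beta>C] fm_jm[OF UU_MM[OF \<beta>U[OF B]]] by simp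
    then show "?\<alpha> (?\<beta> B) = B" by (rule fm_inj[OF UG_mat[OF fa(2)[OF \<beta>C]] UG_mat[OF B]])
   qed
  qed
 qed
 let ?d = "\<lambda>x y. if x \<in> carrier ?G \<and> y \<in> carrier ?G then hs_dist l x y else 0"
 have dist: "hs_dist l x y = nn l (fm x - fm y)" if "x \<in> carrier ?G" "y \<in> carrier ?G" for x y
  using hs_dist_fm[OF UG_mat[OF that(1)] UG_mat[OF that(2)]] .
 interpret M: Metric_space "carrier ?G" ?d
 proof
  show "0 \<le> ?d x y" for x y by (simp add: dist)
  show "?d x y = ?d y x" for x y by (simp add: dist nn_commute)
  show "?d x y = 0 \<longleftrightarrow> x = y" if "x \<in> carrier ?G" "y \<in> carrier ?G" for x y
   using that l fm_inj[OF UG_mat[OF that(1)] UG_mat[OF that(2)]] by (auto simp: dist nn_def)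
  show "?d x z \<le> ?d x y + ?d y z" if "x \<in> carrier ?G" "y \<in> carrier ?G" "z \<in> carrier ?G" for x y z
   using that nn_diff_triangle by (simp add: dist)
 qed
 have iso: "nn l (fm (?\<alpha> x) - fm (?\<alpha> y)) = nn l (fm x - fm y)" if "x \<in> carrier ?G" "y \<in> carrier ?G" for x y
 proof -
  have "W * fm x * adj W - W * fm y * adj W = W * (fm x - fm y) * adj W" by (simp add: algebra_simps)
  moreover have "norm (W * (fm x - fm y) * adj W) = norm (fm x - fm y)"
   by (rule norm_conj_UU[OF W UU_adj[OF W]]) (use UG_UU[OF that(1)] UG_UU[OF that(2)] in simp)
  ultimately show ?thesis
   unfolding fa(1)[OF that(1)] fa(1)[OF that(2)] cjs_diff[symmetric] by (simp add: nn_def del: cjs_simps(4))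
 qed
 have "continuous_map M.mtopology M.mtopology ?\<alpha>"
  unfolding M.continuous_map_to_metric
 proof (intro ballI allI impI)
  fix x e assume x: "x \<in> topspace M.mtopology" and e: "(0::real) < e"
  then have xC: "x \<in> carrier ?G" by simp
  show "\<exists>U. openin M.mtopology U \<and> x \<in> U \<and> (\<forall>y\<in>U. ?\<alpha> y \<in> M.mball (?\<alpha> x) e)"
  proof (intro exI[of _ "M.mball x e"] conjI ballI)
   show "openin M.mtopology (M.mball x e)" by (rule M.openin_mball)
   show "x \<in> M.mball x e" using xC e by (simp add: dist)
   fix y assume y: "y \<in> M.mball x e"
   then show "?\<alpha> y \<in> M.mball (?\<alpha> x) e"
    using xC fa(2) iso[of x y] by (auto simp: M.in_mball dist)
  qed
 qed
 then show ?thesis using hom bij by (simp add: unitary_aut_def unitary_topology_def auto_def)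
qed

text \<open>Padding by \<open>diag_block_mat\<close> is the explicit case of \<open>rs\<close>, so
  the condition in \<open>updown\<close> can be treated by \<open>asim_rs\<close>.\<close>

lemma fm_diag_block:
 assumes A: "A \<in> carrier_mat k k" and kM: "k \<le> M"
 shows "diag_block_mat [A, 1\<^sub>m (M - k)] \<in> carrier_mat M M" "fm (diag_block_mat [A, 1\<^sub>m (M - k)]) = rs k M (fm A)"
proof -
 have d: "dim_row A = k" "dim_col A = k" using A by auto
 \<comment> \<open>\<open>diag_block_mat\<close> recurses down to an empty block, which is removed
   here.\<close>
 have z: "four_block_mat (1\<^sub>m (M - k)) (0\<^sub>m (M - k) 0) (0\<^sub>m 0 (M - k)) (0\<^sub>m 0 0) = (1\<^sub>m (M - k) :: complex mat)"
  by (rule eq_matI) auto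
 have e: "diag_block_mat [A, 1\<^sub>m (M - k)] = four_block_mat A (0\<^sub>m k (M - k)) (0\<^sub>m (M - k) k) (1\<^sub>m (M - k))"
  by (simp add: Let_def d z)
 show c: "diag_block_mat [A, 1\<^sub>m (M - k)] \<in> carrier_mat M M"
  unfolding e using four_block_carrier_mat[OF A one_carrier_mat[of "M - k"]] kM by simp
 show "fm (diag_block_mat [A, 1\<^sub>m (M - k)]) = rs k M (fm A)"
 proof (rule fmat_eqI)
  fix i j
  have "diag_block_mat [A, 1\<^sub>m (M - k)] $$ (i, j) = (if i < k \<and> j < k then A $$ (i, j) else if i = j \<and> k \<le> i then 1 else 0)"
   if "i < M" "j < M"
   unfolding e using that kM by (subst index_mat_four_block(1)) (auto simp: d)
  then show "ent (fm (diag_block_mat [A, 1\<^sub>m (M - k)])) i j = ent (rs k M (fm A)) i j"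
   using kM unfolding ent_fm[OF c] rs_def by (auto simp: ent_fm[OF A] simp del: diag_block_mat.simps)
 qed
qed

text \<open>\<open>k\<close>, \<open>l\<close> and their maximum are asymptotic to each other, so
  the padded distance tends to 0 exactly when the two sequences are asymptotically equal; this gives
  both existence and uniqueness for the definite description.\<close>

lemma updown_eq:
 assumes s: "asim sequentially k l" and u: "u \<in> UP k" and v: "v \<in> UP l"
  and uv: "aeqs l (\<lambda>n. fm (u n)) (\<lambda>n. fm (v n))"
 shows "updown k l (hs_class k u) = hs_class l v"
proof -
 let ?M = "\<lambda>n. max (k n) (l n)"
 have kl: "0 < k n" "0 < l n" for n using s by (auto simp: asim_def)
 have "(\<lambda>n. max (real (k n) / real (l n)) 1) \<longlonglongrightarrow> max 1 1" using s unfolding asim_def by (intro tendsto_max tendsto_const) auto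
 moreover have "max (real (k n) / real (l n)) 1 = real (?M n) / real (l n)" for n
  using kl[of n] by (auto simp: max_def field_simps)
 ultimately have "asim sequentially ?M l" using kl by (simp add: asim_def max_def)
 then have lM: "asim sequentially l ?M" by (rule asim_sym)
 have "(\<lambda>n. (real (k n) / real (l n)) * (real (l n) / real (?M n))) \<longlonglongrightarrow> 1 * 1"
  using s lM unfolding asim_def by (intro tendsto_mult) auto
 then have kM: "asim sequentially k ?M" using kl by (simp add: asim_def max_def)
 have cond: "(\<lambda>n. hs_dist (?M n) (diag_block_mat [a n, 1\<^sub>m (?M n - k n)]) (diag_block_mat [b n, 1\<^sub>m (?M n - l n)])) \<longlonglongrightarrow> 0 \<longleftrightarrow>
  aeqs l (\<lambda>n. fm (a n)) (\<lambda>n. fm (b n))"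
  if a: "a \<in> UP k" and b: "b \<in> UP l" for a b
 proof -
  have aM: "a n \<in> carrier_mat (k n) (k n)" "b n \<in> carrier_mat (l n) (l n)" for n using a b UG_mat by (auto simp: UP_iff)
  have "hs_dist (?M n) (diag_block_mat [a n, 1\<^sub>m (?M n - k n)]) (diag_block_mat [b n, 1\<^sub>m (?M n - l n)]) =
   nn (?M n) (rs (k n) (?M n) (fm (a n)) - rs (l n) (?M n) (fm (b n)))" for n
   using hs_dist_fm[OF fm_diag_block(1)[OF aM(1)] fm_diag_block(1)[OF aM(2)], of n "?M n" n]
    fm_diag_block(2)[OF aM(1), of n "?M n"] fm_diag_block(2)[OF aM(2), of n "?M n"] by (simp del: diag_block_mat.simps)
  then have "?thesis \<longleftrightarrow> (aeqs ?M (\<lambda>n. rs (k n) (?M n) (fm (a n))) (\<lambda>n. rs (l n) (?M n) (fm (b n))) \<longleftrightarrow> aeqs ?M (\<lambda>n. fm (a n)) (\<lambda>n. fm (b n)))"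
   unfolding asim_aeq[OF lM] by (simp add: aeq_def)
  moreover have "aeqs ?M (\<lambda>n. rs (k n) (?M n) (fm (a n))) (\<lambda>n. fm (a n))" by (rule asim_rs[OF kM]) (simp add: UP_UU[OF a])
  moreover have "aeqs ?M (\<lambda>n. rs (l n) (?M n) (fm (b n))) (\<lambda>n. fm (b n))" by (rule asim_rs[OF lM]) (simp add: UP_UU[OF b])
  ultimately show ?thesis using aeq_sandwich aeq_sandwich' by blast
 qed
 show ?thesis
  unfolding updown_def
 proof (rule the_equality)
  show "\<exists>a\<in>UP k. \<exists>b\<in>UP l. hs_class k u = hs_class k a \<and> hs_class l v = hs_class l b \<and>
   (\<lambda>n. hs_dist (?M n) (diag_block_mat [a n, 1\<^sub>m (?M n - k n)]) (diag_block_mat [b n, 1\<^sub>m (?M n - l n)])) \<longlonglongrightarrow> 0"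
   using u v cond[OF u v] uv by blast
  fix Y assume "\<exists>a\<in>UP k. \<exists>b\<in>UP l. hs_class k u = hs_class k a \<and> Y = hs_class l b \<and>
   (\<lambda>n. hs_dist (?M n) (diag_block_mat [a n, 1\<^sub>m (?M n - k n)]) (diag_block_mat [b n, 1\<^sub>m (?M n - l n)])) \<longlonglongrightarrow> 0"
  then obtain a b where ab: "a \<in> UP k" "b \<in> UP l" "hs_class k u = hs_class k a" "Y = hs_class l b"
   "(\<lambda>n. hs_dist (?M n) (diag_block_mat [a n, 1\<^sub>m (?M n - k n)]) (diag_block_mat [b n, 1\<^sub>m (?M n - l n)])) \<longlonglongrightarrow> 0" by blast
  have "aeqs l (\<lambda>n. fm (a n)) (\<lambda>n. fm (b n))" using ab(5) cond[OF ab(1,2)] by blast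
  moreover have "aeqs l (\<lambda>n. fm (u n)) (\<lambda>n. fm (a n))"
   using ab(3) unfolding hs_class_eq[OF u ab(1)] asim_aeq[OF s] .
  ultimately have "aeqs l (\<lambda>n. fm (b n)) (\<lambda>n. fm (v n))"
   using uv by (meson aeq_sym aeq_trans)
  then show "Y = hs_class l v" unfolding ab(4) hs_class_eq[OF ab(2) v] .
 qed
qed

theorem proposition4p3:
  fixes k l :: "nat \<Rightarrow> nat"
    and \<phi> :: "(nat \<Rightarrow> complex mat) set \<Rightarrow> (nat \<Rightarrow> complex mat) set"
  assumes "\<And>n. k n \<ge> 1" and "\<And>n. l n \<ge> 1"
    and "filterlim k at_top sequentially" and "filterlim l at_top sequentially"
    and "\<phi> \<in> iso (UHS k) (UHS l)"
    and "product_form k l \<phi>"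
  shows "(\<lambda>n. real (k n) / real (l n)) \<longlonglongrightarrow> 1 \<and>
    (\<exists>\<alpha>. (\<forall>n. \<alpha> n \<in> unitary_aut (l n)) \<and>
      (\<forall>u\<in>carrier (unitary_prod k).
         updown k l (hs_class k u) \<in> carrier (UHS l) \<and>
         (\<forall>v\<in>carrier (unitary_prod l).
            hs_class l v = updown k l (hs_class k u) \<longrightarrow>
            \<phi> (hs_class k u) = hs_class l (\<lambda>n. \<alpha> n (v n)))))"
proof -
 have kp: "0 < k n" and lp: "0 < l n" for n using assms(1,2)[of n] by linarith+
 obtain h where h: "\<And>n. h n \<in> carrier (unitary_group (k n)) \<rightarrow> carrier (unitary_group (l n))"
  "\<And>u. u \<in> UP k ==> \<phi> (hs_class k u) = hs_class l (\<lambda>n. h n (u n))"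
  using assms(6) unfolding product_form_def by blast
 define \<theta> where "\<theta> n x = fm (h n (jm (k n) x))" for n x
 have A: "amap sequentially k l \<theta>" and S: "asurj sequentially k l \<theta>"
  unfolding \<theta>_def[abs_def] by (rule amap_of_product_form[OF assms(5) h]; assumption)+
 have s: "asim sequentially k l" by (rule dims_asym[OF A S kp lp])
 obtain c where c: "amap sequentially k l (\<lambda>n x. cjs (c n) (\<theta> n x))" "acent sequentially k l (\<lambda>n x. cjs (c n) (\<theta> n x))"
  by (rule conj_fix[OF A S lp kp], rule that)
 \<comment> \<open>Composition with the resizing produces a self-map of U(l), as
   \<open>inner_of_central\<close> requires.\<close>
 let ?g = "\<lambda>n w. cjs (c n) (\<theta> n (rs (l n) (k n) w))"
 have gA: "amap sequentially l l ?g" by (rule amap_comp[OF amap_rs[OF asim_sym[OF s]] c(1)])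
 have gC: "acent sequentially l l ?g" by (rule acent_comp[OF acent_rs[OF asim_sym[OF s]] c(2) amap_rs[OF asim_sym[OF s]] c(1)])
 obtain W where W: "\<And>n. W n \<in> UU (l n)" "anear sequentially l l ?g (\<lambda>n w. W n * w * adj (W n))"
  by (rule inner_of_central[OF gA gC lp assms(4)], rule that)
 define \<alpha> where "\<alpha> n = conj_aut (l n) (c n) (W n)" for n
 show ?thesis
 proof (intro conjI exI[of _ \<alpha>] allI ballI impI)
  show "(\<lambda>n. real (k n) / real (l n)) \<longlonglongrightarrow> 1" using s by (simp add: asim_def)
  show "\<alpha> n \<in> unitary_aut (l n)" for n unfolding \<alpha>_def by (rule conj_aut_unitary_aut[OF W(1) lp])
  fix u assume u: "u \<in> UP k"
  define w where "w n = rs (k n) (l n) (fm (u n))" for n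
  have wU: "w n \<in> UU (l n)" for n unfolding w_def by (rule rs_UU[OF UP_UU[OF u]])
  have jw: "(\<lambda>n. jm (l n) (w n)) \<in> UP l" by (rule jm_UP[OF wU])
  have wu: "aeqs l w (\<lambda>n. fm (u n))" unfolding w_def[abs_def] by (rule asim_rs[OF s]) (simp add: UP_UU[OF u])
  have ud: "updown k l (hs_class k u) = hs_class l (\<lambda>n. jm (l n) (w n))"
   by (rule updown_eq[OF s u jw]) (use aeq_sym[OF wu] in \<open>simp add: fm_jm[OF UU_MM[OF wU]]\<close>)
  show "updown k l (hs_class k u) \<in> carrier (UHS l)" unfolding ud UHS_carrier using jw by blast
  fix v assume v: "v \<in> UP l" and "hs_class l v = updown k l (hs_class k u)"
  then have "aeqs l (\<lambda>n. fm (v n)) w"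
   using hs_class_eq[OF v jw] by (simp add: ud fm_jm[OF UU_MM[OF wU]])
  then have vw: "aeqs l w (\<lambda>n. fm (v n))" by (rule aeq_sym)
  have vG: "v n \<in> carrier (unitary_group (l n))" for n using v by (simp add: UP_iff)
  let ?r = "\<lambda>n. rs (l n) (k n) (w n)"
  have rU: "?r n \<in> UU (k n)" for n by (rule rs_UU[OF wU])
  have "aeqs k ?r w" by (rule asim_rs[OF asim_sym[OF s]]) (simp add: wU)
  then have "aeqs k ?r (\<lambda>n. fm (u n))" by (rule aeq_trans) (use wu in \<open>simp add: asim_aeq[OF s]\<close>)
  then have ru: "aeqs k (\<lambda>n. fm (u n)) ?r" by (rule aeq_sym)
  let ?c = "\<lambda>n x. cjs (c n) x"
  have "aeqs l (\<lambda>n. ?c n (\<theta> n (fm (u n)))) (\<lambda>n. ?c n (\<theta> n (?r n)))"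
   by (rule amap_cont[OF c(1) filterlim_ident _ _ ru]) (simp_all add: UP_UU[OF u] rU)
  also have "aeqs l \<dots> (\<lambda>n. W n * w n * adj (W n))"
   by (rule anear_seq[OF W(2) filterlim_ident]) (simp add: wU)
  also have "aeqs l \<dots> (\<lambda>n. W n * fm (v n) * adj (W n))"
   by (rule aeq_right[OF aeq_left[OF vw]]) (use con_UU[OF W(1)] con_UU[OF UU_adj[OF W(1)]] in simp_all)
  \<comment> \<open>\<open>?c n\<close> is an isometric involution; applying it once more moves the
    complex conjugation to the right-hand side, where it becomes part of
    \<open>\<alpha> n\<close>.\<close>
  finally have "aeqs l (\<lambda>n. ?c n (?c n (\<theta> n (fm (u n))))) (\<lambda>n. ?c n (W n * fm (v n) * adj (W n)))"
   by (rule aeq_mono) (simp add: cjs_diff[symmetric] del: cjs_simps(1,4))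
  moreover have "\<theta> n (fm (u n)) = fm (h n (u n))" for n
   using u UG_mat by (simp add: \<theta>_def UP_iff jm_fm)
  moreover have "fm (\<alpha> n (v n)) = ?c n (W n * fm (v n) * adj (W n))" for n
   unfolding \<alpha>_def by (rule fm_conj_aut(1)[OF W(1) vG])
  ultimately have e: "aeqs l (\<lambda>n. fm (h n (u n))) (\<lambda>n. fm (\<alpha> n (v n)))" by simp
  have hP: "(\<lambda>n. h n (u n)) \<in> UP l" using h(1) u by (auto simp: UP_iff)
  have aP: "(\<lambda>n. \<alpha> n (v n)) \<in> UP l"
   using fm_conj_aut(2)[OF W(1) vG] by (simp add: UP_iff \<alpha>_def)
  show "\<phi> (hs_class k u) = hs_class l (\<lambda>n. \<alpha> n (v n))"
   unfolding h(2)[OF u] hs_class_eq[OF hP aP] by (rule e)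
 qed
qed

end
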